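(* Let $M$ be a simple module in $\mathcal W_{\rm fin}$ and let $\alpha\in\Delta^{\rm re}$ be such that $\pm\alpha\in\Delta^i(M)$. There exist $x\in\mathbb F$ and simple modules $N,L\in\mathcal W_{\rm fin}$ such that $M\simeq\mathcal D_\alpha^xN\simeq\mathcal D_{-\alpha}^{x}L$ and $\alpha\in\Delta^f(N)$ and $-\alpha\in\Delta^f(L)$. Moreover, if $\beta\in\Delta^f(M)$ then $\beta\in\Delta^f(N)$ and $\beta\in\Delta^f(L)$.
   Context: $\mathbb F$ is an algebraically closed field of characteristic zero; $\mathfrak g$ is a simple finite dimensional Lie algebra over $\mathbb F$ with Cartan subalgebra $\mathfrak h$ and non-degenerate invariant symmetric form $(\,,\,)$. $\mathcal A(\mathfrak g)=\mathfrak g\otimes\mathbb F[t,t^{-1}]\oplus\mathbb FD\oplus\mathbb FK$ with $[x\otimes t^m,y\otimes t^n]=[x,y]\otimes t^{m+n}+\delta_{m,-n}m(x,y)K$, $[D,x\otimes t^m]=m\,x\otimes t^m$, $K$ central. For a diagram automorphism $\sigma$ of order $s$ with eigenspaces $\mathfrak g_{\bar j}$, $\mathcal A(\mathfrak g,\sigma)=\bigoplus_{j\in\mathbb Z}\mathfrak g_{\bar j}\otimes t^j\oplus\mathbb FD\oplus\mathbb FK$. $\mathfrak G$ is $\mathcal A(\mathfrak g)$ or $\mathcal A(\mathfrak g,\sigma)$ with Cartan subalgebra $\mathfrak H=\mathfrak h\oplus\mathbb FD\oplus\mathbb FK$ or $\mathfrak h^\sigma\oplus\mathbb FD\oplus\mathbb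 FK$, root system $\Delta$, root spaces $\mathfrak G^\alpha$. $\delta\in\mathfrak H^*$: $\delta(D)=1$, zero on $\mathfrak h$ (or $\mathfrak h^\sigma$) and $K$. $\Delta^{\rm re}=\Delta\setminus\{n\delta\mid n\in\mathbb Z\}$. For $\alpha\in\Delta^{\rm re}$, fix an $\mathfrak{sl}_2$-triple $(e_\alpha,h_\alpha,f_\alpha)$ with $e_\alpha\in\mathfrak G^\alpha$, $f_\alpha\in\mathfrak G^{-\alpha}$, $h_\alpha\in\mathfrak H$ ($\mathfrak G^{\pm\alpha}$ are one dimensional, so $f_{-\alpha}$ is proportional to $e_\alpha$). $\mathcal W_{\rm fin}$ is the category of weight ($\mathfrak H$-diagonalizable) $\mathfrak G$-modules with finite dimensional weight spaces. On a simple $M\in\mathcal W_{\rm fin}$ each $e_\alpha$, $\alpha\in\Delta^{\rm re}$, acts either locally nilpotently or injectively; $\Delta^f(M)$ and $\Delta^i(M)$ denote the sets of $\alpha\in\Delta^{\rm re}$ for which $e_\alpha$ acts locally nilpotently, respectively injectively. Twisted localization: let $U=U(\mathfrak G)$ and let $U_\alpha$ be the Ore localization of $U$ with respect to $\{f_\alpha^n\mid n\in\mathbb Z_{\ge0}\}$; $\mathcal D_\alpha M=U_\alpha\otimes_UM$. For $x\in\mathbb F$ and $u\in U_\alpha$ put $\Theta_x(u)=\sum_{i\ge0}\binom xi\,\mathrm{ad}(f_\alpha)^i(u)\,f_\alpha^{-i}$ (a finite sum), $\binom xi=x(x-1)\cdots(x-i+1)/i!$. For a $U_\alpha$-module $M$,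 $\Phi_\alpha^xM$ is the vector space $\{v^x\mid v\in M\}$ (a copy of $M$) with action $u\cdot v^x=(\Theta_x(u)\cdot v)^x$; if $v$ has weight $\lambda$ then $v^x$ has weight $\lambda+x\alpha$. Finally $\mathcal D_\alpha^xM=\Phi_\alpha^x(\mathcal D_\alpha M)$; $\mathcal D_{-\alpha}^x$ is the same construction for $-\alpha$, using $f_{-\alpha}$.
   Formalization: The second isomorphism is stated with exponent −x, M ≃ D_{−α}^{−x} L, because with D_{−α}^x built from f_{−α} (weights shift by −xα) the same exponent x on both sides fails, e.g. for loop modules of generic dense sl_2-modules. *)

theory Defs
  imports
    "HOL-Computational_Algebra.Polynomial"
    "HOL-Library.Poly_Mapping"
    "HOL-Library.Product_Plus"
    "HOL-Algebra.Module"
    "HOL-Algebra.QuotRing"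
    "HOL-Algebra.Free_Abelian_Groups"
begin

section \<open>Lie algebras\<close>

text \<open>Lie algebras, their Cartan subalgebras and their modules live on subspaces of type-class
  vector spaces (theory HOL.Vector_Spaces). The associative rings built from them, which are
  quotient objects, are records of HOL-Algebra.\<close>

definition fin_dim :: "('k::field \<Rightarrow> 'a::ab_group_add \<Rightarrow> 'a) \<Rightarrow> 'a set \<Rightarrow> bool" where
  "fin_dim scale S \<longleftrightarrow> (\<exists>B. finite B \<and> S \<subseteq> Modules.module.span scale B)"

record ('k, 'l) lie_alg =
  lie_carrier :: "'l set"
  lie_scale :: "'k \<Rightarrow> 'l \<Rightarrow> 'l"
  lie_bracket :: "'l \<Rightarrow> 'l \<Rightarrow> 'l"

definition lie_algebra :: "('k::field, 'l::ab_group_add) lie_alg \<Rightarrow> bool" where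
  "lie_algebra L \<longleftrightarrow>
     vector_space (lie_scale L) \<and> Modules.module.subspace (lie_scale L) (lie_carrier L) \<and>
     (\<forall>x\<in>lie_carrier L. \<forall>y\<in>lie_carrier L. lie_bracket L x y \<in> lie_carrier L) \<and>
     (\<forall>x\<in>lie_carrier L. \<forall>y\<in>lie_carrier L. \<forall>z\<in>lie_carrier L.
        lie_bracket L (x + y) z = lie_bracket L x z + lie_bracket L y z \<and>
        lie_bracket L z (x + y) = lie_bracket L z x + lie_bracket L z y) \<and>
     (\<forall>c. \<forall>x\<in>lie_carrier L. \<forall>y\<in>lie_carrier L.
        lie_bracket L (lie_scale L c x) y = lie_scale L c (lie_bracket L x y) \<and>
        lie_bracket L x (lie_scale L c y) = lie_scale L c (lie_bracket L x y)) \<and>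
     (\<forall>x\<in>lie_carrier L. lie_bracket L x x = 0) \<and>
     (\<forall>x\<in>lie_carrier L. \<forall>y\<in>lie_carrier L. \<forall>z\<in>lie_carrier L.
        lie_bracket L x (lie_bracket L y z) + lie_bracket L y (lie_bracket L z x)
          + lie_bracket L z (lie_bracket L x y) = 0)"

definition lie_ideal :: "('k::field, 'l::ab_group_add) lie_alg \<Rightarrow> 'l set \<Rightarrow> bool" where
  "lie_ideal L I \<longleftrightarrow>
     Modules.module.subspace (lie_scale L) I \<and> I \<subseteq> lie_carrier L \<and>
     (\<forall>x\<in>lie_carrier L. \<forall>y\<in>I. lie_bracket L x y \<in> I)"

definition simple_lie_algebra :: "('k::field, 'l::ab_group_add) lie_alg \<Rightarrow> bool" where
  "simple_lie_algebra L \<longleftrightarrow>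
     lie_algebra L \<and>
     (\<exists>x\<in>lie_carrier L. \<exists>y\<in>lie_carrier L. lie_bracket L x y \<noteq> 0) \<and>
     (\<forall>I. lie_ideal L I \<longrightarrow> I = {0} \<or> I = lie_carrier L)"

definition abelian_subalgebra :: "('k::field, 'l::ab_group_add) lie_alg \<Rightarrow> 'l set \<Rightarrow> bool" where
  "abelian_subalgebra L A \<longleftrightarrow>
     Modules.module.subspace (lie_scale L) A \<and> A \<subseteq> lie_carrier L \<and>
     (\<forall>x\<in>A. \<forall>y\<in>A. lie_bracket L x y = 0)"

text \<open>The usual definition for a semisimple Lie algebra over an algebraically closed field of
  characteristic zero: a maximal abelian subalgebra all of whose elements are ad-diagonalizable.\<close>

definition cartan_subalgebra :: "('k::field, 'l::ab_group_add) lie_alg \<Rightarrow> 'l set \<Rightarrow> bool" where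
  "cartan_subalgebra L H \<longleftrightarrow>
     abelian_subalgebra L H \<and>
     (\<forall>A. abelian_subalgebra L A \<and> H \<subseteq> A \<longrightarrow> A = H) \<and>
     (\<forall>h\<in>H. lie_carrier L \<subseteq>
        Modules.module.span (lie_scale L)
          {x \<in> lie_carrier L. \<exists>c. lie_bracket L h x = lie_scale L c x})"

definition nondeg_invariant_form ::
    "('k::field, 'l::ab_group_add) lie_alg \<Rightarrow> ('l \<Rightarrow> 'l \<Rightarrow> 'k) \<Rightarrow> bool" where
  "nondeg_invariant_form L form \<longleftrightarrow>
     (\<forall>x\<in>lie_carrier L. \<forall>y\<in>lie_carrier L. \<forall>z\<in>lie_carrier L.
        form (x + y) z = form x z + form y z) \<and>
     (\<forall>c. \<forall>x\<in>lie_carrier L. \<forall>y\<in>lie_carrier L. form (lie_scale L c x) y = c * form x y) \<and>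
     (\<forall>x\<in>lie_carrier L. \<forall>y\<in>lie_carrier L. form x y = form y x) \<and>
     (\<forall>x\<in>lie_carrier L. \<forall>y\<in>lie_carrier L. \<forall>z\<in>lie_carrier L.
        form (lie_bracket L x y) z = form x (lie_bracket L y z)) \<and>
     (\<forall>x\<in>lie_carrier L. (\<forall>y\<in>lie_carrier L. form x y = 0) \<longrightarrow> x = 0)"

text \<open>Functionals on a subspace \<open>H\<close> are represented by functions that vanish outside \<open>H\<close>, so that
  every functional, and hence every root, has exactly one representative.\<close>

definition dual_space ::
    "('k::field, 'l::ab_group_add) lie_alg \<Rightarrow> 'l set \<Rightarrow> ('l \<Rightarrow> 'k) set" where
  "dual_space L H =
     {\<mu>. (\<forall>x\<in>H. \<forall>y\<in>H. \<mu> (x + y) = \<mu> x + \<mu> y) \<and>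
          (\<forall>c. \<forall>x\<in>H. \<mu> (lie_scale L c x) = c * \<mu> x) \<and>
          (\<forall>x. x \<notin> H \<longrightarrow> \<mu> x = 0)}"

definition root_space ::
    "('k::field, 'l::ab_group_add) lie_alg \<Rightarrow> 'l set \<Rightarrow> ('l \<Rightarrow> 'k) \<Rightarrow> 'l set" where
  "root_space L H \<alpha> = {x \<in> lie_carrier L. \<forall>h\<in>H. lie_bracket L h x = lie_scale L (\<alpha> h) x}"

definition roots ::
    "('k::field, 'l::ab_group_add) lie_alg \<Rightarrow> 'l set \<Rightarrow> ('l \<Rightarrow> 'k) set" where
  "roots L H = {\<alpha> \<in> dual_space L H. \<alpha> \<noteq> (\<lambda>_. 0) \<and> root_space L H \<alpha> \<noteq> {0}}"

definition sl2_triple :: "('k::field, 'l::ab_group_add) lie_alg \<Rightarrow> 'l \<Rightarrow> 'l \<Rightarrow> 'l \<Rightarrow> bool" where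
  "sl2_triple L e h f \<longleftrightarrow>
     lie_bracket L e f = h \<and> lie_bracket L h e = lie_scale L 2 e \<and>
     lie_bracket L h f = lie_scale L (-2) f \<and> h \<noteq> 0"


section \<open>Diagram automorphisms\<close>

definition root_base ::
    "('k::field, 'l::ab_group_add) lie_alg \<Rightarrow> 'l set \<Rightarrow> ('l \<Rightarrow> 'k) set \<Rightarrow> bool" where
  "root_base L H B \<longleftrightarrow>
     finite B \<and> B \<subseteq> roots L H \<and>
     (\<forall>c. (\<forall>h\<in>H. (\<Sum>\<alpha>\<in>B. c \<alpha> * \<alpha> h) = 0) \<longrightarrow> (\<forall>\<alpha>\<in>B. c \<alpha> = 0)) \<and>
     (\<forall>\<beta>\<in>roots L H. \<exists>n :: ('l \<Rightarrow> 'k) \<Rightarrow> nat.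
        (\<forall>h\<in>H. \<beta> h = (\<Sum>\<alpha>\<in>B. of_nat (n \<alpha>) * \<alpha> h)) \<or>
        (\<forall>h\<in>H. \<beta> h = - (\<Sum>\<alpha>\<in>B. of_nat (n \<alpha>) * \<alpha> h)))"

definition lie_automorphism ::
    "('k::field, 'l::ab_group_add) lie_alg \<Rightarrow> ('l \<Rightarrow> 'l) \<Rightarrow> bool" where
  "lie_automorphism L \<sigma> \<longleftrightarrow>
     bij_betw \<sigma> (lie_carrier L) (lie_carrier L) \<and>
     (\<forall>x\<in>lie_carrier L. \<forall>y\<in>lie_carrier L.
        \<sigma> (x + y) = \<sigma> x + \<sigma> y \<and> \<sigma> (lie_bracket L x y) = lie_bracket L (\<sigma> x) (\<sigma> y)) \<and>
     (\<forall>c. \<forall>x\<in>lie_carrier L. \<sigma> (lie_scale L c x) = lie_scale L c (\<sigma> x))"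

text \<open>Here \<open>\<tau>\<close> is the symmetry of the Dynkin diagram, viewed as a permutation of the simple roots
  that preserves the Cartan matrix; \<open>\<sigma>\<close> permutes the Chevalley generators accordingly.\<close>

definition diagram_automorphism ::
    "('k::field, 'l::ab_group_add) lie_alg \<Rightarrow> 'l set \<Rightarrow> ('l \<Rightarrow> 'l) \<Rightarrow> bool" where
  "diagram_automorphism L H \<sigma> \<longleftrightarrow>
     lie_automorphism L \<sigma> \<and> \<sigma> ` H = H \<and>
     (\<exists>B E F \<tau>. root_base L H B \<and> bij_betw \<tau> B B \<and>
        (\<forall>\<alpha>\<in>B. E \<alpha> \<in> root_space L H \<alpha> \<and> F \<alpha> \<in> root_space L H (- \<alpha>) \<and>
           \<alpha> (lie_bracket L (E \<alpha>) (F \<alpha>)) = 2) \<and>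
        (\<forall>\<alpha>\<in>B. \<forall>\<beta>\<in>B. \<tau> \<beta> (lie_bracket L (E (\<tau> \<alpha>)) (F (\<tau> \<alpha>)))
           = \<beta> (lie_bracket L (E \<alpha>) (F \<alpha>))) \<and>
        (\<forall>\<alpha>\<in>B. \<sigma> (E \<alpha>) = E (\<tau> \<alpha>) \<and> \<sigma> (F \<alpha>) = F (\<tau> \<alpha>)))"

definition automorphism_order ::
    "('k::field, 'l::ab_group_add) lie_alg \<Rightarrow> ('l \<Rightarrow> 'l) \<Rightarrow> nat \<Rightarrow> bool" where
  "automorphism_order L \<sigma> s \<longleftrightarrow>
     0 < s \<and> (\<forall>x\<in>lie_carrier L. (\<sigma> ^^ s) x = x) \<and>
     (\<forall>r. 0 < r \<and> r < s \<longrightarrow> (\<exists>x\<in>lie_carrier L. (\<sigma> ^^ r) x \<noteq> x))"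

definition primitive_root_of_unity :: "nat \<Rightarrow> 'k::field \<Rightarrow> bool" where
  "primitive_root_of_unity s \<epsilon> \<longleftrightarrow>
     0 < s \<and> \<epsilon> ^ s = 1 \<and> (\<forall>r. 0 < r \<and> r < s \<longrightarrow> \<epsilon> ^ r \<noteq> 1)"


section \<open>Affine Lie algebras\<close>

text \<open>The triple \<open>(p, d, c)\<close> stands for \<open>\<Sum>\<^sub>m p\<^sub>m \<otimes> t\<^sup>m + d D + c K\<close>.\<close>

type_synonym ('k, 'g) aff = "(int \<Rightarrow>\<^sub>0 'g) \<times> 'k \<times> 'k"

fun aff_scale :: "('k::field \<Rightarrow> 'g::ab_group_add \<Rightarrow> 'g) \<Rightarrow> 'k \<Rightarrow> ('k, 'g) aff \<Rightarrow> ('k, 'g) aff" where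
  "aff_scale scale a (p, d, c) = (Poly_Mapping.map (scale a) p, a * d, a * c)"

fun aff_bracket ::
    "('k::field, 'g::ab_group_add) lie_alg \<Rightarrow> ('g \<Rightarrow> 'g \<Rightarrow> 'k)
       \<Rightarrow> ('k, 'g) aff \<Rightarrow> ('k, 'g) aff \<Rightarrow> ('k, 'g) aff" where
  "aff_bracket L form (p, d, c) (q, d', c') =
     ((\<Sum>m\<in>Poly_Mapping.keys p. \<Sum>n\<in>Poly_Mapping.keys q. Poly_Mapping.single (m + n)
          (lie_bracket L (Poly_Mapping.lookup p m) (Poly_Mapping.lookup q n)))
        + (\<Sum>n\<in>Poly_Mapping.keys q. Poly_Mapping.single n
             (lie_scale L (d * of_int n) (Poly_Mapping.lookup q n)))
        - (\<Sum>m\<in>Poly_Mapping.keys p. Poly_Mapping.single m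
             (lie_scale L (d' * of_int m) (Poly_Mapping.lookup p m))),
      0,
      (\<Sum>m\<in>Poly_Mapping.keys p.
         of_int m * form (Poly_Mapping.lookup p m) (Poly_Mapping.lookup q (- m))))"

definition affine ::
    "('k::field, 'g::ab_group_add) lie_alg \<Rightarrow> ('g \<Rightarrow> 'g \<Rightarrow> 'k) \<Rightarrow> ('k, ('k, 'g) aff) lie_alg" where
  "affine L form =
     \<lparr>lie_carrier = {(p, d, c). \<forall>j. Poly_Mapping.lookup p j \<in> lie_carrier L},
      lie_scale = aff_scale (lie_scale L),
      lie_bracket = aff_bracket L form\<rparr>"

definition twisted_affine ::
    "('k::field, 'g::ab_group_add) lie_alg \<Rightarrow> ('g \<Rightarrow> 'g \<Rightarrow> 'k) \<Rightarrow> ('g \<Rightarrow> 'g) \<Rightarrow> 'k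
       \<Rightarrow> ('k, ('k, 'g) aff) lie_alg" where
  "twisted_affine L form \<sigma> \<epsilon> =
     (affine L form)\<lparr>lie_carrier := {(p, d, c). \<forall>j. Poly_Mapping.lookup p j \<in>
        {x \<in> lie_carrier L. \<sigma> x = lie_scale L (\<epsilon> powi j) x}}\<rparr>"

definition affine_cartan :: "'g::ab_group_add set \<Rightarrow> ('k, 'g) aff set" where
  "affine_cartan H = {(Poly_Mapping.single 0 h, d, c) | h d c. h \<in> H}"

definition affine_pair ::
    "('k::field, 'g::ab_group_add) lie_alg \<Rightarrow> 'g set \<Rightarrow> ('g \<Rightarrow> 'g \<Rightarrow> 'k)
       \<Rightarrow> ('k, ('k, 'g) aff) lie_alg \<Rightarrow> ('k, 'g) aff set \<Rightarrow> bool" where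
  "affine_pair L H form G HH \<longleftrightarrow>
     (G = affine L form \<and> HH = affine_cartan H) \<or>
     (\<exists>\<sigma> s \<epsilon>. diagram_automorphism L H \<sigma> \<and> automorphism_order L \<sigma> s \<and>
        primitive_root_of_unity s \<epsilon> \<and>
        G = twisted_affine L form \<sigma> \<epsilon> \<and> HH = affine_cartan {h \<in> H. \<sigma> h = h})"

definition delta :: "('k::field, 'g) aff set \<Rightarrow> ('k, 'g) aff \<Rightarrow> 'k" where
  "delta HH x = (if x \<in> HH then fst (snd x) else 0)"

definition real_roots ::
    "('k::field, ('k, 'g::ab_group_add) aff) lie_alg \<Rightarrow> ('k, 'g) aff set
       \<Rightarrow> (('k, 'g) aff \<Rightarrow> 'k) set" where
  "real_roots G HH = roots G HH - {(\<lambda>x. of_int n * delta HH x) | n :: int. True}"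


section \<open>Modules over a Lie algebra\<close>

record ('k, 'l, 'm) rep =
  rep_carrier :: "'m set"
  rep_scale :: "'k \<Rightarrow> 'm \<Rightarrow> 'm"
  rep_act :: "'l \<Rightarrow> 'm \<Rightarrow> 'm"

definition lie_module ::
    "('k::field, 'l::ab_group_add) lie_alg \<Rightarrow> ('k, 'l, 'm::ab_group_add) rep \<Rightarrow> bool" where
  "lie_module L M \<longleftrightarrow>
     vector_space (rep_scale M) \<and> Modules.module.subspace (rep_scale M) (rep_carrier M) \<and>
     (\<forall>x\<in>lie_carrier L. \<forall>v\<in>rep_carrier M. rep_act M x v \<in> rep_carrier M) \<and>
     (\<forall>x\<in>lie_carrier L. \<forall>v\<in>rep_carrier M. \<forall>w\<in>rep_carrier M.
        rep_act M x (v + w) = rep_act M x v + rep_act M x w) \<and>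
     (\<forall>x\<in>lie_carrier L. \<forall>y\<in>lie_carrier L. \<forall>v\<in>rep_carrier M.
        rep_act M (x + y) v = rep_act M x v + rep_act M y v) \<and>
     (\<forall>c. \<forall>x\<in>lie_carrier L. \<forall>v\<in>rep_carrier M.
        rep_act M (lie_scale L c x) v = rep_scale M c (rep_act M x v) \<and>
        rep_act M x (rep_scale M c v) = rep_scale M c (rep_act M x v)) \<and>
     (\<forall>x\<in>lie_carrier L. \<forall>y\<in>lie_carrier L. \<forall>v\<in>rep_carrier M.
        rep_act M (lie_bracket L x y) v
          = rep_act M x (rep_act M y v) - rep_act M y (rep_act M x v))"

definition simple_module ::
    "('k::field, 'l::ab_group_add) lie_alg \<Rightarrow> ('k, 'l, 'm::ab_group_add) rep \<Rightarrow> bool" where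
  "simple_module L M \<longleftrightarrow>
     lie_module L M \<and> rep_carrier M \<noteq> {0} \<and>
     (\<forall>S. Modules.module.subspace (rep_scale M) S \<and> S \<subseteq> rep_carrier M \<and>
        (\<forall>x\<in>lie_carrier L. \<forall>v\<in>S. rep_act M x v \<in> S) \<longrightarrow> S = {0} \<or> S = rep_carrier M)"

definition weight_space ::
    "'l set \<Rightarrow> ('k, 'l, 'm) rep \<Rightarrow> ('l \<Rightarrow> 'k) \<Rightarrow> 'm set" where
  "weight_space H M \<mu> = {v \<in> rep_carrier M. \<forall>h\<in>H. rep_act M h v = rep_scale M (\<mu> h) v}"

text \<open>The objects of the category of weight modules with finite-dimensional weight spaces.\<close>

definition W_fin ::
    "('k::field, 'l::ab_group_add) lie_alg \<Rightarrow> 'l set \<Rightarrow> ('k, 'l, 'm::ab_group_add) rep set" where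
  "W_fin L H =
     {M. lie_module L M \<and>
         rep_carrier M \<subseteq>
           Modules.module.span (rep_scale M) (\<Union>\<mu>\<in>dual_space L H. weight_space H M \<mu>) \<and>
         (\<forall>\<mu>\<in>dual_space L H. fin_dim (rep_scale M) (weight_space H M \<mu>))}"

text \<open>\<open>R\<close> is the set of real roots and \<open>e\<close> the chosen family of root vectors.\<close>

definition Delta_f ::
    "('l \<Rightarrow> 'k) set \<Rightarrow> (('l \<Rightarrow> 'k) \<Rightarrow> 'l) \<Rightarrow> ('k, 'l, 'm::zero) rep \<Rightarrow> ('l \<Rightarrow> 'k) set" where
  "Delta_f R e M = {\<alpha> \<in> R. \<forall>v\<in>rep_carrier M. \<exists>n. (rep_act M (e \<alpha>) ^^ n) v = 0}"

definition Delta_i ::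
    "('l \<Rightarrow> 'k) set \<Rightarrow> (('l \<Rightarrow> 'k) \<Rightarrow> 'l) \<Rightarrow> ('k, 'l, 'm) rep \<Rightarrow> ('l \<Rightarrow> 'k) set" where
  "Delta_i R e M = {\<alpha> \<in> R. inj_on (rep_act M (e \<alpha>)) (rep_carrier M)}"


section \<open>The universal enveloping algebra\<close>

text \<open>The free associative algebra on the underlying set \<open>A\<close> of a Lie algebra. Passing to the
  quotient by \<open>uea_relations\<close> imposes linearity of the generators as well as the commutation
  relations, so the result is the tensor algebra modulo the latter.\<close>

definition word :: "'k::zero \<Rightarrow> 'l list \<Rightarrow> 'l list \<Rightarrow> 'k" where
  "word c w = (\<lambda>v. if v = w then c else 0)"

definition free_algebra :: "'l set \<Rightarrow> ('l list \<Rightarrow> 'k::field) ring" where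
  "free_algebra A =
     \<lparr>carrier = {p. finite {w. p w \<noteq> 0} \<and> (\<forall>w. p w \<noteq> 0 \<longrightarrow> set w \<subseteq> A)},
      monoid.mult = (\<lambda>p q w. \<Sum>i\<le>length w. p (take i w) * q (drop i w)),
      one = word 1 [],
      ring.zero = (\<lambda>_. 0),
      add = (\<lambda>p q w. p w + q w)\<rparr>"

definition uea_relations ::
    "('k::field, 'l::ab_group_add) lie_alg \<Rightarrow> ('l list \<Rightarrow> 'k) set" where
  "uea_relations L =
     {word 1 [x + y] - word 1 [x] - word 1 [y] | x y. x \<in> lie_carrier L \<and> y \<in> lie_carrier L} \<union>
     {word 1 [lie_scale L c x] - word c [x] | c x. x \<in> lie_carrier L} \<union>
     {word 1 [x, y] - word 1 [y, x] - word 1 [lie_bracket L x y] | x y.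
        x \<in> lie_carrier L \<and> y \<in> lie_carrier L}"

definition uea_ideal ::
    "('k::field, 'l::ab_group_add) lie_alg \<Rightarrow> ('l list \<Rightarrow> 'k) set" where
  "uea_ideal L = Idl\<^bsub>free_algebra (lie_carrier L)\<^esub> (uea_relations L)"

definition uea ::
    "('k::field, 'l::ab_group_add) lie_alg \<Rightarrow> ('l list \<Rightarrow> 'k) set ring" where
  "uea L = free_algebra (lie_carrier L) Quot uea_ideal L"

definition uea_class ::
    "('k::field, 'l::ab_group_add) lie_alg \<Rightarrow> ('l list \<Rightarrow> 'k) \<Rightarrow> ('l list \<Rightarrow> 'k) set" where
  "uea_class L p = uea_ideal L +>\<^bsub>free_algebra (lie_carrier L)\<^esub> p"

definition uea_gen ::
    "('k::field, 'l::ab_group_add) lie_alg \<Rightarrow> 'l \<Rightarrow> ('l list \<Rightarrow> 'k) set" where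
  "uea_gen L x = uea_class L (word 1 [x])"

definition uea_scalar ::
    "('k::field, 'l::ab_group_add) lie_alg \<Rightarrow> 'k \<Rightarrow> ('l list \<Rightarrow> 'k) set" where
  "uea_scalar L c = uea_class L (word c [])"

text \<open>A Lie algebra module as a left module over the enveloping algebra. As everywhere below, only
  the additive structure and \<open>smult\<close> of a \<open>module\<close> record are meaningful, and the ring of scalars
  need not be commutative. The choice of representative is immaterial for a \<open>lie_module\<close>.\<close>

definition free_act :: "('k::field, 'l, 'm::ab_group_add) rep \<Rightarrow> ('l list \<Rightarrow> 'k) \<Rightarrow> 'm \<Rightarrow> 'm" where
  "free_act M p v = (\<Sum>w | p w \<noteq> 0. rep_scale M (p w) (foldr (rep_act M) w v))"

definition uea_module ::
    "('k::field, 'l, 'm::ab_group_add) rep \<Rightarrow> (('l list \<Rightarrow> 'k) set, 'm) module" where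
  "uea_module M =
     \<lparr>carrier = rep_carrier M, monoid.mult = undefined, one = undefined,
      ring.zero = 0, add = (+),
      smult = (\<lambda>X v. free_act M (SOME p. p \<in> X) v)\<rparr>"


section \<open>Ore localization and base change\<close>

text \<open>The class \<open>ore_frac R S s r\<close> is the left fraction \<open>s\<^sup>-\<^sup>1 r\<close>.\<close>

definition ore_rel :: "('a, 'b) ring_scheme \<Rightarrow> 'a set \<Rightarrow> (('a \<times> 'a) \<times> ('a \<times> 'a)) set" where
  "ore_rel R S =
     {((s, r), (s', r')). s \<in> S \<and> s' \<in> S \<and> r \<in> carrier R \<and> r' \<in> carrier R \<and>
        (\<exists>a\<in>carrier R. \<exists>b\<in>carrier R.
           a \<otimes>\<^bsub>R\<^esub> s = b \<otimes>\<^bsub>R\<^esub> s' \<and> a \<otimes>\<^bsub>R\<^esub> s \<in> S \<and> a \<otimes>\<^bsub>R\<^esub> r = b \<otimes>\<^bsub>R\<^esub> r')}"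

definition ore_frac :: "('a, 'b) ring_scheme \<Rightarrow> 'a set \<Rightarrow> 'a \<Rightarrow> 'a \<Rightarrow> ('a \<times> 'a) set" where
  "ore_frac R S s r = ore_rel R S `` {(s, r)}"

definition ore_localization :: "('a, 'b) ring_scheme \<Rightarrow> 'a set \<Rightarrow> ('a \<times> 'a) set ring" where
  "ore_localization R S =
     \<lparr>carrier = (S \<times> carrier R) // ore_rel R S,
      monoid.mult = (\<lambda>X Y. THE Z. \<exists>s r t q. (s, r) \<in> X \<and> (t, q) \<in> Y \<and>
         (\<exists>s'\<in>S. \<exists>r'\<in>carrier R. s' \<otimes>\<^bsub>R\<^esub> r = r' \<otimes>\<^bsub>R\<^esub> t \<and>
            Z = ore_frac R S (s' \<otimes>\<^bsub>R\<^esub> s) (r' \<otimes>\<^bsub>R\<^esub> q))),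
      one = ore_frac R S \<one>\<^bsub>R\<^esub> \<one>\<^bsub>R\<^esub>,
      ring.zero = ore_frac R S \<one>\<^bsub>R\<^esub> \<zero>\<^bsub>R\<^esub>,
      add = (\<lambda>X Y. THE Z. \<exists>s r t q. (s, r) \<in> X \<and> (t, q) \<in> Y \<and>
         (\<exists>a\<in>carrier R. \<exists>b\<in>carrier R. a \<otimes>\<^bsub>R\<^esub> s = b \<otimes>\<^bsub>R\<^esub> t \<and> a \<otimes>\<^bsub>R\<^esub> s \<in> S \<and>
            Z = ore_frac R S (a \<otimes>\<^bsub>R\<^esub> s) (a \<otimes>\<^bsub>R\<^esub> r \<oplus>\<^bsub>R\<^esub> b \<otimes>\<^bsub>R\<^esub> q)))\<rparr>"

definition ore_map :: "('a, 'b) ring_scheme \<Rightarrow> 'a set \<Rightarrow> 'a \<Rightarrow> ('a \<times> 'a) set" where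
  "ore_map R S r = ore_frac R S \<one>\<^bsub>R\<^esub> r"

text \<open>The tensor product \<open>A \<otimes>\<^sub>R M\<close> along a ring homomorphism \<open>\<iota> : R \<rightarrow> A\<close>, for a left \<open>R\<close>-module
  \<open>M\<close>: the free abelian group on pairs modulo the biadditivity and balancing relations.\<close>

definition tensor_relations ::
    "('r, 'x) ring_scheme \<Rightarrow> ('a, 'y) ring_scheme \<Rightarrow> ('r \<Rightarrow> 'a) \<Rightarrow> ('r, 'm) module
       \<Rightarrow> (('a \<times> 'm) \<Rightarrow>\<^sub>0 int) set" where
  "tensor_relations R A \<iota> M =
     {frag_of (a \<oplus>\<^bsub>A\<^esub> b, v) - frag_of (a, v) - frag_of (b, v) | a b v.
        a \<in> carrier A \<and> b \<in> carrier A \<and> v \<in> carrier M} \<union>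
     {frag_of (a, v \<oplus>\<^bsub>M\<^esub> w) - frag_of (a, v) - frag_of (a, w) | a v w.
        a \<in> carrier A \<and> v \<in> carrier M \<and> w \<in> carrier M} \<union>
     {frag_of (a \<otimes>\<^bsub>A\<^esub> \<iota> r, v) - frag_of (a, r \<odot>\<^bsub>M\<^esub> v) | a r v.
        a \<in> carrier A \<and> r \<in> carrier R \<and> v \<in> carrier M}"

definition base_change ::
    "('r, 'x) ring_scheme \<Rightarrow> ('a, 'y) ring_scheme \<Rightarrow> ('r \<Rightarrow> 'a) \<Rightarrow> ('r, 'm) module
       \<Rightarrow> ('a, (('a \<times> 'm) \<Rightarrow>\<^sub>0 int) set) module" where
  "base_change R A \<iota> M =
     (let F = free_Abelian_group (carrier A \<times> carrier M);
          N = generate F (tensor_relations R A \<iota> M)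
      in \<lparr>carrier = carrier (F Mod N), monoid.mult = undefined, one = undefined,
          ring.zero = \<one>\<^bsub>F Mod N\<^esub>, add = monoid.mult (F Mod N),
          smult = (\<lambda>a X. N #>\<^bsub>F\<^esub>
            frag_extend (\<lambda>(b, v). frag_of (a \<otimes>\<^bsub>A\<^esub> b, v)) (SOME p. p \<in> X))\<rparr>)"

definition restrict_scalars :: "('r \<Rightarrow> 'a) \<Rightarrow> ('a, 'm) module \<Rightarrow> ('r, 'm) module" where
  "restrict_scalars \<iota> P =
     \<lparr>carrier = carrier P, monoid.mult = monoid.mult P, one = one P, ring.zero = \<zero>\<^bsub>P\<^esub>, add = add P,
      smult = (\<lambda>r. smult P (\<iota> r))\<rparr>"

definition module_isomorphic ::
    "('r, 'x) ring_scheme \<Rightarrow> ('r, 'm) module \<Rightarrow> ('r, 'n) module \<Rightarrow> bool" where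
  "module_isomorphic R M N \<longleftrightarrow>
     (\<exists>\<phi>. bij_betw \<phi> (carrier M) (carrier N) \<and>
        (\<forall>v\<in>carrier M. \<forall>w\<in>carrier M. \<phi> (v \<oplus>\<^bsub>M\<^esub> w) = \<phi> v \<oplus>\<^bsub>N\<^esub> \<phi> w) \<and>
        (\<forall>r\<in>carrier R. \<forall>v\<in>carrier M. \<phi> (r \<odot>\<^bsub>M\<^esub> v) = r \<odot>\<^bsub>N\<^esub> \<phi> v))"


section \<open>Twisted localization\<close>

text \<open>In this section \<open>f\<close> is the element of the Lie algebra that gets inverted.\<close>

definition f_powers ::
    "('k::field, 'l::ab_group_add) lie_alg \<Rightarrow> 'l \<Rightarrow> ('l list \<Rightarrow> 'k) set set" where
  "f_powers L f = {uea_gen L f [^]\<^bsub>uea L\<^esub> n | n :: nat. True}"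

definition U_loc ::
    "('k::field, 'l::ab_group_add) lie_alg \<Rightarrow> 'l
       \<Rightarrow> (('l list \<Rightarrow> 'k) set \<times> ('l list \<Rightarrow> 'k) set) set ring" where
  "U_loc L f = ore_localization (uea L) (f_powers L f)"

definition U_loc_map ::
    "('k::field, 'l::ab_group_add) lie_alg \<Rightarrow> 'l \<Rightarrow> ('l list \<Rightarrow> 'k) set
       \<Rightarrow> (('l list \<Rightarrow> 'k) set \<times> ('l list \<Rightarrow> 'k) set) set" where
  "U_loc_map L f = ore_map (uea L) (f_powers L f)"

definition localization ::
    "('k::field, 'l::ab_group_add) lie_alg \<Rightarrow> 'l \<Rightarrow> ('k, 'l, 'm::ab_group_add) rep
       \<Rightarrow> ((('l list \<Rightarrow> 'k) set \<times> ('l list \<Rightarrow> 'k) set) set,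
           (((('l list \<Rightarrow> 'k) set \<times> ('l list \<Rightarrow> 'k) set) set \<times> 'm) \<Rightarrow>\<^sub>0 int) set) module" where
  "localization L f M = base_change (uea L) (U_loc L f) (U_loc_map L f) (uea_module M)"

definition ad_f ::
    "('k::field, 'l::ab_group_add) lie_alg \<Rightarrow> 'l
       \<Rightarrow> (('l list \<Rightarrow> 'k) set \<times> ('l list \<Rightarrow> 'k) set) set
       \<Rightarrow> (('l list \<Rightarrow> 'k) set \<times> ('l list \<Rightarrow> 'k) set) set" where
  "ad_f L f u =
     (let A = U_loc L f; F = U_loc_map L f (uea_gen L f)
      in (F \<otimes>\<^bsub>A\<^esub> u) \<ominus>\<^bsub>A\<^esub> (u \<otimes>\<^bsub>A\<^esub> F))"

text \<open>The sum over all \<open>i \<ge> 0\<close> is restricted to the indices with \<open>ad(f)\<^sup>i(u) \<noteq> 0\<close>.\<close>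

definition theta ::
    "('k::field_char_0, 'l::ab_group_add) lie_alg \<Rightarrow> 'l \<Rightarrow> 'k
       \<Rightarrow> (('l list \<Rightarrow> 'k) set \<times> ('l list \<Rightarrow> 'k) set) set
       \<Rightarrow> (('l list \<Rightarrow> 'k) set \<times> ('l list \<Rightarrow> 'k) set) set" where
  "theta L f x u =
     (let A = U_loc L f; F = U_loc_map L f (uea_gen L f)
      in \<Oplus>\<^bsub>A\<^esub>i\<in>{i. (ad_f L f ^^ i) u \<noteq> \<zero>\<^bsub>A\<^esub>}.
           U_loc_map L f (uea_scalar L (x gchoose i)) \<otimes>\<^bsub>A\<^esub> (ad_f L f ^^ i) u
             \<otimes>\<^bsub>A\<^esub> (inv\<^bsub>A\<^esub> F) [^]\<^bsub>A\<^esub> i)"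

text \<open>The underlying group of the twist is the given one, with \<open>v\<close> in the role of \<open>v\<^sup>x\<close>.\<close>

definition twist ::
    "('k::field_char_0, 'l::ab_group_add) lie_alg \<Rightarrow> 'l \<Rightarrow> 'k
       \<Rightarrow> ((('l list \<Rightarrow> 'k) set \<times> ('l list \<Rightarrow> 'k) set) set, 'v) module
       \<Rightarrow> ((('l list \<Rightarrow> 'k) set \<times> ('l list \<Rightarrow> 'k) set) set, 'v) module" where
  "twist L f x P = P\<lparr>smult := (\<lambda>u v. theta L f x u \<odot>\<^bsub>P\<^esub> v)\<rparr>"

text \<open>If \<open>f\<close> has weight \<open>-\<alpha>\<close>, twisting by \<open>x\<close> moves weights by \<open>x \<alpha>\<close>. For the root \<open>-\<alpha>\<close> the vector
  that is inverted has weight \<open>\<alpha>\<close>, and twisting by \<open>x\<close> moves weights by \<open>-x \<alpha>\<close>.\<close>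

definition twisted_localization ::
    "('k::field_char_0, 'l::ab_group_add) lie_alg \<Rightarrow> 'l \<Rightarrow> 'k
       \<Rightarrow> ('k, 'l, 'm::ab_group_add) rep
       \<Rightarrow> (('l list \<Rightarrow> 'k) set,
           (((('l list \<Rightarrow> 'k) set \<times> ('l list \<Rightarrow> 'k) set) set \<times> 'm) \<Rightarrow>\<^sub>0 int) set) module" where
  "twisted_localization L f x M =
     restrict_scalars (U_loc_map L f) (twist L f x (localization L f M))"

end

theory Submission
  imports Defs "HOL-Computational_Algebra.Formal_Power_Series"
begin

text \<open>Let \<open>(e, h, f)\<close> be the triple of \<open>\<alpha>\<close>. As \<open>e\<close> and \<open>f\<close> are injective and weight spaces are
  finite-dimensional, \<open>f\<close> is bijective on \<open>M\<close> (\<open>root_vector_invertible\<close>). So \<open>M\<close> is already a module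
  over the localized enveloping algebra, and it can be twisted by \<open>-x\<close> without leaving its underlying
  space: \<open>y\<close> acts by \<open>\<Sum>\<^sub>i (-x choose i) ad(f)\<^sup>i(y) f\<^sup>-\<^sup>i\<close>, the \<open>(-x)\<close>-th power of conjugation by \<open>f\<close>.
  That this power is again multiplicative and that twisting by \<open>x\<close> undoes it are identities
  polynomial in \<open>x\<close>, or instances of Vandermonde's identity.

  The twisted module has a unique simple submodule. Let \<open>S\<close> be any nonzero submodule. The vectors that a
  power of \<open>f\<close> sends into \<open>S\<close> form a submodule of \<open>M\<close>, hence all of \<open>M\<close> (\<open>absorbing\<close>). So \<open>S\<close>
  contains \<open>f\<^sup>n M\<^sup>\<mu>\<close> for large \<open>n\<close>. On such vectors the twisted \<open>e\<close> is inverse to \<open>f\<close> up to the operator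
  \<open>f e + q(n)\<close> on \<open>M\<^sup>\<mu>\<close>, with \<open>q\<close> quadratic, which is invertible for all \<open>n \<ge> n\<^sub>0\<close> where \<open>n\<^sub>0\<close> does not
  depend on \<open>S\<close>. Climbing up with \<open>e\<close> shows that every \<open>S\<close> contains \<open>f\<^sup>n\<^sup>0 M\<^sup>\<mu>\<close>
  (\<open>common_vectors\<close>). Therefore the intersection \<open>N\<close> of all nonzero submodules is nonzero and simple, and
  \<open>M\<close>, twisted by \<open>-x\<close>, is the localization of \<open>N\<close>.

  The exponent \<open>x\<close> solves a quadratic equation that makes some \<open>f w\<close> singular for the twisted \<open>e\<close>. The
  vectors killed by a power of \<open>e\<close> then form a nonzero submodule, which contains \<open>N\<close>. If
  another \<open>e\<^sub>\<beta>\<close> is locally nilpotent on \<open>M\<close>, the weights of \<open>M\<close> are bounded in direction \<open>\<beta>\<close>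
  (\<open>weight_string_bounded\<close>). The weights of \<open>N\<close> are among those of \<open>M\<close> shifted by \<open>-x\<alpha>\<close>, so \<open>e\<^sub>\<beta>\<close> is
  locally nilpotent on \<open>N\<close> as well.

  For \<open>-\<alpha>\<close> the roles of \<open>e\<close> and \<open>f\<close> are exchanged. The equation for \<open>x\<close> says that the Casimir operator
  of the triple has the eigenvalue of a highest weight vector in the twist. A lowest weight vector
  one step above has the same eigenvalue, so the same \<open>x\<close> serves for both signs. Here the triples of \<open>\<alpha>\<close>
  and \<open>-\<alpha>\<close> have to be proportional, that is, real root spaces have to be lines (\<open>triple_structure\<close>).

  The remaining work concerns the constructions themselves. The enveloping algebra is a ring in which
  \<open>f\<close> is locally ad-nilpotent. This alone yields the Ore conditions and common denominators, so every
  element of the tensor product is of the form \<open>f\<^sup>-\<^sup>n \<otimes> v\<close> (\<open>pure_tensor\<close>) and evaluation identifies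
  the localization of \<open>N\<close> with the space of \<open>M\<close>.\<close>

section \<open>Operators on finite-dimensional subspaces\<close>

text \<open>Modules are carried by subspaces \<open>C\<close> of a type, and nothing is known about their operators outside
  \<open>C\<close>.\<close>

definition lin_on :: "('k::field \<Rightarrow> 'v::ab_group_add \<Rightarrow> 'v) \<Rightarrow> 'v set \<Rightarrow> ('v \<Rightarrow> 'v) \<Rightarrow> bool" where
  "lin_on s C u \<longleftrightarrow>
     (\<forall>v\<in>C. u v \<in> C) \<and> (\<forall>v\<in>C. \<forall>w\<in>C. u (v + w) = u v + u w) \<and>
     (\<forall>c. \<forall>v\<in>C. u (s c v) = s c (u v))"

lemma lin_onI:
  assumes "\<And>v. v \<in> C \<Longrightarrow> u v \<in> C"
    and "\<And>v w. v \<in> C \<Longrightarrow> w \<in> C \<Longrightarrow> u (v + w) = u v + u w"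
    and "\<And>c v. v \<in> C \<Longrightarrow> u (s c v) = s c (u v)"
  shows "lin_on s C u"
  using assms by (auto simp: lin_on_def)

lemma lin_on_closed: "lin_on s C u \<Longrightarrow> v \<in> C \<Longrightarrow> u v \<in> C"
  and lin_on_add: "lin_on s C u \<Longrightarrow> v \<in> C \<Longrightarrow> w \<in> C \<Longrightarrow> u (v + w) = u v + u w"
  and lin_on_scale: "lin_on s C u \<Longrightarrow> v \<in> C \<Longrightarrow> u (s c v) = s c (u v)"
  by (auto simp: lin_on_def)

lemma lin_on_funpow_closed: "lin_on s C u \<Longrightarrow> v \<in> C \<Longrightarrow> (u ^^ n) v \<in> C"
  by (induction n) (auto intro: lin_on_closed)

locale lin_space = vector_space scale
  for scale :: "'a::field \<Rightarrow> 'b::ab_group_add \<Rightarrow> 'b" (infixr \<open>*s\<close> 75)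
begin

lemma lin_on_zero:
  assumes "lin_on scale C u" "subspace C"
  shows "u 0 = 0"
  using lin_on_scale[OF assms(1) subspace_0[OF assms(2)], of 0] by simp

lemma lin_on_diff:
  assumes "lin_on scale C u" "subspace C" "v \<in> C" "w \<in> C"
  shows "u (v - w) = u v - u w"
proof -
  have "u (v - w + w) = u (v - w) + u w"
    using lin_on_add[OF assms(1) subspace_diff[OF assms(2-4)] assms(4)] .
  then show ?thesis by (simp add: algebra_simps)
qed

lemma lin_on_minus:
  assumes "lin_on scale C u" "subspace C" "v \<in> C"
  shows "u (- v) = - u v"
  using lin_on_diff[OF assms(1,2) subspace_0[OF assms(2)] assms(3)] lin_on_zero[OF assms(1,2)]
  by simp

lemma lin_on_sum:
  assumes "lin_on scale C u" "subspace C" "\<And>i. i \<in> I \<Longrightarrow> g i \<in> C"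
  shows "u (sum g I) = (\<Sum>i\<in>I. u (g i))"
  using assms(3)
proof (induction I rule: infinite_finite_induct)
  case (insert i I)
  then have "sum g I \<in> C" using assms(2) by (auto intro: subspace_sum)
  with insert show ?case by (simp add: lin_on_add[OF assms(1)])
qed (auto simp: lin_on_zero[OF assms(1,2)])

lemma lin_on_lincomb:
  assumes "lin_on scale D u" "subspace D" "\<And>i. i \<in> I \<Longrightarrow> g i \<in> D"
  shows "u (\<Sum>i\<in>I. a i *s g i) = (\<Sum>i\<in>I. a i *s u (g i))"
  using assms
  by (subst lin_on_sum[OF assms(1,2)])
    (auto simp: lin_on_scale[OF assms(1)] intro!: subspace_scale sum.cong)

lemma lin_on_compose: "lin_on scale C u \<Longrightarrow> lin_on scale C v \<Longrightarrow> lin_on scale C (\<lambda>x. u (v x))"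
  by (auto simp: lin_on_def)

lemma lin_on_combination:
  assumes "lin_on scale C u" "lin_on scale C v" "subspace C"
  shows "lin_on scale C (\<lambda>x. a *s u x + b *s v x)"
  using assms unfolding lin_on_def
  by (auto simp: scale_right_distrib scale_left_commute subspace_add subspace_scale algebra_simps)

lemma lin_on_funpow: "lin_on scale C u \<Longrightarrow> lin_on scale C (u ^^ n)"
  by (induction n) (auto simp: lin_on_def)

definition operator_poly :: "('b \<Rightarrow> 'b) \<Rightarrow> 'a poly \<Rightarrow> 'b \<Rightarrow> 'b" where
  "operator_poly u p v = (\<Sum>i\<le>degree p. coeff p i *s (u ^^ i) v)"

lemma operator_poly_upto:
  assumes "degree p \<le> n"
  shows "operator_poly u p v = (\<Sum>i\<le>n. coeff p i *s (u ^^ i) v)"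
  unfolding operator_poly_def using assms
  by (intro sum.mono_neutral_left) (auto simp: coeff_eq_0)

lemma operator_poly_0: "operator_poly u 0 v = 0"
  by (simp add: operator_poly_def)

lemma operator_poly_add: "operator_poly u (p + q) v = operator_poly u p v + operator_poly u q v"
proof -
  define n where "n = max (degree p) (degree q)"
  have d: "degree (p + q) \<le> n" unfolding n_def by (rule degree_add_le_max)
  have "degree p \<le> n" "degree q \<le> n" by (auto simp: n_def)
  then show ?thesis
    unfolding operator_poly_upto[OF d] by (simp add: operator_poly_upto scale_left_distrib sum.distrib)
qed

lemma operator_poly_smult: "operator_poly u (Polynomial.smult a p) v = a *s operator_poly u p v"
  by (simp add: operator_poly_upto[OF degree_smult_le] operator_poly_def scale_sum_right)

lemma operator_poly_closed:
  assumes "lin_on scale C u" "subspace C" "v \<in> C"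
  shows "operator_poly u p v \<in> C"
  unfolding operator_poly_def
  by (intro subspace_sum subspace_scale assms lin_on_funpow_closed[OF assms(1)])

lemma operator_poly_pCons:
  assumes "lin_on scale C u" "subspace C" "v \<in> C"
  shows "operator_poly u (pCons a p) v = a *s v + u (operator_poly u p v)"
proof -
  have "u (operator_poly u p v) = (\<Sum>i\<le>degree p. coeff p i *s (u ^^ Suc i) v)"
    unfolding operator_poly_def
    by (subst lin_on_sum[OF assms(1,2)])
      (auto simp: lin_on_scale[OF assms(1)] lin_on_funpow_closed[OF assms(1)] assms
        intro!: subspace_scale)
  then show ?thesis
    by (simp add: operator_poly_upto[OF degree_pCons_le] sum.atMost_Suc_shift del: sum.atMost_Suc)
qed

lemma operator_poly_mult:
  assumes "lin_on scale C u" "subspace C" "v \<in> C"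
  shows "operator_poly u (p * q) v = operator_poly u p (operator_poly u q v)"
proof (induction p)
  case 0
  then show ?case by (simp add: operator_poly_0)
next
  case (pCons a p)
  have "operator_poly u (pCons a p * q) v = a *s operator_poly u q v + operator_poly u (pCons 0 (p * q)) v"
    by (simp add: operator_poly_add operator_poly_smult)
  also have "\<dots> = a *s operator_poly u q v + u (operator_poly u p (operator_poly u q v))"
    using pCons by (simp add: operator_poly_pCons[OF assms])
  finally show ?case
    by (simp add: operator_poly_pCons[OF assms(1,2) operator_poly_closed[OF assms]])
qed

lemma operator_poly_eigenvector:
  assumes "u v = a *s v" and "lin_on scale C u" "v \<in> C"
  shows "operator_poly u p v = poly p a *s v"
proof -
  have "(u ^^ i) v = a ^ i *s v" for i
    using assms by (induction i) (auto simp: lin_on_scale mult.commute)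
  then show ?thesis by (simp add: operator_poly_def poly_altdef scale_sum_left)
qed

text \<open>More iterates of \<open>v\<close> than the dimension are linearly dependent; the coefficients of a relation are those
  of the polynomial.\<close>

lemma annihilating_poly_vector:
  assumes u: "lin_on scale C u" "subspace C" and fin: "finite B" "C \<subseteq> span B" and v: "v \<in> C"
  obtains p where "p \<noteq> 0" "operator_poly u p v = 0"
proof -
  define n where "n = card B"
  define g where "g = (\<lambda>i. (u ^^ i) v)"
  have gC: "g i \<in> C" for i unfolding g_def by (rule lin_on_funpow_closed[OF u(1) v])
  show ?thesis
  proof (cases "inj_on g {..n}")
    case False
    then obtain i j where ij: "i < j" "g i = g j"
      by (metis inj_onI linorder_neqE_nat)
    define p where "p = monom 1 j - monom (1::'a) i"
    have "coeff p j = 1" using ij by (simp add: p_def)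
    then have "p \<noteq> 0" by auto
    moreover have "degree p \<le> j" unfolding p_def
      using ij by (intro degree_diff_le) (auto simp: degree_monom_eq)
    then have "operator_poly u p v = (\<Sum>k\<le>j. (if k = j then g k else 0) - (if k = i then g k else 0))"
      unfolding operator_poly_upto[OF \<open>degree p \<le> j\<close>]
      by (intro sum.cong) (use ij in \<open>auto simp: p_def g_def\<close>)
    then have "operator_poly u p v = g j - g i"
      using ij by (simp add: sum_subtractf)
    ultimately show ?thesis using that ij by simp
  next
    case True
    have "card (g ` {..n}) = Suc n" using card_image[OF True] by simp
    moreover have "g ` {..n} \<subseteq> span B" using gC fin by auto
    ultimately have "dependent (g ` {..n})"
      using independent_span_bound[OF fin(1), of "g ` {..n}"] by (auto simp: n_def)
    then obtain c where c: "\<exists>w\<in>g ` {..n}. c w \<noteq> 0" "(\<Sum>w\<in>g ` {..n}. c w *s w) = 0"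
      by (auto simp: dependent_finite)
    define p where "p = (\<Sum>i\<le>n. monom (c (g i)) i)"
    have cp: "coeff p i = (if i \<le> n then c (g i) else 0)" for i
      by (auto simp: p_def coeff_sum)
    then have "p \<noteq> 0" using c(1) by (metis (no_types, lifting) atMost_iff coeff_0 imageE)
    moreover have "degree p \<le> n" by (rule degree_le) (auto simp: cp)
    then have "operator_poly u p v = (\<Sum>i\<le>n. c (g i) *s g i)"
      by (simp add: operator_poly_upto cp g_def)
    then have "operator_poly u p v = 0" using c(2) by (simp add: sum.reindex[OF True])
    ultimately show ?thesis using that by blast
  qed
qed

text \<open>An injective operator on a finite-dimensional space is onto: in a polynomial relation for a
  vector \<open>v\<close>, injectivity allows us to cancel the operator until the constant term is nonzero, and
  then the relation exhibits \<open>v\<close> as a value.\<close>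

lemma injective_imp_onto:
  assumes u: "lin_on scale C u" "subspace C" and fin: "finite B" "C \<subseteq> span B" and v: "v \<in> C"
    and inj: "\<And>w. w \<in> C \<Longrightarrow> u w = 0 \<Longrightarrow> w = 0"
  shows "\<exists>w\<in>C. u w = v"
proof -
  obtain p where "p \<noteq> 0" "operator_poly u p v = 0"
    using annihilating_poly_vector[OF u fin v] .
  then show ?thesis
  proof (induction p)
    case (pCons a p)
    have eq: "operator_poly u (pCons a p) v = a *s v + u (operator_poly u p v)" by (rule operator_poly_pCons[OF u v])
    have pC: "operator_poly u p v \<in> C" by (rule operator_poly_closed[OF u v])
    show ?case
    proof (cases "a = 0")
      case True
      have "u (operator_poly u p v) = 0" using eq pCons.prems(2) True by simp
      then have "operator_poly u p v = 0" by (rule inj[OF pC])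
      moreover have "p \<noteq> 0" using pCons.prems(1) True by auto
      ultimately show ?thesis by (rule pCons.IH[rotated])
    next
      case False
      have "u (operator_poly u p v) = (- a) *s v"
        using eq pCons.prems(2) by (simp add: add_eq_0_iff)
      then have "u ((- inverse a) *s operator_poly u p v) = v"
        using False lin_on_scale[OF u(1) pC, of "- inverse a"] by simp
      then show ?thesis using pC subspace_scale[OF u(2)] by blast
    qed
  qed simp
qed

lemma finite_basis:
  assumes "finite B" "C \<subseteq> span B"
  obtains B' where "finite B'" "B' \<subseteq> C" "independent B'" "C \<subseteq> span B'"
proof -
  obtain B' where B': "B' \<subseteq> C" "independent B'" "C \<subseteq> span B'"
    using maximal_independent_subset[of C] .
  moreover have "finite B'" using independent_span_bound[OF assms(1) B'(2)] B'(1) assms(2) by auto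
  ultimately show ?thesis using that by blast
qed

lemma span_subset_vanish:
  assumes u: "lin_on scale C u" "subspace C" and B: "B \<subseteq> C" and C: "C \<subseteq> span B"
    and "\<And>b. b \<in> B \<Longrightarrow> u b = 0" and v: "v \<in> C"
  shows "u v = 0"
proof -
  have "subspace {w \<in> C. u w = 0}"
    using u by (auto simp: subspace_def lin_on_def lin_on_zero[OF u])
  then have "span B \<subseteq> {w \<in> C. u w = 0}"
    using B assms(5) by (intro span_minimal) auto
  then show ?thesis using v C by auto
qed

text \<open>The product of polynomials that annihilate the members of a basis annihilates the whole space, and all
  eigenvalues are among its roots.\<close>

lemma finite_eigenvalues:
  assumes u: "lin_on scale C u" "subspace C" and fin: "finite B" "C \<subseteq> span B"
  shows "finite {a. \<exists>v\<in>C. v \<noteq> 0 \<and> u v = a *s v}"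
proof -
  obtain B' where B': "finite B'" "B' \<subseteq> C" "independent B'" "C \<subseteq> span B'"
    using finite_basis[OF fin] .
  have "\<forall>b\<in>B'. \<exists>p. p \<noteq> 0 \<and> operator_poly u p b = 0"
    using annihilating_poly_vector[OF u fin] B'(2) by (metis subsetD)
  then obtain q where q: "\<And>b. b \<in> B' \<Longrightarrow> q b \<noteq> 0 \<and> operator_poly u (q b) b = 0" by metis
  define P where "P = (\<Prod>b\<in>B'. q b)"
  have lin: "lin_on scale C (operator_poly u P)"
    using u(1) operator_poly_closed[OF u]
    by (intro lin_onI)
      (auto simp: operator_poly_def lin_on_add[OF lin_on_funpow[OF u(1)]] sum.distrib scale_sum_right
        lin_on_scale[OF lin_on_funpow[OF u(1)]] scale_right_distrib mult.commute)
  have "operator_poly u P b = 0" if b: "b \<in> B'" for b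
  proof -
    have "P = (\<Prod>b\<in>B' - {b}. q b) * q b"
      unfolding P_def using prod.remove[OF B'(1) b, of q] by (simp add: mult.commute)
    moreover have "b \<in> C" using b B' by auto
    ultimately have "operator_poly u P b = operator_poly u (\<Prod>b\<in>B' - {b}. q b) 0"
      using q[OF b] operator_poly_mult[OF u, of b] by simp
    also have "(u ^^ i) 0 = 0" for i by (induction i) (auto simp: lin_on_zero[OF u])
    then have "operator_poly u (\<Prod>b\<in>B' - {b}. q b) 0 = 0" by (simp add: operator_poly_def)
    finally show ?thesis .
  qed
  then have P0: "operator_poly u P v = 0" if "v \<in> C" for v
    using span_subset_vanish[OF lin u(2) B'(2) B'(4) _ that] by blast
  have "P \<noteq> 0" unfolding P_def using q B'(1) by auto
  then have "finite {a. poly P a = 0}" by (rule poly_roots_finite)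
  moreover have "{a. \<exists>v\<in>C. v \<noteq> 0 \<and> u v = a *s v} \<subseteq> {a. poly P a = 0}"
    using P0 operator_poly_eigenvector[OF _ u(1)] by fastforce
  ultimately show ?thesis by (rule finite_subset[rotated])
qed

text \<open>Unlike the summands of a linear combination, the terms here have distinct indices.\<close>

lemma span_Union_decomposition:
  assumes sub: "\<And>i. i \<in> I \<Longrightarrow> subspace (V i)" and v: "v \<in> span (\<Union>i\<in>I. V i)"
  obtains E g where "finite E" "E \<subseteq> I" "\<And>i. i \<in> E \<Longrightarrow> g i \<in> V i" "v = sum g E"
proof -
  have "\<exists>E g. finite E \<and> E \<subseteq> I \<and> (\<forall>i\<in>E. g i \<in> V i) \<and> v = sum g E" using v
  proof (induction rule: span_induct_alt)
    case base
    then show ?case by (intro exI[of _ "{}"]) auto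
  next
    case (step c x y)
    then obtain E g where Eg: "finite E" "E \<subseteq> I" "\<And>i. i \<in> E \<Longrightarrow> g i \<in> V i" "y = sum g E"
      by blast
    obtain j where j: "j \<in> I" "x \<in> V j" using step by blast
    define g' where "g' = (\<lambda>i. (if i = j then c *s x else 0) + (if i \<in> E then g i else 0))"
    have "sum g' (insert j E) = c *s x + (\<Sum>i\<in>insert j E. if i \<in> E then g i else 0)"
      using Eg(1) by (simp add: g'_def sum.distrib)
    also have "(\<Sum>i\<in>insert j E. if i \<in> E then g i else 0) = sum g E"
      using Eg(1) by (intro sum.mono_neutral_cong_right) auto
    finally have "c *s x + y = sum g' (insert j E)" using Eg(4) by simp
    moreover have "\<forall>i\<in>insert j E. g' i \<in> V i"
      using Eg(2,3) j sub unfolding g'_def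
      by (auto intro!: subspace_add subspace_scale subspace_0)
    ultimately show ?case using Eg j by (intro exI[of _ "insert j E"] exI[of _ g']) auto
  qed
  then show ?thesis using that by blast
qed

text \<open>The components of a vector of \<open>W\<close> in pairwise distinct joint eigenspaces lie in \<open>W\<close> as soon
  as \<open>W\<close> is stable under the operators: applying an operator and subtracting a multiple removes
  one component and multiplies the others by scalars.\<close>

lemma eigen_components:
  assumes W: "subspace W" "W \<subseteq> C" and C: "subspace C"
    and u: "\<And>i. i \<in> I \<Longrightarrow> lin_on scale C (u i)"
    and stab: "\<And>i w. i \<in> I \<Longrightarrow> w \<in> W \<Longrightarrow> u i w \<in> W"
    and E: "finite E"
    and g: "\<And>\<mu>. \<mu> \<in> E \<Longrightarrow> g \<mu> \<in> C" "\<And>\<mu> i. \<mu> \<in> E \<Longrightarrow> i \<in> I \<Longrightarrow> u i (g \<mu>) = \<chi> \<mu> i *s g \<mu>"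
    and sep: "\<And>\<mu> \<nu>. \<mu> \<in> E \<Longrightarrow> \<nu> \<in> E \<Longrightarrow> \<mu> \<noteq> \<nu> \<Longrightarrow> \<exists>i\<in>I. \<chi> \<mu> i \<noteq> \<chi> \<nu> i"
    and sum: "sum g E \<in> W"
  shows "\<forall>\<mu>\<in>E. g \<mu> \<in> W"
  using E g sep sum
proof (induction "card E" arbitrary: E g rule: less_induct)
  case less
  show ?case
  proof (cases "\<exists>\<mu>\<in>E. \<exists>\<nu>\<in>E. \<mu> \<noteq> \<nu>")
    case False
    show ?thesis
    proof
      fix \<mu> assume "\<mu> \<in> E"
      then have "E = {\<mu>}" using False by auto
      then show "g \<mu> \<in> W" using less.prems(5) by simp
    qed
  next
    case True
    then obtain \<mu>0 \<mu>1 where \<mu>: "\<mu>0 \<in> E" "\<mu>1 \<in> E" "\<mu>0 \<noteq> \<mu>1" by blast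
    then obtain i where i: "i \<in> I" "\<chi> \<mu>0 i \<noteq> \<chi> \<mu>1 i" using less.prems(4) by blast
    define E1 where "E1 = {\<mu> \<in> E. \<chi> \<mu> i \<noteq> \<chi> \<mu>0 i}"
    have E1: "E1 \<subseteq> E" "\<mu>1 \<in> E1" "\<mu>0 \<notin> E1" using \<mu> i by (auto simp: E1_def)
    have fin: "finite E1" using E1(1) less.prems(1) by (rule finite_subset)
    have card1: "card E1 < card E"
      using E1 \<mu> less.prems(1) by (intro psubset_card_mono) auto
    have card2: "card (E - E1) < card E"
      using E1 \<mu> less.prems(1) by (intro psubset_card_mono) auto
    define g' where "g' = (\<lambda>\<mu>. (\<chi> \<mu> i - \<chi> \<mu>0 i) *s g \<mu>)"
    have "u i (sum g E) - \<chi> \<mu>0 i *s sum g E = sum g' E"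
      using lin_on_sum[OF u[OF i(1)] C, of E g] less.prems(2,3) i(1)
      by (simp add: g'_def scale_left_diff_distrib sum_subtractf scale_sum_right)
    also have "\<dots> = sum g' E1"
      using less.prems(1) E1(1) by (intro sum.mono_neutral_right) (auto simp: E1_def g'_def)
    finally have "sum g' E1 \<in> W"
      using subspace_diff[OF W(1) stab[OF i(1) less.prems(5)] subspace_scale[OF W(1) less.prems(5)]]
      by metis
    moreover have "g' \<mu> \<in> C" if "\<mu> \<in> E1" for \<mu>
      using that E1 less.prems(2) C by (auto simp: g'_def intro!: subspace_scale)
    moreover have "u j (g' \<mu>) = \<chi> \<mu> j *s g' \<mu>" if "\<mu> \<in> E1" "j \<in> I" for \<mu> j
      using that E1(1) less.prems(2,3) lin_on_scale[OF u[OF that(2)]]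
      by (auto simp: g'_def scale_left_commute subset_iff mult.commute)
    ultimately have 1: "\<forall>\<mu>\<in>E1. g' \<mu> \<in> W"
      using E1(1) by (intro less.hyps[OF card1 fin] less.prems(4)) auto
    have 2: "\<forall>\<mu>\<in>E1. g \<mu> \<in> W"
    proof
      fix \<mu> assume "\<mu> \<in> E1"
      then have "inverse (\<chi> \<mu> i - \<chi> \<mu>0 i) *s g' \<mu> = g \<mu>" "g' \<mu> \<in> W"
        using 1 by (auto simp: g'_def E1_def)
      then show "g \<mu> \<in> W" using subspace_scale[OF W(1)] by metis
    qed
    have "sum g (E - E1) = sum g E - sum g E1"
      using less.prems(1) E1(1) by (simp add: sum_diff fin)
    also have "\<dots> \<in> W"
      using 2 less.prems(5) W(1) by (auto intro!: subspace_diff subspace_sum)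
    finally have "\<forall>\<mu>\<in>E - E1. g \<mu> \<in> W"
      using less.prems by (intro less.hyps[OF card2]) auto
    then show ?thesis using 2 by blast
  qed
qed

end

text \<open>A polynomial that annihilates \<open>v\<close> splits into linear factors. Applying them to \<open>v\<close> one after the other
  gives zero in the end, and the last vector before that is an eigenvector.\<close>

lemma eigenvector_exists:
  fixes s :: "'k::alg_closed_field \<Rightarrow> 'v::ab_group_add \<Rightarrow> 'v"
  assumes vs: "vector_space s" and u: "lin_on s C u" "Modules.module.subspace s C"
    and fin: "fin_dim s C" and v: "v \<in> C" "v \<noteq> 0"
  obtains a w where "w \<in> C" "w \<noteq> 0" "u w = s a w"
proof -
  interpret lin_space s using vs by (rule lin_space.intro)
  obtain B where B: "finite B" "C \<subseteq> span B" using fin by (auto simp: fin_dim_def)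
  obtain p where "p \<noteq> 0" "operator_poly u p v = 0"
    using annihilating_poly_vector[OF u B v(1)] .
  then have "\<exists>a w. w \<in> C \<and> w \<noteq> 0 \<and> u w = s a w"
  proof (induction "degree p" arbitrary: p rule: less_induct)
    case less
    show ?case
    proof (cases "degree p = 0")
      case True
      then obtain c where "p = [:c:]" by (metis degree_eq_zeroE)
      then show ?thesis using less.prems v by (auto simp: operator_poly_def)
    next
      case False
      then obtain a where "poly p a = 0" using alg_closed_imp_poly_has_root[of p] by auto
      then obtain q where q: "p = [:-a, 1:] * q" by (auto simp: poly_eq_0_iff_dvd)
      have q0: "q \<noteq> 0" using q less.prems(1) by auto
      have "degree p = degree [:-a, 1:] + degree q"
        unfolding q by (rule degree_mult_eq) (use q0 in auto)
      then have "degree q < degree p" by simp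
      have qC: "operator_poly u q v \<in> C" by (rule operator_poly_closed[OF u v(1)])
      have "operator_poly u p v = operator_poly u [:-a, 1:] (operator_poly u q v)"
        unfolding q by (rule operator_poly_mult[OF u v(1)])
      also have "\<dots> = u (operator_poly u q v) - s a (operator_poly u q v)"
        using operator_poly_pCons[OF u qC, of "-a" 1] by (simp add: operator_poly_def)
      finally have "u (operator_poly u q v) = s a (operator_poly u q v)" using less.prems by simp
      then show ?thesis
        using less.hyps[OF \<open>degree q < degree p\<close> q0] qC by blast
    qed
  qed
  then show ?thesis using that by blast
qed

lemma joint_eigenvector_exists:
  fixes s :: "'k::alg_closed_field \<Rightarrow> 'v::ab_group_add \<Rightarrow> 'v"
  assumes vs: "vector_space s" and C: "Modules.module.subspace s C" "fin_dim s C" "C \<noteq> {0}"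
    and u: "\<And>i. i \<in> I \<Longrightarrow> lin_on s C (u i)"
    and comm: "\<And>i j v. i \<in> I \<Longrightarrow> j \<in> I \<Longrightarrow> v \<in> C \<Longrightarrow> u i (u j v) = u j (u i v)"
  shows "\<exists>w\<in>C. w \<noteq> 0 \<and> (\<forall>i\<in>I. \<exists>a. u i w = s a w)"
proof -
  interpret lin_space s using vs by (rule lin_space.intro)
  obtain B where B: "finite B" "C \<subseteq> span B" using C by (auto simp: fin_dim_def)
  \<comment> \<open>A stable nonzero subspace with a basis of least size: every operator is a scalar on it.\<close>
  define P where "P = (\<lambda>n. \<exists>W b. subspace W \<and> W \<subseteq> C \<and> W \<noteq> {0} \<and> (\<forall>i\<in>I. \<forall>v\<in>W. u i v \<in> W) \<and>
     finite b \<and> b \<subseteq> W \<and> independent b \<and> W \<subseteq> span b \<and> card b = n)"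
  have ex: "\<exists>n. P n"
  proof -
    obtain B' where "finite B'" "B' \<subseteq> C" "independent B'" "C \<subseteq> span B'"
      using finite_basis[OF B] .
    then have "P (card B')" unfolding P_def using C u by (blast intro: lin_on_closed)
    then show ?thesis ..
  qed
  define n where "n = (LEAST n. P n)"
  have "P n" unfolding n_def using ex by (rule LeastI_ex)
  then obtain W b where W: "subspace W" "W \<subseteq> C" "W \<noteq> {0}" "\<And>i v. i \<in> I \<Longrightarrow> v \<in> W \<Longrightarrow> u i v \<in> W"
    and b: "finite b" "b \<subseteq> W" "independent b" "W \<subseteq> span b" "card b = n"
    unfolding P_def by blast
  have min: "\<not> P m" if "m < n" for m using that not_less_Least unfolding n_def by blast
  obtain w where w: "w \<in> W" "w \<noteq> 0" using W(1,3) subspace_0 by blast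
  have "\<exists>a. u i w = s a w" if i: "i \<in> I" for i
  proof -
    have lin: "lin_on s W (u i)"
      using u[OF i] W(2,4) i unfolding lin_on_def by blast
    have fin: "fin_dim s W" using b(1,4) by (auto simp: fin_dim_def)
    obtain a w' where w': "w' \<in> W" "w' \<noteq> 0" "u i w' = s a w'"
      using eigenvector_exists[OF vs lin W(1) fin w] .
    define V where "V = {v \<in> W. u i v = s a v}"
    have V: "subspace V"
      using W(1) lin unfolding V_def
      by (auto simp: subspace_def lin_on_zero[OF lin W(1)] lin_on_add lin_on_scale
          scale_right_distrib mult.commute)
    have VW: "V \<subseteq> W" by (auto simp: V_def)
    obtain b' where b': "finite b'" "b' \<subseteq> V" "independent b'" "V \<subseteq> span b'"
      using finite_basis[of b V] b VW by blast
    have stab: "u j v \<in> V" if "j \<in> I" "v \<in> V" for j v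
      using that i comm[of i j v] W(2,4) u[OF that(1)] by (auto simp: V_def lin_on_scale subset_iff)
    have "V \<noteq> {0}" using w' by (auto simp: V_def)
    then have "P (card b')" unfolding P_def using V VW W(2) stab b' by blast
    then have ge: "n \<le> card b'" using min not_less by blast
    have sp: "b' \<subseteq> span b" using b' VW b(4) by auto
    obtain t where t: "card t = card b" "finite t" "b' \<subseteq> t" "b \<subseteq> span t"
    proof -
      have bspan: "card b' \<le> card b" using independent_span_bound[OF b(1) b'(3) sp] by simp
      have "b \<subseteq> span b'"
      proof (rule ccontr)
        assume "\<not> b \<subseteq> span b'"
        then obtain x where x: "x \<in> b" "x \<notin> span b'" by blast
        have "independent (insert x b')" using x b'(3) by (simp add: independent_insert)
        moreover have "insert x b' \<subseteq> span b" using x sp by (auto intro: span_base)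
        ultimately have "card (insert x b') \<le> card b"
          using independent_span_bound[OF b(1)] by blast
        moreover have "x \<notin> b'" using x(2) span_base by blast
        ultimately show False using ge b(5) b'(1) by simp
      qed
      then show ?thesis using that[of b'] ge b(5) bspan b'(1) by auto
    qed
    then have "t = b'" using ge b(5) by (metis card_seteq)
    then have "w \<in> span b'" using w(1) b(4) t(4) by (metis span_mono span_span subsetD)
    moreover have "span b' \<subseteq> V" using b'(2) V by (rule span_minimal)
    ultimately show ?thesis by (auto simp: V_def)
  qed
  then show ?thesis using w W(2) by blast
qed

section \<open>Twisting operators by a power of an invertible operator\<close>

text \<open>Functions of the exponent that are polynomial with vector coefficients. In the binomial basis the
  coefficients are determined one by one by the values at \<open>0, 1, 2, \<dots>\<close>.\<close>

definition polyfun :: "('k::field_char_0 \<Rightarrow> 'v::ab_group_add \<Rightarrow> 'v) \<Rightarrow> ('k \<Rightarrow> 'v) \<Rightarrow> bool" where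
  "polyfun s g \<longleftrightarrow> (\<exists>c n. \<forall>x. g x = (\<Sum>j<n. s (x gchoose j) (c j)))"

text \<open>\<open>G\<close> is the inverse of \<open>F\<close>; in the applications \<open>F\<close> is the action of the root vector \<open>f\<close>.\<close>

locale conjugation = lin_space scale
  for scale :: "'a::field_char_0 \<Rightarrow> 'b::ab_group_add \<Rightarrow> 'b" (infixr \<open>*s\<close> 75) +
  fixes C :: "'b set" and F G :: "'b \<Rightarrow> 'b"
  assumes C: "subspace C"
    and F: "lin_on scale C F" and G: "lin_on scale C G"
    and FG: "\<And>v. v \<in> C \<Longrightarrow> F (G v) = v" and GF: "\<And>v. v \<in> C \<Longrightarrow> G (F v) = v"
begin

text \<open>At \<open>m\<close> the binomial coefficients \<open>(m choose j)\<close> with \<open>j > m\<close> vanish and \<open>(m choose m)\<close> is \<open>1\<close>, so the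
  coefficients vanish in turn.\<close>

lemma polyfun_vanish:
  assumes "polyfun scale g" and "\<And>n. g (of_nat n) = 0"
  shows "g x = 0"
proof -
  obtain c n where g: "\<And>x. g x = (\<Sum>j<n. (x gchoose j) *s c j)"
    using assms(1) by (auto simp: polyfun_def)
  have "m < n \<longrightarrow> c m = 0" for m
  proof (induction m rule: less_induct)
    case (less m)
    show ?case
    proof
      assume m: "m < n"
      have "(of_nat m gchoose j) *s c j = (if j = m then c m else 0)" if "j < n" for j
        using less.IH[of j] that
        by (cases j m rule: linorder_cases)
          (auto simp: binomial_gbinomial[symmetric])
      then have "g (of_nat m) = (\<Sum>j<n. if j = m then c m else 0)"
        unfolding g by (intro sum.cong) auto
      then show "c m = 0" using assms(2) m by simp
    qed
  qed
  then show ?thesis by (simp add: g)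
qed

lemma polyfun_basic: "polyfun scale (\<lambda>x. (x gchoose j) *s w)"
  unfolding polyfun_def
proof (intro exI allI)
  fix x :: 'a
  show "(x gchoose j) *s w = (\<Sum>i<Suc j. (x gchoose i) *s (if i = j then w else 0))"
    by simp
qed

lemma polyfun_add:
  assumes "polyfun scale g" "polyfun scale h"
  shows "polyfun scale (\<lambda>x. g x + h x)"
proof -
  obtain c n where g: "\<And>x. g x = (\<Sum>j<n. (x gchoose j) *s c j)"
    using assms(1) by (auto simp: polyfun_def)
  obtain d m where h: "\<And>x. h x = (\<Sum>j<m. (x gchoose j) *s d j)"
    using assms(2) by (auto simp: polyfun_def)
  have "g x + h x = (\<Sum>j<max n m. (x gchoose j) *s ((if j < n then c j else 0) + (if j < m then d j else 0)))" for x
  proof -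
    have "g x = (\<Sum>j<max n m. (x gchoose j) *s (if j < n then c j else 0))"
      unfolding g by (intro sum.mono_neutral_cong_left) auto
    moreover have "h x = (\<Sum>j<max n m. (x gchoose j) *s (if j < m then d j else 0))"
      unfolding h by (intro sum.mono_neutral_cong_left) auto
    ultimately show ?thesis by (simp add: scale_right_distrib sum.distrib)
  qed
  then show ?thesis unfolding polyfun_def by (intro exI allI)
qed

lemma polyfun_0: "polyfun scale (\<lambda>x. 0)"
  unfolding polyfun_def by (rule exI[of _ "\<lambda>_. 0"], rule exI[of _ 0]) simp

lemma polyfun_sum: "(\<And>i. i \<in> I \<Longrightarrow> polyfun scale (g i)) \<Longrightarrow> polyfun scale (\<lambda>x. \<Sum>i\<in>I. g i x)"
  by (induction I rule: infinite_finite_induct) (auto intro: polyfun_0 polyfun_add)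

lemma polyfun_scale:
  assumes "polyfun scale g"
  shows "polyfun scale (\<lambda>x. a *s g x)"
proof -
  obtain c n where "\<And>x. g x = (\<Sum>j<n. (x gchoose j) *s c j)"
    using assms by (auto simp: polyfun_def)
  then have "a *s g x = (\<Sum>j<n. (x gchoose j) *s (a *s c j))" for x
    by (simp add: scale_sum_right mult.commute)
  then show ?thesis unfolding polyfun_def by (intro exI allI)
qed

lemma polyfun_times:
  assumes "polyfun scale g"
  shows "polyfun scale (\<lambda>x. x *s g x)"
proof -
  obtain c n where g: "\<And>x. g x = (\<Sum>j<n. (x gchoose j) *s c j)"
    using assms by (auto simp: polyfun_def)
  have "x *s g x = (\<Sum>j<n. (x gchoose j) *s (of_nat j *s c j) + (x gchoose Suc j) *s (of_nat (Suc j) *s c j))" for x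
    unfolding g scale_sum_right scale_scale gbinomial_mult_1
    by (simp add: scale_left_distrib mult.commute)
  moreover have "polyfun scale (\<lambda>x. \<Sum>j<n. (x gchoose j) *s (of_nat j *s c j) + (x gchoose Suc j) *s (of_nat (Suc j) *s c j))"
    by (intro polyfun_sum polyfun_add polyfun_basic)
  ultimately show ?thesis by simp
qed

lemma polyfun_gchoose:
  assumes "polyfun scale g"
  shows "polyfun scale (\<lambda>x. (x gchoose i) *s g x)"
proof (induction i)
  case 0
  then show ?case using assms by simp
next
  case (Suc i)
  have "((x::'a) gchoose Suc i) = inverse (of_nat (Suc i)) * (x * (x gchoose i) + (- of_nat i) * (x gchoose i))" for x
    using gbinomial_mult_1[of x i] by (simp add: field_simps del: of_nat_Suc)
  then have "(x gchoose Suc i) *s g x = inverse (of_nat (Suc i)) *s (x *s ((x gchoose i) *s g x) + (- of_nat i) *s ((x gchoose i) *s g x))" for x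
    by (metis scale_left_distrib scale_scale)
  moreover have "polyfun scale (\<lambda>x. inverse (of_nat (Suc i)) *s (x *s ((x gchoose i) *s g x) + (- of_nat i) *s ((x gchoose i) *s g x)))"
    by (intro polyfun_scale polyfun_add polyfun_times Suc)
  ultimately show ?case by simp
qed

lemma polyfun_diff:
  assumes "polyfun scale g" "polyfun scale h"
  shows "polyfun scale (\<lambda>x. g x - h x)"
  using polyfun_add[OF assms(1) polyfun_scale[OF assms(2), of "- 1"]] by simp

text \<open>This is \<open>[F, u] F\<^sup>-\<^sup>1\<close>, and its \<open>i\<close>-th iterate is \<open>ad(F)\<^sup>i(u) F\<^sup>-\<^sup>i\<close>.\<close>

definition conj_diff :: "('b \<Rightarrow> 'b) \<Rightarrow> 'b \<Rightarrow> 'b" where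
  "conj_diff u v = F (u (G v)) - u v"

definition conj_nilpotent :: "('b \<Rightarrow> 'b) \<Rightarrow> bool" where
  "conj_nilpotent u \<longleftrightarrow> (\<exists>K. \<forall>v\<in>C. (conj_diff ^^ K) u v = 0)"

text \<open>Conjugation by \<open>F\<close> is \<open>1 + conj_diff\<close>, so this binomial series is its \<open>x\<close>-th power.\<close>

definition conj_power :: "'a \<Rightarrow> ('b \<Rightarrow> 'b) \<Rightarrow> 'b \<Rightarrow> 'b" where
  "conj_power x u v = (\<Sum>i | (conj_diff ^^ i) u v \<noteq> 0. (x gchoose i) *s (conj_diff ^^ i) u v)"

lemma conj_diff_lin: "lin_on scale C u \<Longrightarrow> lin_on scale C (conj_diff u)"
  using F G C unfolding lin_on_def conj_diff_def
  by (auto simp: scale_right_diff_distrib intro: subspace_diff)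

lemma conj_diff_pow_lin: "lin_on scale C u \<Longrightarrow> lin_on scale C ((conj_diff ^^ i) u)"
  by (induction i) (auto intro: conj_diff_lin)

lemma conj_diff_cong: "(\<And>v. v \<in> C \<Longrightarrow> u v = u' v) \<Longrightarrow> v \<in> C \<Longrightarrow> conj_diff u v = conj_diff u' v"
  using G by (auto simp: conj_diff_def lin_on_def)

lemma conj_diff_pow_cong:
  "(\<And>v. v \<in> C \<Longrightarrow> u v = u' v) \<Longrightarrow> v \<in> C \<Longrightarrow> (conj_diff ^^ i) u v = (conj_diff ^^ i) u' v"
  by (induction i arbitrary: v) (auto intro: conj_diff_cong)

lemma conj_power_cong:
  "(\<And>v. v \<in> C \<Longrightarrow> u v = u' v) \<Longrightarrow> v \<in> C \<Longrightarrow> conj_power x u v = conj_power x u' v"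
  unfolding conj_power_def using conj_diff_pow_cong[of u u' v] by (simp cong: sum.cong)

lemma conj_diff_zero: "(\<And>v. v \<in> C \<Longrightarrow> u v = 0) \<Longrightarrow> v \<in> C \<Longrightarrow> conj_diff u v = 0"
  using G by (auto simp: conj_diff_def lin_on_def lin_on_zero[OF F C])

lemma conj_diff_pow_vanish:
  assumes "\<And>v. v \<in> C \<Longrightarrow> (conj_diff ^^ K) u v = 0" "K \<le> i" "v \<in> C"
  shows "(conj_diff ^^ i) u v = 0"
  using assms(2,3)
proof (induction i arbitrary: v rule: dec_induct)
  case base
  then show ?case using assms(1) by simp
next
  case (step i)
  then show ?case by (auto intro: conj_diff_zero)
qed

lemma conj_nilpotentE:
  assumes "conj_nilpotent u"
  obtains K where "\<And>i v. K \<le> i \<Longrightarrow> v \<in> C \<Longrightarrow> (conj_diff ^^ i) u v = 0"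
  using assms conj_diff_pow_vanish unfolding conj_nilpotent_def by metis

lemma conj_power_upto:
  assumes "\<And>i. K \<le> i \<Longrightarrow> (conj_diff ^^ i) u v = 0"
  shows "conj_power x u v = (\<Sum>i<K. (x gchoose i) *s (conj_diff ^^ i) u v)"
proof -
  have "{i. (conj_diff ^^ i) u v \<noteq> 0} \<subseteq> {..<K}" using assms not_less by auto
  then show ?thesis unfolding conj_power_def by (intro sum.mono_neutral_left) auto
qed

lemma conj_diff_pow_sum:
  assumes "\<And>i. i \<in> I \<Longrightarrow> lin_on scale C (u i)" "v \<in> C"
    and "\<And>v. v \<in> C \<Longrightarrow> w v = (\<Sum>i\<in>I. a i *s u i v)"
  shows "(conj_diff ^^ j) w v = (\<Sum>i\<in>I. a i *s (conj_diff ^^ j) (u i) v)"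
  using assms(2)
proof (induction j arbitrary: v)
  case 0
  then show ?case using assms(3) by simp
next
  case (Suc j)
  have GC: "G v \<in> C" using G Suc.prems by (auto simp: lin_on_def)
  have lin: "lin_on scale C ((conj_diff ^^ j) (u i))" if "i \<in> I" for i
    by (rule conj_diff_pow_lin) (rule assms(1)[OF that])
  have "F (\<Sum>i\<in>I. a i *s (conj_diff ^^ j) (u i) (G v))
      = (\<Sum>i\<in>I. a i *s F ((conj_diff ^^ j) (u i) (G v)))"
    using lin GC by (intro lin_on_lincomb[OF F C]) (auto intro: lin_on_closed)
  then show ?case
    using Suc.IH[OF GC] Suc.IH[OF Suc.prems]
    by (simp add: conj_diff_def[of "(conj_diff ^^ j) x" for x] sum_subtractf scale_right_diff_distrib)
qed

lemma conj_power_lin: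
  assumes "lin_on scale C u" "conj_nilpotent u"
  shows "lin_on scale C (conj_power x u)"
proof -
  obtain K where K: "\<And>i v. K \<le> i \<Longrightarrow> v \<in> C \<Longrightarrow> (conj_diff ^^ i) u v = 0"
    using conj_nilpotentE[OF assms(2)] by blast
  have eq: "conj_power x u v = (\<Sum>i<K. (x gchoose i) *s (conj_diff ^^ i) u v)" if "v \<in> C" for v
    using K that by (intro conj_power_upto) auto
  note lin = conj_diff_pow_lin[OF assms(1)]
  show ?thesis
  proof (rule lin_onI)
    fix v assume v: "v \<in> C"
    show "conj_power x u v \<in> C"
      unfolding eq[OF v] by (intro subspace_sum subspace_scale C lin_on_closed[OF lin v])
    fix c
    show "conj_power x u (c *s v) = c *s conj_power x u v"
      using v C by (simp add: eq subspace_scale lin_on_scale[OF lin] scale_sum_right mult.commute)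
    fix w assume w: "w \<in> C"
    show "conj_power x u (v + w) = conj_power x u v + conj_power x u w"
      using v w C by (simp add: eq subspace_add lin_on_add[OF lin] scale_right_distrib sum.distrib)
  qed
qed

lemma conj_power_combination:
  assumes "lin_on scale C u" "conj_nilpotent u" "lin_on scale C v" "conj_nilpotent v"
    and "\<And>y. y \<in> C \<Longrightarrow> w y = a *s u y + b *s v y" "y \<in> C"
  shows "conj_power x w y = a *s conj_power x u y + b *s conj_power x v y"
proof -
  obtain K where K: "\<And>i v. K \<le> i \<Longrightarrow> v \<in> C \<Longrightarrow> (conj_diff ^^ i) u v = 0"
    using conj_nilpotentE[OF assms(2)] by blast
  obtain K' where K': "\<And>i y. K' \<le> i \<Longrightarrow> y \<in> C \<Longrightarrow> (conj_diff ^^ i) v y = 0"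
    using conj_nilpotentE[OF assms(4)] by blast
  define N where "N = max K K'"
  have pow: "(conj_diff ^^ j) w y = a *s (conj_diff ^^ j) u y + b *s (conj_diff ^^ j) v y" for j
    using conj_diff_pow_sum[of "{True, False}" "\<lambda>i. if i then u else v" y w "\<lambda>i. if i then a else b" j]
      assms by auto
  have "conj_power x w y = (\<Sum>i<N. (x gchoose i) *s (conj_diff ^^ i) w y)"
    using K K' assms(6) by (intro conj_power_upto) (auto simp: pow N_def)
  moreover have "conj_power x u y = (\<Sum>i<N. (x gchoose i) *s (conj_diff ^^ i) u y)"
    using K assms(6) by (intro conj_power_upto) (auto simp: N_def)
  moreover have "conj_power x v y = (\<Sum>i<N. (x gchoose i) *s (conj_diff ^^ i) v y)"
    using K' assms(6) by (intro conj_power_upto) (auto simp: N_def)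
  ultimately show ?thesis
    by (simp add: pow scale_right_distrib sum.distrib scale_sum_right mult.commute)
qed

lemma conj_power_of_nat:
  assumes "lin_on scale C u" "conj_nilpotent u" "v \<in> C"
  shows "conj_power (of_nat n) u v = (F ^^ n) (u ((G ^^ n) v))"
proof -
  obtain K where K: "\<And>i v. K \<le> i \<Longrightarrow> v \<in> C \<Longrightarrow> (conj_diff ^^ i) u v = 0"
    using conj_nilpotentE[OF assms(2)] by blast
  have eq: "conj_power x u v = (\<Sum>i<Suc K. (x gchoose i) *s (conj_diff ^^ i) u v)" if "v \<in> C" for x v
    using K that by (intro conj_power_upto) auto
  have step: "conj_power (x + 1) u v = F (conj_power x u (G v))" if v: "v \<in> C" for x v
  proof -
    have GC: "G v \<in> C" using G v by (rule lin_on_closed)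
    have "conj_power (x + 1) u v
        = u v + (\<Sum>i<K. (x + 1 gchoose Suc i) *s (conj_diff ^^ Suc i) u v)"
      unfolding eq[OF v] by (simp add: sum.lessThan_Suc_shift del: sum.lessThan_Suc funpow.simps(2))
    also have "\<dots> = (u v + (\<Sum>i<K. (x gchoose Suc i) *s (conj_diff ^^ Suc i) u v))
       + (\<Sum>i<K. (x gchoose i) *s (conj_diff ^^ Suc i) u v)"
      unfolding gbinomial_Suc_Suc scale_left_distrib sum.distrib by (simp only: ac_simps)
    also have "u v + (\<Sum>i<K. (x gchoose Suc i) *s (conj_diff ^^ Suc i) u v)
        = (\<Sum>i<Suc K. (x gchoose i) *s (conj_diff ^^ i) u v)"
      by (simp add: sum.lessThan_Suc_shift del: sum.lessThan_Suc funpow.simps(2))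
    also have "(\<Sum>i<K. (x gchoose i) *s (conj_diff ^^ Suc i) u v)
        = (\<Sum>i<Suc K. (x gchoose i) *s (conj_diff ^^ Suc i) u v)"
      using K[of "Suc K" v] v by simp
    also have "(\<Sum>i<Suc K. (x gchoose i) *s (conj_diff ^^ i) u v)
       + (\<Sum>i<Suc K. (x gchoose i) *s (conj_diff ^^ Suc i) u v)
       = (\<Sum>i<Suc K. (x gchoose i) *s F ((conj_diff ^^ i) u (G v)))"
      unfolding sum.distrib[symmetric] scale_right_distrib[symmetric]
      by (simp add: conj_diff_def[of "(conj_diff ^^ i) u" for i])
    also have "\<dots> = F (conj_power x u (G v))"
      unfolding eq[OF GC]
      by (rule lin_on_lincomb[OF F C, symmetric])
        (rule lin_on_closed[OF conj_diff_pow_lin[OF assms(1)] GC])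
    finally show ?thesis .
  qed
  show ?thesis using assms(3)
  proof (induction n arbitrary: v)
    case 0
    then show ?case by (simp add: eq sum.lessThan_Suc_shift gbinomial_0_left del: sum.lessThan_Suc)
  next
    case (Suc n)
    have "G v \<in> C" using G Suc.prems by (rule lin_on_closed)
    then have "conj_power (of_nat n + 1) u v = F ((F ^^ n) (u ((G ^^ n) (G v))))"
      using step[OF Suc.prems] Suc.IH by simp
    then show ?case by (simp add: funpow_swap1 add.commute)
  qed
qed

lemma G_pow_closed: "v \<in> C \<Longrightarrow> (G ^^ n) v \<in> C" and F_pow_closed: "v \<in> C \<Longrightarrow> (F ^^ n) v \<in> C"
  by (auto intro: lin_on_funpow_closed[OF G] lin_on_funpow_closed[OF F])

lemma GF_pow: "v \<in> C \<Longrightarrow> (G ^^ n) ((F ^^ n) v) = v"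
  by (induction n) (auto simp: funpow_swap1[of G] GF F_pow_closed)

lemma FG_pow: "v \<in> C \<Longrightarrow> (F ^^ n) ((G ^^ n) v) = v"
  by (induction n) (auto simp: funpow_swap1[of F] FG G_pow_closed)

lemma polyfun_conj_power:
  assumes "conj_nilpotent u" "v \<in> C"
  shows "polyfun scale (\<lambda>x. conj_power x u v)"
proof -
  obtain K where "\<And>i v. K \<le> i \<Longrightarrow> v \<in> C \<Longrightarrow> (conj_diff ^^ i) u v = 0"
    using conj_nilpotentE[OF assms(1)] by blast
  then have "(\<lambda>x. conj_power x u v) = (\<lambda>x. \<Sum>i<K. (x gchoose i) *s (conj_diff ^^ i) u v)"
    using assms(2) conj_power_upto by blast
  then show ?thesis by (simp add: polyfun_sum polyfun_basic)
qed

lemma polyfun_conj_power_twice: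
  assumes "lin_on scale C u" "conj_nilpotent u" "lin_on scale C v" "conj_nilpotent v" "y \<in> C"
  shows "polyfun scale (\<lambda>x. conj_power x u (conj_power x v y))"
proof -
  obtain K where K: "\<And>i v. K \<le> i \<Longrightarrow> v \<in> C \<Longrightarrow> (conj_diff ^^ i) u v = 0"
    using conj_nilpotentE[OF assms(2)] by blast
  obtain K' where K': "\<And>i y. K' \<le> i \<Longrightarrow> y \<in> C \<Longrightarrow> (conj_diff ^^ i) v y = 0"
    using conj_nilpotentE[OF assms(4)] by blast
  have "conj_power x u (conj_power x v y) =
     (\<Sum>i<K. (x gchoose i) *s (\<Sum>j<K'. (x gchoose j) *s (conj_diff ^^ i) u ((conj_diff ^^ j) v y)))" for x
  proof -
    have cl: "(conj_diff ^^ j) v y \<in> C" for j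
      using conj_diff_pow_lin[OF assms(3)] assms(5) by (rule lin_on_closed)
    have v: "conj_power x v y = (\<Sum>j<K'. (x gchoose j) *s (conj_diff ^^ j) v y)"
      using K' assms(5) by (intro conj_power_upto)
    have vC: "conj_power x v y \<in> C" by (rule lin_on_closed[OF conj_power_lin[OF assms(3,4)] assms(5)])
    have eq: "conj_power x u (conj_power x v y)
       = (\<Sum>i<K. (x gchoose i) *s (conj_diff ^^ i) u (conj_power x v y))"
      using K vC by (intro conj_power_upto)
    have "(conj_diff ^^ i) u (conj_power x v y)
       = (\<Sum>j<K'. (x gchoose j) *s (conj_diff ^^ i) u ((conj_diff ^^ j) v y))" for i
      unfolding v using cl by (intro lin_on_lincomb[OF conj_diff_pow_lin[OF assms(1)] C])
    then show ?thesis unfolding eq by (simp only:)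
  qed
  then show ?thesis by (simp add: polyfun_sum polyfun_gchoose polyfun_basic)
qed

text \<open>Conjugation by \<open>F\<^sup>n\<close> is multiplicative. Both sides of the following identities are polynomial in
  the exponent, so they extend from the natural numbers to the whole field.\<close>

lemma conj_power_mult:
  assumes u: "lin_on scale C u" "conj_nilpotent u" and v: "lin_on scale C v" "conj_nilpotent v"
    and w: "conj_nilpotent w" "\<And>y. y \<in> C \<Longrightarrow> w y = u (v y)" and y: "y \<in> C"
  shows "conj_power x w y = conj_power x u (conj_power x v y)"
proof -
  have wl: "lin_on scale C w"
    using lin_on_compose[OF u(1) v(1)] w(2) C unfolding lin_on_def
    by (auto simp: subspace_add subspace_scale)
  have "conj_power x w y - conj_power x u (conj_power x v y) = 0"
  proof (rule polyfun_vanish)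
    show "polyfun scale (\<lambda>x. conj_power x w y - conj_power x u (conj_power x v y))"
      by (intro polyfun_diff polyfun_conj_power polyfun_conj_power_twice u v w y)
    fix n
    have "v ((G ^^ n) y) \<in> C" using v(1) y by (intro lin_on_closed[OF v(1)] G_pow_closed)
    then show "conj_power (of_nat n) w y - conj_power (of_nat n) u (conj_power (of_nat n) v y) = 0"
      using y w(2) u v wl w(1)
      by (simp add: conj_power_of_nat G_pow_closed F_pow_closed GF_pow)
  qed
  then show ?thesis by simp
qed

lemma conj_power_commutator:
  assumes u: "lin_on scale C u" "conj_nilpotent u" and v: "lin_on scale C v" "conj_nilpotent v"
    and w: "conj_nilpotent w" "\<And>y. y \<in> C \<Longrightarrow> w y = u (v y) - v (u y)" and y: "y \<in> C"
  shows "conj_power x w y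
    = conj_power x u (conj_power x v y) - conj_power x v (conj_power x u y)"
proof -
  have wl: "lin_on scale C w"
    using lin_on_compose[OF u(1) v(1)] lin_on_compose[OF v(1) u(1)] w(2) C unfolding lin_on_def
    by (auto simp: subspace_add subspace_scale subspace_diff scale_right_diff_distrib)
  have "conj_power x w y - (conj_power x u (conj_power x v y) - conj_power x v (conj_power x u y)) = 0"
  proof (rule polyfun_vanish)
    show "polyfun scale (\<lambda>x. conj_power x w y -
        (conj_power x u (conj_power x v y) - conj_power x v (conj_power x u y)))"
      by (intro polyfun_diff polyfun_conj_power polyfun_conj_power_twice u v w y)
    fix n
    have "u (v ((G ^^ n) y)) \<in> C" "v (u ((G ^^ n) y)) \<in> C" "v ((G ^^ n) y) \<in> C" "u ((G ^^ n) y) \<in> C"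
      using u(1) v(1) y by (auto intro!: lin_on_closed[OF v(1)] lin_on_closed[OF u(1)] G_pow_closed)
    then show "conj_power (of_nat n) w y - (conj_power (of_nat n) u (conj_power (of_nat n) v y)
        - conj_power (of_nat n) v (conj_power (of_nat n) u y)) = 0"
      using y w(2) u v wl w(1)
      by (simp add: conj_power_of_nat G_pow_closed F_pow_closed GF_pow
          lin_on_diff[OF lin_on_funpow[OF F] C])
  qed
  then show ?thesis by simp
qed

lemma conj_diff_pow_conj_power:
  assumes u: "lin_on scale C u" "conj_nilpotent u" and v: "v \<in> C"
  shows "(conj_diff ^^ i) (conj_power x u) v = conj_power x ((conj_diff ^^ i) u) v"
proof -
  obtain K where K: "\<And>i v. K \<le> i \<Longrightarrow> v \<in> C \<Longrightarrow> (conj_diff ^^ i) u v = 0"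
    using conj_nilpotentE[OF u(2)] by blast
  have "(conj_diff ^^ i) (conj_power x u) v
     = (\<Sum>j<K. (x gchoose j) *s (conj_diff ^^ i) ((conj_diff ^^ j) u) v)"
    using conj_diff_pow_lin[OF u(1)] v K
    by (intro conj_diff_pow_sum conj_power_upto) auto
  also have "\<dots> = (\<Sum>j<K. (x gchoose j) *s (conj_diff ^^ j) ((conj_diff ^^ i) u) v)"
    unfolding funpow_add[THEN fun_cong, unfolded o_apply, symmetric] by (simp add: add.commute)
  also have "\<dots> = conj_power x ((conj_diff ^^ i) u) v"
    using K v by (intro conj_power_upto[symmetric])
      (auto simp: funpow_add[THEN fun_cong, unfolded o_apply, symmetric])
  finally show ?thesis .
qed

text \<open>By Vandermonde's identity the two binomial series multiply to \<open>(1 + conj_diff)\<^sup>0\<close>.\<close>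

lemma conj_power_neg:
  assumes u: "lin_on scale C u" "conj_nilpotent u" and v: "v \<in> C"
  shows "conj_power x (conj_power (- x) u) v = u v"
proof -
  obtain K where K: "\<And>i v. K \<le> i \<Longrightarrow> v \<in> C \<Longrightarrow> (conj_diff ^^ i) u v = 0"
    using conj_nilpotentE[OF u(2)] by blast
  define t where "t = (\<lambda>i. (conj_diff ^^ i) u v)"
  define b where "b = (\<lambda>i. (x gchoose i))"
  define c where "c = (\<lambda>i. (- x gchoose i))"
  have t0: "t i = 0" if "Suc K \<le> i" for i using K that v by (simp add: t_def)
  have inner: "conj_power (- x) ((conj_diff ^^ i) u) v = (\<Sum>j<Suc K. c j *s t (i + j))" for i
    unfolding t_def c_def using K v
    by (subst conj_power_upto[of "Suc K"])
      (auto simp: funpow_add[THEN fun_cong, unfolded o_apply, symmetric] add.commute)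
  have "conj_power x (conj_power (- x) u) v = (\<Sum>i<Suc K. b i *s (\<Sum>j<Suc K. c j *s t (i + j)))"
    unfolding inner[symmetric] b_def conj_diff_pow_conj_power[OF u v, symmetric]
  proof (rule conj_power_upto)
    fix i assume "Suc K \<le> i"
    then show "(conj_diff ^^ i) (conj_power (- x) u) v = 0"
      unfolding conj_diff_pow_conj_power[OF u v] inner by (intro sum.neutral) (auto simp: t0)
  qed
  also have "\<dots> = (\<Sum>i<Suc K. \<Sum>j<Suc K - i. (b i * c j) *s t (i + j))"
    unfolding scale_sum_right scale_scale
    by (intro sum.cong sum.mono_neutral_right) (auto simp: t0)
  also have "\<dots> = (\<Sum>(i, j)\<in>(SIGMA i:{..<Suc K}. {..<Suc K - i}). (b i * c j) *s t (i + j))"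
    by (subst sum.Sigma) auto
  also have "(SIGMA i:{..<Suc K}. {..<Suc K - i}) = {(i, j). i + j < Suc K}" by auto
  also have "(\<Sum>(i, j)\<in>{(i, j). i + j < Suc K}. (b i * c j) *s t (i + j))
     = (\<Sum>m<Suc K. \<Sum>i\<le>m. (b i * c (m - i)) *s t (i + (m - i)))"
    by (rule sum.triangle_reindex)
  also have "\<dots> = (\<Sum>m<Suc K. (\<Sum>i=0..m. b i * c (m - i)) *s t m)"
    unfolding scale_sum_left by (intro sum.cong) (auto simp: atMost_atLeast0)
  also have "\<dots> = (\<Sum>m<Suc K. (if m = 0 then t 0 else 0))"
    unfolding b_def c_def gbinomial_Vandermonde by (intro sum.cong) (auto simp: gbinomial_0_left)
  also have "\<dots> = u v" by (simp add: t_def)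
  finally show ?thesis .
qed

end

section \<open>Ore localization at a locally ad-nilpotent element\<close>

text \<open>Local ad-nilpotency of \<open>f\<close> is what yields the Ore conditions with respect to the powers of \<open>f\<close>.\<close>

locale ad_nilpotent = ring R for R (structure) +
  fixes f
  assumes f: "f \<in> carrier R"
    and ad_nilpotent: "\<And>r. r \<in> carrier R \<Longrightarrow> \<exists>n. ((\<lambda>r. f \<otimes> r \<ominus> r \<otimes> f) ^^ n) r = \<zero>"
begin

definition S where "S = {f [^] n | n :: nat. True}"

definition ad where "ad r = f \<otimes> r \<ominus> r \<otimes> f"

abbreviation A where "A \<equiv> ore_localization R S"

text \<open>The fraction \<open>f\<^sup>-\<^sup>n r\<close>.\<close>

definition frac :: "nat \<Rightarrow> 'a \<Rightarrow> ('a \<times> 'a) set" where "frac n r = ore_frac R S (f [^] n) r"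

lemma ad_closed: "r \<in> carrier R \<Longrightarrow> ad r \<in> carrier R"
  using f by (simp add: ad_def)

lemma ad_pow_closed: "r \<in> carrier R \<Longrightarrow> (ad ^^ i) r \<in> carrier R"
  by (induction i) (auto intro: ad_closed)

lemma ad_nil: "r \<in> carrier R \<Longrightarrow> \<exists>n. (ad ^^ n) r = \<zero>"
  using ad_nilpotent[of r] unfolding ad_def[abs_def] .

lemma pow_closed: "f [^] (n::nat) \<in> carrier R" using f by simp

lemma pow_add: "f [^] (n + m :: nat) = f [^] n \<otimes> f [^] m"
  using nat_pow_mult[OF f, of n m] by simp

lemma pow_comm: "f [^] (n::nat) \<otimes> f [^] (m::nat) = f [^] m \<otimes> f [^] n"
  unfolding pow_add[symmetric] by (simp add: add.commute)

lemma pow_shift: "r \<in> carrier R \<Longrightarrow> f [^] (k + n :: nat) \<otimes> r = f [^] k \<otimes> (f [^] n \<otimes> r)"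
  unfolding pow_add using pow_closed by (simp add: m_assoc)

text \<open>From \<open>f r = r f + ad r\<close> by induction on the exponent that kills \<open>r\<close>: a power of \<open>f\<close> moves \<open>ad r\<close>
  into \<open>R f\<close>, and it already maps \<open>r f\<close> there.\<close>

lemma ore_condition_single:
  assumes "(ad ^^ N) r = \<zero>" "r \<in> carrier R"
  shows "\<exists>k. \<exists>r'\<in>carrier R. f [^] (k::nat) \<otimes> r = r' \<otimes> f"
  using assms
proof (induction N arbitrary: r)
  case 0
  then show ?case using f by (intro exI[of _ 0] bexI[of _ \<zero>]) auto
next
  case (Suc N)
  have "(ad ^^ N) (ad r) = \<zero>" using Suc.prems by (simp add: funpow_swap1)
  then obtain k r' where r': "r' \<in> carrier R" "f [^] (k::nat) \<otimes> ad r = r' \<otimes> f"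
    using Suc.IH[of "ad r"] ad_closed Suc.prems by blast
  have "f \<otimes> r = r \<otimes> f \<oplus> ad r"
    using f Suc.prems unfolding ad_def minus_eq
    by (subst a_lcomm[of "r \<otimes> f"]) (auto simp: r_neg)
  then have "f [^] (Suc k) \<otimes> r = f [^] k \<otimes> (r \<otimes> f \<oplus> ad r)"
    using f Suc.prems by (simp add: m_assoc)
  also have "\<dots> = (f [^] k \<otimes> r \<oplus> r') \<otimes> f"
    using f Suc.prems r' by (simp add: r_distr l_distr ad_closed m_assoc)
  finally show ?case
    using f r' Suc.prems by (intro exI[of _ "Suc k"] bexI[of _ "f [^] k \<otimes> r \<oplus> r'"]) auto
qed

lemma ore_condition:
  assumes "r \<in> carrier R"
  shows "\<exists>k. \<exists>r'\<in>carrier R. f [^] (k::nat) \<otimes> r = r' \<otimes> f [^] (m::nat)"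
  using assms
proof (induction m arbitrary: r)
  case 0
  then show ?case by (intro exI[of _ 0] bexI[of _ r]) auto
next
  case (Suc m)
  obtain k r' where r': "r' \<in> carrier R" "f [^] (k::nat) \<otimes> r = r' \<otimes> f [^] m"
    using Suc by blast
  obtain l r'' where r'': "r'' \<in> carrier R" "f [^] (l::nat) \<otimes> r' = r'' \<otimes> f"
    using ore_condition_single ad_nil[OF r'(1)] r'(1) by blast
  have "f [^] (l + k) \<otimes> r = f [^] l \<otimes> (r' \<otimes> f [^] m)"
    using Suc.prems r' by (simp add: pow_shift)
  also have "\<dots> = r'' \<otimes> (f \<otimes> f [^] m)"
    using r'(1) r'' f by (simp add: m_assoc[symmetric])
  also have "f \<otimes> f [^] m = f [^] Suc m" using pow_add[of 1 m] f by simp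
  finally show ?case using r'' by blast
qed

text \<open>If \<open>r f = 0\<close> then \<open>ad\<^sup>i r = f\<^sup>i r\<close>, so ad-nilpotency moves the annihilation to the left.\<close>

lemma ore_reversible:
  assumes "r \<in> carrier R" "r \<otimes> f [^] (m::nat) = \<zero>"
  shows "\<exists>k. f [^] (k::nat) \<otimes> r = \<zero>"
  using assms
proof (induction m arbitrary: r)
  case 0
  then show ?case by (intro exI[of _ 0]) auto
next
  case (Suc m)
  define q where "q = r \<otimes> f [^] m"
  have q: "q \<in> carrier R" "q \<otimes> f = \<zero>" using Suc.prems f by (auto simp: q_def m_assoc)
  have "(ad ^^ i) q = f [^] i \<otimes> q" for i
  proof (induction i)
    case 0
    then show ?case using q by simp
  next
    case (Suc i)
    have "f \<otimes> f [^] i = f [^] Suc i" using pow_add[of 1 i] f by simp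
    then show ?case
      using Suc f q by (simp add: ad_def m_assoc minus_eq) (simp add: m_assoc[symmetric])
  qed
  then obtain k where k: "f [^] (k::nat) \<otimes> q = \<zero>" using ad_nil[OF q(1)] by metis
  then have "(f [^] k \<otimes> r) \<otimes> f [^] m = \<zero>" using f Suc.prems by (simp add: q_def m_assoc)
  then obtain l where "f [^] (l::nat) \<otimes> (f [^] k \<otimes> r) = \<zero>"
    using Suc.IH[of "f [^] k \<otimes> r"] f Suc.prems by auto
  then show ?case using pow_shift[of r l k] Suc.prems by auto
qed

lemma ore_cancel:
  assumes "u \<in> carrier R" "w \<in> carrier R" "u \<otimes> f [^] (m::nat) = w \<otimes> f [^] m"
  shows "\<exists>k. f [^] (k::nat) \<otimes> u = f [^] k \<otimes> w"
proof -
  have "(u \<ominus> w) \<otimes> f [^] m = \<zero>"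
    using assms pow_closed[of m] by (simp add: minus_eq l_distr l_minus r_neg)
  then obtain k where "f [^] (k::nat) \<otimes> (u \<ominus> w) = \<zero>"
    using ore_reversible[of "u \<ominus> w"] assms by auto
  then have "f [^] k \<otimes> u \<ominus> f [^] k \<otimes> w = \<zero>"
    using assms pow_closed[of k] by (simp add: minus_eq r_distr r_minus)
  then have "\<ominus> (\<ominus> (f [^] k \<otimes> w)) = f [^] k \<otimes> u"
    using assms pow_closed[of k] by (intro minus_equality) (auto simp: minus_eq)
  then show ?thesis using assms pow_closed[of k] by (metis m_closed minus_minus)
qed

text \<open>The equation \<open>c f\<^sup>n = f\<^sup>j\<close> determines \<open>c\<close> up to left multiplication by a power of \<open>f\<close>; no
  subtraction \<open>j - n\<close> occurs because \<open>j < n\<close> is possible.\<close>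

lemma pow_left_quotient:
  assumes "c \<in> carrier R" "c \<otimes> f [^] (n::nat) = f [^] (j::nat)"
  shows "\<exists>L. f [^] (L + n) \<otimes> c = f [^] (L + j)"
proof -
  have "(f [^] n \<otimes> c) \<otimes> f [^] n = f [^] j \<otimes> f [^] n"
    using assms pow_closed pow_comm[of n j] by (simp add: m_assoc)
  moreover have "f [^] n \<otimes> c \<in> carrier R" using assms pow_closed by simp
  ultimately obtain L where L: "f [^] (L::nat) \<otimes> (f [^] n \<otimes> c) = f [^] L \<otimes> f [^] j"
    using ore_cancel pow_closed by blast
  have "f [^] (L + n) \<otimes> c = f [^] (L + j)" using L assms(1) by (simp add: pow_shift) (simp add: pow_add)
  then show ?thesis ..
qed

text \<open>The multipliers in the definition of equality of fractions are arbitrary ring elements; they can be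
  replaced by powers of \<open>f\<close>.\<close>

lemma ore_rel_iff:
  assumes "r \<in> carrier R" "q \<in> carrier R"
  shows "((f [^] (n::nat), r), (f [^] (m::nat), q)) \<in> ore_rel R S
     \<longleftrightarrow> (\<exists>k. f [^] (k + m) \<otimes> r = f [^] (k + n) \<otimes> q)"
proof
  assume "((f [^] n, r), (f [^] m, q)) \<in> ore_rel R S"
  then obtain a b j where ab: "a \<in> carrier R" "b \<in> carrier R" "a \<otimes> f [^] n = f [^] (j::nat)"
      "b \<otimes> f [^] m = f [^] j" "a \<otimes> r = b \<otimes> q"
    unfolding ore_rel_def S_def by auto
  obtain L where L: "f [^] (L + n) \<otimes> a = f [^] (L + j)" using pow_left_quotient ab by blast
  obtain L' where L': "f [^] (L' + m) \<otimes> b = f [^] (L' + j)" using pow_left_quotient ab by blast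
  have "f [^] (L' + L + j + m) \<otimes> r = f [^] (L' + m) \<otimes> (f [^] (L + j) \<otimes> r)"
    using assms by (simp add: pow_shift[symmetric] ac_simps)
  also have "\<dots> = f [^] (L' + m) \<otimes> (f [^] (L + n) \<otimes> (a \<otimes> r))"
    unfolding L[symmetric] using assms ab pow_closed by (simp add: m_assoc)
  also have "\<dots> = f [^] (L + n) \<otimes> (f [^] (L' + m) \<otimes> (b \<otimes> q))"
    unfolding ab(5) using assms ab pow_closed
    by (simp add: pow_shift[symmetric] ac_simps)
  also have "\<dots> = f [^] (L + n) \<otimes> (f [^] (L' + j) \<otimes> q)"
    unfolding L'[symmetric] using assms ab pow_closed by (simp add: m_assoc)
  also have "\<dots> = f [^] (L' + L + j + n) \<otimes> q"
    using assms by (simp add: pow_shift[symmetric] ac_simps)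
  finally show "\<exists>k. f [^] (k + m) \<otimes> r = f [^] (k + n) \<otimes> q" by blast
next
  assume "\<exists>k. f [^] (k + m) \<otimes> r = f [^] (k + n) \<otimes> q"
  then obtain k where k: "f [^] (k + m) \<otimes> r = f [^] (k + n) \<otimes> q" ..
  have "f [^] (k + m) \<otimes> f [^] n = f [^] (k + n) \<otimes> f [^] m"
    unfolding pow_add[symmetric] by (simp add: ac_simps)
  moreover have "f [^] (k + m) \<otimes> f [^] n \<in> S" unfolding pow_add[symmetric] S_def by blast
  ultimately show "((f [^] n, r), (f [^] m, q)) \<in> ore_rel R S"
    using k assms pow_closed unfolding ore_rel_def S_def by blast
qed

lemma S_pow: "f [^] (n::nat) \<in> S" unfolding S_def by blast

lemma equiv_ore: "equiv (S \<times> carrier R) (ore_rel R S)"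
proof (rule equivI)
  show "ore_rel R S \<subseteq> (S \<times> carrier R) \<times> (S \<times> carrier R)" unfolding ore_rel_def by auto
  show "refl_on (S \<times> carrier R) (ore_rel R S)"
    unfolding refl_on_def
  proof safe
    fix s r assume "s \<in> S" "r \<in> carrier R"
    then show "((s, r), (s, r)) \<in> ore_rel R S"
      using ore_rel_iff[of r r] unfolding S_def by auto
  qed
  show "sym (ore_rel R S)"
  proof (rule symI, clarify)
    fix s r t q assume 1: "((s, r), t, q) \<in> ore_rel R S"
    then have r: "r \<in> carrier R" "q \<in> carrier R" unfolding ore_rel_def by auto
    obtain n m where s: "s = f [^] (n::nat)" "t = f [^] (m::nat)"
      using 1 unfolding ore_rel_def S_def by blast
    show "((t, q), s, r) \<in> ore_rel R S"
      using 1 unfolding s ore_rel_iff[OF r] ore_rel_iff[OF r(2,1)] by metis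
  qed
  show "trans (ore_rel R S)"
  proof (rule transI, clarify)
    fix s r s' r' s'' r''
    assume 1: "((s, r), s', r') \<in> ore_rel R S" and 2: "((s', r'), s'', r'') \<in> ore_rel R S"
    then have r: "r \<in> carrier R" "r' \<in> carrier R" "r'' \<in> carrier R" unfolding ore_rel_def by auto
    obtain n m l where s: "s = f [^] (n::nat)" "s' = f [^] (m::nat)" "s'' = f [^] (l::nat)"
      using 1 2 unfolding ore_rel_def S_def by blast
    obtain k where k: "f [^] (k + m) \<otimes> r = f [^] (k + n) \<otimes> r'"
      using 1 unfolding s ore_rel_iff[OF r(1,2)] by blast
    obtain k' where k': "f [^] (k' + l) \<otimes> r' = f [^] (k' + m) \<otimes> r''"
      using 2 unfolding s ore_rel_iff[OF r(2,3)] by blast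
    have "f [^] ((k + k' + m) + l) \<otimes> r = f [^] (k' + l) \<otimes> (f [^] (k + m) \<otimes> r)"
      using r by (simp add: pow_shift[symmetric] ac_simps)
    also have "\<dots> = f [^] (k + n) \<otimes> (f [^] (k' + l) \<otimes> r')"
      unfolding k using r by (simp add: pow_shift[symmetric] ac_simps)
    also have "\<dots> = f [^] ((k + k' + m) + n) \<otimes> r''"
      unfolding k' using r by (simp add: pow_shift[symmetric] ac_simps)
    finally show "((s, r), s'', r'') \<in> ore_rel R S"
      unfolding s ore_rel_iff[OF r(1,3)] by blast
  qed
qed

lemma frac_eq:
  assumes "r \<in> carrier R" "q \<in> carrier R"
  shows "frac n r = frac m q \<longleftrightarrow> (\<exists>k. f [^] (k + m) \<otimes> r = f [^] (k + n) \<otimes> q)"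
  unfolding frac_def ore_frac_def ore_rel_iff[OF assms, symmetric]
  using eq_equiv_class_iff[OF equiv_ore] S_pow assms by auto

lemma carrier_A: "carrier A = {frac n r | n r. r \<in> carrier R}"
  unfolding ore_localization_def frac_def ore_frac_def quotient_def S_def by auto

lemma frac_closed: "r \<in> carrier R \<Longrightarrow> frac n r \<in> carrier A"
  unfolding carrier_A by blast

lemma in_frac:
  assumes "r \<in> carrier R"
  shows "(s, q) \<in> frac n r \<longleftrightarrow> q \<in> carrier R \<and> (\<exists>m. s = f [^] (m::nat) \<and> frac m q = frac n r)"
proof
  assume "(s, q) \<in> frac n r"
  then have rel: "((f [^] n, r), (s, q)) \<in> ore_rel R S" unfolding frac_def ore_frac_def by auto
  then obtain m where m: "s = f [^] (m::nat)" "q \<in> carrier R" unfolding ore_rel_def S_def by auto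
  have "frac n r = frac m q"
    using equiv_class_eq[OF equiv_ore rel] by (simp add: frac_def ore_frac_def m)
  then show "q \<in> carrier R \<and> (\<exists>m. s = f [^] (m::nat) \<and> frac m q = frac n r)" using m by metis
next
  assume "q \<in> carrier R \<and> (\<exists>m. s = f [^] (m::nat) \<and> frac m q = frac n r)"
  then obtain m where m: "q \<in> carrier R" "s = f [^] (m::nat)" "frac m q = frac n r" by blast
  have "(s, q) \<in> frac m q"
    unfolding frac_def ore_frac_def m(2) Image_singleton_iff
    by (subst ore_rel_iff) (auto simp: m(1))
  then show "(s, q) \<in> frac n r" using m(3) by simp
qed

lemma frac_expand:
  assumes "r \<in> carrier R"
  shows "frac (k + n) (f [^] k \<otimes> r) = frac n r"
  using assms pow_closed
  by (subst frac_eq) (auto intro!: exI[of _ 0] simp: pow_shift[symmetric] ac_simps)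

text \<open>Both numerators are brought to the form of a right multiple of a common power of \<open>f\<close>. The two left factors
  then agree after right multiplication with a power of \<open>f\<close>, hence after left multiplication.\<close>

lemma mult_welldefined:
  assumes r: "r1 \<in> carrier R" "r2 \<in> carrier R" "q1 \<in> carrier R" "q2 \<in> carrier R"
    and eq: "frac n1 r1 = frac n2 r2" "frac m1 q1 = frac m2 q2"
    and p: "p1 \<in> carrier R" "f [^] k1 \<otimes> r1 = p1 \<otimes> f [^] m1"
      "p2 \<in> carrier R" "f [^] k2 \<otimes> r2 = p2 \<otimes> f [^] m2"
  shows "frac (k1 + n1) (p1 \<otimes> q1) = frac (k2 + n2) (p2 \<otimes> q2)"
proof -
  obtain a where a: "f [^] (a + n2) \<otimes> r1 = f [^] (a + n1) \<otimes> r2"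
    using eq(1) frac_eq r by auto
  obtain b where b: "f [^] (b + m2) \<otimes> q1 = f [^] (b + m1) \<otimes> q2"
    using eq(2) frac_eq r by auto
  define u where "u = f [^] (a + n2 + k2) \<otimes> p1"
  define w where "w = f [^] (k1 + a + n1) \<otimes> p2"
  have uw: "u \<in> carrier R" "w \<in> carrier R" using p pow_closed by (auto simp: u_def w_def)
  have "u \<otimes> f [^] m1 = f [^] (a + n2 + k2) \<otimes> (f [^] k1 \<otimes> r1)"
    using p pow_closed by (simp add: u_def m_assoc)
  also have "\<dots> = f [^] (k1 + k2) \<otimes> (f [^] (a + n2) \<otimes> r1)"
    using r by (simp add: pow_shift[symmetric] ac_simps)
  also have "\<dots> = f [^] (k1 + a + n1) \<otimes> (f [^] k2 \<otimes> r2)"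
    unfolding a using r by (simp add: pow_shift[symmetric] ac_simps)
  also have "\<dots> = w \<otimes> f [^] m2"
    using p pow_closed by (simp add: w_def m_assoc)
  finally have eq1: "u \<otimes> f [^] m1 = w \<otimes> f [^] m2" .
  obtain c1 u' where u': "u' \<in> carrier R" "f [^] (c1::nat) \<otimes> u = u' \<otimes> f [^] (b + m2)"
    using ore_condition[OF uw(1)] by blast
  have fw: "f [^] c1 \<otimes> w \<in> carrier R" using uw pow_closed by simp
  obtain c2 w' where w': "w' \<in> carrier R" "f [^] (c2::nat) \<otimes> (f [^] c1 \<otimes> w) = w' \<otimes> f [^] (b + m1)"
    using ore_condition[OF fw] by blast
  define v where "v = f [^] c2 \<otimes> u'"
  have v: "v \<in> carrier R" using u' pow_closed by (simp add: v_def)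
  have vu: "f [^] (c2 + c1) \<otimes> u = v \<otimes> f [^] (b + m2)"
    using uw u' pow_closed by (simp add: pow_shift v_def m_assoc)
  have wu: "f [^] (c2 + c1) \<otimes> w = w' \<otimes> f [^] (b + m1)"
    using uw w' by (simp add: pow_shift)
  have "v \<otimes> f [^] (b + m1 + m2) = (v \<otimes> f [^] (b + m2)) \<otimes> f [^] m1"
    using v pow_closed by (simp add: m_assoc pow_add[symmetric] ac_simps)
  also have "\<dots> = f [^] (c2 + c1) \<otimes> (w \<otimes> f [^] m2)"
    unfolding vu[symmetric] eq1[symmetric] using uw pow_closed by (simp add: m_assoc)
  also have "\<dots> = (w' \<otimes> f [^] (b + m1)) \<otimes> f [^] m2"
    unfolding wu[symmetric] using uw pow_closed by (simp add: m_assoc)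
  also have "\<dots> = w' \<otimes> f [^] (b + m1 + m2)"
    using w' pow_closed by (simp add: m_assoc pow_add[symmetric] ac_simps)
  finally obtain l where l: "f [^] (l::nat) \<otimes> v = f [^] l \<otimes> w'"
    using ore_cancel v w' by blast
  have "f [^] (l + c2 + c1) \<otimes> (u \<otimes> q1) = f [^] l \<otimes> ((f [^] (c2 + c1) \<otimes> u) \<otimes> q1)"
    using uw r pow_closed by (simp add: pow_add m_assoc)
  also have "\<dots> = (f [^] l \<otimes> v) \<otimes> (f [^] (b + m2) \<otimes> q1)"
    unfolding vu using v r pow_closed by (simp add: m_assoc)
  also have "\<dots> = f [^] l \<otimes> ((w' \<otimes> f [^] (b + m1)) \<otimes> q2)"
    unfolding l b using w' r pow_closed by (simp add: m_assoc)
  also have "\<dots> = f [^] (l + c2 + c1) \<otimes> (w \<otimes> q2)"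
    unfolding wu[symmetric] using uw r pow_closed by (simp add: pow_add m_assoc)
  finally have fin: "f [^] (l + c2 + c1) \<otimes> (u \<otimes> q1) = f [^] (l + c2 + c1) \<otimes> (w \<otimes> q2)" .
  have "f [^] ((l + c2 + c1 + a) + (k2 + n2)) \<otimes> (p1 \<otimes> q1) = f [^] (l + c2 + c1) \<otimes> (u \<otimes> q1)"
    unfolding u_def using p r pow_closed by (simp add: m_assoc pow_shift[symmetric] ac_simps)
  also have "\<dots> = f [^] ((l + c2 + c1 + a) + (k1 + n1)) \<otimes> (p2 \<otimes> q2)"
    unfolding fin unfolding w_def
    using p r pow_closed by (simp add: m_assoc pow_shift[symmetric] ac_simps)
  finally show ?thesis using p r by (subst frac_eq) auto
qed

lemma mult_frac:
  assumes r: "r \<in> carrier R" "q \<in> carrier R" and p: "p \<in> carrier R" "f [^] k \<otimes> r = p \<otimes> f [^] m"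
  shows "frac n r \<otimes>\<^bsub>A\<^esub> frac m q = frac (k + n) (p \<otimes> q)"
proof -
  have "frac n r \<otimes>\<^bsub>A\<^esub> frac m q = (THE Z. \<exists>s r' t q'. (s, r') \<in> frac n r \<and> (t, q') \<in> frac m q \<and>
         (\<exists>s'\<in>S. \<exists>p'\<in>carrier R. s' \<otimes> r' = p' \<otimes> t \<and> Z = ore_frac R S (s' \<otimes> s) (p' \<otimes> q')))"
    unfolding ore_localization_def by simp
  also have "\<dots> = frac (k + n) (p \<otimes> q)"
  proof (rule the_equality)
    have "(f [^] n, r) \<in> frac n r" "(f [^] m, q) \<in> frac m q" using r by (auto simp: in_frac)
    moreover have "frac (k + n) (p \<otimes> q) = ore_frac R S (f [^] k \<otimes> f [^] n) (p \<otimes> q)"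
      by (simp add: frac_def pow_add)
    ultimately show "\<exists>s r' t q'. (s, r') \<in> frac n r \<and> (t, q') \<in> frac m q \<and>
         (\<exists>s'\<in>S. \<exists>p'\<in>carrier R. s' \<otimes> r' = p' \<otimes> t \<and>
            frac (k + n) (p \<otimes> q) = ore_frac R S (s' \<otimes> s) (p' \<otimes> q'))"
      using S_pow p by blast
  next
    fix Z
    assume "\<exists>s r' t q'. (s, r') \<in> frac n r \<and> (t, q') \<in> frac m q \<and>
         (\<exists>s'\<in>S. \<exists>p'\<in>carrier R. s' \<otimes> r' = p' \<otimes> t \<and> Z = ore_frac R S (s' \<otimes> s) (p' \<otimes> q'))"
    then obtain n' r' m' q' k' p' where *: "r' \<in> carrier R" "frac n' r' = frac n r"
       "q' \<in> carrier R" "frac m' q' = frac m q" "p' \<in> carrier R"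
       "f [^] (k'::nat) \<otimes> r' = p' \<otimes> f [^] m'" "Z = ore_frac R S (f [^] k' \<otimes> f [^] n') (p' \<otimes> q')"
      unfolding in_frac[OF r(1)] in_frac[OF r(2)] S_def by auto
    have "Z = frac (k' + n') (p' \<otimes> q')" unfolding *(7) frac_def pow_add ..
    also have "\<dots> = frac (k + n) (p \<otimes> q)"
      by (rule mult_welldefined[OF *(1) r(1) *(3) r(2) *(2,4,5,6) p])
    finally show "Z = frac (k + n) (p \<otimes> q)" .
  qed
  finally show ?thesis .
qed

lemma add_welldefined:
  assumes r: "r1 \<in> carrier R" "r2 \<in> carrier R" "q1 \<in> carrier R" "q2 \<in> carrier R"
    and eq: "frac n1 r1 = frac n2 r2" "frac m1 q1 = frac m2 q2"
  shows "frac (n1 + m1) (f [^] m1 \<otimes> r1 \<oplus> f [^] n1 \<otimes> q1)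
    = frac (n2 + m2) (f [^] m2 \<otimes> r2 \<oplus> f [^] n2 \<otimes> q2)"
proof -
  obtain a where a: "f [^] (a + n2) \<otimes> r1 = f [^] (a + n1) \<otimes> r2"
    using eq(1) frac_eq r by auto
  obtain b where b: "f [^] (b + m2) \<otimes> q1 = f [^] (b + m1) \<otimes> q2"
    using eq(2) frac_eq r by auto
  have 1: "f [^] ((a + b) + (n2 + m2)) \<otimes> (f [^] m1 \<otimes> r1) = f [^] ((a + b) + (n1 + m1)) \<otimes> (f [^] m2 \<otimes> r2)"
  proof -
    have "f [^] ((a + b) + (n2 + m2)) \<otimes> (f [^] m1 \<otimes> r1) = f [^] (b + m1 + m2) \<otimes> (f [^] (a + n2) \<otimes> r1)"
      using r by (simp add: pow_shift[symmetric] ac_simps)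
    also have "\<dots> = f [^] ((a + b) + (n1 + m1)) \<otimes> (f [^] m2 \<otimes> r2)"
      unfolding a using r by (simp add: pow_shift[symmetric] ac_simps)
    finally show ?thesis .
  qed
  have 2: "f [^] ((a + b) + (n2 + m2)) \<otimes> (f [^] n1 \<otimes> q1) = f [^] ((a + b) + (n1 + m1)) \<otimes> (f [^] n2 \<otimes> q2)"
  proof -
    have "f [^] ((a + b) + (n2 + m2)) \<otimes> (f [^] n1 \<otimes> q1) = f [^] (a + n1 + n2) \<otimes> (f [^] (b + m2) \<otimes> q1)"
      using r by (simp add: pow_shift[symmetric] ac_simps)
    also have "\<dots> = f [^] ((a + b) + (n1 + m1)) \<otimes> (f [^] n2 \<otimes> q2)"
      unfolding b using r by (simp add: pow_shift[symmetric] ac_simps)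
    finally show ?thesis .
  qed
  have "f [^] ((a + b) + (n2 + m2)) \<otimes> (f [^] m1 \<otimes> r1 \<oplus> f [^] n1 \<otimes> q1)
     = f [^] ((a + b) + (n1 + m1)) \<otimes> (f [^] m2 \<otimes> r2 \<oplus> f [^] n2 \<otimes> q2)"
    using r pow_closed 1 2 by (simp add: r_distr)
  then show ?thesis using r pow_closed by (subst frac_eq) auto
qed

text \<open>The sum is defined through arbitrary common left multiples of the denominators; here the product of the
  two powers serves as the canonical choice.\<close>

lemma add_frac:
  assumes r: "r \<in> carrier R" "q \<in> carrier R"
  shows "frac n r \<oplus>\<^bsub>A\<^esub> frac m q = frac (n + m) (f [^] m \<otimes> r \<oplus> f [^] n \<otimes> q)"
proof -
  have "frac n r \<oplus>\<^bsub>A\<^esub> frac m q = (THE Z. \<exists>s r' t q'. (s, r') \<in> frac n r \<and> (t, q') \<in> frac m q \<and>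
         (\<exists>a\<in>carrier R. \<exists>b\<in>carrier R. a \<otimes> s = b \<otimes> t \<and> a \<otimes> s \<in> S \<and>
            Z = ore_frac R S (a \<otimes> s) (a \<otimes> r' \<oplus> b \<otimes> q')))"
    unfolding ore_localization_def by simp
  also have "\<dots> = frac (n + m) (f [^] m \<otimes> r \<oplus> f [^] n \<otimes> q)"
  proof (rule the_equality)
    have "(f [^] n, r) \<in> frac n r" "(f [^] m, q) \<in> frac m q" using r by (auto simp: in_frac)
    moreover have "frac (n + m) (f [^] m \<otimes> r \<oplus> f [^] n \<otimes> q)
        = ore_frac R S (f [^] m \<otimes> f [^] n) (f [^] m \<otimes> r \<oplus> f [^] n \<otimes> q)"
      by (simp add: frac_def pow_add pow_comm)
    moreover have "f [^] m \<otimes> f [^] n \<in> S" unfolding pow_add[symmetric] by (rule S_pow)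
    ultimately show "\<exists>s r' t q'. (s, r') \<in> frac n r \<and> (t, q') \<in> frac m q \<and>
         (\<exists>a\<in>carrier R. \<exists>b\<in>carrier R. a \<otimes> s = b \<otimes> t \<and> a \<otimes> s \<in> S \<and>
            frac (n + m) (f [^] m \<otimes> r \<oplus> f [^] n \<otimes> q) = ore_frac R S (a \<otimes> s) (a \<otimes> r' \<oplus> b \<otimes> q'))"
      using pow_closed pow_comm by blast
  next
    fix Z
    assume "\<exists>s r' t q'. (s, r') \<in> frac n r \<and> (t, q') \<in> frac m q \<and>
         (\<exists>a\<in>carrier R. \<exists>b\<in>carrier R. a \<otimes> s = b \<otimes> t \<and> a \<otimes> s \<in> S \<and>
            Z = ore_frac R S (a \<otimes> s) (a \<otimes> r' \<oplus> b \<otimes> q'))"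
    then obtain n' r' m' q' a b j where *: "r' \<in> carrier R" "frac n' r' = frac n r"
       "q' \<in> carrier R" "frac m' q' = frac m q" "a \<in> carrier R" "b \<in> carrier R"
       "a \<otimes> f [^] n' = b \<otimes> f [^] m'" "a \<otimes> f [^] n' = f [^] (j::nat)"
       "Z = ore_frac R S (f [^] j) (a \<otimes> r' \<oplus> b \<otimes> q')"
      unfolding in_frac[OF r(1)] in_frac[OF r(2)] S_def by auto
    obtain L where L: "f [^] (L + n') \<otimes> a = f [^] (L + j)" using pow_left_quotient * by blast
    obtain L' where L': "f [^] (L' + m') \<otimes> b = f [^] (L' + j)" using pow_left_quotient *(6-8) by metis
    have 1: "f [^] ((L + L') + (n' + m')) \<otimes> (a \<otimes> r') = f [^] ((L + L') + j) \<otimes> (f [^] m' \<otimes> r')"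
    proof -
      have "f [^] ((L + L') + (n' + m')) \<otimes> (a \<otimes> r') = f [^] (L' + m') \<otimes> ((f [^] (L + n') \<otimes> a) \<otimes> r')"
        using * pow_closed by (simp add: pow_shift[symmetric] m_assoc ac_simps)
      also have "\<dots> = f [^] ((L + L') + j) \<otimes> (f [^] m' \<otimes> r')"
        unfolding L using * by (simp add: pow_shift[symmetric] ac_simps)
      finally show ?thesis .
    qed
    have 2: "f [^] ((L + L') + (n' + m')) \<otimes> (b \<otimes> q') = f [^] ((L + L') + j) \<otimes> (f [^] n' \<otimes> q')"
    proof -
      have "f [^] ((L + L') + (n' + m')) \<otimes> (b \<otimes> q') = f [^] (L + n') \<otimes> ((f [^] (L' + m') \<otimes> b) \<otimes> q')"
        using * pow_closed by (simp add: pow_shift[symmetric] m_assoc ac_simps)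
      also have "\<dots> = f [^] ((L + L') + j) \<otimes> (f [^] n' \<otimes> q')"
        unfolding L' using * by (simp add: pow_shift[symmetric] ac_simps)
      finally show ?thesis .
    qed
    have "f [^] ((L + L') + (n' + m')) \<otimes> (a \<otimes> r' \<oplus> b \<otimes> q')
       = f [^] ((L + L') + j) \<otimes> (f [^] m' \<otimes> r' \<oplus> f [^] n' \<otimes> q')"
      using * pow_closed 1 2 by (simp add: r_distr)
    then have "frac j (a \<otimes> r' \<oplus> b \<otimes> q') = frac (n' + m') (f [^] m' \<otimes> r' \<oplus> f [^] n' \<otimes> q')"
      using * pow_closed by (subst frac_eq) auto
    also have "\<dots> = frac (n + m) (f [^] m \<otimes> r \<oplus> f [^] n \<otimes> q)"
      by (rule add_welldefined[OF *(1) r(1) *(3) r(2) *(2,4)])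
    finally show "Z = frac (n + m) (f [^] m \<otimes> r \<oplus> f [^] n \<otimes> q)"
      unfolding *(9) frac_def .
  qed
  finally show ?thesis .
qed

lemma add_frac_same:
  assumes r: "r \<in> carrier R" "q \<in> carrier R"
  shows "frac n r \<oplus>\<^bsub>A\<^esub> frac n q = frac n (r \<oplus> q)"
  using frac_expand[of "r \<oplus> q" n n] r pow_closed by (simp add: add_frac r_distr)

lemma zero_A: "\<zero>\<^bsub>A\<^esub> = frac n \<zero>"
proof -
  have "\<zero>\<^bsub>A\<^esub> = frac 0 \<zero>" by (simp add: ore_localization_def frac_def)
  also have "\<dots> = frac n \<zero>" using pow_closed by (subst frac_eq) auto
  finally show ?thesis .
qed

lemma one_A: "\<one>\<^bsub>A\<^esub> = frac 0 \<one>"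
  by (simp add: ore_localization_def frac_def)

lemma carrier_A_cases:
  assumes "X \<in> carrier A"
  obtains n r where "r \<in> carrier R" "X = frac n r"
  using assms unfolding carrier_A by blast

lemma common_denominator:
  assumes "X \<in> carrier A" "Y \<in> carrier A"
  obtains n r q where "r \<in> carrier R" "q \<in> carrier R" "X = frac n r" "Y = frac n q"
proof -
  obtain n r where X: "r \<in> carrier R" "X = frac n r" using assms(1) by (rule carrier_A_cases)
  obtain m q where Y: "q \<in> carrier R" "Y = frac m q" using assms(2) by (rule carrier_A_cases)
  have "X = frac (m + n) (f [^] m \<otimes> r)" "Y = frac (m + n) (f [^] n \<otimes> q)"
    using frac_expand[OF X(1), of m n] frac_expand[OF Y(1), of n m] X Y
    by (auto simp: add.commute)
  then show ?thesis
    using that m_closed[OF pow_closed[of m] X(1)] m_closed[OF pow_closed[of n] Y(1)] by metis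
qed

lemma abelian_group_A: "abelian_group A"
proof (rule abelian_groupI)
  show "\<zero>\<^bsub>A\<^esub> \<in> carrier A" by (simp add: zero_A[of 0] frac_closed)
next
  fix X Y assume XY: "X \<in> carrier A" "Y \<in> carrier A"
  obtain n r q where X: "r \<in> carrier R" "q \<in> carrier R" "X = frac n r" "Y = frac n q"
    using common_denominator[OF XY] by metis
  show "X \<oplus>\<^bsub>A\<^esub> Y \<in> carrier A" "X \<oplus>\<^bsub>A\<^esub> Y = Y \<oplus>\<^bsub>A\<^esub> X"
    using X by (auto simp: add_frac_same frac_closed a_comm)
  fix Z assume "Z \<in> carrier A"
  then obtain m p where Z: "p \<in> carrier R" "Z = frac m p" by (rule carrier_A_cases)
  have "X = frac (m + n) (f [^] m \<otimes> r)" "Y = frac (m + n) (f [^] m \<otimes> q)"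
    "Z = frac (m + n) (f [^] n \<otimes> p)"
    using frac_expand[OF X(1), of m n] frac_expand[OF X(2), of m n] frac_expand[OF Z(1), of n m] X Z
    by (auto simp: add.commute)
  then show "X \<oplus>\<^bsub>A\<^esub> Y \<oplus>\<^bsub>A\<^esub> Z = X \<oplus>\<^bsub>A\<^esub> (Y \<oplus>\<^bsub>A\<^esub> Z)"
    using X Z pow_closed by (simp add: add_frac_same a_assoc)
next
  fix X assume "X \<in> carrier A"
  then obtain n r where X: "r \<in> carrier R" "X = frac n r" by (rule carrier_A_cases)
  show "\<zero>\<^bsub>A\<^esub> \<oplus>\<^bsub>A\<^esub> X = X" using X by (simp add: zero_A[of n] add_frac_same)
  have "frac n (\<ominus> r) \<oplus>\<^bsub>A\<^esub> X = \<zero>\<^bsub>A\<^esub>" using X by (simp add: zero_A[of n] add_frac_same l_neg)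
  then show "\<exists>Y\<in>carrier A. Y \<oplus>\<^bsub>A\<^esub> X = \<zero>\<^bsub>A\<^esub>" using frac_closed[OF a_inv_closed[OF X(1)]] by blast
qed

lemma ore_map_frac: "ore_map R S r = frac 0 r"
  by (simp add: ore_map_def frac_def)

lemma frac_mult_map:
  assumes "r \<in> carrier R" "q \<in> carrier R"
  shows "frac n r \<otimes>\<^bsub>A\<^esub> frac 0 q = frac n (r \<otimes> q)"
  using mult_frac[of r q r 0 0 n] assms by simp

lemma minus_frac:
  assumes "r \<in> carrier R" "q \<in> carrier R"
  shows "frac n r \<ominus>\<^bsub>A\<^esub> frac n q = frac n (r \<ominus> q)"
proof -
  interpret A: abelian_group A by (rule abelian_group_A)
  have "frac n (\<ominus> q) \<oplus>\<^bsub>A\<^esub> frac n q = \<zero>\<^bsub>A\<^esub>"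
    using assms by (simp add: zero_A[of n] add_frac_same l_neg)
  then have "\<ominus>\<^bsub>A\<^esub> frac n q = frac n (\<ominus> q)"
    using assms by (intro A.minus_equality) (auto simp: frac_closed)
  then show ?thesis using assms by (simp add: a_minus_def add_frac_same)
qed

text \<open>Uniqueness of the inverse is read off from equality of fractions.\<close>

lemma inv_frac: "inv\<^bsub>A\<^esub> (frac 0 f) = frac 1 \<one>"
proof -
  have 1: "frac 0 f \<otimes>\<^bsub>A\<^esub> frac 1 \<one> = \<one>\<^bsub>A\<^esub>"
    using mult_frac[of f \<one> \<one> 0 1 0] f by (simp add: one_A)
  have "frac 1 \<one> \<otimes>\<^bsub>A\<^esub> frac 0 f = frac 1 (\<one> \<otimes> f)" using f by (intro frac_mult_map) auto
  also have "\<dots> = frac 0 \<one>" using f by (subst frac_eq) (auto intro!: exI[of _ 0])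
  finally have 2: "frac 1 \<one> \<otimes>\<^bsub>A\<^esub> frac 0 f = \<one>\<^bsub>A\<^esub>" by (simp add: one_A)
  have uniq: "Y = frac 1 \<one>" if Y: "Y \<in> carrier A" "frac 0 f \<otimes>\<^bsub>A\<^esub> Y = \<one>\<^bsub>A\<^esub>" for Y
  proof -
    obtain n r where r: "r \<in> carrier R" "Y = frac n r" using Y(1) by (rule carrier_A_cases)
    have "f [^] n \<otimes> f = f \<otimes> f [^] n" using pow_comm[of n 1] f by simp
    then have "frac 0 f \<otimes>\<^bsub>A\<^esub> Y = frac (n + 0) (f \<otimes> r)"
      unfolding r(2) using f r by (intro mult_frac)
    then have "frac n (f \<otimes> r) = frac 0 \<one>" using Y(2) by (simp add: one_A)
    then obtain k where "f [^] (k + 0) \<otimes> (f \<otimes> r) = f [^] (k + n) \<otimes> \<one>"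
      using f r by (subst (asm) frac_eq) auto
    then have "f [^] (k + 1) \<otimes> r = f [^] (k + n) \<otimes> \<one>"
      using f r by (simp add: m_assoc)
    then show ?thesis unfolding r(2) using r by (subst frac_eq) auto
  qed
  have "frac 1 \<one> \<in> carrier A" by (rule frac_closed) simp
  then have "frac 1 \<one> \<in> carrier A \<and> frac 0 f \<otimes>\<^bsub>A\<^esub> frac 1 \<one> = \<one>\<^bsub>A\<^esub> \<and>
      frac 1 \<one> \<otimes>\<^bsub>A\<^esub> frac 0 f = \<one>\<^bsub>A\<^esub>"
    using 1 2 by (intro conjI)
  then show ?thesis unfolding m_inv_def
    by (rule the_equality) (elim conjE, rule uniq)
qed

lemma inv_pow_frac: "(frac 1 \<one>) [^]\<^bsub>A\<^esub> (i::nat) = frac i \<one>"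
proof (induction i)
  case 0
  then show ?case by (simp add: one_A)
next
  case (Suc i)
  have "frac i \<one> \<otimes>\<^bsub>A\<^esub> frac 1 \<one> = frac (1 + i) (\<one> \<otimes> \<one>)"
    using f by (intro mult_frac) auto
  then show ?case using Suc by simp
qed

lemma ad_frac:
  assumes "r \<in> carrier R"
  shows "((\<lambda>u. (frac 0 f \<otimes>\<^bsub>A\<^esub> u) \<ominus>\<^bsub>A\<^esub> (u \<otimes>\<^bsub>A\<^esub> frac 0 f)) ^^ i) (frac 0 r) = frac 0 ((ad ^^ i) r)"
  using assms f ad_pow_closed[OF assms]
  by (induction i) (auto simp: frac_mult_map minus_frac ad_def)

end

section \<open>The localized module as a tensor product\<close>

text \<open>An action \<open>\<rho>\<close> of \<open>R\<close> in which \<open>f\<close> is invertible, with inverse \<open>G\<close>, extends to the localization.\<close>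

locale localized_action =
  ad_nilpotent R f + conjugation scale C "\<rho> f" G
  for R :: "('r, 'x) ring_scheme" (structure) and f :: 'r
    and scale :: "'k::field_char_0 \<Rightarrow> 'v::ab_group_add \<Rightarrow> 'v" (infixr \<open>*s\<close> 75)
    and C :: "'v set" and \<rho> :: "'r \<Rightarrow> 'v \<Rightarrow> 'v" and G :: "'v \<Rightarrow> 'v" +
  assumes action_lin: "r \<in> carrier R \<Longrightarrow> lin_on scale C (\<rho> r)"
    and action_mult: "r \<in> carrier R \<Longrightarrow> q \<in> carrier R \<Longrightarrow> v \<in> C \<Longrightarrow> \<rho> (r \<otimes> q) v = \<rho> r (\<rho> q v)"
    and action_add: "r \<in> carrier R \<Longrightarrow> q \<in> carrier R \<Longrightarrow> v \<in> C \<Longrightarrow> \<rho> (r \<oplus> q) v = \<rho> r v + \<rho> q v"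
    and action_one: "v \<in> C \<Longrightarrow> \<rho> \<one> v = v"
begin

lemma action_closed: "r \<in> carrier R \<Longrightarrow> v \<in> C \<Longrightarrow> \<rho> r v \<in> C"
  using action_lin by (rule lin_on_closed)

lemma action_zero: "v \<in> C \<Longrightarrow> \<rho> \<zero> v = 0"
  using action_add[of \<zero> \<zero> v] by simp

lemma action_diff: "r \<in> carrier R \<Longrightarrow> q \<in> carrier R \<Longrightarrow> v \<in> C \<Longrightarrow> \<rho> (r \<ominus> q) v = \<rho> r v - \<rho> q v"
proof -
  assume *: "r \<in> carrier R" "q \<in> carrier R" "v \<in> C"
  have "\<rho> ((r \<ominus> q) \<oplus> q) v = \<rho> (r \<ominus> q) v + \<rho> q v" using * by (intro action_add) auto
  moreover have "(r \<ominus> q) \<oplus> q = r" using * by (simp add: minus_eq a_assoc l_neg)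
  ultimately show ?thesis by (simp add: algebra_simps)
qed

lemma action_pow: "v \<in> C \<Longrightarrow> \<rho> (f [^] (n::nat)) v = (\<rho> f ^^ n) v"
proof (induction n arbitrary: v)
  case 0
  then show ?case by (simp add: action_one)
next
  case (Suc n)
  then show ?case using f by (simp add: action_mult action_closed funpow_swap1)
qed

text \<open>The commutator \<open>[F, u] F\<^sup>-\<^sup>1\<close> of operators corresponds to \<open>ad f\<close> in the ring.\<close>

lemma conj_diff_action:
  assumes "r \<in> carrier R" "v \<in> C"
  shows "(conj_diff ^^ i) (\<rho> r) v = \<rho> ((ad ^^ i) r) ((G ^^ i) v)"
  using assms(2)
proof (induction i arbitrary: v)
  case 0
  then show ?case by simp
next
  case (Suc i)
  let ?q = "(ad ^^ i) r"
  have q: "?q \<in> carrier R" by (rule ad_pow_closed[OF assms(1)])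
  have Gv: "G v \<in> C" "(G ^^ i) v \<in> C" "(G ^^ i) (G v) \<in> C"
    using G_pow_closed[OF Suc.prems, of "Suc i"] G_pow_closed[OF Suc.prems, of i]
      lin_on_closed[OF G Suc.prems] by (auto simp: funpow_swap1)
  have "(G ^^ i) v = \<rho> f ((G ^^ i) (G v))"
    using FG[OF Gv(2)] by (simp add: funpow_swap1)
  define y where "y = (G ^^ i) (G v)"
  have y: "y \<in> C" "(G ^^ i) v = \<rho> f y" "(G ^^ Suc i) v = y"
    using Gv(3) \<open>(G ^^ i) v = _\<close> by (auto simp: y_def funpow_swap1 GF)
  have "(conj_diff ^^ Suc i) (\<rho> r) v = \<rho> f ((conj_diff ^^ i) (\<rho> r) (G v)) - (conj_diff ^^ i) (\<rho> r) v"
    by (simp add: conj_diff_def[of "(conj_diff ^^ i) (\<rho> r)"])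
  also have "\<dots> = \<rho> f (\<rho> ?q y) - \<rho> ?q (\<rho> f y)"
    using Suc.IH[OF Suc.prems] Suc.IH[OF Gv(1)] y by (simp add: y_def)
  also have "\<dots> = \<rho> (ad ?q) y"
    using q f y(1) by (simp add: ad_def[of ?q] action_diff action_mult)
  finally show ?case unfolding y(3) by simp
qed

lemma action_conj_nilpotent: "r \<in> carrier R \<Longrightarrow> conj_nilpotent (\<rho> r)"
proof -
  assume r: "r \<in> carrier R"
  then obtain n where "(ad ^^ n) r = \<zero>" using ad_nil by blast
  then show ?thesis unfolding conj_nilpotent_def
    using conj_diff_action[OF r] G_pow_closed by (intro exI[of _ n]) (simp add: action_zero)
qed

definition act :: "('r \<times> 'r) set \<Rightarrow> 'v \<Rightarrow> 'v" where
  "act X v = (SOME w. \<exists>n r. r \<in> carrier R \<and> X = frac n r \<and> w = (G ^^ n) (\<rho> r v))"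

lemma action_frac_eq:
  assumes "r \<in> carrier R" "q \<in> carrier R" "v \<in> C" "frac n r = frac m q"
  shows "(G ^^ n) (\<rho> r v) = (G ^^ m) (\<rho> q v)"
proof -
  obtain k where k: "f [^] (k + m) \<otimes> r = f [^] (k + n) \<otimes> q"
    using assms frac_eq by blast
  have "(\<rho> f ^^ (k + m)) (\<rho> r v) = (\<rho> f ^^ (k + n)) (\<rho> q v)"
    using arg_cong[OF k, of "\<lambda>z. \<rho> z v"] assms f
    by (simp only: action_mult action_closed pow_closed action_pow)
  then have "(G ^^ ((m + n) + k)) ((\<rho> f ^^ (k + m)) (\<rho> r v)) = (G ^^ ((m + n) + k)) ((\<rho> f ^^ (k + n)) (\<rho> q v))"
    by simp
  moreover have "(G ^^ (a + c)) ((\<rho> f ^^ c) w) = (G ^^ a) w" if "w \<in> C" for a c w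
    using GF_pow[OF that, of c] by (simp add: funpow_add)
  from this[of "\<rho> r v" n "k + m"] this[of "\<rho> q v" m "k + n"]
  have "(G ^^ ((m + n) + k)) ((\<rho> f ^^ (k + m)) (\<rho> r v)) = (G ^^ n) (\<rho> r v)"
    "(G ^^ ((m + n) + k)) ((\<rho> f ^^ (k + n)) (\<rho> q v)) = (G ^^ m) (\<rho> q v)"
    using action_closed assms by (auto simp: ac_simps)
  ultimately show ?thesis by simp
qed

lemma act_frac:
  assumes "r \<in> carrier R" "v \<in> C"
  shows "act (frac n r) v = (G ^^ n) (\<rho> r v)"
  unfolding act_def
  by (rule some_equality) (use assms action_frac_eq in blast)+

lemma act_lin: "X \<in> carrier A \<Longrightarrow> lin_on scale C (act X)"
proof (elim carrier_A_cases)
  fix n r assume r: "r \<in> carrier R" "X = frac n r"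
  have "lin_on scale C (\<lambda>v. (G ^^ n) (\<rho> r v))"
    by (rule lin_on_compose[OF lin_on_funpow[OF G] action_lin[OF r(1)]])
  then show ?thesis unfolding r(2) lin_on_def
    using act_frac[OF r(1)] C by (auto simp: subspace_add subspace_scale)
qed

lemma act_closed: "X \<in> carrier A \<Longrightarrow> v \<in> C \<Longrightarrow> act X v \<in> C"
  using act_lin by (rule lin_on_closed)

lemma act_add:
  assumes "X \<in> carrier A" "Y \<in> carrier A" "v \<in> C"
  shows "act (X \<oplus>\<^bsub>A\<^esub> Y) v = act X v + act Y v"
proof -
  obtain n r q where "r \<in> carrier R" "q \<in> carrier R" "X = frac n r" "Y = frac n q"
    using common_denominator[OF assms(1,2)] by metis
  then show ?thesis using assms(3)
    by (simp add: add_frac_same act_frac action_add action_closed lin_on_add[OF lin_on_funpow[OF G]])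
qed

lemma mult_closed_A: "X \<in> carrier A \<Longrightarrow> Y \<in> carrier A \<Longrightarrow> X \<otimes>\<^bsub>A\<^esub> Y \<in> carrier A"
  and act_mult: "X \<in> carrier A \<Longrightarrow> Y \<in> carrier A \<Longrightarrow> v \<in> C \<Longrightarrow> act (X \<otimes>\<^bsub>A\<^esub> Y) v = act X (act Y v)"
proof -
  assume XY: "X \<in> carrier A" "Y \<in> carrier A"
  obtain n r where X: "r \<in> carrier R" "X = frac n r" using XY(1) by (rule carrier_A_cases)
  obtain m q where Y: "q \<in> carrier R" "Y = frac m q" using XY(2) by (rule carrier_A_cases)
  obtain k p where p: "p \<in> carrier R" "f [^] (k::nat) \<otimes> r = p \<otimes> f [^] m"
    using ore_condition[OF X(1)] by blast
  have eq: "X \<otimes>\<^bsub>A\<^esub> Y = frac (k + n) (p \<otimes> q)"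
    unfolding X(2) Y(2) by (rule mult_frac[OF X(1) Y(1) p])
  then show "X \<otimes>\<^bsub>A\<^esub> Y \<in> carrier A" using p Y frac_closed by simp
  assume v: "v \<in> C"
  define w where "w = (G ^^ m) (\<rho> q v)"
  have wC: "w \<in> C" unfolding w_def using v Y by (intro G_pow_closed action_closed)
  have qv: "\<rho> q v = (\<rho> f ^^ m) w" unfolding w_def using v Y by (simp add: FG_pow action_closed)
  have "(\<rho> f ^^ k) (\<rho> r w) = \<rho> p ((\<rho> f ^^ m) w)"
    using arg_cong[OF p(2), of "\<lambda>z. \<rho> z w"] p(1) X(1) wC
    by (simp only: action_mult action_closed pow_closed action_pow)
  then have "\<rho> r w = (G ^^ k) (\<rho> p (\<rho> q v))"
    unfolding qv using GF_pow[of "\<rho> r w" k] wC X by (simp add: action_closed)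
  then have "act X (act Y v) = (G ^^ n) ((G ^^ k) (\<rho> p (\<rho> q v)))"
    unfolding X(2) Y(2) using X Y v wC by (simp add: act_frac w_def[symmetric])
  then show "act (X \<otimes>\<^bsub>A\<^esub> Y) v = act X (act Y v)"
    unfolding eq using p Y v
    by (simp add: act_frac action_mult) (metis add.commute comp_apply funpow_add)
qed

lemma act_finsum:
  assumes "finite I" "\<And>i. i \<in> I \<Longrightarrow> u i \<in> carrier A" "v \<in> C"
  shows "act (\<Oplus>\<^bsub>A\<^esub>i\<in>I. u i) v = (\<Sum>i\<in>I. act (u i) v)"
proof -
  interpret A: abelian_group A by (rule abelian_group_A)
  have "act (\<Oplus>\<^bsub>A\<^esub>i\<in>I. u i) v = (\<Sum>i\<in>I. act (u i) v) \<and> (\<Oplus>\<^bsub>A\<^esub>i\<in>I. u i) \<in> carrier A"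
    using assms
  proof (induction I rule: finite_induct)
    case empty
    then show ?case by (simp add: zero_A[of 0] act_frac action_zero frac_closed)
  next
    case (insert i I)
    then show ?case by (simp add: act_add Pi_def)
  qed
  then show ?thesis ..
qed

lemma act_map: "r \<in> carrier R \<Longrightarrow> v \<in> C \<Longrightarrow> act (ore_map R S r) v = \<rho> r v"
  by (simp add: ore_map_frac act_frac)

text \<open>The twist of the localized ring acts as the power of conjugation by \<open>f\<close>; the scalars \<open>sc c\<close> are those of
  the enveloping algebra.\<close>

lemma act_theta:
  assumes r: "r \<in> carrier R" and v: "v \<in> C"
    and sc: "\<And>c. sc c \<in> carrier R" "\<And>c v. v \<in> C \<Longrightarrow> \<rho> (sc c) v = c *s v"
    and \<iota>: "\<iota> = ore_map R S"
    and adA: "adA = (\<lambda>u. (\<iota> f \<otimes>\<^bsub>A\<^esub> u) \<ominus>\<^bsub>A\<^esub> (u \<otimes>\<^bsub>A\<^esub> \<iota> f))"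
    and \<theta>: "\<theta> = (\<Oplus>\<^bsub>A\<^esub>i\<in>{i. (adA ^^ i) (\<iota> r) \<noteq> \<zero>\<^bsub>A\<^esub>}.
           \<iota> (sc (x gchoose i)) \<otimes>\<^bsub>A\<^esub> (adA ^^ i) (\<iota> r) \<otimes>\<^bsub>A\<^esub> (inv\<^bsub>A\<^esub> (\<iota> f)) [^]\<^bsub>A\<^esub> i)"
  shows "\<theta> \<in> carrier A" "act \<theta> v = conj_power x (\<rho> r) v"
proof -
  interpret A: abelian_group A by (rule abelian_group_A)
  have ad: "(adA ^^ i) (\<iota> r) = frac 0 ((ad ^^ i) r)" for i
    unfolding adA \<iota> ore_map_frac by (rule ad_frac[OF r])
  define I where "I = {i. (adA ^^ i) (\<iota> r) \<noteq> \<zero>\<^bsub>A\<^esub>}"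
  define t where "t = (\<lambda>i. \<iota> (sc (x gchoose i)) \<otimes>\<^bsub>A\<^esub> (adA ^^ i) (\<iota> r) \<otimes>\<^bsub>A\<^esub> (inv\<^bsub>A\<^esub> (\<iota> f)) [^]\<^bsub>A\<^esub> i)"
  obtain n where n: "(ad ^^ n) r = \<zero>" using ad_nil[OF r] by blast
  have ad0: "(ad ^^ i) r = \<zero>" if "n \<le> i" for i
    using that
  proof (induction i rule: dec_induct)
    case (step i)
    have "ad \<zero> = \<zero>" using f by (simp add: ad_def minus_eq)
    then show ?case using step by simp
  qed (rule n)
  have I: "I \<subseteq> {..<n}"
  proof
    fix i assume "i \<in> I"
    then have "(ad ^^ i) r \<noteq> \<zero>" by (auto simp: I_def ad zero_A[of 0])
    then show "i \<in> {..<n}" using ad0[of i] by force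
  qed
  have t: "t i = frac 0 (sc (x gchoose i)) \<otimes>\<^bsub>A\<^esub> frac 0 ((ad ^^ i) r) \<otimes>\<^bsub>A\<^esub> frac i \<one>" for i
    unfolding t_def ad unfolding \<iota> ore_map_frac inv_frac inv_pow_frac ..
  have adc: "(ad ^^ i) r \<in> carrier R" for i by (rule ad_pow_closed[OF r])
  have tc: "t i \<in> carrier A" for i unfolding t by (intro mult_closed_A frac_closed sc adc one_closed)
  have \<theta>t: "\<theta> = (\<Oplus>\<^bsub>A\<^esub>i\<in>I. t i)" unfolding \<theta> t_def I_def ..
  show "\<theta> \<in> carrier A" unfolding \<theta>t by (rule A.finsum_closed, rule Pi_I, rule tc)
  have at: "act (t i) v = (x gchoose i) *s (conj_diff ^^ i) (\<rho> r) v" for i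
  proof -
    have "act (t i) v = \<rho> (sc (x gchoose i)) (\<rho> ((ad ^^ i) r) ((G ^^ i) v))"
      unfolding t using v sc(1) adc
      by (simp add: act_mult mult_closed_A frac_closed act_frac action_one action_closed G_pow_closed)
    then show ?thesis
      using v adc by (simp add: sc(2) conj_diff_action[OF r] action_closed G_pow_closed)
  qed
  have "act \<theta> v = (\<Sum>i\<in>I. act (t i) v)"
    unfolding \<theta>t
  proof (rule act_finsum[OF _ tc v])
    show "finite I" using I by (rule finite_subset) simp
  qed
  also have "\<dots> = (\<Sum>i<n. act (t i) v)"
  proof (rule sum.mono_neutral_left)
    show "\<forall>i\<in>{..<n} - I. act (t i) v = 0"
    proof
      fix i assume "i \<in> {..<n} - I"
      then have "frac 0 ((ad ^^ i) r) = \<zero>\<^bsub>A\<^esub>" by (simp add: I_def ad)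
      then have "act (frac 0 ((ad ^^ i) r)) ((G ^^ i) v) = act (frac 0 \<zero>) ((G ^^ i) v)"
        by (simp add: zero_A[of 0])
      then have "(conj_diff ^^ i) (\<rho> r) v = 0"
        using v adc by (simp add: act_frac G_pow_closed conj_diff_action[OF r] action_zero)
      then show "act (t i) v = 0" by (simp add: at)
    qed
  qed (use I in auto)
  also have "\<dots> = conj_power x (\<rho> r) v"
    unfolding at using v
    by (intro conj_power_upto[symmetric]) (simp add: conj_diff_action[OF r] ad0 action_zero G_pow_closed)
  finally show "act \<theta> v = conj_power x (\<rho> r) v" .
qed

end

text \<open>\<open>N\<close> is a submodule that meets every orbit of \<open>f\<close>, so that its localization is the whole
  space \<open>C\<close>.\<close>

locale localized_submodule = localized_action R f scale C \<rho> G
  for R :: "('r, 'x) ring_scheme" (structure) and f :: 'r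
    and scale :: "'k::field_char_0 \<Rightarrow> 'v::ab_group_add \<Rightarrow> 'v" (infixr \<open>*s\<close> 75)
    and C :: "'v set" and \<rho> :: "'r \<Rightarrow> 'v \<Rightarrow> 'v" and G :: "'v \<Rightarrow> 'v" +
  fixes N :: "('r, 'v) module"
  assumes N_subspace: "subspace (carrier N)" and N_subset: "carrier N \<subseteq> C"
    and N_add: "\<And>v w. v \<in> carrier N \<Longrightarrow> w \<in> carrier N \<Longrightarrow> v \<oplus>\<^bsub>N\<^esub> w = v + w"
    and N_smult: "\<And>r v. r \<in> carrier R \<Longrightarrow> v \<in> carrier N \<Longrightarrow> r \<odot>\<^bsub>N\<^esub> v = \<rho> r v"
    and N_stable: "\<And>r v. r \<in> carrier R \<Longrightarrow> v \<in> carrier N \<Longrightarrow> \<rho> r v \<in> carrier N"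
    and N_absorbs: "\<And>v. v \<in> C \<Longrightarrow> \<exists>n. (\<rho> f ^^ n) v \<in> carrier N"
begin

abbreviation "D \<equiv> carrier N"
abbreviation "Fr \<equiv> free_Abelian_group (carrier A \<times> D)"
abbreviation "Rel \<equiv> tensor_relations R A (ore_map R S) N"
abbreviation "K \<equiv> generate Fr Rel"
abbreviation "P \<equiv> base_change R A (ore_map R S) N"

text \<open>The map \<open>a \<otimes> v \<mapsto> a v\<close>, on representatives.\<close>

definition eval :: "(('r \<times> 'r) set \<times> 'v \<Rightarrow>\<^sub>0 int) \<Rightarrow> 'v" where
  "eval p = (\<Sum>x\<in>Poly_Mapping.keys p. of_int (Poly_Mapping.lookup p x) *s act (fst x) (snd x))"

lemma eval_superset:
  assumes "finite T" "Poly_Mapping.keys p \<subseteq> T"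
  shows "eval p = (\<Sum>x\<in>T. of_int (Poly_Mapping.lookup p x) *s act (fst x) (snd x))"
  unfolding eval_def using assms
  by (intro sum.mono_neutral_left) (auto simp: in_keys_iff)

lemma eval_diff: "eval (p - q) = eval p - eval q"
proof -
  let ?T = "Poly_Mapping.keys p \<union> Poly_Mapping.keys q"
  have "Poly_Mapping.keys (p - q) \<subseteq> ?T" by (rule keys_diff)
  then show ?thesis
    by (simp add: eval_superset[of ?T] lookup_minus scale_left_diff_distrib sum_subtractf)
qed

lemma eval_0: "eval 0 = 0" by (simp add: eval_def)

lemma eval_add: "eval (p + q) = eval p + eval q"
  using eval_diff[of "p + q" q] by (simp add: algebra_simps)

lemma eval_minus: "eval (- p) = - eval p"
  using eval_diff[of 0 p] by (simp add: eval_0)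

lemma eval_frag: "eval (frag_of (a, v)) = act a v"
  by (simp add: eval_def)

lemma eval_closed: "p \<in> carrier Fr \<Longrightarrow> eval p \<in> C"
  unfolding eval_def using C N_subset
  by (intro subspace_sum subspace_scale act_closed) auto

lemma map_closed: "r \<in> carrier R \<Longrightarrow> ore_map R S r \<in> carrier A"
  by (simp add: ore_map_frac frac_closed)

lemma add_closed_A: "X \<in> carrier A \<Longrightarrow> Y \<in> carrier A \<Longrightarrow> X \<oplus>\<^bsub>A\<^esub> Y \<in> carrier A"
  using abelian_groupE(1)[OF abelian_group_A] by blast

lemma rel_cases:
  assumes "p \<in> Rel"
  obtains a b v where "a \<in> carrier A" "b \<in> carrier A" "v \<in> D"
      "p = frag_of (a \<oplus>\<^bsub>A\<^esub> b, v) - frag_of (a, v) - frag_of (b, v)"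
    | a v w where "a \<in> carrier A" "v \<in> D" "w \<in> D"
      "p = frag_of (a, v + w) - frag_of (a, v) - frag_of (a, w)"
    | a r v where "a \<in> carrier A" "r \<in> carrier R" "v \<in> D"
      "p = frag_of (a \<otimes>\<^bsub>A\<^esub> ore_map R S r, v) - frag_of (a, \<rho> r v)"
  using assms unfolding tensor_relations_def by (auto simp: N_add N_smult)

lemma frag_diff_closed: "p \<in> carrier Fr \<Longrightarrow> q \<in> carrier Fr \<Longrightarrow> p - q \<in> carrier Fr"
  using keys_diff[of p q] by auto

lemma rel_carrier: "Rel \<subseteq> carrier Fr"
proof
  fix p assume "p \<in> Rel"
  then show "p \<in> carrier Fr"
  proof (cases rule: rel_cases)
    case (1 a b v)
    then show ?thesis
      by (auto intro!: frag_diff_closed simp: add_closed_A simp del: carrier_free_Abelian_group_iff)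
  next
    case (2 a v w)
    then show ?thesis using subspace_add[OF N_subspace]
      by (auto intro!: frag_diff_closed simp del: carrier_free_Abelian_group_iff)
  next
    case (3 a r v)
    then show ?thesis using N_stable
      by (auto intro!: frag_diff_closed simp: mult_closed_A map_closed
          simp del: carrier_free_Abelian_group_iff)
  qed
qed

lemma subgroup_K: "subgroup K Fr"
  by (rule group.generate_is_subgroup[OF group_free_Abelian_group rel_carrier])

lemma K_carrier: "p \<in> K \<Longrightarrow> p \<in> carrier Fr"
  using subgroup.subset[OF subgroup_K] by blast

lemma K_add: "p \<in> K \<Longrightarrow> q \<in> K \<Longrightarrow> p + q \<in> K"
  using subgroup.m_closed[OF subgroup_K] by simp

lemma K_minus: "p \<in> K \<Longrightarrow> - p \<in> K"
  using subgroup.m_inv_closed[OF subgroup_K, of p] K_carrier[of p] by simp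

lemma K_diff: "p \<in> K \<Longrightarrow> q \<in> K \<Longrightarrow> p - q \<in> K"
  using K_add[of p "- q"] K_minus[of q] by simp

lemma K_rel: "p \<in> Rel \<Longrightarrow> p \<in> K" by (rule generate.incl)

lemma K_linear:
  assumes "a \<in> carrier A" "v \<in> D" "w \<in> D"
  shows "frag_of (a, v + w) - frag_of (a, v) - frag_of (a, w) \<in> K"
proof (rule K_rel)
  have "frag_of (a, v \<oplus>\<^bsub>N\<^esub> w) - frag_of (a, v) - frag_of (a, w) \<in> Rel"
    unfolding tensor_relations_def using assms by blast
  then show "frag_of (a, v + w) - frag_of (a, v) - frag_of (a, w) \<in> Rel"
    using assms by (simp add: N_add)
qed

lemma K_balanced:
  assumes "a \<in> carrier A" "v \<in> D" "r \<in> carrier R"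
  shows "frag_of (a \<otimes>\<^bsub>A\<^esub> ore_map R S r, v) - frag_of (a, \<rho> r v) \<in> K"
proof (rule K_rel)
  have "frag_of (a \<otimes>\<^bsub>A\<^esub> ore_map R S r, v) - frag_of (a, r \<odot>\<^bsub>N\<^esub> v) \<in> Rel"
    unfolding tensor_relations_def using assms by blast
  then show "frag_of (a \<otimes>\<^bsub>A\<^esub> ore_map R S r, v) - frag_of (a, \<rho> r v) \<in> Rel"
    using assms by (simp add: N_smult)
qed

lemma K_zero:
  assumes "a \<in> carrier A"
  shows "frag_of (a, 0) \<in> K"
  using K_minus[OF K_linear[OF assms, of 0 0]] subspace_0[OF N_subspace] by simp

lemma eval_rel: "p \<in> Rel \<Longrightarrow> eval p = 0"
proof (erule rel_cases)
  fix a b v assume "a \<in> carrier A" "b \<in> carrier A" "v \<in> D"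
    "p = frag_of (a \<oplus>\<^bsub>A\<^esub> b, v) - frag_of (a, v) - frag_of (b, v)"
  then show ?thesis using N_subset by (auto simp: eval_diff eval_frag act_add)
next
  fix a v w assume *: "a \<in> carrier A" "v \<in> D" "w \<in> D"
    "p = frag_of (a, v + w) - frag_of (a, v) - frag_of (a, w)"
  then have "act a (v + w) = act a v + act a w"
    using N_subset by (intro lin_on_add[OF act_lin]) auto
  then show ?thesis by (simp add: *(4) eval_diff eval_frag)
next
  fix a r v assume "a \<in> carrier A" "r \<in> carrier R" "v \<in> D"
    "p = frag_of (a \<otimes>\<^bsub>A\<^esub> ore_map R S r, v) - frag_of (a, \<rho> r v)"
  then show ?thesis
    using N_subset by (auto simp: eval_diff eval_frag act_mult map_closed act_map subset_iff)
qed

lemma eval_K: "p \<in> K \<Longrightarrow> eval p = 0"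
proof (induction rule: generate.induct)
  case (inv p)
  then have "p \<in> carrier Fr" using rel_carrier by blast
  then show ?case using eval_rel[OF inv] by (simp add: eval_minus)
qed (auto simp: eval_0 eval_add eval_rel)

lemma frac_split: "r \<in> carrier R \<Longrightarrow> frac n r = frac n \<one> \<otimes>\<^bsub>A\<^esub> ore_map R S r"
  by (simp add: ore_map_frac frac_mult_map)

text \<open>\<open>f\<^sup>-\<^sup>n \<otimes> w = f\<^sup>-\<^sup>k\<^sup>-\<^sup>n \<otimes> f\<^sup>k w\<close>, which provides common denominators.\<close>

lemma K_raise:
  assumes "w \<in> D"
  shows "frag_of (frac n \<one>, w) - frag_of (frac (k + n) \<one>, \<rho> (f [^] k) w) \<in> K"
proof -
  have "frac n \<one> = frac (k + n) (f [^] k)"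
    using frac_expand[of \<one> k n] pow_closed by simp
  also have "\<dots> = frac (k + n) \<one> \<otimes>\<^bsub>A\<^esub> ore_map R S (f [^] k)"
    by (rule frac_split) (rule pow_closed)
  finally show ?thesis
    using K_balanced[OF frac_closed[OF one_closed] assms pow_closed] by metis
qed

text \<open>Every element of the tensor product is a pure tensor \<open>f\<^sup>-\<^sup>n \<otimes> w\<close>.\<close>

lemma pure_tensor:
  assumes "p \<in> carrier Fr"
  shows "\<exists>n w. w \<in> D \<and> p - frag_of (frac n \<one>, w) \<in> K"
proof -
  have "Poly_Mapping.keys p \<subseteq> carrier A \<times> D" using assms by simp
  then show ?thesis
  proof (induction rule: frag_induction)
    case zero
    have "- frag_of (frac 0 \<one>, 0) \<in> K" by (intro K_minus K_zero frac_closed) simp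
    then show ?case using subspace_0[OF N_subspace] by (intro exI[of _ 0]) auto
  next
    case (one x)
    obtain X v where x: "x = (X, v)" "X \<in> carrier A" "v \<in> D" using one by auto
    obtain n r where r: "r \<in> carrier R" "X = frac n r" using x(2) by (rule carrier_A_cases)
    have "frag_of x - frag_of (frac n \<one>, \<rho> r v) \<in> K"
      unfolding x(1) r(2) frac_split[OF r(1)]
      by (rule K_balanced[OF frac_closed[OF one_closed] x(3) r(1)])
    then show ?case using N_stable[OF r(1) x(3)] by blast
  next
    case (diff a b)
    then obtain n w m v where 1: "w \<in> D" "a - frag_of (frac n \<one>, w) \<in> K"
      and 2: "v \<in> D" "b - frag_of (frac m \<one>, v) \<in> K" by blast
    define w' where "w' = \<rho> (f [^] m) w"
    define v' where "v' = \<rho> (f [^] n) v"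
    have wv: "w' \<in> D" "v' \<in> D" "w' - v' \<in> D"
      using 1 2 N_stable[OF pow_closed] subspace_diff[OF N_subspace] by (auto simp: w'_def v'_def)
    let ?a = "frac (m + n) \<one>"
    have aA: "?a \<in> carrier A" by (rule frac_closed) simp
    have k1: "frag_of (frac n \<one>, w) - frag_of (?a, w') \<in> K" unfolding w'_def by (rule K_raise[OF 1(1)])
    have k2: "frag_of (frac m \<one>, v) - frag_of (?a, v') \<in> K"
      unfolding v'_def using K_raise[OF 2(1), of m n] by (simp add: add.commute)
    have k3: "frag_of (?a, w') - frag_of (?a, w' - v') - frag_of (?a, v') \<in> K"
      using K_linear[OF aA wv(3) wv(2)] by simp
    have "(a - frag_of (frac n \<one>, w)) + (frag_of (frac n \<one>, w) - frag_of (?a, w'))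
       - (b - frag_of (frac m \<one>, v)) - (frag_of (frac m \<one>, v) - frag_of (?a, v'))
       + (frag_of (?a, w') - frag_of (?a, w' - v') - frag_of (?a, v')) \<in> K"
      by (intro K_add K_diff 1 2 k1 k2 k3)
    then have "a - b - frag_of (?a, w' - v') \<in> K" by (simp add: algebra_simps)
    then show ?case using wv(3) by blast
  qed
qed

text \<open>On a pure tensor, evaluation is \<open>w \<mapsto> f\<^sup>-\<^sup>n w\<close>, which is injective.\<close>

lemma eval_kernel:
  assumes p: "p \<in> carrier Fr" and ev: "eval p = 0"
  shows "p \<in> K"
proof -
  obtain n w where w: "w \<in> D" "p - frag_of (frac n \<one>, w) \<in> K" using pure_tensor[OF p] by blast
  have wC: "w \<in> C" using w N_subset by blast
  have "eval (p - frag_of (frac n \<one>, w)) = 0" using eval_K[OF w(2)] .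
  then have "(G ^^ n) w = 0" using ev wC by (simp add: eval_diff eval_frag act_frac action_one)
  then have "w = 0" using FG_pow[OF wC, of n] lin_on_zero[OF lin_on_funpow[OF F] C] by metis
  then have "frag_of (frac n \<one>, w) \<in> K" using K_zero[OF frac_closed[OF one_closed]] by simp
  then show ?thesis using K_add[OF w(2), of "frag_of (frac n \<one>, w)"] by simp
qed

text \<open>The element of the tensor product that evaluates to \<open>v\<close>; this is the isomorphism from \<open>C\<close>.\<close>

definition coset :: "'v \<Rightarrow> (('r \<times> 'r) set \<times> 'v \<Rightarrow>\<^sub>0 int) set" where
  "coset v = {p \<in> carrier Fr. eval p = v}"

lemma coset_eq:
  assumes p: "p \<in> carrier Fr"
  shows "K #>\<^bsub>Fr\<^esub> p = coset (eval p)"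
proof (rule subset_antisym; rule subsetI)
  fix q assume "q \<in> K #>\<^bsub>Fr\<^esub> p"
  then obtain k where k: "k \<in> K" "q = k + p" by (auto simp: r_coset_def)
  have "k + p \<in> carrier Fr"
    using K_carrier[OF k(1)] p keys_add[of k p] by auto
  then show "q \<in> coset (eval p)" using k eval_K[OF k(1)] by (simp add: coset_def eval_add)
next
  fix q assume q: "q \<in> coset (eval p)"
  then have "q - p \<in> K"
    using p by (intro eval_kernel frag_diff_closed) (auto simp: coset_def eval_diff)
  then show "q \<in> K #>\<^bsub>Fr\<^esub> p" by (auto simp: r_coset_def intro!: bexI[of _ "q - p"])
qed

lemma coset_nonempty:
  assumes "v \<in> C"
  obtains p where "p \<in> carrier Fr" "eval p = v"
proof -
  obtain n where n: "(\<rho> f ^^ n) v \<in> D" using N_absorbs[OF assms] by blast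
  let ?p = "frag_of (frac n \<one>, (\<rho> f ^^ n) v)"
  have "?p \<in> carrier Fr" using n frac_closed[OF one_closed] by simp
  moreover have "eval ?p = v"
    using n N_subset by (simp add: eval_frag act_frac action_one subset_iff GF_pow[OF assms])
  ultimately show ?thesis using that by blast
qed

lemma coset_surj: "carrier P = coset ` C"
proof -
  have "carrier P = (\<lambda>p. K #>\<^bsub>Fr\<^esub> p) ` carrier Fr"
    by (simp add: base_change_def Let_def carrier_FactGroup)
  also have "\<dots> = (\<lambda>p. coset (eval p)) ` carrier Fr" by (intro image_cong coset_eq refl)
  also have "\<dots> = coset ` C" 
  proof (rule subset_antisym; rule subsetI)
    fix X assume "X \<in> coset ` C"
    then obtain v where v: "v \<in> C" "X = coset v" by blast
    obtain p where "p \<in> carrier Fr" "eval p = v" using coset_nonempty[OF v(1)] .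
    then show "X \<in> (\<lambda>p. coset (eval p)) ` carrier Fr" using v(2) by blast
  qed (use eval_closed in blast)
  finally show ?thesis .
qed

lemma coset_bij: "bij_betw coset C (carrier P)"
proof (rule bij_betw_imageI)
  show "inj_on coset C"
  proof (rule inj_onI)
    fix v w assume vw: "v \<in> C" "w \<in> C" "coset v = coset w"
    obtain p where "p \<in> carrier Fr" "eval p = v" using coset_nonempty[OF vw(1)] .
    then have "p \<in> coset w" using vw(3) by (auto simp: coset_def)
    then show "v = w" using \<open>eval p = v\<close> by (simp add: coset_def)
  qed
  show "coset ` C = carrier P" using coset_surj by simp
qed

lemma coset_add:
  assumes "v \<in> C" "w \<in> C"
  shows "coset v \<oplus>\<^bsub>P\<^esub> coset w = coset (v + w)"
proof -
  obtain p where p: "p \<in> carrier Fr" "eval p = v" using coset_nonempty[OF assms(1)] .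
  have "coset v \<oplus>\<^bsub>P\<^esub> coset w = coset v <#>\<^bsub>Fr\<^esub> coset w"
    by (simp add: base_change_def Let_def FactGroup_def)
  also have "\<dots> = {a + b | a b. a \<in> coset v \<and> b \<in> coset w}" by (auto simp: set_mult_def)
  also have "\<dots> = coset (v + w)"
  proof (rule subset_antisym; rule subsetI)
    fix q assume "q \<in> {a + b | a b. a \<in> coset v \<and> b \<in> coset w}"
    then obtain a b where ab: "q = a + b" "a \<in> coset v" "b \<in> coset w" by blast
    have "a + b \<in> carrier Fr" using ab keys_add[of a b] by (auto simp: coset_def)
    then show "q \<in> coset (v + w)" using ab by (simp add: coset_def eval_add)
  next
    fix q assume "q \<in> coset (v + w)"
    then have "q - p \<in> coset w"
      using p by (auto simp: coset_def eval_diff intro!: frag_diff_closed simp del: carrier_free_Abelian_group_iff)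
    moreover have "p \<in> coset v" using p by (simp add: coset_def)
    ultimately have "q = p + (q - p) \<and> p \<in> coset v \<and> q - p \<in> coset w" by simp
    then show "q \<in> {a + b | a b. a \<in> coset v \<and> b \<in> coset w}" by blast
  qed
  finally show ?thesis .
qed

lemma coset_smult:
  assumes a: "a \<in> carrier A" and v: "v \<in> C"
  shows "a \<odot>\<^bsub>P\<^esub> coset v = coset (act a v)"
proof -
  define g where "g = (\<lambda>(b, v :: 'v). frag_of (a \<otimes>\<^bsub>A\<^esub> b, v))"
  have key: "frag_extend g p \<in> carrier Fr \<and> eval (frag_extend g p) = act a (eval p) \<and> eval p \<in> C"
    if "p \<in> carrier Fr" for p
  proof -
    have "Poly_Mapping.keys p \<subseteq> carrier A \<times> D" using that by simp
    then show ?thesis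
    proof (induction rule: frag_induction)
      case zero
      then show ?case using C lin_on_zero[OF act_lin[OF a] C] by (simp add: eval_0 subspace_0)
    next
      case (one x)
      then obtain X v where x: "x = (X, v)" "X \<in> carrier A" "v \<in> D" by auto
      have "v \<in> C" using x N_subset by blast
      then show ?case using x a by (simp add: g_def eval_frag act_mult mult_closed_A act_closed)
    next
      case (diff p q)
      then have "frag_extend g p - frag_extend g q \<in> carrier Fr"
        by (intro frag_diff_closed) simp_all
      moreover have "act a (eval p - eval q) = act a (eval p) - act a (eval q)"
        using diff by (intro lin_on_diff[OF act_lin[OF a] C]) simp_all
      moreover have "eval p - eval q \<in> C" using diff by (intro subspace_diff[OF C]) simp_all
      ultimately show ?case using diff by (simp add: frag_extend_diff eval_diff)
    qed
  qed
  define p where "p = (SOME p. p \<in> coset v)"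
  obtain q where "q \<in> carrier Fr" "eval q = v" using coset_nonempty[OF v] .
  then have "q \<in> coset v" by (simp add: coset_def)
  then have "p \<in> coset v" unfolding p_def by (rule someI)
  then have p: "p \<in> carrier Fr" "eval p = v" by (auto simp: coset_def)
  have "a \<odot>\<^bsub>P\<^esub> coset v = K #>\<^bsub>Fr\<^esub> frag_extend g p"
    by (simp add: base_change_def Let_def g_def p_def)
  also have "\<dots> = coset (eval (frag_extend g p))" using key[OF p(1)] by (intro coset_eq) simp
  finally show ?thesis using key[OF p(1)] p(2) by simp
qed

end

section \<open>The enveloping algebra and its action on modules\<close>

lemma free_algebra_simps:
  "p \<in> carrier (free_algebra A) \<longleftrightarrow> finite {w. p w \<noteq> 0} \<and> (\<forall>w. p w \<noteq> 0 \<longrightarrow> set w \<subseteq> A)"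
  "p \<otimes>\<^bsub>free_algebra A\<^esub> q = (\<lambda>w. \<Sum>i\<le>length w. p (take i w) * q (drop i w))"
  "p \<oplus>\<^bsub>free_algebra A\<^esub> q = (\<lambda>w. p w + q w)"
  "\<zero>\<^bsub>free_algebra A\<^esub> = (\<lambda>_. 0)"
  "\<one>\<^bsub>free_algebra A\<^esub> = word 1 []"
  by (auto simp: free_algebra_def)

lemma free_algebra_mult_closed:
  assumes "p \<in> carrier (free_algebra A)" "q \<in> carrier (free_algebra A)"
  shows "p \<otimes>\<^bsub>free_algebra A\<^esub> q \<in> carrier (free_algebra A)"
proof -
  have split: "\<exists>u v. w = u @ v \<and> p u \<noteq> 0 \<and> q v \<noteq> 0"
    if "(p \<otimes>\<^bsub>free_algebra A\<^esub> q) w \<noteq> 0" for w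
  proof -
    have "\<exists>i. p (take i w) * q (drop i w) \<noteq> 0"
    proof (rule ccontr)
      assume "\<nexists>i. p (take i w) * q (drop i w) \<noteq> 0"
      then have "(p \<otimes>\<^bsub>free_algebra A\<^esub> q) w = 0"
        unfolding free_algebra_simps(2) by (intro sum.neutral) auto
      then show False using that by simp
    qed
    then obtain i where "p (take i w) \<noteq> 0" "q (drop i w) \<noteq> 0" by auto
    then show ?thesis by (intro exI[of _ "take i w"] exI[of _ "drop i w"]) simp
  qed
  have "{w. (p \<otimes>\<^bsub>free_algebra A\<^esub> q) w \<noteq> 0} \<subseteq> (\<lambda>(u, v). u @ v) ` ({w. p w \<noteq> 0} \<times> {w. q w \<noteq> 0})"
    using split by fastforce
  then have "finite {w. (p \<otimes>\<^bsub>free_algebra A\<^esub> q) w \<noteq> 0}"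
    using assms by (auto simp: free_algebra_simps(1) intro: finite_subset)
  moreover have "set w \<subseteq> A" if nz: "(p \<otimes>\<^bsub>free_algebra A\<^esub> q) w \<noteq> 0" for w
  proof -
    obtain u v where "w = u @ v" "p u \<noteq> 0" "q v \<noteq> 0" using split[OF nz] by blast
    then show ?thesis using assms by (simp add: free_algebra_simps(1))
  qed
  ultimately show ?thesis unfolding free_algebra_simps(1) by blast
qed

lemma free_algebra_add_closed:
  assumes "p \<in> carrier (free_algebra A)" "q \<in> carrier (free_algebra A)"
  shows "p \<oplus>\<^bsub>free_algebra A\<^esub> q \<in> carrier (free_algebra A)"
proof -
  have "{w. p w + q w \<noteq> 0} \<subseteq> {w. p w \<noteq> 0} \<union> {w. q w \<noteq> 0}" by auto
  then have "finite {w. p w + q w \<noteq> 0}"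
    using assms by (auto simp: free_algebra_simps intro: finite_subset)
  moreover have "set w \<subseteq> A" if "p w + q w \<noteq> 0" for w
    using that assms by (cases "p w = 0") (auto simp: free_algebra_simps)
  ultimately show ?thesis by (auto simp: free_algebra_simps)
qed

lemma free_algebra_mult_assoc:
  "p \<otimes>\<^bsub>free_algebra A\<^esub> q \<otimes>\<^bsub>free_algebra A\<^esub> r = p \<otimes>\<^bsub>free_algebra A\<^esub> (q \<otimes>\<^bsub>free_algebra A\<^esub> r)"
proof
  fix w :: "'a list"
  define n where "n = length w"
  define g where "g = (\<lambda>a b. p (take a w) * q (take b (drop a w)) * r (drop (a + b) w))"
  have "(p \<otimes>\<^bsub>free_algebra A\<^esub> q \<otimes>\<^bsub>free_algebra A\<^esub> r) w = (\<Sum>k\<le>n. \<Sum>i\<le>k. g i (k - i))"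
    unfolding free_algebra_simps n_def sum_distrib_right
    by (intro sum.cong) (auto simp: g_def min_def drop_take)
  also have "\<dots> = (\<Sum>(i, j)\<in>{(i, j). i + j \<le> n}. g i j)"
    by (rule sum.triangle_reindex_eq[symmetric])
  also have "{(i, j). i + j \<le> n} = (SIGMA i:{..n}. {..n - i})" by auto
  also have "(\<Sum>(i, j)\<in>(SIGMA i:{..n}. {..n - i}). g i j) = (\<Sum>i\<le>n. \<Sum>j\<le>n - i. g i j)"
    by (subst sum.Sigma) auto
  also have "\<dots> = (p \<otimes>\<^bsub>free_algebra A\<^esub> (q \<otimes>\<^bsub>free_algebra A\<^esub> r)) w"
    unfolding free_algebra_simps n_def sum_distrib_left
    by (intro sum.cong) (auto simp: g_def mult.assoc add.commute)
  finally show "(p \<otimes>\<^bsub>free_algebra A\<^esub> q \<otimes>\<^bsub>free_algebra A\<^esub> r) w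
     = (p \<otimes>\<^bsub>free_algebra A\<^esub> (q \<otimes>\<^bsub>free_algebra A\<^esub> r)) w" .
qed

lemma word_closed: "set w \<subseteq> A \<Longrightarrow> word c w \<in> carrier (free_algebra A)"
proof -
  assume "set w \<subseteq> A"
  moreover have "finite {v. word c w v \<noteq> 0}"
    by (rule finite_subset[of _ "{w}"]) (auto simp: word_def)
  ultimately show ?thesis by (auto simp: free_algebra_simps word_def)
qed

lemma word_mult: "word c u \<otimes>\<^bsub>free_algebra A\<^esub> word d v = word (c * d) (u @ v)"
proof
  fix w :: "'a list"
  have "(word c u \<otimes>\<^bsub>free_algebra A\<^esub> word d v) w
     = (\<Sum>i\<le>length w. if i = length u then (if w = u @ v then c * d else 0) else 0)"
    unfolding free_algebra_simps
  proof (intro sum.cong refl)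
    fix i assume i: "i \<in> {..length w}"
    show "word c u (take i w) * word d v (drop i w)
       = (if i = length u then (if w = u @ v then c * d else 0) else 0)"
    proof (cases "take i w = u \<and> drop i w = v")
      case True
      then have "w = u @ v" "i = length u" using i by (metis append_take_drop_id) (use True i in auto)
      then show ?thesis using True by (simp add: word_def)
    next
      case False
      then have "\<not> (i = length u \<and> w = u @ v)" by auto
      then show ?thesis using False by (auto simp: word_def)
    qed
  qed
  also have "\<dots> = word (c * d) (u @ v) w" by (auto simp: word_def)
  finally show "(word c u \<otimes>\<^bsub>free_algebra A\<^esub> word d v) w = word (c * d) (u @ v) w" .
qed

lemma free_algebra_one_mult:
  "word 1 [] \<otimes>\<^bsub>free_algebra A\<^esub> p = p" "p \<otimes>\<^bsub>free_algebra A\<^esub> word 1 [] = p"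
proof -
  show "word 1 [] \<otimes>\<^bsub>free_algebra A\<^esub> p = p"
  proof
    fix w :: "'a list"
    have "(word 1 [] \<otimes>\<^bsub>free_algebra A\<^esub> p) w = (\<Sum>i\<le>length w. if i = 0 then p w else 0)"
      unfolding free_algebra_simps by (intro sum.cong) (auto simp: word_def)
    then show "(word 1 [] \<otimes>\<^bsub>free_algebra A\<^esub> p) w = p w" by simp
  qed
  show "p \<otimes>\<^bsub>free_algebra A\<^esub> word 1 [] = p"
  proof
    fix w :: "'a list"
    have "(p \<otimes>\<^bsub>free_algebra A\<^esub> word 1 []) w = (\<Sum>i\<le>length w. if i = length w then p w else 0)"
      unfolding free_algebra_simps by (intro sum.cong) (auto simp: word_def)
    then show "(p \<otimes>\<^bsub>free_algebra A\<^esub> word 1 []) w = p w" by simp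
  qed
qed

lemma ring_free_algebra: "ring (free_algebra A :: ('l list \<Rightarrow> 'k::field) ring)"
proof (rule ringI)
  let ?R = "free_algebra A :: ('l list \<Rightarrow> 'k) ring"
  show "abelian_group ?R"
  proof (rule abelian_groupI)
    show "\<zero>\<^bsub>?R\<^esub> \<in> carrier ?R" by (simp add: free_algebra_simps)
    fix p assume p: "p \<in> carrier ?R"
    have "(\<lambda>w. - p w) \<in> carrier ?R" using p by (simp add: free_algebra_simps)
    moreover have "(\<lambda>w. - p w) \<oplus>\<^bsub>?R\<^esub> p = \<zero>\<^bsub>?R\<^esub>" by (simp add: free_algebra_simps)
    ultimately show "\<exists>q\<in>carrier ?R. q \<oplus>\<^bsub>?R\<^esub> p = \<zero>\<^bsub>?R\<^esub>" by blast
    show "\<zero>\<^bsub>?R\<^esub> \<oplus>\<^bsub>?R\<^esub> p = p" by (simp add: free_algebra_simps)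
    fix q assume q: "q \<in> carrier ?R"
    show "p \<oplus>\<^bsub>?R\<^esub> q \<in> carrier ?R" by (rule free_algebra_add_closed[OF p q])
    show "p \<oplus>\<^bsub>?R\<^esub> q = q \<oplus>\<^bsub>?R\<^esub> p" by (simp add: free_algebra_simps add.commute)
    fix r show "p \<oplus>\<^bsub>?R\<^esub> q \<oplus>\<^bsub>?R\<^esub> r = p \<oplus>\<^bsub>?R\<^esub> (q \<oplus>\<^bsub>?R\<^esub> r)"
      by (simp add: free_algebra_simps add.assoc)
  qed
  show "Group.monoid ?R"
  proof (rule Group.monoidI)
    show "\<one>\<^bsub>?R\<^esub> \<in> carrier ?R" by (simp add: free_algebra_simps(5) word_closed)
  qed (auto simp: free_algebra_mult_closed free_algebra_mult_assoc free_algebra_one_mult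
      free_algebra_simps(5) simp del: free_algebra_simps(2))
  show "(p \<oplus>\<^bsub>?R\<^esub> q) \<otimes>\<^bsub>?R\<^esub> r = p \<otimes>\<^bsub>?R\<^esub> r \<oplus>\<^bsub>?R\<^esub> q \<otimes>\<^bsub>?R\<^esub> r" for p q r
    by (simp add: free_algebra_simps distrib_right sum.distrib)
  show "r \<otimes>\<^bsub>?R\<^esub> (p \<oplus>\<^bsub>?R\<^esub> q) = r \<otimes>\<^bsub>?R\<^esub> p \<oplus>\<^bsub>?R\<^esub> r \<otimes>\<^bsub>?R\<^esub> q" for p q r
    by (simp add: free_algebra_simps distrib_left sum.distrib)
qed

text \<open>Removing one word at a time from the support.\<close>

lemma free_algebra_induct [consumes 1, case_names zero step]:
  assumes p: "p \<in> carrier (free_algebra A)"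
    and zero: "P (\<lambda>_. 0)"
    and step: "\<And>c w q. set w \<subseteq> A \<Longrightarrow> q \<in> carrier (free_algebra A) \<Longrightarrow> P q \<Longrightarrow>
      P (word c w \<oplus>\<^bsub>free_algebra A\<^esub> q)"
  shows "P p"
  using p
proof (induction "card {w. p w \<noteq> 0}" arbitrary: p)
  case 0
  then have "p = (\<lambda>_. 0)" by (auto simp: free_algebra_simps)
  then show ?case using zero by simp
next
  case (Suc n)
  then have fin: "finite {w. p w \<noteq> 0}" by (simp add: free_algebra_simps)
  have "{w. p w \<noteq> 0} \<noteq> {}" using Suc.hyps(2) by (metis card.empty nat.distinct(1))
  then obtain w where w: "p w \<noteq> 0" by blast
  define q where "q = p(w := 0)"
  have supp: "{v. q v \<noteq> 0} = {v. p v \<noteq> 0} - {w}" by (auto simp: q_def)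
  have q: "q \<in> carrier (free_algebra A)"
    using Suc.prems fin supp by (auto simp: free_algebra_simps q_def)
  have "P q" using Suc.hyps(2) w fin by (intro Suc.hyps(1) q) (simp add: supp card_Diff_singleton)
  moreover have "set w \<subseteq> A" using Suc.prems w by (simp add: free_algebra_simps)
  ultimately have "P (word (p w) w \<oplus>\<^bsub>free_algebra A\<^esub> q)" using step q by blast
  moreover have "word (p w) w \<oplus>\<^bsub>free_algebra A\<^esub> q = p"
    by (auto simp: free_algebra_simps word_def q_def)
  ultimately show ?case by simp
qed

locale lie_closed =
  fixes L :: "('k::field, 'l::ab_group_add) lie_alg"
  assumes add_closed: "x \<in> lie_carrier L \<Longrightarrow> y \<in> lie_carrier L \<Longrightarrow> x + y \<in> lie_carrier L"
    and scale_closed: "x \<in> lie_carrier L \<Longrightarrow> lie_scale L c x \<in> lie_carrier L"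
    and bracket_closed: "x \<in> lie_carrier L \<Longrightarrow> y \<in> lie_carrier L \<Longrightarrow> lie_bracket L x y \<in> lie_carrier L"
begin

abbreviation "W \<equiv> free_algebra (lie_carrier L) :: ('l list \<Rightarrow> 'k) ring"
abbreviation "U \<equiv> uea L"
abbreviation "I \<equiv> uea_ideal L"

interpretation W: ring W by (rule ring_free_algebra)

lemma diff_eq_minus:
  assumes "p \<in> carrier W" "q \<in> carrier W"
  shows "p - q = p \<ominus>\<^bsub>W\<^esub> q"
proof -
  have "\<ominus>\<^bsub>W\<^esub> q = - q"
    using assms by (intro W.minus_equality) (auto simp: free_algebra_simps)
  then show ?thesis by (auto simp: a_minus_def free_algebra_simps)
qed

lemma relations_closed: "uea_relations L \<subseteq> carrier W"
  unfolding uea_relations_def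
  using add_closed scale_closed bracket_closed
  by (auto simp: diff_eq_minus word_closed)

lemma ideal_I: "ideal I W"
  unfolding uea_ideal_def by (rule W.genideal_ideal[OF relations_closed])

lemma relations_I: "uea_relations L \<subseteq> I"
  unfolding uea_ideal_def by (rule W.genideal_self[OF relations_closed])

lemma ring_U: "ring U"
  unfolding uea_def by (rule ideal.quotient_is_ring[OF ideal_I])

lemma class_hom: "uea_class L \<in> ring_hom W U"
  using ideal.rcos_ring_hom[OF ideal_I] unfolding uea_class_def[abs_def] uea_def .

lemma class_closed: "p \<in> carrier W \<Longrightarrow> uea_class L p \<in> carrier U"
  using ring_hom_closed[OF class_hom] .

lemma class_mult: "p \<in> carrier W \<Longrightarrow> q \<in> carrier W \<Longrightarrow>
    uea_class L (p \<otimes>\<^bsub>W\<^esub> q) = uea_class L p \<otimes>\<^bsub>U\<^esub> uea_class L q"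
  using ring_hom_mult[OF class_hom] .

lemma class_add: "p \<in> carrier W \<Longrightarrow> q \<in> carrier W \<Longrightarrow>
    uea_class L (p \<oplus>\<^bsub>W\<^esub> q) = uea_class L p \<oplus>\<^bsub>U\<^esub> uea_class L q"
  using ring_hom_add[OF class_hom] .

lemma class_one: "uea_class L (word 1 []) = \<one>\<^bsub>U\<^esub>"
  using ring_hom_one[OF class_hom] by (simp add: free_algebra_simps)

lemma class_surj:
  assumes "X \<in> carrier U"
  obtains p where "p \<in> carrier W" "X = uea_class L p"
  using assms unfolding uea_def FactRing_def uea_class_def by (auto simp: A_RCOSETS_def')

lemma class_I: "p \<in> I \<Longrightarrow> uea_class L p = \<zero>\<^bsub>U\<^esub>"
proof -
  assume p: "p \<in> I"
  interpret I: ideal I W by (rule ideal_I)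
  show ?thesis using I.a_rcos_const[OF p] by (simp add: uea_class_def uea_def FactRing_def)
qed

lemma class_diff: "p \<in> carrier W \<Longrightarrow> q \<in> carrier W \<Longrightarrow>
    uea_class L (p - q) = uea_class L p \<ominus>\<^bsub>U\<^esub> uea_class L q"
proof -
  assume *: "p \<in> carrier W" "q \<in> carrier W"
  interpret U: ring U by (rule ring_U)
  have pq: "p - q \<in> carrier W" using * by (simp add: diff_eq_minus)
  have "(p - q) \<oplus>\<^bsub>W\<^esub> q = p" by (simp add: free_algebra_simps)
  then have "uea_class L (p - q) \<oplus>\<^bsub>U\<^esub> uea_class L q = uea_class L p"
    using class_add[OF pq *(2)] by simp
  then show ?thesis using * pq
    by (metis U.minus_eq U.a_assoc U.r_neg U.r_zero U.a_inv_closed class_closed)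
qed

lemma class_word_Cons:
  assumes "x \<in> lie_carrier L" "set w \<subseteq> lie_carrier L"
  shows "uea_class L (word 1 (x # w)) = uea_gen L x \<otimes>\<^bsub>U\<^esub> uea_class L (word 1 w)"
proof -
  have "word 1 (x # w) = word 1 [x] \<otimes>\<^bsub>W\<^esub> word 1 w" by (simp add: word_mult)
  then show ?thesis using assms by (simp add: class_mult word_closed uea_gen_def)
qed

lemma gen_closed: "x \<in> lie_carrier L \<Longrightarrow> uea_gen L x \<in> carrier U"
  unfolding uea_gen_def by (intro class_closed word_closed) simp

lemma scalar_closed: "uea_scalar L c \<in> carrier U"
  unfolding uea_scalar_def by (intro class_closed word_closed) simp

text \<open>The enveloping algebra is generated by scalars and the elements of the Lie algebra.\<close>

lemma uea_induct [consumes 1, case_names scalar gen mult add]: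
  assumes X: "X \<in> carrier U"
    and scalar: "\<And>c. P (uea_scalar L c)"
    and gen: "\<And>x. x \<in> lie_carrier L \<Longrightarrow> P (uea_gen L x)"
    and mult: "\<And>X Y. X \<in> carrier U \<Longrightarrow> Y \<in> carrier U \<Longrightarrow> P X \<Longrightarrow> P Y \<Longrightarrow> P (X \<otimes>\<^bsub>U\<^esub> Y)"
    and add: "\<And>X Y. X \<in> carrier U \<Longrightarrow> Y \<in> carrier U \<Longrightarrow> P X \<Longrightarrow> P Y \<Longrightarrow> P (X \<oplus>\<^bsub>U\<^esub> Y)"
  shows "P X"
proof -
  have word1: "P (uea_class L (word 1 w))" if "set w \<subseteq> lie_carrier L" for w
    using that
  proof (induction w)
    case Nil
    then show ?case using scalar[of 1] by (simp add: uea_scalar_def)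
  next
    case (Cons x w)
    then have "P (uea_gen L x \<otimes>\<^bsub>U\<^esub> uea_class L (word 1 w))"
      by (intro mult gen_closed class_closed word_closed gen) auto
    then show ?case using Cons.prems by (simp add: class_word_Cons)
  qed
  have word: "P (uea_class L (word c w))" if w: "set w \<subseteq> lie_carrier L" for c w
  proof -
    have "word c w = word c [] \<otimes>\<^bsub>W\<^esub> word 1 w" by (simp add: word_mult)
    then have "uea_class L (word c w) = uea_scalar L c \<otimes>\<^bsub>U\<^esub> uea_class L (word 1 w)"
      using w by (simp add: class_mult word_closed uea_scalar_def)
    then show ?thesis using w by (simp add: mult scalar_closed class_closed word_closed scalar word1)
  qed
  obtain p where p: "p \<in> carrier W" "X = uea_class L p" using X by (rule class_surj)
  have "P (uea_class L p)" using p(1)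
  proof (induction rule: free_algebra_induct)
    case zero
    have "word 0 [] = ((\<lambda>_. 0) :: 'l list \<Rightarrow> 'k)" by (auto simp: word_def)
    then show ?case using scalar[of 0] by (simp add: uea_scalar_def)
  next
    case (step c w q)
    then show ?case by (simp add: class_add word_closed add class_closed word)
  qed
  then show ?thesis using p(2) by simp
qed

lemma relation_add:
  assumes "x \<in> lie_carrier L" "y \<in> lie_carrier L"
  shows "word 1 [x + y] - word 1 [x] - word 1 [y] \<in> uea_relations L"
  unfolding uea_relations_def
  by (rule UnI1, rule UnI1, rule CollectI, rule exI[of _ x], rule exI[of _ y])
    (simp add: assms)

lemma relation_bracket:
  assumes "x \<in> lie_carrier L" "y \<in> lie_carrier L"
  shows "word 1 [x, y] - word 1 [y, x] - word 1 [lie_bracket L x y] \<in> uea_relations L"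
  unfolding uea_relations_def
  by (rule UnI2, rule CollectI, rule exI[of _ x], rule exI[of _ y]) (simp add: assms)

lemma gen_add:
  assumes "x \<in> lie_carrier L" "y \<in> lie_carrier L"
  shows "uea_gen L (x + y) = uea_gen L x \<oplus>\<^bsub>U\<^esub> uea_gen L y"
proof -
  interpret U: ring U by (rule ring_U)
  let ?s = "word 1 [x] \<oplus>\<^bsub>W\<^esub> word 1 [y] :: 'l list \<Rightarrow> 'k"
  let ?r = "word 1 [x + y] - word 1 [x] - word 1 [y] :: 'l list \<Rightarrow> 'k"
  have rel: "?r \<in> uea_relations L" by (rule relation_add[OF assms])
  have rI: "?r \<in> I" and r: "?r \<in> carrier W"
    using relations_I[THEN subsetD, OF rel] relations_closed[THEN subsetD, OF rel] .
  have xy: "word 1 [x] \<in> carrier W" "word 1 [y] \<in> carrier W" using assms by (auto simp: word_closed)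
  have s: "?s \<in> carrier W" using xy by (rule free_algebra_add_closed)
  have "word 1 [x + y] = ?r \<oplus>\<^bsub>W\<^esub> ?s" by (simp add: free_algebra_simps fun_eq_iff)
  then have "uea_class L (word 1 [x + y]) = \<zero>\<^bsub>U\<^esub> \<oplus>\<^bsub>U\<^esub> uea_class L ?s"
    unfolding class_I[OF rI, symmetric] class_add[OF r s, symmetric] by simp
  also have "\<dots> = uea_class L ?s" by (rule U.l_zero[OF class_closed[OF s]])
  finally show ?thesis unfolding uea_gen_def class_add[OF xy] .
qed

lemma gen_bracket:
  assumes "x \<in> lie_carrier L" "y \<in> lie_carrier L"
  shows "uea_gen L x \<otimes>\<^bsub>U\<^esub> uea_gen L y \<ominus>\<^bsub>U\<^esub> uea_gen L y \<otimes>\<^bsub>U\<^esub> uea_gen L x = uea_gen L (lie_bracket L x y)"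
proof -
  interpret U: ring U by (rule ring_U)
  let ?b = "word 1 [lie_bracket L x y] :: 'l list \<Rightarrow> 'k"
  let ?r = "word 1 [x, y] - word 1 [y, x] - ?b"
  have rel: "?r \<in> uea_relations L" by (rule relation_bracket[OF assms])
  have rI: "?r \<in> I" and r: "?r \<in> carrier W"
    using relations_I[THEN subsetD, OF rel] relations_closed[THEN subsetD, OF rel] .
  have b: "?b \<in> carrier W" by (rule word_closed) (simp add: assms bracket_closed)
  have xy: "word 1 [x, y] \<in> carrier W" "word 1 [y, x] \<in> carrier W"
    by (rule word_closed, simp add: assms)+
  have "word 1 [x, y] - word 1 [y, x] = ?r \<oplus>\<^bsub>W\<^esub> ?b"
    by (simp add: free_algebra_simps fun_eq_iff)
  then have "uea_class L (word 1 [x, y] - word 1 [y, x]) = \<zero>\<^bsub>U\<^esub> \<oplus>\<^bsub>U\<^esub> uea_class L ?b"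
    unfolding class_I[OF rI, symmetric] class_add[OF r b, symmetric] by simp
  then have "uea_class L (word 1 [x, y] - word 1 [y, x]) = uea_class L ?b"
    unfolding U.l_zero[OF class_closed[OF b]] .
  then have "uea_class L (word 1 [x, y]) \<ominus>\<^bsub>U\<^esub> uea_class L (word 1 [y, x]) = uea_class L ?b"
    by (simp add: class_diff xy)
  moreover have "uea_class L (word 1 [x, y]) = uea_gen L x \<otimes>\<^bsub>U\<^esub> uea_gen L y"
    using class_word_Cons[of x "[y]"] assms unfolding uea_gen_def[of L y] by simp
  moreover have "uea_class L (word 1 [y, x]) = uea_gen L y \<otimes>\<^bsub>U\<^esub> uea_gen L x"
    using class_word_Cons[of y "[x]"] assms unfolding uea_gen_def[of L x] by simp
  ultimately show ?thesis by (simp only: uea_gen_def)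
qed

lemma gen_zero: "0 \<in> lie_carrier L \<Longrightarrow> uea_gen L 0 = \<zero>\<^bsub>U\<^esub>"
proof -
  interpret U: ring U by (rule ring_U)
  assume z: "0 \<in> lie_carrier L"
  have "uea_gen L 0 = uea_gen L 0 \<oplus>\<^bsub>U\<^esub> uea_gen L 0" using gen_add[OF z z] by simp
  then show ?thesis using gen_closed[OF z] by (metis U.add.l_cancel_one)
qed

lemma scalar_central:
  assumes "X \<in> carrier U"
  shows "uea_scalar L c \<otimes>\<^bsub>U\<^esub> X = X \<otimes>\<^bsub>U\<^esub> uea_scalar L c"
proof -
  obtain p where p: "p \<in> carrier W" "X = uea_class L p" using assms by (rule class_surj)
  have "word c [] \<otimes>\<^bsub>W\<^esub> p = p \<otimes>\<^bsub>W\<^esub> word c []"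
  proof
    fix w :: "'l list"
    have "(word c [] \<otimes>\<^bsub>W\<^esub> p) w = (\<Sum>i\<le>length w. if i = 0 then c * p w else 0)"
      unfolding free_algebra_simps by (intro sum.cong) (auto simp: word_def)
    moreover have "(p \<otimes>\<^bsub>W\<^esub> word c []) w = (\<Sum>i\<le>length w. if i = length w then c * p w else 0)"
      unfolding free_algebra_simps by (intro sum.cong) (auto simp: word_def)
    ultimately show "(word c [] \<otimes>\<^bsub>W\<^esub> p) w = (p \<otimes>\<^bsub>W\<^esub> word c []) w" by simp
  qed
  then show ?thesis using p
    by (metis class_mult uea_scalar_def word_closed empty_subsetI list.set(1))
qed

end

text \<open>Nilpotency of \<open>ad f\<close> passes to products since \<open>ad f\<close> is a derivation.\<close>

lemma (in ring) ad_nilpotent_mult: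
  assumes f: "f \<in> carrier R"
  defines "ad \<equiv> (\<lambda>r. f \<otimes> r \<ominus> r \<otimes> f)"
  assumes x: "x \<in> carrier R" "(ad ^^ n) x = \<zero>" and y: "y \<in> carrier R" "(ad ^^ m) y = \<zero>"
  shows "(ad ^^ (n + m)) (x \<otimes> y) = \<zero>"
proof -
  have cl: "ad r \<in> carrier R" if "r \<in> carrier R" for r using that f by (simp add: ad_def)
  have add: "ad (r \<oplus> q) = ad r \<oplus> ad q" if "r \<in> carrier R" "q \<in> carrier R" for r q
    using that f unfolding ad_def minus_eq by (simp add: r_distr l_distr minus_add a_ac)
  have zero: "ad \<zero> = \<zero>" using f by (simp add: ad_def minus_eq)
  have deriv: "ad (r \<otimes> q) = ad r \<otimes> q \<oplus> r \<otimes> ad q" if "r \<in> carrier R" "q \<in> carrier R" for r q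
  proof -
    have "ad r \<otimes> q \<oplus> r \<otimes> ad q
       = (f \<otimes> r \<otimes> q \<oplus> \<ominus> (r \<otimes> f \<otimes> q)) \<oplus> (r \<otimes> f \<otimes> q \<oplus> \<ominus> (r \<otimes> q \<otimes> f))"
      using that f unfolding ad_def minus_eq by (simp add: r_distr l_distr l_minus r_minus m_assoc)
    also have "\<dots> = f \<otimes> r \<otimes> q \<oplus> (\<ominus> (r \<otimes> f \<otimes> q) \<oplus> (r \<otimes> f \<otimes> q \<oplus> \<ominus> (r \<otimes> q \<otimes> f)))"
      using that f by (simp add: a_assoc)
    also have "\<dots> = f \<otimes> r \<otimes> q \<oplus> \<ominus> (r \<otimes> q \<otimes> f)"
      using that f by (simp add: r_neg2 r_neg1)
    finally show ?thesis using that f unfolding ad_def minus_eq by (simp add: m_assoc)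
  qed
  have zpow: "(ad ^^ k) \<zero> = \<zero>" for k by (induction k) (auto simp: zero)
  have addpow: "(ad ^^ k) (r \<oplus> q) = (ad ^^ k) r \<oplus> (ad ^^ k) q \<and> (ad ^^ k) r \<in> carrier R \<and> (ad ^^ k) q \<in> carrier R"
    if "r \<in> carrier R" "q \<in> carrier R" for r q k
    using that by (induction k) (auto simp: add cl)
  show ?thesis using x y
  proof (induction "n + m" arbitrary: n m x y)
    case 0
    then show ?case by simp
  next
    case (Suc k)
    show ?case
    proof (cases "n = 0 \<or> m = 0")
      case True
      then have "x \<otimes> y = \<zero>" using Suc.prems by auto
      then show ?thesis by (simp add: zpow)
    next
      case False
      then obtain n' m' where nm: "n = Suc n'" "m = Suc m'" by (metis not0_implies_Suc)
      have "(ad ^^ k) (ad x \<otimes> y) = \<zero>"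
        using Suc.hyps(1)[of n' m "ad x" y] Suc.prems Suc.hyps(2) nm cl
        by (simp add: funpow_swap1)
      moreover have "(ad ^^ k) (x \<otimes> ad y) = \<zero>"
        using Suc.hyps(1)[of n m' x "ad y"] Suc.prems Suc.hyps(2) nm cl
        by (simp add: funpow_swap1)
      ultimately have "(ad ^^ k) (ad (x \<otimes> y)) = \<zero>"
        using Suc.prems addpow[of "ad x \<otimes> y" "x \<otimes> ad y" k] by (simp add: deriv cl)
      then show ?thesis by (simp add: Suc.hyps(2)[symmetric] funpow_swap1)
    qed
  qed
qed

context lie_closed
begin

lemma ad_nilpotent_uea:
  assumes f: "f \<in> lie_carrier L" and z: "0 \<in> lie_carrier L"
    and nil: "\<And>x. x \<in> lie_carrier L \<Longrightarrow> \<exists>n. (lie_bracket L f ^^ n) x = 0"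
  shows "ad_nilpotent U (uea_gen L f)"
proof -
  interpret U: ring U by (rule ring_U)
  define F where "F = uea_gen L f"
  define ad where "ad = (\<lambda>r. F \<otimes>\<^bsub>U\<^esub> r \<ominus>\<^bsub>U\<^esub> r \<otimes>\<^bsub>U\<^esub> F)"
  have F: "F \<in> carrier U" unfolding F_def by (rule gen_closed[OF f])
  have cl: "ad r \<in> carrier U" if "r \<in> carrier U" for r using that F by (simp add: ad_def)
  have ad_add: "ad (r \<oplus>\<^bsub>U\<^esub> q) = ad r \<oplus>\<^bsub>U\<^esub> ad q" if "r \<in> carrier U" "q \<in> carrier U" for r q
    using that F unfolding ad_def U.minus_eq by (simp add: U.r_distr U.l_distr U.minus_add U.a_ac)
  have addpow: "(ad ^^ k) (r \<oplus>\<^bsub>U\<^esub> q) = (ad ^^ k) r \<oplus>\<^bsub>U\<^esub> (ad ^^ k) q \<and> (ad ^^ k) r \<in> carrier U \<and> (ad ^^ k) q \<in> carrier U"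
    if "r \<in> carrier U" "q \<in> carrier U" for r q k
    using that by (induction k) (auto simp: ad_add cl)
  have zero: "ad \<zero>\<^bsub>U\<^esub> = \<zero>\<^bsub>U\<^esub>" using F by (simp add: ad_def U.minus_eq)
  have up: "(ad ^^ i) r = \<zero>\<^bsub>U\<^esub>" if "n \<le> i" "(ad ^^ n) r = \<zero>\<^bsub>U\<^esub>" for n i r
    using that by (induction i rule: dec_induct) (auto simp: zero)
  have "\<exists>n. (ad ^^ n) X = \<zero>\<^bsub>U\<^esub>" if "X \<in> carrier U" for X
    using that
  proof (induction rule: uea_induct)
    case (scalar c)
    have "ad (uea_scalar L c) = \<zero>\<^bsub>U\<^esub>"
      unfolding ad_def using scalar_central[OF F, of c] F scalar_closed[of c]
      by (simp add: U.minus_eq U.r_neg)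
    then have "(ad ^^ 1) (uea_scalar L c) = \<zero>\<^bsub>U\<^esub>" by simp
    then show ?case by blast
  next
    case (gen x)
    have pow: "(ad ^^ n) (uea_gen L x) = uea_gen L ((lie_bracket L f ^^ n) x)
        \<and> (lie_bracket L f ^^ n) x \<in> lie_carrier L" for n
      using gen f by (induction n) (auto simp: ad_def[abs_def] F_def gen_bracket bracket_closed)
    obtain n where "(lie_bracket L f ^^ n) x = 0" using nil[OF gen] by blast
    then have "(ad ^^ n) (uea_gen L x) = \<zero>\<^bsub>U\<^esub>" using pow[of n] gen_zero[OF z] by simp
    then show ?case by blast
  next
    case (mult X Y)
    then show ?case
      using U.ad_nilpotent_mult[OF F, folded ad_def] by blast
  next
    case (add X Y)
    then obtain n m where "(ad ^^ n) X = \<zero>\<^bsub>U\<^esub>" "(ad ^^ m) Y = \<zero>\<^bsub>U\<^esub>" by blast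
    then have "(ad ^^ (max n m)) X = \<zero>\<^bsub>U\<^esub>" "(ad ^^ (max n m)) Y = \<zero>\<^bsub>U\<^esub>"
      using up by (metis max.cobounded1, metis max.cobounded2)
    then have "(ad ^^ (max n m)) (X \<oplus>\<^bsub>U\<^esub> Y) = \<zero>\<^bsub>U\<^esub>"
      using addpow[OF add(1,2)] by simp
    then show ?case by blast
  qed
  then show ?thesis
    by (intro ad_nilpotent.intro ad_nilpotent_axioms.intro ring_U)
      (auto simp: F[unfolded F_def] ad_def F_def)
qed

end

text \<open>A representation of the Lie algebra extends to the enveloping algebra.\<close>

definition uea_act :: "('k::field, 'l, 'm::ab_group_add) rep \<Rightarrow> ('l list \<Rightarrow> 'k) set \<Rightarrow> 'm \<Rightarrow> 'm" where
  "uea_act M X v = free_act M (SOME p. p \<in> X) v"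

lemma uea_module_simps:
  "carrier (uea_module M) = rep_carrier M"
  "v \<oplus>\<^bsub>uea_module M\<^esub> w = v + w"
  "X \<odot>\<^bsub>uea_module M\<^esub> v = uea_act M X v"
  by (simp_all add: uea_module_def uea_act_def)

locale lie_rep = lie_closed L + lin_space "rep_scale M"
  for L :: "('k::field, 'l::ab_group_add) lie_alg" and M :: "('k, 'l, 'm::ab_group_add) rep" +
  assumes mod: "lie_module L M"
begin

abbreviation "C \<equiv> rep_carrier M"

lemma subspace_C: "subspace C" using mod by (simp add: lie_module_def)

lemma act_lin: "x \<in> lie_carrier L \<Longrightarrow> lin_on (rep_scale M) C (rep_act M x)"
  using mod by (auto simp: lie_module_def lin_on_def)

lemma act_add: "x \<in> lie_carrier L \<Longrightarrow> y \<in> lie_carrier L \<Longrightarrow> v \<in> C \<Longrightarrow>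
    rep_act M (x + y) v = rep_act M x v + rep_act M y v"
  and act_scale: "x \<in> lie_carrier L \<Longrightarrow> v \<in> C \<Longrightarrow> rep_act M (lie_scale L c x) v = rep_scale M c (rep_act M x v)"
  and act_bracket: "x \<in> lie_carrier L \<Longrightarrow> y \<in> lie_carrier L \<Longrightarrow> v \<in> C \<Longrightarrow>
    rep_act M (lie_bracket L x y) v = rep_act M x (rep_act M y v) - rep_act M y (rep_act M x v)"
  using mod by (auto simp: lie_module_def)

lemma word_act_lin: "set w \<subseteq> lie_carrier L \<Longrightarrow> lin_on (rep_scale M) C (foldr (rep_act M) w)"
proof (induction w)
  case Nil
  then show ?case by (simp add: lin_on_def)
next
  case (Cons x w)
  then show ?case using lin_on_compose[OF act_lin[of x], of "foldr (rep_act M) w"]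
    by (simp add: o_def)
qed

lemma free_act_superset:
  assumes "finite T" "{w. p w \<noteq> 0} \<subseteq> T"
  shows "free_act M p v = (\<Sum>w\<in>T. rep_scale M (p w) (foldr (rep_act M) w v))"
  unfolding free_act_def using assms by (intro sum.mono_neutral_left) auto

lemma free_act_add:
  assumes "p \<in> carrier W" "q \<in> carrier W"
  shows "free_act M (p \<oplus>\<^bsub>W\<^esub> q) v = free_act M p v + free_act M q v"
proof -
  let ?T = "{w. p w \<noteq> 0} \<union> {w. q w \<noteq> 0}"
  have fin: "finite ?T" using assms by (simp add: free_algebra_simps)
  have 1: "free_act M p v = (\<Sum>w\<in>?T. rep_scale M (p w) (foldr (rep_act M) w v))"
    "free_act M q v = (\<Sum>w\<in>?T. rep_scale M (q w) (foldr (rep_act M) w v))"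
    using fin by (intro free_act_superset; auto)+
  have "free_act M (p \<oplus>\<^bsub>W\<^esub> q) v
     = (\<Sum>w\<in>?T. rep_scale M ((p \<oplus>\<^bsub>W\<^esub> q) w) (foldr (rep_act M) w v))"
    using fin by (intro free_act_superset) (auto simp: free_algebra_simps)
  then show ?thesis unfolding 1 by (simp add: free_algebra_simps scale_left_distrib sum.distrib)
qed

lemma free_act_word: "free_act M (word c w) v = rep_scale M c (foldr (rep_act M) w v)"
  by (subst free_act_superset[of "{w}"]) (auto simp: word_def)

lemma free_act_zero: "free_act M (\<lambda>_. 0) v = 0"
  by (simp add: free_act_def)

lemma free_act_lin:
  assumes "p \<in> carrier W"
  shows "lin_on (rep_scale M) C (free_act M p)"
  using assms
proof (induction rule: free_algebra_induct)
  case zero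
  then show ?case using subspace_C by (simp add: lin_on_def free_act_zero subspace_0)
next
  case (step c w q)
  have "lin_on (rep_scale M) C (\<lambda>v. rep_scale M c (foldr (rep_act M) w v) + rep_scale M 1 (free_act M q v))"
    by (intro lin_on_combination word_act_lin step subspace_C)
  moreover have "free_act M (word c w \<oplus>\<^bsub>W\<^esub> q)
      = (\<lambda>v. rep_scale M c (foldr (rep_act M) w v) + rep_scale M 1 (free_act M q v))"
    using step by (intro ext) (simp add: free_act_add word_closed free_act_word)
  ultimately show ?case by (simp only:)
qed

lemma free_act_mult:
  assumes "p \<in> carrier W" "q \<in> carrier W" "v \<in> C"
  shows "free_act M (p \<otimes>\<^bsub>W\<^esub> q) v = free_act M p (free_act M q v)"
proof -
  interpret W: ring W by (rule ring_free_algebra)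
  have word: "free_act M (word c w \<otimes>\<^bsub>W\<^esub> q) v = free_act M (word c w) (free_act M q v)"
    if w: "set w \<subseteq> lie_carrier L" for c w
    using assms(2)
  proof (induction rule: free_algebra_induct)
    case zero
    have "word c w \<otimes>\<^bsub>W\<^esub> (\<lambda>_. 0) = (\<lambda>_. 0)" by (simp add: free_algebra_simps)
    then show ?case
      by (simp add: free_act_zero lin_on_zero[OF free_act_lin[OF word_closed[OF w]] subspace_C])
  next
    case (step d u q)
    note lin = free_act_lin[OF word_closed[OF w], of c]
    have cl: "free_act M (word d u) v \<in> C" "free_act M q v \<in> C"
      using step assms(3) by (auto intro!: lin_on_closed[OF free_act_lin] word_closed)
    have uv: "foldr (rep_act M) u v \<in> C" by (rule lin_on_closed[OF word_act_lin[OF step(1)] assms(3)])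
    have "word c w \<otimes>\<^bsub>W\<^esub> (word d u \<oplus>\<^bsub>W\<^esub> q) = word (c * d) (w @ u) \<oplus>\<^bsub>W\<^esub> word c w \<otimes>\<^bsub>W\<^esub> q"
      using w step by (simp add: W.r_distr word_closed word_mult)
    then have "free_act M (word c w \<otimes>\<^bsub>W\<^esub> (word d u \<oplus>\<^bsub>W\<^esub> q)) v
       = free_act M (word (c * d) (w @ u)) v + free_act M (word c w) (free_act M q v)"
      using w step by (simp add: free_act_add word_closed)
    also have "free_act M (word (c * d) (w @ u)) v = free_act M (word c w) (free_act M (word d u) v)"
      using uv by (simp add: free_act_word lin_on_scale[OF word_act_lin[OF w]])
    finally show ?case using step cl by (simp add: free_act_add word_closed lin_on_add[OF lin])
  qed
  show ?thesis using assms(1)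
  proof (induction rule: free_algebra_induct)
    case zero
    have "(\<lambda>_. 0) \<otimes>\<^bsub>W\<^esub> q = (\<lambda>_. 0)" by (simp add: free_algebra_simps)
    then show ?case by (simp add: free_act_zero)
  next
    case (step c w p)
    then show ?case using assms(2)
      by (simp add: W.l_distr word_closed free_act_add word)
  qed
qed

lemma diff_closed: "p \<in> carrier W \<Longrightarrow> q \<in> carrier W \<Longrightarrow> p - q \<in> carrier W"
proof -
  interpret W: ring W by (rule ring_free_algebra)
  assume "p \<in> carrier W" "q \<in> carrier W"
  then show ?thesis by (simp add: diff_eq_minus)
qed

lemma free_act_diff:
  assumes "p \<in> carrier W" "q \<in> carrier W"
  shows "free_act M (p - q) v = free_act M p v - free_act M q v"
proof -
  interpret W: ring W by (rule ring_free_algebra)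
  have "p - q \<in> carrier W" using assms by (simp add: diff_eq_minus)
  moreover have "(p - q) \<oplus>\<^bsub>W\<^esub> q = p" by (simp add: free_algebra_simps)
  ultimately show ?thesis using free_act_add[of "p - q" q v] assms by simp
qed

text \<open>The annihilator of a module is an ideal, and it contains the defining relations because the module is a
  representation.\<close>

lemma free_act_ideal:
  assumes "p \<in> I" "v \<in> C"
  shows "free_act M p v = 0"
proof -
  interpret W: ring W by (rule ring_free_algebra)
  define J where "J = {p \<in> carrier W. \<forall>v\<in>C. free_act M p v = 0}"
  have "ideal J W"
  proof (rule idealI[OF ring_free_algebra])
    show "subgroup J (add_monoid W)"
    proof (rule group.subgroupI[OF W.a_group])
      show "J \<noteq> {}" using W.zero_closed free_act_zero by (auto simp: J_def free_algebra_simps(4))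
    next
      fix p assume p: "p \<in> J"
      then have pc: "p \<in> carrier W" by (simp add: J_def)
      have "\<ominus>\<^bsub>W\<^esub> p = \<zero>\<^bsub>W\<^esub> - p" using diff_eq_minus[OF W.zero_closed pc] pc by (simp add: W.minus_eq)
      then have "free_act M (\<ominus>\<^bsub>W\<^esub> p) v = 0" if "v \<in> C" for v
        using p that free_act_diff[OF W.zero_closed pc]
        by (simp add: J_def free_act_zero free_algebra_simps(4))
      then have "\<ominus>\<^bsub>W\<^esub> p \<in> J" using W.a_inv_closed[OF pc] by (simp add: J_def)
      then show "inv\<^bsub>add_monoid W\<^esub> p \<in> J" by (simp add: a_inv_def)
    next
      fix p q assume "p \<in> J" "q \<in> J"
      then show "p \<otimes>\<^bsub>add_monoid W\<^esub> q \<in> J" by (auto simp: J_def free_act_add)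
    qed (auto simp: J_def)
  next
    fix a x assume "a \<in> J" "x \<in> carrier W"
    then show "x \<otimes>\<^bsub>W\<^esub> a \<in> J" "a \<otimes>\<^bsub>W\<^esub> x \<in> J"
      using lin_on_zero[OF free_act_lin subspace_C] lin_on_closed[OF free_act_lin]
      by (auto simp: J_def free_act_mult)
  qed
  moreover have "uea_relations L \<subseteq> J"
  proof
    fix p assume p: "p \<in> uea_relations L"
    have pW: "p \<in> carrier W" using p relations_closed by blast
    have "free_act M p v = 0" if v: "v \<in> C" for v
      using p unfolding uea_relations_def
    proof (elim UnE CollectE exE conjE)
      fix x y assume "p = word 1 [x + y] - word 1 [x] - word 1 [y]" "x \<in> lie_carrier L" "y \<in> lie_carrier L"
      then show ?thesis using v
        by (simp add: free_act_diff diff_closed word_closed add_closed free_act_word act_add)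
    next
      fix c x assume "p = word 1 [lie_scale L c x] - word c [x]" "x \<in> lie_carrier L"
      then show ?thesis using v
        by (simp add: free_act_diff word_closed scale_closed free_act_word act_scale)
    next
      fix x y assume "p = word 1 [x, y] - word 1 [y, x] - word 1 [lie_bracket L x y]"
        "x \<in> lie_carrier L" "y \<in> lie_carrier L"
      then show ?thesis using v
        by (simp add: free_act_diff diff_closed word_closed bracket_closed free_act_word act_bracket)
    qed
    then show "p \<in> J" using pW by (simp add: J_def)
  qed
  ultimately have "I \<subseteq> J" unfolding uea_ideal_def by (rule W.genideal_minimal)
  then show ?thesis using assms by (auto simp: J_def)
qed

text \<open>The choice of representatives in the action of classes is immaterial.\<close>

lemma uea_act_class:
  assumes p: "p \<in> carrier W" and v: "v \<in> C"
  shows "uea_act M (uea_class L p) v = free_act M p v"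
proof -
  interpret I: ideal I W by (rule ideal_I)
  define q where "q = (SOME q. q \<in> uea_class L p)"
  have "p \<in> uea_class L p" unfolding uea_class_def by (rule I.a_rcos_self[OF p])
  then have "q \<in> uea_class L p" unfolding q_def by (rule someI[of "\<lambda>q. q \<in> uea_class L p"])
  then obtain i where i: "i \<in> I" "q = i \<oplus>\<^bsub>W\<^esub> p"
    unfolding uea_class_def by (auto simp: a_r_coset_def')
  have "i \<in> carrier W" using i I.a_subset by blast
  then have "free_act M q v = free_act M p v"
    unfolding i(2) using free_act_ideal[OF i(1) v] by (simp add: free_act_add p)
  then show ?thesis unfolding uea_act_def q_def .
qed

lemma uea_act_lin:
  assumes "X \<in> carrier U"
  shows "lin_on (rep_scale M) C (uea_act M X)"
proof -
  obtain p where p: "p \<in> carrier W" "X = uea_class L p" using assms by (rule class_surj)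
  then show ?thesis using free_act_lin[OF p(1)] subspace_C
    unfolding lin_on_def by (auto simp: uea_act_class subspace_add subspace_scale)
qed

lemma uea_act_mult:
  assumes "X \<in> carrier U" "Y \<in> carrier U" "v \<in> C"
  shows "uea_act M (X \<otimes>\<^bsub>U\<^esub> Y) v = uea_act M X (uea_act M Y v)"
proof -
  interpret W: ring W by (rule ring_free_algebra)
  obtain p where p: "p \<in> carrier W" "X = uea_class L p" using assms(1) by (rule class_surj)
  obtain q where q: "q \<in> carrier W" "Y = uea_class L q" using assms(2) by (rule class_surj)
  show ?thesis unfolding p(2) q(2) class_mult[OF p(1) q(1), symmetric]
    using p q assms(3) lin_on_closed[OF free_act_lin]
    by (simp add: uea_act_class free_act_mult)
qed

lemma uea_act_add:
  assumes "X \<in> carrier U" "Y \<in> carrier U" "v \<in> C"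
  shows "uea_act M (X \<oplus>\<^bsub>U\<^esub> Y) v = uea_act M X v + uea_act M Y v"
proof -
  interpret W: ring W by (rule ring_free_algebra)
  obtain p where p: "p \<in> carrier W" "X = uea_class L p" using assms(1) by (rule class_surj)
  obtain q where q: "q \<in> carrier W" "Y = uea_class L q" using assms(2) by (rule class_surj)
  show ?thesis unfolding p(2) q(2) class_add[OF p(1) q(1), symmetric]
    using p q assms(3) by (simp add: uea_act_class free_act_add)
qed

lemma uea_act_scalar: "v \<in> C \<Longrightarrow> uea_act M (uea_scalar L c) v = rep_scale M c v"
  by (simp add: uea_scalar_def uea_act_class word_closed free_act_word)

lemma uea_act_gen: "x \<in> lie_carrier L \<Longrightarrow> v \<in> C \<Longrightarrow> uea_act M (uea_gen L x) v = rep_act M x v"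
  by (simp add: uea_gen_def uea_act_class word_closed free_act_word)

lemma uea_act_one: "v \<in> C \<Longrightarrow> uea_act M \<one>\<^bsub>U\<^esub> v = v"
  using uea_act_scalar[of v 1] by (simp add: uea_scalar_def class_one)

end

section \<open>Weight modules\<close>

text \<open>What is used of an \<open>sl\<^sub>2\<close>-triple in root spaces; \<open>[h, e]\<close> and \<open>[h, f]\<close> follow from \<open>\<beta> h = 2\<close>.\<close>

definition root_triple ::
    "('k::field, 'l::ab_group_add) lie_alg \<Rightarrow> 'l set \<Rightarrow> ('l \<Rightarrow> 'k) \<Rightarrow> 'l \<Rightarrow> 'l \<Rightarrow> 'l \<Rightarrow> bool" where
  "root_triple L H \<beta> e h f \<longleftrightarrow>
     \<beta> \<in> dual_space L H \<and> e \<in> root_space L H \<beta> \<and> f \<in> root_space L H (- \<beta>) \<and> h \<in> H \<and>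
     lie_bracket L e f = h \<and> \<beta> h = 2"

lemma dual_space_shift:
  "\<mu> \<in> dual_space L H \<Longrightarrow> \<alpha> \<in> dual_space L H \<Longrightarrow> (\<lambda>z. \<mu> z + c * \<alpha> z) \<in> dual_space L H"
  by (auto simp: dual_space_def algebra_simps)

context lie_rep
begin

lemma act_zero:
  assumes "0 \<in> lie_carrier L" "v \<in> C"
  shows "rep_act M 0 v = 0"
  using act_add[OF assms(1) assms(1) assms(2)] by simp

lemma act_closed: "x \<in> lie_carrier L \<Longrightarrow> v \<in> C \<Longrightarrow> rep_act M x v \<in> C"
  using act_lin by (rule lin_on_closed)

lemma act_pow_closed: "x \<in> lie_carrier L \<Longrightarrow> v \<in> C \<Longrightarrow> (rep_act M x ^^ n) v \<in> C"
  using act_lin by (rule lin_on_funpow_closed)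

definition submodule :: "'m set \<Rightarrow> bool" where
  "submodule D \<longleftrightarrow> subspace D \<and> D \<subseteq> C \<and> (\<forall>y\<in>lie_carrier L. \<forall>v\<in>D. rep_act M y v \<in> D)"

lemma submodule_pow:
  assumes "submodule D" "g \<in> lie_carrier L" "(rep_act M g ^^ n) v \<in> D" "n \<le> m"
  shows "(rep_act M g ^^ m) v \<in> D"
  using assms(4)
proof (induction m rule: dec_induct)
  case base
  then show ?case by (rule assms(3))
next
  case (step m)
  then show ?case using assms(1,2) by (simp add: submodule_def)
qed

text \<open>Moving a power of an ad-nilpotent \<open>g\<close> past \<open>y\<close> only produces brackets \<open>ad(g)\<^sup>i(y)\<close>, which
  vanish for large \<open>i\<close>; so the vectors that some power of \<open>g\<close> sends to a submodule form a
  submodule.\<close>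

lemma absorbing_submodule:
  assumes D: "submodule D" and g: "g \<in> lie_carrier L" and z: "0 \<in> lie_carrier L"
    and nil: "\<And>y. y \<in> lie_carrier L \<Longrightarrow> \<exists>n. (lie_bracket L g ^^ n) y = 0"
  shows "submodule {v \<in> C. \<exists>n. (rep_act M g ^^ n) v \<in> D}" (is "submodule ?T")
proof -
  have D': "subspace D" "D \<subseteq> C" "\<And>y v. y \<in> lie_carrier L \<Longrightarrow> v \<in> D \<Longrightarrow> rep_act M y v \<in> D"
    using D by (auto simp: submodule_def)
  note lin = lin_on_funpow[OF act_lin[OF g]]
  note up = submodule_pow[OF D g]
  have move: "\<exists>k. (rep_act M g ^^ k) (rep_act M y v) \<in> D"
    if "(lie_bracket L g ^^ N) y = 0" "y \<in> lie_carrier L" "v \<in> C" "(rep_act M g ^^ m) v \<in> D" for N y m v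
    using that
  proof (induction N arbitrary: y m v)
    case 0
    then show ?case using act_zero[OF z] subspace_0[OF D'(1)] by (intro exI[of _ 0]) auto
  next
    case (Suc N)
    note outer = Suc.IH
    have y: "y \<in> lie_carrier L" by fact
    have br: "(lie_bracket L g ^^ N) (lie_bracket L g y) = 0" "lie_bracket L g y \<in> lie_carrier L"
      using Suc.prems bracket_closed[OF g] by (simp_all add: funpow_swap1)
    show ?case using Suc.prems(3,4)
    proof (induction m arbitrary: v)
      case 0
      then show ?case using D'(3)[OF y] by (intro exI[of _ 0]) auto
    next
      case (Suc m)
      have gv: "rep_act M g v \<in> C" using g Suc.prems by (simp add: act_closed)
      obtain k1 where k1: "(rep_act M g ^^ k1) (rep_act M y (rep_act M g v)) \<in> D"
        using Suc.IH[OF gv] Suc.prems(2) by (auto simp: funpow_swap1)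
      obtain k2 where k2: "(rep_act M g ^^ k2) (rep_act M (lie_bracket L g y) v) \<in> D"
        using outer[OF br Suc.prems] by blast
      define k where "k = max k1 k2"
      have "rep_act M g (rep_act M y v) = rep_act M y (rep_act M g v) + rep_act M (lie_bracket L g y) v"
        using act_bracket[OF g y Suc.prems(1)] by simp
      then have "(rep_act M g ^^ Suc k) (rep_act M y v)
         = (rep_act M g ^^ k) (rep_act M y (rep_act M g v)) + (rep_act M g ^^ k) (rep_act M (lie_bracket L g y) v)"
        using lin_on_add[OF lin] act_closed[OF y gv] act_closed[OF br(2) Suc.prems(1)]
        by (simp add: funpow_swap1)
      moreover have "\<dots> \<in> D"
        by (intro subspace_add[OF D'(1)] up[OF k1] up[OF k2]) (auto simp: k_def)
      ultimately show ?case by (intro exI[of _ "Suc k"]) simp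
    qed
  qed
  have "subspace ?T"
    unfolding subspace_def
  proof (intro conjI ballI allI)
    show "0 \<in> ?T" using subspace_0[OF subspace_C] subspace_0[OF D'(1)] by (auto intro!: exI[of _ 0])
  next
    fix v w assume "v \<in> ?T" "w \<in> ?T"
    then obtain n m where v: "v \<in> C" "(rep_act M g ^^ n) v \<in> D" and w: "w \<in> C" "(rep_act M g ^^ m) w \<in> D"
      by auto
    have "(rep_act M g ^^ max n m) (v + w) \<in> D"
      unfolding lin_on_add[OF lin v(1) w(1)]
      by (intro subspace_add[OF D'(1)] up[OF v(2)] up[OF w(2)]) auto
    then show "v + w \<in> ?T" using subspace_add[OF subspace_C v(1) w(1)] by auto
  next
    fix c v assume "v \<in> ?T"
    then obtain n where v: "v \<in> C" "(rep_act M g ^^ n) v \<in> D" by auto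
    have "(rep_act M g ^^ n) (rep_scale M c v) \<in> D"
      unfolding lin_on_scale[OF lin v(1)] by (rule subspace_scale[OF D'(1) v(2)])
    then show "rep_scale M c v \<in> ?T" using subspace_scale[OF subspace_C v(1)] by blast
  qed
  moreover have "rep_act M y v \<in> ?T" if "y \<in> lie_carrier L" "v \<in> ?T" for y v
    using move that nil act_closed by blast
  ultimately show ?thesis unfolding submodule_def by blast
qed

lemma lie_module_restrict:
  assumes "submodule D"
  shows "lie_module L (M\<lparr>rep_carrier := D\<rparr>)"
  using assms mod unfolding submodule_def lie_module_def by (auto simp: subset_iff)

end

locale weight_rep = lie_rep L M
  for L :: "('k::field_char_0, 'l::ab_group_add) lie_alg" and M :: "('k, 'l, 'm::ab_group_add) rep" +
  fixes H :: "'l set"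
  assumes H: "H \<subseteq> lie_carrier L" and Wfin: "M \<in> W_fin L H"
begin

abbreviation "wt \<equiv> weight_space H M"

lemma wt_C: "v \<in> wt \<mu> \<Longrightarrow> v \<in> C"
  by (simp add: weight_space_def)

lemma wt_act: "v \<in> wt \<mu> \<Longrightarrow> z \<in> H \<Longrightarrow> rep_act M z v = rep_scale M (\<mu> z) v"
  by (simp add: weight_space_def)

lemma wt_subspace: "subspace (wt \<mu>)"
  using subspace_C H act_lin lin_on_zero[OF act_lin subspace_C]
  unfolding subspace_def weight_space_def
  by (auto simp: lin_on_def subset_iff scale_right_distrib mult.commute)

lemma wt_fin: "\<mu> \<in> dual_space L H \<Longrightarrow> fin_dim (rep_scale M) (wt \<mu>)"
  using Wfin by (simp add: W_fin_def)

lemma wt_root: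
  assumes "x \<in> root_space L H \<beta>" "v \<in> wt \<mu>"
  shows "rep_act M x v \<in> wt (\<lambda>z. \<mu> z + \<beta> z)"
proof -
  have x: "x \<in> lie_carrier L" using assms by (simp add: root_space_def)
  have v: "v \<in> C" using assms by (simp add: wt_C)
  have "rep_act M z (rep_act M x v) = rep_scale M (\<mu> z + \<beta> z) (rep_act M x v)" if z: "z \<in> H" for z
  proof -
    have "rep_act M (lie_bracket L z x) v = rep_scale M (\<beta> z) (rep_act M x v)"
      using assms(1) z x v by (simp add: root_space_def act_scale)
    moreover have "rep_act M x (rep_act M z v) = rep_scale M (\<mu> z) (rep_act M x v)"
      using z x v assms(2) by (simp add: wt_act lin_on_scale[OF act_lin])
    moreover have "rep_act M (lie_bracket L z x) v = rep_act M z (rep_act M x v) - rep_act M x (rep_act M z v)"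
      using z x v H by (intro act_bracket) auto
    ultimately show ?thesis by (simp add: scale_left_distrib algebra_simps)
  qed
  then show ?thesis using act_closed[OF x v] by (simp add: weight_space_def)
qed

lemma wt_root_pow:
  assumes "x \<in> root_space L H \<beta>" "v \<in> wt \<mu>"
  shows "(rep_act M x ^^ n) v \<in> wt (\<lambda>z. \<mu> z + of_nat n * \<beta> z)"
proof (induction n)
  case 0
  then show ?case using assms by simp
next
  case (Suc n)
  then show ?case using wt_root[OF assms(1) Suc] by (simp add: algebra_simps)
qed

lemma weight_decomposition:
  assumes "v \<in> C"
  obtains E g where "finite E" "E \<subseteq> dual_space L H" "\<And>\<mu>. \<mu> \<in> E \<Longrightarrow> g \<mu> \<in> wt \<mu>" "v = sum g E"
proof -
  have "v \<in> span (\<Union>\<mu>\<in>dual_space L H. wt \<mu>)" using Wfin assms by (auto simp: W_fin_def)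
  from span_Union_decomposition[OF wt_subspace this] show ?thesis using that by metis
qed

text \<open>Distinct weights are separated by the Cartan subalgebra, since functionals vanish outside it.\<close>

lemma weight_components:
  assumes D: "submodule D" and E: "finite E" "E \<subseteq> dual_space L H"
    and g: "\<And>\<mu>. \<mu> \<in> E \<Longrightarrow> g \<mu> \<in> wt \<mu>" and s: "sum g E \<in> D"
  shows "\<forall>\<mu>\<in>E. g \<mu> \<in> D"
proof (rule eigen_components[where u = "rep_act M" and \<chi> = "\<lambda>\<mu>. \<mu>" and I = H and C = C])
  show "subspace D" "D \<subseteq> C" using D by (auto simp: submodule_def)
  show "subspace C" by (rule subspace_C)
  show "lin_on (rep_scale M) C (rep_act M i)" if "i \<in> H" for i using that H act_lin by blast
  show "rep_act M i w \<in> D" if "i \<in> H" "w \<in> D" for i w using that H D by (auto simp: submodule_def)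
  show "g \<mu> \<in> C" if "\<mu> \<in> E" for \<mu> using g[OF that] by (rule wt_C)
  show "rep_act M i (g \<mu>) = rep_scale M (\<mu> i) (g \<mu>)" if "\<mu> \<in> E" "i \<in> H" for \<mu> i
    using g[OF that(1)] that(2) by (rule wt_act)
  show "\<exists>i\<in>H. \<mu> i \<noteq> \<nu> i" if "\<mu> \<in> E" "\<nu> \<in> E" "\<mu> \<noteq> \<nu>" for \<mu> \<nu>
  proof (rule ccontr)
    assume "\<not> (\<exists>i\<in>H. \<mu> i \<noteq> \<nu> i)"
    moreover have "\<mu> z = 0" "\<nu> z = 0" if "z \<notin> H" for z
      using that \<open>\<mu> \<in> E\<close> \<open>\<nu> \<in> E\<close> E(2) by (auto simp: dual_space_def)
    ultimately have "\<mu> = \<nu>" by (intro ext) metis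
    then show False using that(3) by simp
  qed
qed (use E s in auto)

text \<open>A submodule of a weight module contains the weight components of its vectors.\<close>

lemma W_fin_restrict:
  assumes D: "submodule D"
  shows "M\<lparr>rep_carrier := D\<rparr> \<in> W_fin L H"
proof -
  have ws: "weight_space H (M\<lparr>rep_carrier := D\<rparr>) \<mu> = D \<inter> wt \<mu>" for \<mu>
    using D by (auto simp: weight_space_def submodule_def)
  have "D \<subseteq> span (\<Union>\<mu>\<in>dual_space L H. D \<inter> wt \<mu>)"
  proof
    fix v assume v: "v \<in> D"
    then have "v \<in> C" using D by (auto simp: submodule_def)
    then obtain E g where Eg: "finite E" "E \<subseteq> dual_space L H" "\<And>\<mu>. \<mu> \<in> E \<Longrightarrow> g \<mu> \<in> wt \<mu>" "v = sum g E"
      using weight_decomposition by metis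
    have "\<forall>\<mu>\<in>E. g \<mu> \<in> D" using weight_components[OF D Eg(1-3)] v Eg(4) by blast
    then have "g \<mu> \<in> span (\<Union>\<mu>\<in>dual_space L H. D \<inter> wt \<mu>)" if "\<mu> \<in> E" for \<mu>
      using Eg that by (intro span_base) blast
    then show "v \<in> span (\<Union>\<mu>\<in>dual_space L H. D \<inter> wt \<mu>)" unfolding Eg(4) by (rule span_sum)
  qed
  moreover have "fin_dim (rep_scale M) (D \<inter> wt \<mu>)" if "\<mu> \<in> dual_space L H" for \<mu>
    using wt_fin[OF that] by (auto simp: fin_dim_def)
  ultimately show ?thesis
    unfolding W_fin_def using lie_module_restrict[OF D] by (auto simp: ws)
qed

text \<open>The standard formula \<open>e f\<^sup>n\<^sup>+\<^sup>1 = f\<^sup>n\<^sup>+\<^sup>1 e + (n + 1) f\<^sup>n (h - n)\<close>.\<close>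

lemma triple_commute:
  assumes t: "root_triple L H \<beta> e h f" and v: "v \<in> wt \<mu>"
  shows "rep_act M e ((rep_act M f ^^ Suc n) v)
    = (rep_act M f ^^ Suc n) (rep_act M e v)
      + rep_scale M ((of_nat n + 1) * (\<mu> h - of_nat n)) ((rep_act M f ^^ n) v)"
proof -
  have ef: "e \<in> lie_carrier L" "f \<in> lie_carrier L" "h \<in> H" "f \<in> root_space L H (- \<beta>)" "\<beta> h = 2"
    "lie_bracket L e f = h"
    using t by (auto simp: root_triple_def root_space_def)
  have vC: "v \<in> C" using v by (rule wt_C)
  have step: "rep_act M e (rep_act M f w) = rep_act M f (rep_act M e w) + rep_scale M (\<nu> h) w"
    if w: "w \<in> wt \<nu>" for w \<nu>
    using act_bracket[OF ef(1,2) wt_C[OF w]] wt_act[OF w ef(3)] ef(6) by (simp add: algebra_simps)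
  note linf = act_lin[OF ef(2)]
  show ?thesis
  proof (induction n)
    case 0
    then show ?case using step[OF v] by simp
  next
    case (Suc n)
    let ?F = "rep_act M f" and ?c = "\<mu> h"
    have wn: "(?F ^^ Suc n) v \<in> wt (\<lambda>z. \<mu> z + of_nat (Suc n) * (- \<beta>) z)"
      by (rule wt_root_pow[OF ef(4) v])
    have cl: "(?F ^^ Suc n) (rep_act M e v) \<in> C" "(?F ^^ n) v \<in> C"
      using act_pow_closed ef act_closed vC by blast+
    have "rep_act M e ((?F ^^ Suc (Suc n)) v) = ?F (rep_act M e ((?F ^^ Suc n) v))
       + rep_scale M (?c - 2 * of_nat (Suc n)) ((?F ^^ Suc n) v)"
      using step[OF wn] ef(5) by (simp add: mult.commute)
    also have "?F (rep_act M e ((?F ^^ Suc n) v)) = ?F ((?F ^^ Suc n) (rep_act M e v))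
       + rep_scale M ((of_nat n + 1) * (?c - of_nat n)) (?F ((?F ^^ n) v))"
      unfolding Suc.IH using cl subspace_scale[OF subspace_C]
      by (simp add: lin_on_add[OF linf] lin_on_scale[OF linf])
    finally have "rep_act M e ((?F ^^ Suc (Suc n)) v) = (?F ^^ Suc (Suc n)) (rep_act M e v)
       + (rep_scale M ((of_nat n + 1) * (?c - of_nat n)) ((?F ^^ Suc n) v)
         + rep_scale M (?c - 2 * of_nat (Suc n)) ((?F ^^ Suc n) v))"
      by (simp add: add.assoc)
    also have "rep_scale M ((of_nat n + 1) * (?c - of_nat n)) ((?F ^^ Suc n) v)
         + rep_scale M (?c - 2 * of_nat (Suc n)) ((?F ^^ Suc n) v)
       = rep_scale M ((of_nat (Suc n) + 1) * (?c - of_nat (Suc n))) ((?F ^^ Suc n) v)"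
      unfolding scale_left_distrib[symmetric] by (simp add: algebra_simps)
    finally show ?case .
  qed
qed

lemma fe_lin:
  assumes t: "root_triple L H \<beta> e h f"
  shows "lin_on (rep_scale M) (wt \<mu>) (\<lambda>v. rep_act M f (rep_act M e v))"
proof -
  have ef: "e \<in> lie_carrier L" "f \<in> lie_carrier L"
    "e \<in> root_space L H \<beta>" "f \<in> root_space L H (- \<beta>)"
    using t by (auto simp: root_triple_def root_space_def)
  have cl: "rep_act M f (rep_act M e v) \<in> wt \<mu>" if "v \<in> wt \<mu>" for v
    using wt_root[OF ef(4) wt_root[OF ef(3) that]] by simp
  have "lin_on (rep_scale M) C (\<lambda>v. rep_act M f (rep_act M e v))"
    by (rule lin_on_compose[OF act_lin[OF ef(2)] act_lin[OF ef(1)]])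
  then show ?thesis using cl wt_C unfolding lin_on_def by blast
qed

lemma fe_eigenvalues_finite:
  assumes t: "root_triple L H \<beta> e h f" and \<mu>: "\<mu> \<in> dual_space L H"
  shows "finite {a. \<exists>v\<in>wt \<mu>. v \<noteq> 0 \<and> rep_act M f (rep_act M e v) = rep_scale M a v}"
proof -
  obtain B where B: "finite B" "wt \<mu> \<subseteq> span B" using wt_fin[OF \<mu>] by (auto simp: fin_dim_def)
  show ?thesis by (rule finite_eigenvalues[OF fe_lin[OF t] wt_subspace B])
qed

lemma finite_quadratic_nat:
  fixes a b :: 'k
  shows "finite {n :: nat. of_nat n * of_nat n + b * of_nat n + a = (0::'k)}"
proof -
  have "finite {x :: 'k. poly [:a, b, 1:] x = 0}" by (rule poly_roots_finite) simp
  then have "finite (of_nat -` {x :: 'k. poly [:a, b, 1:] x = 0} :: nat set)"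
    by (rule finite_vimageI) (rule inj_of_nat)
  moreover have "{n :: nat. of_nat n * of_nat n + b * of_nat n + a = (0::'k)} \<subseteq>
      of_nat -` {x :: 'k. poly [:a, b, 1:] x = 0}"
    by (auto simp: algebra_simps)
  ultimately show ?thesis by (rule finite_subset[rotated])
qed

text \<open>If \<open>e\<close> is locally nilpotent, then a nonzero vector of weight \<open>\<lambda> + k\<beta>\<close> yields a singular vector
  of some weight \<open>\<lambda> + k'\<beta>\<close> with \<open>k' \<ge> k\<close>. For large \<open>k'\<close> its image under \<open>f\<^sup>k\<^sup>'\<close> is a nonzero
  vector of weight \<open>\<lambda>\<close> and an eigenvector of \<open>f e\<close>; the eigenvalues obtained in this way are too many
  for the finite-dimensional weight space.\<close>

lemma weight_string_bounded:
  assumes t: "root_triple L H \<beta> e h f" and \<mu>: "\<mu> \<in> dual_space L H"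
    and nil: "\<And>v. v \<in> C \<Longrightarrow> \<exists>n. (rep_act M e ^^ n) v = 0"
  shows "\<exists>K. \<forall>k\<ge>K. wt (\<lambda>z. \<mu> z + of_nat k * \<beta> z) = {0}"
proof (rule ccontr)
  assume neg: "\<nexists>K. \<forall>k\<ge>K. wt (\<lambda>z. \<mu> z + of_nat k * \<beta> z) = {0}"
  have ef: "e \<in> lie_carrier L" "f \<in> lie_carrier L" "h \<in> H" "\<beta> h = 2"
    "e \<in> root_space L H \<beta>" "f \<in> root_space L H (- \<beta>)"
    using t by (auto simp: root_triple_def root_space_def)
  let ?E = "rep_act M e" and ?F = "rep_act M f"
  define c where "c = \<mu> h"
  define Ev where "Ev = {a. \<exists>v\<in>wt \<mu>. v \<noteq> 0 \<and> ?F (?E v) = rep_scale M a v}"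
  have Ev: "finite Ev" unfolding Ev_def by (rule fe_eigenvalues_finite[OF t \<mu>])
  define Bad where "Bad = {k :: nat. of_nat k * (c + of_nat k + 1) \<in> Ev}"
  have "Bad = (\<Union>a\<in>Ev. {k :: nat. of_nat k * of_nat k + (c + 1) * of_nat k + (- a) = (0::'k)})"
    by (auto simp: Bad_def algebra_simps)
  then have "finite Bad" using finite_UN_I[OF Ev finite_quadratic_nat] by (simp only:)
  then obtain K1 where K1: "\<And>k. k \<in> Bad \<Longrightarrow> k < K1"
    using finite_nat_set_iff_bounded by auto
  obtain K2 where K2: "\<And>k j. K2 \<le> k \<Longrightarrow> j < k \<Longrightarrow> c + 2 * of_nat k - of_nat j \<noteq> (0 :: 'k)"
  proof (cases "\<exists>m :: nat. c = - of_nat m")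
    case True
    then obtain m :: nat where m: "c = - of_nat m" by blast
    have "c + 2 * of_nat k - of_nat j \<noteq> 0" if "m \<le> k" "j < k" for k j
    proof
      assume "c + 2 * of_nat k - of_nat j = 0"
      then have "(of_nat (2 * k) :: 'k) = of_nat (m + j)" by (simp add: m algebra_simps)
      then have "2 * k = m + j" by (simp only: of_nat_eq_iff)
      then show False using that by simp
    qed
    then show ?thesis using that by blast
  next
    case False
    have "c + 2 * of_nat k - of_nat j \<noteq> 0" if "j < k" for k j :: nat
    proof
      assume "c + 2 * of_nat k - of_nat j = 0"
      then have "c = - (2 * of_nat k - of_nat j)" by (simp add: eq_diff_eq)
      moreover have "(of_nat (2 * k - j) :: 'k) = 2 * of_nat k - of_nat j"
        using that by (subst of_nat_diff) auto
      ultimately have "c = - of_nat (2 * k - j)" by (simp only:)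
      then show False using False by blast
    qed
    then show ?thesis using that by blast
  qed
  obtain k where k: "K1 + K2 + 1 \<le> k" "wt (\<lambda>z. \<mu> z + of_nat k * \<beta> z) \<noteq> {0}" using neg by blast
  then obtain v where v: "v \<in> wt (\<lambda>z. \<mu> z + of_nat k * \<beta> z)" "v \<noteq> 0"
    using subspace_0[OF wt_subspace] by blast
  define m where "m = (LEAST m. (?E ^^ m) v = 0)"
  have m: "(?E ^^ m) v = 0" unfolding m_def using nil[OF wt_C[OF v(1)]] by (rule LeastI_ex)
  then have "m \<noteq> 0" using v(2) by (intro notI) simp
  then obtain m' where m': "m = Suc m'" by (cases m) auto
  define u where "u = (?E ^^ m') v"
  have "u \<noteq> 0" unfolding u_def using not_less_Least[of m' "\<lambda>m. (?E ^^ m) v = 0"] m' m_def by simp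
  have eu: "?E u = 0" using m by (simp add: u_def m')
  define k' where "k' = k + m'"
  have uw: "u \<in> wt (\<lambda>z. \<mu> z + of_nat k' * \<beta> z)"
    using wt_root_pow[OF ef(5) v(1), of m'] by (simp add: u_def k'_def algebra_simps)
  have uC: "u \<in> C" using uw by (rule wt_C)
  have comm: "?E ((?F ^^ Suc j) u) = rep_scale M ((of_nat j + 1) * (c + 2 * of_nat k' - of_nat j)) ((?F ^^ j) u)" for j
    using triple_commute[OF t uw, of j] eu lin_on_zero[OF lin_on_funpow[OF act_lin[OF ef(2)]] subspace_C, of "Suc j"]
    by (simp add: ef(4) c_def mult.commute)
  have nz: "j \<le> k' \<longrightarrow> (?F ^^ j) u \<noteq> 0" for j
  proof (induction j)
    case 0
    then show ?case using \<open>u \<noteq> 0\<close> by simp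
  next
    case (Suc j)
    show ?case
    proof (intro impI notI)
      assume j: "Suc j \<le> k'" and z: "(?F ^^ Suc j) u = 0"
      have "?E 0 = 0" by (rule lin_on_zero[OF act_lin[OF ef(1)] subspace_C])
      then have "rep_scale M ((of_nat j + 1) * (c + 2 * of_nat k' - of_nat j)) ((?F ^^ j) u) = 0"
        using comm[of j] unfolding z by simp
      moreover have "(of_nat j + 1 :: 'k) \<noteq> 0" by (metis of_nat_Suc of_nat_neq_0 add.commute)
      moreover have "c + 2 * of_nat k' - of_nat j \<noteq> 0"
        using j k(1) by (intro K2) (auto simp: k'_def)
      ultimately show False using Suc j by (simp only: scale_eq_0_iff mult_eq_0_iff) auto
    qed
  qed
  define y where "y = (?F ^^ k') u"
  have "y \<noteq> 0" using nz unfolding y_def by blast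
  have yw: "y \<in> wt \<mu>" using wt_root_pow[OF ef(6) uw, of k'] by (simp add: y_def)
  obtain j where j: "k' = Suc j" using k(1) by (cases k') (auto simp: k'_def)
  have "?F (?E y) = rep_scale M ((of_nat j + 1) * (c + 2 * of_nat k' - of_nat j)) y"
    unfolding y_def j using comm[of j, unfolded j] act_pow_closed[OF ef(2) uC]
    by (simp add: lin_on_scale[OF act_lin[OF ef(2)]])
  moreover have "(of_nat j + 1) * (c + 2 * of_nat k' - of_nat j) = of_nat k' * (c + of_nat k' + 1)"
    by (simp add: j algebra_simps)
  ultimately have "of_nat k' * (c + of_nat k' + 1) \<in> Ev"
    unfolding Ev_def using yw \<open>y \<noteq> 0\<close> by auto
  then have "k' \<in> Bad" by (simp add: Bad_def)
  then show False using K1[of k'] k(1) by (simp add: k'_def)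
qed

end

section \<open>The twisted module\<close>

text \<open>Two operators that agree on \<open>C\<close> may differ elsewhere, as the actions of \<open>f\<close> and of its class in the
  enveloping algebra do. The powers of conjugation only see \<open>C\<close>.\<close>

lemma conj_power_cong_base:
  assumes 1: "conjugation s C F G" and 2: "conjugation s C F' G"
    and eq: "\<And>v. v \<in> C \<Longrightarrow> F v = F' v" and u: "lin_on s C u" and v: "v \<in> C"
  shows "(conjugation.conj_diff F G ^^ i) u v = (conjugation.conj_diff F' G ^^ i) u v"
    and "conjugation.conj_power s F G x u v = conjugation.conj_power s F' G x u v"
proof -
  interpret A: conjugation s C F G by fact
  interpret B: conjugation s C F' G by fact
  have pow: "(A.conj_diff ^^ i) u v = (B.conj_diff ^^ i) u v" if "v \<in> C" for i v
    using that
  proof (induction i arbitrary: v)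
    case (Suc i)
    have Gv: "G v \<in> C" using A.G Suc.prems by (rule lin_on_closed)
    have "(B.conj_diff ^^ i) u (G v) \<in> C" using B.conj_diff_pow_lin[OF u] Gv by (rule lin_on_closed)
    then show ?case using Suc.IH[OF Gv] Suc.IH[OF Suc.prems]
      by (simp add: A.conj_diff_def[of "(A.conj_diff ^^ i) u"] B.conj_diff_def[of "(B.conj_diff ^^ i) u"] eq)
  qed simp
  show "(A.conj_diff ^^ i) u v = (B.conj_diff ^^ i) u v" by (rule pow[OF v])
  show "A.conj_power x u v = B.conj_power x u v"
    unfolding A.conj_power_def B.conj_power_def pow[OF v] ..
qed

locale twisted_module = weight_rep L M H
  for L :: "('k::field_char_0, 'l::ab_group_add) lie_alg" and M :: "('k, 'l, 'm::ab_group_add) rep"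
    and H :: "'l set" +
  fixes \<alpha> :: "'l \<Rightarrow> 'k" and e h f :: 'l and G :: "'m \<Rightarrow> 'm" and x :: 'k
  assumes zero_L: "0 \<in> lie_carrier L"
    and triple: "root_triple L H \<alpha> e h f"
    and f_nil: "\<And>y. y \<in> lie_carrier L \<Longrightarrow> \<exists>n. (lie_bracket L f ^^ n) y = 0"
    and e_nil: "\<And>y. y \<in> lie_carrier L \<Longrightarrow> \<exists>n. (lie_bracket L e ^^ n) y = 0"
    and conj: "conjugation (rep_scale M) (rep_carrier M) (rep_act M f) G"

sublocale twisted_module \<subseteq> cj: conjugation "rep_scale M" "rep_carrier M" "rep_act M f" G
  by (rule conj)

context twisted_module
begin

abbreviation "F \<equiv> rep_act M f"

lemma triple_facts:
  "\<alpha> \<in> dual_space L H" "e \<in> root_space L H \<alpha>" "f \<in> root_space L H (- \<alpha>)" "h \<in> H"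
  "lie_bracket L e f = h" "\<alpha> h = 2" "e \<in> lie_carrier L" "f \<in> lie_carrier L" "h \<in> lie_carrier L"
  using triple H by (auto simp: root_triple_def root_space_def)

lemma ad_f_pow_closed: "y \<in> lie_carrier L \<Longrightarrow> (lie_bracket L f ^^ i) y \<in> lie_carrier L"
  using triple_facts(8) by (induction i) (auto intro: bracket_closed)

text \<open>This holds for every representation in which \<open>f\<close> acts as in \<open>M\<close>, in particular for the twist.\<close>

lemma conj_diff_rep:
  assumes M': "lie_rep L M'" "rep_carrier M' = C" "rep_scale M' = rep_scale M"
    and ff: "\<And>v. v \<in> C \<Longrightarrow> rep_act M' f v = F v"
    and y: "y \<in> lie_carrier L" and v: "v \<in> C"
  shows "(cj.conj_diff ^^ i) (rep_act M' y) v = rep_act M' ((lie_bracket L f ^^ i) y) ((G ^^ i) v)"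
  using v
proof (induction i arbitrary: v)
  case 0
  then show ?case by simp
next
  case (Suc i)
  interpret M': lie_rep L M' by fact
  let ?q = "(lie_bracket L f ^^ i) y"
  have q: "?q \<in> lie_carrier L" by (rule ad_f_pow_closed[OF y])
  have Gv: "G v \<in> C" "(G ^^ i) v \<in> C" "(G ^^ i) (G v) \<in> C"
    using cj.G_pow_closed[OF Suc.prems, of i] lin_on_closed[OF cj.G Suc.prems]
      cj.G_pow_closed[OF lin_on_closed[OF cj.G Suc.prems], of i] by auto
  define w where "w = (G ^^ i) (G v)"
  have w: "w \<in> C" "(G ^^ i) v = F w" "(G ^^ Suc i) v = w"
    using Gv(3) cj.FG[OF Gv(2)] by (auto simp: w_def funpow_swap1)
  have "(cj.conj_diff ^^ Suc i) (rep_act M' y) v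
      = F ((cj.conj_diff ^^ i) (rep_act M' y) (G v)) - (cj.conj_diff ^^ i) (rep_act M' y) v"
    by (simp add: cj.conj_diff_def[of "(cj.conj_diff ^^ i) (rep_act M' y)"])
  also have "\<dots> = F (rep_act M' ?q w) - rep_act M' ?q (F w)"
    unfolding Suc.IH[OF Suc.prems] Suc.IH[OF Gv(1)] w(2) w_def ..
  also have "\<dots> = rep_act M' f (rep_act M' ?q w) - rep_act M' ?q (rep_act M' f w)"
    using M'.act_closed[OF q, of w] w(1) M'(2) by (simp add: ff)
  also have "\<dots> = rep_act M' (lie_bracket L f ?q) w"
    using M'.act_bracket[OF triple_facts(8) q] w(1) M'(2) by simp
  finally show ?case unfolding w(3) by simp
qed

lemma conj_diff_act:
  "y \<in> lie_carrier L \<Longrightarrow> v \<in> C \<Longrightarrow>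
    (cj.conj_diff ^^ i) (rep_act M y) v = rep_act M ((lie_bracket L f ^^ i) y) ((G ^^ i) v)"
  by (rule conj_diff_rep[OF lie_rep_axioms]) auto

lemma act_conj_nilpotent: "y \<in> lie_carrier L \<Longrightarrow> cj.conj_nilpotent (rep_act M y)"
proof -
  assume y: "y \<in> lie_carrier L"
  obtain n where "(lie_bracket L f ^^ n) y = 0" using f_nil[OF y] by blast
  then show ?thesis unfolding cj.conj_nilpotent_def
    using act_zero[OF zero_L] cj.G_pow_closed by (intro exI[of _ n]) (simp add: conj_diff_act[OF y])
qed

definition twisted :: "('k, 'l, 'm) rep" where
  "twisted = M\<lparr>rep_act := \<lambda>y. cj.conj_power (- x) (rep_act M y)\<rparr>"

lemma twisted_simps:
  "rep_carrier twisted = C" "rep_scale twisted = rep_scale M"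
  "rep_act twisted y = cj.conj_power (- x) (rep_act M y)"
  by (simp_all add: twisted_def)

lemma twisted_lie_module: "lie_module L twisted"
proof -
  note nil = act_conj_nilpotent and lin = act_lin
  have lin': "lin_on (rep_scale M) C (cj.conj_power (- x) (rep_act M y))" if "y \<in> lie_carrier L" for y
    by (rule cj.conj_power_lin[OF lin[OF that] nil[OF that]])
  have add: "cj.conj_power (- x) (rep_act M (y + z)) v
      = cj.conj_power (- x) (rep_act M y) v + cj.conj_power (- x) (rep_act M z) v"
    if "y \<in> lie_carrier L" "z \<in> lie_carrier L" "v \<in> C" for y z v
    using cj.conj_power_combination[OF lin[OF that(1)] nil[OF that(1)] lin[OF that(2)] nil[OF that(2)],
        of "rep_act M (y + z)" 1 1 v] that act_add by simp
  have scale: "cj.conj_power (- x) (rep_act M (lie_scale L c y)) v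
      = rep_scale M c (cj.conj_power (- x) (rep_act M y) v)"
    if "y \<in> lie_carrier L" "v \<in> C" for c y v
    using cj.conj_power_combination[OF lin[OF that(1)] nil[OF that(1)] lin[OF that(1)] nil[OF that(1)],
        of "rep_act M (lie_scale L c y)" c 0 v] that act_scale by simp
  have bracket: "cj.conj_power (- x) (rep_act M (lie_bracket L y z)) v
      = cj.conj_power (- x) (rep_act M y) (cj.conj_power (- x) (rep_act M z) v)
        - cj.conj_power (- x) (rep_act M z) (cj.conj_power (- x) (rep_act M y) v)"
    if "y \<in> lie_carrier L" "z \<in> lie_carrier L" "v \<in> C" for y z v
    using that act_bracket bracket_closed
    by (intro cj.conj_power_commutator lin nil) auto
  show ?thesis
    unfolding lie_module_def twisted_simps
    using lin' add scale bracket vector_space_axioms subspace_C by (simp add: lin_on_def)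
qed

lemma twisted_rep: "lie_rep L twisted"
proof -
  have "lin_space (rep_scale twisted)"
    unfolding twisted_simps by (rule lin_space_axioms)
  then show ?thesis
    by (intro lie_rep.intro lie_closed_axioms lie_rep_axioms.intro twisted_lie_module)
qed

sublocale tw: lie_rep L twisted
  rewrites "rep_carrier twisted = C" and "rep_scale twisted = rep_scale M"
  by (rule twisted_rep) (simp_all add: twisted_simps)

lemma gchoose_2: "2 * ((a::'k) gchoose 2) = a * (a - 1)"
  using gbinomial_mult_1[of a 1] by (simp add: numeral_2_eq_2 algebra_simps)

lemma f_swap: "z \<in> H \<Longrightarrow> v \<in> C \<Longrightarrow> rep_act M z (F v) = F (rep_act M z v) - rep_scale M (\<alpha> z) (F v)"
proof -
  assume z: "z \<in> H" and v: "v \<in> C"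
  have zL: "z \<in> lie_carrier L" using z H by blast
  have "rep_act M (lie_bracket L z f) v = rep_scale M (- \<alpha> z) (F v)"
    using triple_facts(3,8) z v by (simp add: root_space_def act_scale)
  then show ?thesis using act_bracket[OF zL triple_facts(8) v] by (simp add: algebra_simps)
qed

text \<open>As \<open>[f, z] = \<alpha>(z) f\<close>, the binomial series stops after the linear term, and all weights are shifted by
  \<open>-x\<alpha>\<close>.\<close>

lemma twisted_H:
  assumes z: "z \<in> H" and v: "v \<in> C"
  shows "rep_act twisted z v = rep_act M z v - rep_scale M (x * \<alpha> z) v"
proof -
  have zL: "z \<in> lie_carrier L" using z H by blast
  have d1: "cj.conj_diff (rep_act M z) w = rep_scale M (\<alpha> z) w" if w: "w \<in> C" for w
  proof -
    have "G w \<in> C" using cj.G w by (rule lin_on_closed)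
    then show ?thesis using f_swap[OF z, of "G w"] w by (simp add: cj.conj_diff_def cj.FG)
  qed
  have d2: "(cj.conj_diff ^^ 2) (rep_act M z) w = 0" if w: "w \<in> C" for w
  proof -
    have Gw: "G w \<in> C" using cj.G w by (rule lin_on_closed)
    have "(cj.conj_diff ^^ 2) (rep_act M z) w
        = F (cj.conj_diff (rep_act M z) (G w)) - cj.conj_diff (rep_act M z) w"
      by (simp add: numeral_2_eq_2 cj.conj_diff_def[of "cj.conj_diff (rep_act M z)"])
    then show ?thesis using d1[OF w] d1[OF Gw] Gw w by (simp add: lin_on_scale[OF cj.F] cj.FG)
  qed
  have "(cj.conj_diff ^^ i) (rep_act M z) v = 0" if "2 \<le> i" for i
    using cj.conj_diff_pow_vanish[of 2 "rep_act M z" i v] d2 that v by blast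
  then have "cj.conj_power (- x) (rep_act M z) v
      = (\<Sum>i<2. rep_scale M (- x gchoose i) ((cj.conj_diff ^^ i) (rep_act M z) v))"
    by (rule cj.conj_power_upto)
  then show ?thesis using d1[OF v] by (simp add: twisted_simps numeral_2_eq_2)
qed

lemma twisted_f:
  assumes v: "v \<in> C"
  shows "rep_act twisted f v = F v"
proof -
  have d1: "(cj.conj_diff ^^ 1) F w = 0" if "w \<in> C" for w
    using that cj.FG by (simp add: cj.conj_diff_def)
  have "(cj.conj_diff ^^ i) F v = 0" if "1 \<le> i" for i
    using cj.conj_diff_pow_vanish[of 1 F i v] d1 that v by blast
  then have "cj.conj_power (- x) F v
      = (\<Sum>i<1. rep_scale M (- x gchoose i) ((cj.conj_diff ^^ i) F v))"
    by (rule cj.conj_power_upto)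
  then show ?thesis by (simp add: twisted_simps)
qed

lemma twisted_f_pow: "v \<in> C \<Longrightarrow> (rep_act twisted f ^^ n) v = (F ^^ n) v"
  by (induction n) (auto simp: twisted_f cj.F_pow_closed)

text \<open>The series is \<open>e + x h f\<^sup>-\<^sup>1 - x (x + 1) f\<^sup>-\<^sup>1\<close>, because \<open>[f, e] = -h\<close> and \<open>[f, [f, e]] = -2 f\<close>.\<close>

lemma twisted_e:
  assumes u: "u \<in> wt \<mu>"
  shows "rep_act twisted e (F u)
    = rep_act M f (rep_act M e u) + rep_scale M ((1 + x) * (\<mu> h - x)) u"
proof -
  let ?E = "rep_act M e" and ?h = "rep_act M h"
  note ef = triple_facts
  have uC: "u \<in> C" using u by (rule wt_C)
  have G: "G w \<in> C" if "w \<in> C" for w using cj.G that by (rule lin_on_closed)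
  have EF: "?E (F w) - F (?E w) = ?h w" if "w \<in> C" for w
    using act_bracket[OF ef(7,8) that] ef(5) by simp
  have d1: "cj.conj_diff ?E w = - ?h (G w)" if w: "w \<in> C" for w
    using EF[OF G[OF w]] w by (simp add: cj.conj_diff_def cj.FG algebra_simps)
  have d2: "(cj.conj_diff ^^ 2) ?E w = rep_scale M (- 2) (G w)" if w: "w \<in> C" for w
  proof -
    have "(cj.conj_diff ^^ 2) ?E w = F (cj.conj_diff ?E (G w)) - cj.conj_diff ?E w"
      by (simp add: numeral_2_eq_2 cj.conj_diff_def[of "cj.conj_diff ?E"])
    also have "\<dots> = F (- ?h (G (G w))) + ?h (F (G (G w)))"
      using d1[OF w] d1[OF G[OF w]] cj.FG[OF G[OF w]] by simp
    also have "F (- ?h (G (G w))) = - F (?h (G (G w)))"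
      by (rule lin_on_minus[OF cj.F subspace_C act_closed[OF ef(9) G[OF G[OF w]]]])
    also have "- F (?h (G (G w))) + ?h (F (G (G w))) = rep_scale M (- 2) (F (G (G w)))"
      using f_swap[OF ef(4) G[OF G[OF w]]] ef(6) by simp
    finally show ?thesis by (simp add: cj.FG[OF G[OF w]])
  qed
  have d3: "(cj.conj_diff ^^ 3) ?E w = 0" if w: "w \<in> C" for w
  proof -
    have "(cj.conj_diff ^^ 3) ?E w = F ((cj.conj_diff ^^ 2) ?E (G w)) - (cj.conj_diff ^^ 2) ?E w"
      by (simp add: numeral_3_eq_3 numeral_2_eq_2 cj.conj_diff_def[of "cj.conj_diff (cj.conj_diff ?E)"])
    also have "\<dots> = F (rep_scale M (- 2) (G (G w))) - rep_scale M (- 2) (G w)"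
      unfolding d2[OF w] d2[OF G[OF w]] ..
    finally show ?thesis
      using cj.FG[OF G[OF w]] lin_on_scale[OF cj.F G[OF G[OF w]], of "- 2"] by simp
  qed
  have Fu: "F u \<in> C" using cj.F uC by (rule lin_on_closed)
  have GFu: "G (F u) = u" by (rule cj.GF[OF uC])
  have "(cj.conj_diff ^^ i) ?E (F u) = 0" if "3 \<le> i" for i
    using cj.conj_diff_pow_vanish[of 3 ?E i "F u"] d3 that Fu by blast
  then have "cj.conj_power (- x) ?E (F u)
      = (\<Sum>i<3. rep_scale M (- x gchoose i) ((cj.conj_diff ^^ i) ?E (F u)))"
    by (rule cj.conj_power_upto)
  also have "\<dots> = ?E (F u) + rep_scale M (- x) (cj.conj_diff ?E (F u))
      + rep_scale M (- x gchoose 2) ((cj.conj_diff ^^ 2) ?E (F u))"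
    by (simp add: numeral_3_eq_3 numeral_2_eq_2)
  also have "?E (F u) = F (?E u) + rep_scale M (\<mu> h) u"
    using EF[OF uC] wt_act[OF u ef(4)] by (simp add: algebra_simps)
  also have "cj.conj_diff ?E (F u) = rep_scale M (- \<mu> h) u"
    unfolding d1[OF Fu] GFu using wt_act[OF u ef(4)] by simp
  also have "(cj.conj_diff ^^ 2) ?E (F u) = rep_scale M (- 2) u"
    unfolding d2[OF Fu] GFu ..
  also have "F (?E u) + rep_scale M (\<mu> h) u + rep_scale M (- x) (rep_scale M (- \<mu> h) u)
      + rep_scale M (- x gchoose 2) (rep_scale M (- 2) u)
    = F (?E u) + rep_scale M (\<mu> h + (- x) * (- \<mu> h) + (- x gchoose 2) * (- 2)) u"
    by (simp only: scale_left_distrib scale_scale add.assoc)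
  also have "\<mu> h + (- x) * (- \<mu> h) + (- x gchoose 2) * (- 2) = (1 + x) * (\<mu> h - x)"
    using gchoose_2[of "- x"] by (simp add: algebra_simps)
  finally show ?thesis by (simp add: twisted_simps)
qed

lemma twisted_e_pow:
  assumes u: "u \<in> wt \<mu>"
  shows "rep_act twisted e ((F ^^ Suc n) u)
    = (F ^^ n) (F (rep_act M e u) + rep_scale M ((of_nat n + 1 + x) * (\<mu> h - of_nat n - x)) u)"
proof -
  let ?E = "rep_act M e"
  have uC: "u \<in> C" using u by (rule wt_C)
  have un: "(F ^^ n) u \<in> wt (\<lambda>z. \<mu> z + of_nat n * (- \<alpha>) z)"
    by (rule wt_root_pow[OF triple_facts(3) u])
  have Eu: "?E u \<in> C" using act_closed triple_facts uC by blast
  note linn = lin_on_funpow[OF cj.F, of n]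
  have fe: "F (?E ((F ^^ n) u)) = (F ^^ n) (F (?E u)) + rep_scale M (of_nat n * (\<mu> h - of_nat n + 1)) ((F ^^ n) u)"
  proof (cases n)
    case (Suc m)
    have cl: "(F ^^ Suc m) (?E u) \<in> C" "(F ^^ m) u \<in> C" using cj.F_pow_closed Eu uC by blast+
    have "F (?E ((F ^^ n) u)) = F ((F ^^ Suc m) (?E u)) + rep_scale M ((of_nat m + 1) * (\<mu> h - of_nat m)) (F ((F ^^ m) u))"
      unfolding Suc triple_commute[OF triple u]
      using cl subspace_scale[OF subspace_C] by (simp add: lin_on_add[OF cj.F] lin_on_scale[OF cj.F])
    then show ?thesis by (simp add: Suc funpow_swap1 add.commute)
  qed simp
  have "rep_act twisted e ((F ^^ Suc n) u) = F (?E ((F ^^ n) u))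
      + rep_scale M ((1 + x) * (\<mu> h - 2 * of_nat n - x)) ((F ^^ n) u)"
    using twisted_e[OF un] triple_facts(6) by (simp add: mult.commute)
  also have "\<dots> = (F ^^ n) (F (?E u)) + (rep_scale M (of_nat n * (\<mu> h - of_nat n + 1)) ((F ^^ n) u)
      + rep_scale M ((1 + x) * (\<mu> h - 2 * of_nat n - x)) ((F ^^ n) u))"
    unfolding fe by (simp only: add.assoc)
  also have "\<dots> = (F ^^ n) (F (?E u)) + rep_scale M ((of_nat n + 1 + x) * (\<mu> h - of_nat n - x)) ((F ^^ n) u)"
    unfolding scale_left_distrib[symmetric] by (simp add: algebra_simps)
  also have "\<dots> = (F ^^ n) (F (?E u) + rep_scale M ((of_nat n + 1 + x) * (\<mu> h - of_nat n - x)) u)"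
    using lin_on_closed[OF cj.F Eu] uC subspace_scale[OF subspace_C uC]
    by (simp add: lin_on_add[OF linn] lin_on_scale[OF linn])
  finally show ?thesis .
qed

lemma twisted_weight_space:
  "weight_space H twisted \<mu> = wt (\<lambda>z. \<mu> z + x * \<alpha> z)"
proof -
  have "rep_act twisted z v = rep_scale M (\<mu> z) v
      \<longleftrightarrow> rep_act M z v = rep_scale M (\<mu> z + x * \<alpha> z) v" if "z \<in> H" "v \<in> C" for z v
    unfolding twisted_H[OF that] scale_left_distrib by (rule diff_eq_eq)
  then show ?thesis unfolding weight_space_def twisted_simps(1,2) by blast
qed

lemma twisted_W_fin: "twisted \<in> W_fin L H"
proof -
  have "C \<subseteq> span (\<Union>\<mu>\<in>dual_space L H. weight_space H twisted \<mu>)"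
  proof
    fix v assume "v \<in> C"
    then obtain E g where Eg: "finite E" "E \<subseteq> dual_space L H" "\<And>\<mu>. \<mu> \<in> E \<Longrightarrow> g \<mu> \<in> wt \<mu>" "v = sum g E"
      using weight_decomposition by metis
    have "g \<mu> \<in> span (\<Union>\<mu>\<in>dual_space L H. weight_space H twisted \<mu>)" if "\<mu> \<in> E" for \<mu>
    proof (rule span_base, rule UN_I)
      show "(\<lambda>z. \<mu> z + (- x) * \<alpha> z) \<in> dual_space L H"
        by (rule dual_space_shift) (use that Eg(2) triple_facts in auto)
      show "g \<mu> \<in> weight_space H twisted (\<lambda>z. \<mu> z + (- x) * \<alpha> z)"
        using Eg(3)[OF that] by (simp add: twisted_weight_space)
    qed
    then show "v \<in> span (\<Union>\<mu>\<in>dual_space L H. weight_space H twisted \<mu>)" unfolding Eg(4) by (rule span_sum)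
  qed
  moreover have "fin_dim (rep_scale M) (weight_space H twisted \<mu>)" if "\<mu> \<in> dual_space L H" for \<mu>
    unfolding twisted_weight_space by (rule wt_fin[OF dual_space_shift[OF that triple_facts(1)]])
  ultimately show ?thesis
    unfolding W_fin_def by (simp add: twisted_lie_module twisted_simps)
qed

sublocale tw: weight_rep L twisted H
  rewrites "rep_carrier twisted = C" and "rep_scale twisted = rep_scale M"
  by (unfold_locales) (simp_all add: H twisted_W_fin twisted_simps)

end

section \<open>The simple submodule of the twisted module\<close>

locale twisted_simple = twisted_module L M H \<alpha> e h f G x
  for L :: "('k::field_char_0, 'l::ab_group_add) lie_alg" and M :: "('k, 'l, 'm::ab_group_add) rep"
    and H :: "'l set" and \<alpha> :: "'l \<Rightarrow> 'k" and e h f :: 'l and G :: "'m \<Rightarrow> 'm" and x :: 'k +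
  fixes \<mu> :: "'l \<Rightarrow> 'k" and w :: 'm
  assumes simple: "simple_module L M"
    and \<mu>: "\<mu> \<in> dual_space L H" and w: "w \<in> weight_space H M \<mu>" "w \<noteq> 0"
    and singular: "rep_act M f (rep_act M e w) + rep_scale M ((1 + x) * (\<mu> h - x)) w = 0"
begin

text \<open>The vectors that a power of \<open>f\<close> sends into \<open>S\<close> form a submodule of the twist that is stable under
  \<open>f\<^sup>-\<^sup>1\<close>. Twisting back expresses the original action through these operators, so they form a submodule
  of the simple module \<open>M\<close>.\<close>

lemma absorbing:
  assumes S: "tw.submodule S" "S \<noteq> {0}" and v: "v \<in> C"
  shows "\<exists>n. (F ^^ n) v \<in> S"
proof -
  define T where "T = {v \<in> C. \<exists>n. (rep_act twisted f ^^ n) v \<in> S}"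
  have T: "tw.submodule T"
    unfolding T_def by (rule tw.absorbing_submodule[OF S(1) triple_facts(8) zero_L f_nil])
  have T': "subspace T" "T \<subseteq> C" "\<And>y v. y \<in> lie_carrier L \<Longrightarrow> v \<in> T \<Longrightarrow> rep_act twisted y v \<in> T"
    using T by (auto simp: tw.submodule_def)
  have T_iff: "v \<in> T \<longleftrightarrow> v \<in> C \<and> (\<exists>n. (F ^^ n) v \<in> S)" for v
    unfolding T_def using twisted_f_pow by auto
  have GT: "(G ^^ i) v \<in> T" if "v \<in> T" for i v
    using that
  proof (induction i)
    case (Suc i)
    then have u: "(G ^^ i) v \<in> T" "(G ^^ i) v \<in> C" using T'(2) by auto
    then obtain n where "(F ^^ n) ((G ^^ i) v) \<in> S" using T_iff by blast
    then have "(F ^^ Suc n) (G ((G ^^ i) v)) \<in> S"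
      using cj.FG[OF u(2)] by (simp add: funpow_swap1)
    moreover have "G ((G ^^ i) v) \<in> C" using cj.G u(2) by (rule lin_on_closed)
    ultimately have "G ((G ^^ i) v) \<in> T" unfolding T_iff by blast
    then show ?case by simp
  qed simp
  have "rep_act M y v \<in> T" if y: "y \<in> lie_carrier L" and v: "v \<in> T" for y v
  proof -
    have vC: "v \<in> C" using v T'(2) by blast
    have "rep_act M y v = cj.conj_power x (rep_act twisted y) v"
      unfolding twisted_simps
      using cj.conj_power_neg[OF act_lin[OF y] act_conj_nilpotent[OF y] vC] by simp
    also have "\<dots> \<in> T"
      unfolding cj.conj_power_def
    proof (intro subspace_sum subspace_scale T'(1))
      fix i
      have "(cj.conj_diff ^^ i) (rep_act twisted y) v = rep_act twisted ((lie_bracket L f ^^ i) y) ((G ^^ i) v)"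
        by (rule conj_diff_rep[OF twisted_rep _ _ twisted_f y vC]) (simp_all add: twisted_simps)
      then show "(cj.conj_diff ^^ i) (rep_act twisted y) v \<in> T"
        using T'(3)[OF ad_f_pow_closed[OF y] GT[OF v]] by simp
    qed
    finally show ?thesis .
  qed
  then have "T = {0} \<or> T = C"
    using simple T'(1,2) unfolding simple_module_def by blast
  have "S \<subseteq> T"
  proof
    fix v assume "v \<in> S"
    then show "v \<in> T" using S(1) unfolding T_iff tw.submodule_def
      by (auto intro!: exI[of _ 0])
  qed
  moreover have "0 \<in> S" using S(1) subspace_0 by (simp add: tw.submodule_def)
  ultimately have "T \<noteq> {0}" using S(2) by blast
  with \<open>T = {0} \<or> T = C\<close> have "T = C" by blast
  then show ?thesis using v T_iff by blast
qed

text \<open>All nonzero submodules contain the same vectors deep in the string through \<open>\<mu>\<close>. On \<open>f\<^sup>n\<^sup>+\<^sup>1 u\<close>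
  with \<open>u\<close> of weight \<open>\<mu>\<close> the twisted \<open>e\<close> gives \<open>f\<^sup>n\<close> applied to \<open>(f e + q(n)) u\<close>, where \<open>q\<close> is
  quadratic in \<open>n\<close>. The operator \<open>f e + q(n)\<close> is bijective on the weight space for all but finitely
  many \<open>n\<close>, so below some level that does not depend on the submodule one can climb back up.\<close>

lemma common_vectors:
  "\<exists>n. \<forall>S. tw.submodule S \<and> S \<noteq> {0} \<longrightarrow> (\<forall>u\<in>wt \<mu>. (F ^^ n) u \<in> S)"
proof -
  let ?J = "\<lambda>v. F (rep_act M e v)"
  define q where "q = (\<lambda>n :: nat. (of_nat n + 1 + x) * (\<mu> h - of_nat n - x))"
  define Ev where "Ev = {a. \<exists>v\<in>wt \<mu>. v \<noteq> 0 \<and> ?J v = rep_scale M a v}"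
  have Ev: "finite Ev" unfolding Ev_def by (rule fe_eigenvalues_finite[OF triple \<mu>])
  have "{n. - q n \<in> Ev} = (\<Union>a\<in>Ev. {n. of_nat n * of_nat n + (1 + 2 * x - \<mu> h) * of_nat n
      + (- (1 + x) * (\<mu> h - x) - a) = 0})"
    by (auto simp: q_def algebra_simps)
  then have "finite {n. - q n \<in> Ev}" using finite_UN_I[OF Ev finite_quadratic_nat] by (simp only:)
  then obtain n0 where n0: "\<And>n. n0 \<le> n \<Longrightarrow> - q n \<notin> Ev"
    unfolding finite_nat_set_iff_bounded by (metis mem_Collect_eq not_less)
  obtain B where B: "finite B" "wt \<mu> \<subseteq> span B" using wt_fin[OF \<mu>] by (auto simp: fin_dim_def)
  note J = fe_lin[OF triple, of \<mu>]
  have onto: "\<exists>u\<in>wt \<mu>. ?J u + rep_scale M (q n) u = v" if n: "n0 \<le> n" and v: "v \<in> wt \<mu>" for n v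
  proof (rule injective_imp_onto[OF _ wt_subspace B v])
    have "lin_on (rep_scale M) (wt \<mu>) (\<lambda>u. rep_scale M 1 (?J u) + rep_scale M (q n) (id u))"
      by (rule lin_on_combination[OF J _ wt_subspace]) (simp add: lin_on_def)
    then show "lin_on (rep_scale M) (wt \<mu>) (\<lambda>u. ?J u + rep_scale M (q n) u)" by simp
    fix u assume u: "u \<in> wt \<mu>" "?J u + rep_scale M (q n) u = 0"
    then have "?J u = rep_scale M (- q n) u" by (simp add: eq_neg_iff_add_eq_0)
    then show "u = 0" using n0[OF n] u(1) unfolding Ev_def by blast
  qed
  have "(F ^^ n0) u \<in> S" if S: "tw.submodule S" "S \<noteq> {0}" and u: "u \<in> wt \<mu>" for S u
  proof -
    have S': "subspace S" "\<And>y v. y \<in> lie_carrier L \<Longrightarrow> v \<in> S \<Longrightarrow> rep_act twisted y v \<in> S"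
      using S(1) by (auto simp: tw.submodule_def)
    have FS: "(F ^^ m) v \<in> S" if "(F ^^ n) v \<in> S" "n \<le> m" "v \<in> C" for n m v
      using tw.submodule_pow[OF S(1) triple_facts(8), of n v m] that by (simp add: twisted_f_pow)
    obtain B' where B': "finite B'" "B' \<subseteq> wt \<mu>" "independent B'" "wt \<mu> \<subseteq> span B'"
      using finite_basis[OF B] .
    have "\<forall>b\<in>B'. \<exists>n. (F ^^ n) b \<in> S" using absorbing[OF S] B'(2) wt_C by blast
    then obtain k where k: "\<And>b. b \<in> B' \<Longrightarrow> (F ^^ k b) b \<in> S" by metis
    define m where "m = n0 + (\<Sum>b\<in>B'. k b)"
    have mS: "(F ^^ m) v \<in> S" if v: "v \<in> wt \<mu>" for v
    proof -
      have "subspace {v \<in> C. (F ^^ m) v \<in> S}"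
        unfolding subspace_def
        using lin_on_add[OF lin_on_funpow[OF cj.F]] lin_on_scale[OF lin_on_funpow[OF cj.F]] S'(1)
          subspace_C lin_on_zero[OF lin_on_funpow[OF cj.F] subspace_C]
        by (auto simp: subspace_add subspace_scale subspace_0)
      moreover have "B' \<subseteq> {v \<in> C. (F ^^ m) v \<in> S}"
      proof
        fix b assume b: "b \<in> B'"
        have "k b \<le> (\<Sum>b\<in>B'. k b)" by (rule member_le_sum[OF b _ B'(1)]) simp
        then have "(F ^^ m) b \<in> S" using FS[OF k[OF b], of m] b B'(2) wt_C by (auto simp: m_def)
        then show "b \<in> {v \<in> C. (F ^^ m) v \<in> S}" using b B'(2) wt_C by blast
      qed
      ultimately have "span B' \<subseteq> {v \<in> C. (F ^^ m) v \<in> S}" by (rule span_minimal[rotated])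
      then show ?thesis using v B'(4) by blast
    qed
    have "\<forall>v\<in>wt \<mu>. (F ^^ n0) v \<in> S"
    proof (rule inc_induct[where P = "\<lambda>n. \<forall>v\<in>wt \<mu>. (F ^^ n) v \<in> S" and j = m])
      show "n0 \<le> m" by (simp add: m_def)
      show "\<forall>v\<in>wt \<mu>. (F ^^ m) v \<in> S" using mS by blast
    next
      fix n assume n: "n0 \<le> n" "n < m" and IH: "\<forall>v\<in>wt \<mu>. (F ^^ Suc n) v \<in> S"
      show "\<forall>v\<in>wt \<mu>. (F ^^ n) v \<in> S"
      proof
        fix v assume "v \<in> wt \<mu>"
        then obtain u where u: "u \<in> wt \<mu>" "?J u + rep_scale M (q n) u = v" using onto[OF n(1)] by blast
        have "rep_act twisted e ((F ^^ Suc n) u) = (F ^^ n) v"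
          using twisted_e_pow[OF u(1), of n] u(2) by (simp add: q_def)
        then show "(F ^^ n) v \<in> S" using S'(2)[OF triple_facts(7)] IH u(1) by metis
      qed
    qed
    then show ?thesis using u by blast
  qed
  then show ?thesis by blast
qed

definition socle :: "'m set" where
  "socle = \<Inter> {S. tw.submodule S \<and> S \<noteq> {0}}"

definition socle_rep :: "('k, 'l, 'm) rep" where
  "socle_rep = twisted\<lparr>rep_carrier := socle\<rparr>"

lemma whole_submodule: "tw.submodule C" "C \<noteq> {0}"
  using simple subspace_C tw.act_closed by (auto simp: tw.submodule_def simple_module_def)

lemma socle_least: "tw.submodule S \<Longrightarrow> S \<noteq> {0} \<Longrightarrow> socle \<subseteq> S"
  by (auto simp: socle_def)

lemma socle_C: "socle \<subseteq> C"
  by (rule socle_least[OF whole_submodule])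

lemma socle_submodule: "tw.submodule socle"
proof -
  have "subspace socle"
    unfolding socle_def by (rule subspace_Inter) (auto simp: tw.submodule_def)
  moreover have "rep_act twisted y v \<in> socle" if "y \<in> lie_carrier L" "v \<in> socle" for y v
    using that unfolding socle_def tw.submodule_def by blast
  ultimately show ?thesis using socle_C unfolding tw.submodule_def by blast
qed

lemma socle_nonzero: "socle \<noteq> {0}"
proof -
  obtain n where "\<And>S. tw.submodule S \<and> S \<noteq> {0} \<Longrightarrow> (F ^^ n) w \<in> S"
    using common_vectors w(1) by blast
  then have "(F ^^ n) w \<in> socle" unfolding socle_def by blast
  moreover have "(F ^^ n) w \<noteq> 0"
    using cj.GF_pow[OF wt_C[OF w(1)], of n] w(2)
      lin_on_zero[OF lin_on_funpow[OF cj.G] subspace_C, of n] by metis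
  ultimately show ?thesis by blast
qed

lemma socle_simps:
  "rep_carrier socle_rep = socle" "rep_scale socle_rep = rep_scale M"
  "rep_act socle_rep = rep_act twisted"
  by (simp_all add: socle_rep_def twisted_def)

lemma socle_module: "lie_module L socle_rep"
  unfolding socle_rep_def by (rule tw.lie_module_restrict[OF socle_submodule])

lemma socle_simple: "simple_module L socle_rep"
  unfolding simple_module_def socle_simps
proof (intro conjI allI impI socle_module socle_nonzero)
  fix S assume S: "subspace S \<and> S \<subseteq> socle \<and> (\<forall>y\<in>lie_carrier L. \<forall>v\<in>S. rep_act twisted y v \<in> S)"
  then have "tw.submodule S" using socle_C unfolding tw.submodule_def by blast
  then show "S = {0} \<or> S = socle" using socle_least S by blast
qed

lemma socle_W_fin: "socle_rep \<in> W_fin L H"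
  unfolding socle_rep_def by (rule tw.W_fin_restrict[OF socle_submodule])

text \<open>The vectors killed by a power of \<open>e\<close> form a submodule of the twist, which is nonzero because it contains
  \<open>f w\<close>.\<close>

lemma socle_e_nilpotent:
  assumes "v \<in> socle"
  shows "\<exists>n. (rep_act socle_rep e ^^ n) v = 0"
proof -
  define T where "T = {v \<in> C. \<exists>n. (rep_act twisted e ^^ n) v \<in> {0}}"
  have zero: "tw.submodule {0}"
    using subspace_0[OF subspace_C] lin_on_zero[OF tw.act_lin subspace_C]
    by (auto simp: tw.submodule_def subspace_single_0)
  have T: "tw.submodule T"
    unfolding T_def by (rule tw.absorbing_submodule[OF zero triple_facts(7) zero_L e_nil])
  have Fw: "F w \<in> C" using cj.F wt_C[OF w(1)] by (rule lin_on_closed)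
  have "rep_act twisted e (F w) = 0" using twisted_e[OF w(1)] singular by simp
  then have "F w \<in> T" unfolding T_def using Fw by (auto intro!: exI[of _ 1])
  moreover have "F w \<noteq> 0"
    using cj.GF[OF wt_C[OF w(1)]] w(2) lin_on_zero[OF cj.G subspace_C] by metis
  ultimately have "socle \<subseteq> T" using T by (intro socle_least) auto
  then show ?thesis using assms unfolding socle_simps T_def by blast
qed

text \<open>The weights of the twist are those of \<open>M\<close> shifted by \<open>-x\<alpha>\<close>, and those of \<open>M\<close> are bounded in the
  direction of \<open>\<beta>\<close>.\<close>

lemma socle_locally_nilpotent:
  assumes t: "root_triple L H \<beta> e' h' f'"
    and nil: "\<And>v. v \<in> C \<Longrightarrow> \<exists>n. (rep_act M e' ^^ n) v = 0" and v: "v \<in> socle"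
  shows "\<exists>n. (rep_act socle_rep e' ^^ n) v = 0"
proof -
  have e': "e' \<in> root_space L H \<beta>" "e' \<in> lie_carrier L"
    using t by (auto simp: root_triple_def root_space_def)
  let ?E = "rep_act twisted e'"
  have lin: "lin_on (rep_scale M) C (?E ^^ n)" for n
    by (rule lin_on_funpow[OF tw.act_lin[OF e'(2)]])
  have vC: "v \<in> C" using v socle_C by blast
  obtain E g where Eg: "finite E" "E \<subseteq> dual_space L H" "\<And>\<nu>. \<nu> \<in> E \<Longrightarrow> g \<nu> \<in> weight_space H twisted \<nu>" "v = sum g E"
    using tw.weight_decomposition[OF vC] by metis
  have gC: "g \<nu> \<in> C" if "\<nu> \<in> E" for \<nu> using tw.wt_C[OF Eg(3)[OF that]] .
  have "\<exists>n. \<forall>k\<ge>n. (?E ^^ k) (g \<nu>) = 0" if \<nu>: "\<nu> \<in> E" for \<nu>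
  proof -
    have "(\<lambda>z. \<nu> z + x * \<alpha> z) \<in> dual_space L H"
      using \<nu> Eg(2) triple_facts(1) by (intro dual_space_shift) auto
    then obtain K where K: "\<And>k. k \<ge> K \<Longrightarrow> wt (\<lambda>z. (\<nu> z + x * \<alpha> z) + of_nat k * \<beta> z) = {0}"
      using weight_string_bounded[OF t _ nil] by blast
    have "(?E ^^ k) (g \<nu>) = 0" if "k \<ge> K" for k
      using tw.wt_root_pow[OF e'(1) Eg(3)[OF \<nu>], of k] K[OF that]
      by (simp add: twisted_weight_space algebra_simps)
    then show ?thesis by blast
  qed
  then obtain n where n: "\<And>\<nu> k. \<nu> \<in> E \<Longrightarrow> k \<ge> n \<nu> \<Longrightarrow> (?E ^^ k) (g \<nu>) = 0" by metis
  define k where "k = (\<Sum>\<nu>\<in>E. n \<nu>)"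
  have "(?E ^^ k) (g \<nu>) = 0" if "\<nu> \<in> E" for \<nu>
    using n[OF that, of k] member_le_sum[OF that _ Eg(1), of n] by (simp add: k_def)
  moreover have "(?E ^^ k) v = (\<Sum>\<nu>\<in>E. (?E ^^ k) (g \<nu>))"
    unfolding Eg(4) by (rule lin_on_sum[OF lin subspace_C gC])
  ultimately have "(?E ^^ k) v = 0" by simp
  then show ?thesis unfolding socle_simps by blast
qed

lemma conj_uea: "conjugation (rep_scale M) C (uea_act twisted (uea_gen L f)) G"
proof -
  have eq: "uea_act twisted (uea_gen L f) v = F v" if "v \<in> C" for v
    using tw.uea_act_gen[OF triple_facts(8) that] twisted_f[OF that] by simp
  show ?thesis
  proof (intro conjugation.intro conjugation_axioms.intro lin_space_axioms subspace_C cj.G)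
    show "lin_on (rep_scale M) C (uea_act twisted (uea_gen L f))"
      by (rule tw.uea_act_lin[OF gen_closed[OF triple_facts(8)]])
    fix v assume v: "v \<in> C"
    have "G v \<in> C" using cj.G v by (rule lin_on_closed)
    then show "uea_act twisted (uea_gen L f) (G v) = v" using cj.FG[OF v] by (simp add: eq)
    show "G (uea_act twisted (uea_gen L f) v) = v" using cj.GF[OF v] by (simp add: eq[OF v])
  qed
qed

lemma uea_gen_f: "v \<in> C \<Longrightarrow> uea_act twisted (uea_gen L f) v = F v"
  using tw.uea_act_gen[OF triple_facts(8)] twisted_f by simp

lemma uea_gen_f_pow: "v \<in> C \<Longrightarrow> (uea_act twisted (uea_gen L f) ^^ n) v = (F ^^ n) v"
  by (induction n) (auto simp: uea_gen_f cj.F_pow_closed)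

sublocale loc: localized_action "uea L" "uea_gen L f" "rep_scale M" C "uea_act twisted" G
proof (intro localized_action.intro conj_uea localized_action_axioms.intro)
  show "ad_nilpotent U (uea_gen L f)"
    by (rule ad_nilpotent_uea[OF triple_facts(8) zero_L f_nil])
qed (auto intro: tw.uea_act_lin tw.uea_act_mult tw.uea_act_add tw.uea_act_one)

text \<open>Twisting back recovers the original action on \<open>M\<close>: this is clear on generators, and both sides
  are multiplicative.\<close>

lemma untwist:
  assumes "X \<in> carrier U" "v \<in> C"
  shows "loc.conj_power x (uea_act twisted X) v = uea_act M X v"
  using assms
proof (induction arbitrary: v rule: uea_induct)
  case (scalar c)
  have lin: "lin_on (rep_scale M) C (rep_scale M c)"
    using subspace_C by (simp add: lin_on_def subspace_scale scale_right_distrib mult.commute)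
  have d1: "(loc.conj_diff ^^ 1) (rep_scale M c) u = 0" if "u \<in> C" for u
    using loc.FG[OF that] lin_on_scale[OF loc.F lin_on_closed[OF loc.G that]] by (simp add: loc.conj_diff_def)
  have "loc.conj_power x (uea_act twisted (uea_scalar L c)) v = loc.conj_power x (rep_scale M c) v"
    by (rule loc.conj_power_cong[OF _ scalar]) (simp add: tw.uea_act_scalar)
  also have "\<dots> = (\<Sum>i<1. rep_scale M (x gchoose i) ((loc.conj_diff ^^ i) (rep_scale M c) v))"
    using loc.conj_diff_pow_vanish[of 1 "rep_scale M c" _ v] d1 scalar by (intro loc.conj_power_upto) blast
  finally show ?case by (simp add: uea_act_scalar scalar)
next
  case (gen y)
  note lin = act_lin[OF gen(1)] and nil = act_conj_nilpotent[OF gen(1)]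
  have eq: "cj.conj_power z u v = loc.conj_power z u v" if "lin_on (rep_scale M) C u" "v \<in> C" for z u v
    by (rule conj_power_cong_base(2)[OF cj.conjugation_axioms loc.conjugation_axioms _ that])
      (simp add: uea_gen_f)
  have "loc.conj_power x (uea_act twisted (uea_gen L y)) v = loc.conj_power x (cj.conj_power (- x) (rep_act M y)) v"
    using gen by (intro loc.conj_power_cong) (simp_all add: tw.uea_act_gen twisted_simps)
  also have "\<dots> = cj.conj_power x (cj.conj_power (- x) (rep_act M y)) v"
    by (rule eq[symmetric, OF cj.conj_power_lin[OF lin nil] gen(2)])
  also have "\<dots> = rep_act M y v" by (rule cj.conj_power_neg[OF lin nil gen(2)])
  finally show ?case using gen by (simp add: uea_act_gen)
next
  case (mult X Y)
  have YC: "uea_act M Y v \<in> C" using uea_act_lin[OF mult(2)] mult(5) by (rule lin_on_closed)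
  have "loc.conj_power x (uea_act twisted (X \<otimes>\<^bsub>U\<^esub> Y)) v
      = loc.conj_power x (uea_act twisted X) (loc.conj_power x (uea_act twisted Y) v)"
    using mult tw.uea_act_mult
    by (intro loc.conj_power_mult loc.action_lin loc.action_conj_nilpotent) (auto simp: loc.m_closed)
  then show ?case using mult YC by (simp add: uea_act_mult)
next
  case (add X Y)
  have "loc.conj_power x (uea_act twisted (X \<oplus>\<^bsub>U\<^esub> Y)) v
      = rep_scale M 1 (loc.conj_power x (uea_act twisted X) v) + rep_scale M 1 (loc.conj_power x (uea_act twisted Y) v)"
    using add tw.uea_act_add
    by (intro loc.conj_power_combination loc.action_lin loc.action_conj_nilpotent) auto
  then show ?case using add by (simp add: uea_act_add)
qed

lemma uea_act_socle: "uea_act socle_rep X v = uea_act twisted X v"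
  by (simp add: uea_act_def free_act_def socle_simps twisted_simps(2))

lemma socle_localization:
  "localized_submodule U (uea_gen L f) (rep_scale M) C (uea_act twisted) G (uea_module socle_rep)"
proof -
  have "lin_space (rep_scale socle_rep)" unfolding socle_simps by (rule lin_space_axioms)
  then interpret so: lie_rep L socle_rep
    by (intro lie_rep.intro lie_closed_axioms lie_rep_axioms.intro socle_module)
  show ?thesis
  proof (intro localized_submodule.intro loc.localized_action_axioms localized_submodule_axioms.intro)
    show "subspace (carrier (uea_module socle_rep))" "carrier (uea_module socle_rep) \<subseteq> C"
      using socle_submodule by (auto simp: uea_module_simps socle_simps tw.submodule_def)
    fix X v assume "X \<in> carrier U" "v \<in> carrier (uea_module socle_rep)"
    then show "X \<odot>\<^bsub>uea_module socle_rep\<^esub> v = uea_act twisted X v"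
      "uea_act twisted X v \<in> carrier (uea_module socle_rep)"
      using lin_on_closed[OF so.uea_act_lin] by (auto simp: uea_module_simps uea_act_socle)
  next
    fix v assume v: "v \<in> C"
    show "\<exists>n. (uea_act twisted (uea_gen L f) ^^ n) v \<in> carrier (uea_module socle_rep)"
      using absorbing[OF socle_submodule socle_nonzero v]
      by (simp add: uea_gen_f_pow[OF v] uea_module_simps socle_simps)
  qed (simp add: uea_module_simps)
qed

text \<open>The isomorphism sends \<open>v\<close> to the tensor that evaluates to \<open>v\<close> in the twist. It is equivariant because
  the twist by \<open>x\<close> of the localization undoes the twist by \<open>-x\<close>.\<close>

lemma socle_isomorphic:
  "module_isomorphic U (uea_module M) (twisted_localization L f x socle_rep)"
proof -
  interpret ls: localized_submodule U "uea_gen L f" "rep_scale M" C "uea_act twisted" G "uea_module socle_rep"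
    by (rule socle_localization)
  have S: "f_powers L f = loc.S" unfolding f_powers_def loc.S_def ..
  have A: "U_loc L f = loc.A" and \<iota>: "U_loc_map L f = ore_map U loc.S"
    unfolding U_loc_def U_loc_map_def S by simp_all
  have P: "localization L f socle_rep = ls.P"
    unfolding localization_def A \<iota> ..
  have th: "theta L f x (U_loc_map L f X) \<in> carrier loc.A"
    "loc.act (theta L f x (U_loc_map L f X)) v = uea_act M X v"
    if X: "X \<in> carrier U" and v: "v \<in> C" for X v
  proof -
    have adf: "ad_f L f = (\<lambda>u. (U_loc_map L f (uea_gen L f) \<otimes>\<^bsub>loc.A\<^esub> u) \<ominus>\<^bsub>loc.A\<^esub> (u \<otimes>\<^bsub>loc.A\<^esub> U_loc_map L f (uea_gen L f)))"
      unfolding ad_f_def[abs_def] Let_def A ..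
    have eq: "theta L f x (U_loc_map L f X) = (\<Oplus>\<^bsub>loc.A\<^esub>i\<in>{i. (ad_f L f ^^ i) (U_loc_map L f X) \<noteq> \<zero>\<^bsub>loc.A\<^esub>}.
           U_loc_map L f (uea_scalar L (x gchoose i)) \<otimes>\<^bsub>loc.A\<^esub> (ad_f L f ^^ i) (U_loc_map L f X)
             \<otimes>\<^bsub>loc.A\<^esub> (inv\<^bsub>loc.A\<^esub> (U_loc_map L f (uea_gen L f))) [^]\<^bsub>loc.A\<^esub> i)"
      unfolding theta_def Let_def A ..
    note t = loc.act_theta[OF X v scalar_closed tw.uea_act_scalar \<iota> adf eq]
    show "theta L f x (U_loc_map L f X) \<in> carrier loc.A" by (rule t(1))
    show "loc.act (theta L f x (U_loc_map L f X)) v = uea_act M X v"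
      using t(2) untwist[OF X v] by simp
  qed
  show ?thesis
    unfolding module_isomorphic_def twisted_localization_def
  proof (intro exI[of _ ls.coset] conjI ballI)
    show "bij_betw ls.coset (carrier (uea_module M))
       (carrier (restrict_scalars (U_loc_map L f) (twist L f x (localization L f socle_rep))))"
      using ls.coset_bij by (simp add: uea_module_simps restrict_scalars_def twist_def P)
  next
    fix v u assume "v \<in> carrier (uea_module M)" "u \<in> carrier (uea_module M)"
    then show "ls.coset (v \<oplus>\<^bsub>uea_module M\<^esub> u) = ls.coset v
       \<oplus>\<^bsub>restrict_scalars (U_loc_map L f) (twist L f x (localization L f socle_rep))\<^esub> ls.coset u"
      using ls.coset_add by (simp add: uea_module_simps restrict_scalars_def twist_def P)
  next
    fix X v assume X: "X \<in> carrier U" and "v \<in> carrier (uea_module M)"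
    then have v: "v \<in> C" by (simp add: uea_module_simps)
    show "ls.coset (X \<odot>\<^bsub>uea_module M\<^esub> v) = X
       \<odot>\<^bsub>restrict_scalars (U_loc_map L f) (twist L f x (localization L f socle_rep))\<^esub> ls.coset v"
      using ls.coset_smult[OF th(1)[OF X v] v] th(2)[OF X v]
      by (simp add: uea_module_simps restrict_scalars_def twist_def P)
  qed
qed

end

section \<open>Root vectors in the finite-dimensional algebra\<close>

context lin_space
begin

text \<open>Linearly independent functionals take arbitrary prescribed values.\<close>

lemma independent_functionals:
  assumes "finite B" and H: "subspace H"
    and lin: "\<And>\<beta> h k. \<beta> \<in> B \<Longrightarrow> h \<in> H \<Longrightarrow> k \<in> H \<Longrightarrow> \<beta> (h + k) = \<beta> h + \<beta> k"
      "\<And>\<beta> c h. \<beta> \<in> B \<Longrightarrow> h \<in> H \<Longrightarrow> \<beta> (c *s h) = c * \<beta> h"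
    and ind: "\<And>c. (\<forall>h\<in>H. (\<Sum>\<beta>\<in>B. c \<beta> * \<beta> h) = 0) \<Longrightarrow> \<forall>\<beta>\<in>B. c \<beta> = 0"
  shows "\<exists>h\<in>H. \<forall>\<beta>\<in>B. (\<beta> h :: 'a) = t \<beta>"
  using assms(1) lin ind
proof (induction B arbitrary: t rule: finite_induct)
  case empty
  then show ?case using subspace_0[OF H] by auto
next
  case (insert \<gamma> B)
  have indB: "\<forall>\<beta>\<in>B. c \<beta> = 0" if "\<forall>h\<in>H. (\<Sum>\<beta>\<in>B. c \<beta> * \<beta> h) = 0" for c
  proof -
    have "(\<Sum>\<beta>\<in>insert \<gamma> B. (if \<beta> = \<gamma> then 0 else c \<beta>) * \<beta> h) = (\<Sum>\<beta>\<in>B. c \<beta> * \<beta> h)" for h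
      using insert.hyps by (simp, intro sum.cong) auto
    then have "\<forall>\<beta>\<in>insert \<gamma> B. (if \<beta> = \<gamma> then 0 else c \<beta>) = 0"
      using that by (intro insert.prems(3)) simp
    then show ?thesis using insert.hyps(2) by (metis insertI2)
  qed
  have IH: "\<exists>h\<in>H. \<forall>\<beta>\<in>B. \<beta> h = t \<beta>" for t
    by (rule insert.IH) (use insert.prems(1,2) indB in auto)
  have lin\<gamma>: "\<gamma> (h + k) = \<gamma> h + \<gamma> k" "\<gamma> (c *s h) = c * \<gamma> h" if "h \<in> H" "k \<in> H" for h k c
    using insert.prems(1,2) that by auto
  note add = insert.prems(1) and scl = insert.prems(2)
  have linsum: "\<beta> (\<Sum>i\<in>J. c i *s y i) = (\<Sum>i\<in>J. c i * \<beta> (y i))"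
    if \<beta>: "\<beta> \<in> insert \<gamma> B" and y: "\<And>i. i \<in> J \<Longrightarrow> y i \<in> H" for \<beta> c and J :: "('b \<Rightarrow> 'a) set" and y
  proof -
    have zero: "\<beta> 0 = 0" using scl[OF \<beta> subspace_0[OF H], of 0] by simp
    show ?thesis using y
    proof (induction J rule: infinite_finite_induct)
      case (insert i J)
      have s: "(\<Sum>i\<in>J. c i *s y i) \<in> H" and yi: "y i \<in> H"
        using insert.prems by (auto intro!: subspace_sum subspace_scale H)
      have "\<beta> (c i *s y i + (\<Sum>i\<in>J. c i *s y i)) = c i * \<beta> (y i) + \<beta> (\<Sum>i\<in>J. c i *s y i)"
        unfolding add[OF \<beta> subspace_scale[OF H yi] s] scl[OF \<beta> yi] ..
      then show ?case using insert by simp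
    qed (simp_all add: zero)
  qed
  obtain d where d: "\<And>\<alpha>. \<alpha> \<in> B \<Longrightarrow> d \<alpha> \<in> H \<and> (\<forall>\<beta>\<in>B. \<beta> (d \<alpha>) = (if \<beta> = \<alpha> then 1 else 0))"
    using IH[of "\<lambda>\<beta>. if \<beta> = \<alpha> then 1 else 0" for \<alpha>] by metis
  have "\<exists>k\<in>H. (\<forall>\<beta>\<in>B. \<beta> k = 0) \<and> \<gamma> k \<noteq> 0"
  proof (rule ccontr)
    assume no: "\<not> ?thesis"
    have "\<gamma> h = (\<Sum>\<beta>\<in>B. \<gamma> (d \<beta>) * \<beta> h)" if h: "h \<in> H" for h
    proof -
      define k where "k = h + (- 1) *s (\<Sum>\<alpha>\<in>B. \<alpha> h *s d \<alpha>)"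
      have s: "(\<Sum>\<alpha>\<in>B. \<alpha> h *s d \<alpha>) \<in> H" using d by (intro subspace_sum subspace_scale H) auto
      have kH: "k \<in> H" unfolding k_def by (intro subspace_add subspace_scale H h s)
      have val: "\<beta> k = \<beta> h - (\<Sum>\<alpha>\<in>B. \<alpha> h * \<beta> (d \<alpha>))" if "\<beta> \<in> insert \<gamma> B" for \<beta>
        unfolding k_def
        using insert.prems(1)[OF that h subspace_scale[OF H s, of "- 1"]] insert.prems(2)[OF that s, of "- 1"]
          linsum[OF that, of B d "\<lambda>\<alpha>. \<alpha> h"] d by simp
      have "\<beta> k = 0" if b: "\<beta> \<in> B" for \<beta>
      proof -
        have "(\<Sum>\<alpha>\<in>B. \<alpha> h * \<beta> (d \<alpha>)) = (\<Sum>\<alpha>\<in>B. if \<alpha> = \<beta> then \<beta> h else 0)"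
        proof (intro sum.cong HOL.refl)
          fix \<alpha> assume "\<alpha> \<in> B"
          then have "\<beta> (d \<alpha>) = (if \<beta> = \<alpha> then 1 else 0)" using d b by blast
          then show "\<alpha> h * \<beta> (d \<alpha>) = (if \<alpha> = \<beta> then \<beta> h else 0)" by auto
        qed
        then show ?thesis using val[of \<beta>] b insert.hyps(1) by simp
      qed
      then have "\<gamma> k = 0" using no kH by blast
      then show ?thesis using val[of \<gamma>] by (simp add: mult.commute)
    qed
    then have "\<forall>h\<in>H. (\<Sum>\<beta>\<in>insert \<gamma> B. (if \<beta> = \<gamma> then - 1 else \<gamma> (d \<beta>)) * \<beta> h) = 0"
    proof (intro ballI)
      fix h assume h: "h \<in> H" and eq: "\<And>h. h \<in> H \<Longrightarrow> \<gamma> h = (\<Sum>\<beta>\<in>B. \<gamma> (d \<beta>) * \<beta> h)"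
      have "(\<Sum>\<beta>\<in>B. (if \<beta> = \<gamma> then - 1 else \<gamma> (d \<beta>)) * \<beta> h) = (\<Sum>\<beta>\<in>B. \<gamma> (d \<beta>) * \<beta> h)"
        using insert.hyps(2) by (intro sum.cong) auto
      then show "(\<Sum>\<beta>\<in>insert \<gamma> B. (if \<beta> = \<gamma> then - 1 else \<gamma> (d \<beta>)) * \<beta> h) = 0"
        using insert.hyps eq[OF h] by simp
    qed
    then have "(- 1 :: 'a) = 0" using insert.prems(3)[of "\<lambda>\<beta>. if \<beta> = \<gamma> then - 1 else \<gamma> (d \<beta>)"] by auto
    then show False by simp
  qed
  then obtain k where k: "k \<in> H" "\<And>\<beta>. \<beta> \<in> B \<Longrightarrow> \<beta> k = 0" "\<gamma> k \<noteq> 0" by blast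
  obtain h where h: "h \<in> H" "\<And>\<beta>. \<beta> \<in> B \<Longrightarrow> \<beta> h = t \<beta>" using IH[of t] by blast
  define y where "y = h + ((t \<gamma> - \<gamma> h) / \<gamma> k) *s k"
  have "y \<in> H" unfolding y_def by (intro subspace_add subspace_scale H h k)
  moreover have "\<beta> y = t \<beta>" if "\<beta> \<in> insert \<gamma> B" for \<beta>
    using that insert.prems(1)[OF that h(1) subspace_scale[OF H k(1)]] insert.prems(2)[OF that k(1)] h k
    by (auto simp: y_def)
  ultimately show ?case by blast
qed

end

locale fin_dim_lie_algebra =
  fixes L :: "('k::{alg_closed_field, field_char_0}, 'g::ab_group_add) lie_alg"
  assumes lie: "lie_algebra L" and fd: "fin_dim (lie_scale L) (lie_carrier L)"

sublocale fin_dim_lie_algebra \<subseteq> lin_space "lie_scale L"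
  using lie by (auto simp: lie_algebra_def intro: lin_space.intro)

context fin_dim_lie_algebra
begin

abbreviation "\<g> \<equiv> lie_carrier L"
abbreviation br where "br \<equiv> lie_bracket L"

lemma g_subspace: "subspace \<g>" using lie by (simp add: lie_algebra_def)

lemma br_closed: "x \<in> \<g> \<Longrightarrow> y \<in> \<g> \<Longrightarrow> br x y \<in> \<g>"
  and br_add_left: "x \<in> \<g> \<Longrightarrow> y \<in> \<g> \<Longrightarrow> z \<in> \<g> \<Longrightarrow> br (x + y) z = br x z + br y z"
  and br_add_right: "x \<in> \<g> \<Longrightarrow> y \<in> \<g> \<Longrightarrow> z \<in> \<g> \<Longrightarrow> br z (x + y) = br z x + br z y"
  and br_scale_left: "x \<in> \<g> \<Longrightarrow> y \<in> \<g> \<Longrightarrow> br (lie_scale L c x) y = lie_scale L c (br x y)"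
  and br_scale_right: "x \<in> \<g> \<Longrightarrow> y \<in> \<g> \<Longrightarrow> br x (lie_scale L c y) = lie_scale L c (br x y)"
  and br_self: "x \<in> \<g> \<Longrightarrow> br x x = 0"
  and jacobi: "x \<in> \<g> \<Longrightarrow> y \<in> \<g> \<Longrightarrow> z \<in> \<g> \<Longrightarrow> br x (br y z) + br y (br z x) + br z (br x y) = 0"
  using lie by (auto simp: lie_algebra_def)

lemma br_lin: "x \<in> \<g> \<Longrightarrow> lin_on (lie_scale L) \<g> (br x)"
  by (intro lin_onI br_closed br_add_right br_scale_right)

lemma br_zero_right: "x \<in> \<g> \<Longrightarrow> br x 0 = 0"
  by (rule lin_on_zero[OF br_lin g_subspace])

lemma br_anti: "x \<in> \<g> \<Longrightarrow> y \<in> \<g> \<Longrightarrow> br y x = - br x y"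
proof -
  assume xy: "x \<in> \<g>" "y \<in> \<g>"
  have "br (x + y) (x + y) = 0" using xy subspace_add[OF g_subspace] by (intro br_self) auto
  moreover have "br (x + y) (x + y) = br x (x + y) + br y (x + y)"
    using xy subspace_add[OF g_subspace] by (intro br_add_left) auto
  moreover have "br x (x + y) = br x y" "br y (x + y) = br y x"
    using xy by (simp_all add: br_add_right br_self)
  ultimately have "br x y + br y x = 0" by simp
  then show ?thesis by (simp add: eq_neg_iff_add_eq_0 add.commute)
qed

lemma br_zero_left: "x \<in> \<g> \<Longrightarrow> br 0 x = 0"
  using br_anti[of x 0] br_zero_right[of x] subspace_0[OF g_subspace] by simp

lemma br_derivation:
  assumes "x \<in> \<g>" "y \<in> \<g>" "z \<in> \<g>"
  shows "br x (br y z) = br (br x y) z + br y (br x z)"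
proof -
  have "br z (br x y) = - br (br x y) z" using assms by (intro br_anti br_closed)
  moreover have "br y (br z x) = - br y (br x z)"
    using assms br_anti[of x z] lin_on_minus[OF br_lin[OF assms(2)] g_subspace br_closed[OF assms(1,3)]]
    by simp
  ultimately have "br x (br y z) + (- br y (br x z)) + (- br (br x y) z) = 0"
    using jacobi[OF assms] by simp
  then show ?thesis by (simp add: algebra_simps)
qed

text \<open>An eigenvector of a diagonalizable \<open>ad h\<close> with nonzero eigenvalue is ad-nilpotent, because it
  shifts the finitely many eigenvalues of \<open>ad h\<close>.\<close>

lemma eigenvector_ad_nilpotent:
  assumes h: "h \<in> \<g>" and diag: "\<g> \<subseteq> span {x \<in> \<g>. \<exists>c. br h x = lie_scale L c x}"
    and y: "y \<in> \<g>" "br h y = lie_scale L b y" "b \<noteq> 0"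
  shows "\<exists>N. \<forall>z\<in>\<g>. (br y ^^ N) z = 0"
proof -
  obtain B where B: "finite B" "\<g> \<subseteq> span B" using fd by (auto simp: fin_dim_def)
  define Ev where "Ev = {a. \<exists>v\<in>\<g>. v \<noteq> 0 \<and> br h v = lie_scale L a v}"
  have Ev: "finite Ev" unfolding Ev_def by (rule finite_eigenvalues[OF br_lin[OF h] g_subspace B])
  have shift: "br h ((br y ^^ k) z) = lie_scale L (a + of_nat k * b) ((br y ^^ k) z)"
    if z: "z \<in> \<g>" "br h z = lie_scale L a z" for a z k
  proof (induction k)
    case 0
    then show ?case using z by simp
  next
    case (Suc k)
    have cl: "(br y ^^ k) z \<in> \<g>" by (rule lin_on_funpow_closed[OF br_lin[OF y(1)] z(1)])
    have "br h (br y ((br y ^^ k) z)) = br (br h y) ((br y ^^ k) z) + br y (br h ((br y ^^ k) z))"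
      by (rule br_derivation[OF h y(1) cl])
    also have "\<dots> = lie_scale L (b + (a + of_nat k * b)) (br y ((br y ^^ k) z))"
      unfolding y(2) Suc br_scale_left[OF y(1) cl] br_scale_right[OF y(1) cl] by (rule scale_left_distrib[symmetric])
    finally show ?case by (simp add: algebra_simps)
  qed
  have "finite {k :: nat. a + of_nat k * b \<in> Ev}" for a
  proof -
    have "inj (\<lambda>k :: nat. a + of_nat k * b)" using y(3) by (auto simp: inj_on_def)
    then have "finite ((\<lambda>k :: nat. a + of_nat k * b) -` Ev)" using Ev by (rule finite_vimageI[rotated])
    then show ?thesis by (simp add: vimage_def)
  qed
  then have "\<forall>a. \<exists>N. \<forall>k\<ge>N. a + of_nat k * b \<notin> Ev"
    unfolding finite_nat_set_iff_bounded by (metis mem_Collect_eq not_less)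
  then obtain N where N: "\<And>a k. k \<ge> N a \<Longrightarrow> a + of_nat k * b \<notin> Ev" by metis
  define M where "M = (\<Sum>a\<in>Ev. N a)"
  have kill: "(br y ^^ M) z = 0" if z: "z \<in> \<g>" "br h z = lie_scale L a z" for a z
  proof (cases "z = 0")
    case True
    then show ?thesis using lin_on_zero[OF lin_on_funpow[OF br_lin[OF y(1)]] g_subspace] by simp
  next
    case False
    then have "a \<in> Ev" using z by (auto simp: Ev_def)
    then have "N a \<le> M" unfolding M_def by (intro member_le_sum) (auto simp: Ev)
    then have "a + of_nat M * b \<notin> Ev" by (rule N)
    then show ?thesis
      using shift[OF z, of M] lin_on_funpow_closed[OF br_lin[OF y(1)] z(1), of M] unfolding Ev_def by blast
  qed
  have "(br y ^^ M) z = 0" if "z \<in> \<g>" for z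
    by (rule span_subset_vanish[OF lin_on_funpow[OF br_lin[OF y(1)]] g_subspace _ diag _ that])
      (use kill in auto)
  then show ?thesis by blast
qed

text \<open>If \<open>y\<close> and \<open>z\<close> have the same weight, subtracting a multiple of \<open>y\<close> from \<open>z\<close> achieves that
  \<open>[y, [x, z]] = 0\<close>. Then \<open>ad x\<close> maps \<open>ad(y)\<^sup>k\<^sup>+\<^sup>1 z\<close> to a nonzero multiple of \<open>ad(y)\<^sup>k z\<close>, which
  contradicts the nilpotency of \<open>ad y\<close> unless \<open>z = 0\<close>.\<close>

lemma root_space_line:
  assumes K: "subspace K" "K \<subseteq> \<g>"
    and a: "\<And>h k. h \<in> K \<Longrightarrow> k \<in> K \<Longrightarrow> a (h + k) = a h + a k" "\<And>c h. h \<in> K \<Longrightarrow> a (lie_scale L c h) = c * a h"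
    and x: "x \<in> \<g>" "\<And>h. h \<in> K \<Longrightarrow> br h x = lie_scale L (a h) x"
    and y: "y \<in> \<g>" "\<And>h. h \<in> K \<Longrightarrow> br h y = lie_scale L (- a h) y"
    and xy: "br x y \<in> K" "a (br x y) = 2"
    and z: "z \<in> \<g>" "\<And>h. h \<in> K \<Longrightarrow> br h z = lie_scale L (- a h) z"
    and xz: "br x z \<in> K"
    and nil: "\<And>v. v \<in> \<g> \<Longrightarrow> (br y ^^ N) v = 0"
  shows "z = lie_scale L (a (br x z) / 2) y"
proof -
  define h0 where "h0 = br x y"
  define s where "s = a (br x z) / 2"
  define w where "w = z + lie_scale L (- s) y"
  have w: "w \<in> \<g>" unfolding w_def using y z g_subspace by (intro subspace_add subspace_scale)
  have h0: "h0 \<in> K" "h0 \<in> \<g>" using xy K by (auto simp: h0_def)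
  have xw: "br x w = br x z + lie_scale L (- s) h0"
    unfolding w_def h0_def using x y z g_subspace by (simp add: br_add_right subspace_scale br_scale_right del: scale_minus_left)
  have xwK: "br x w \<in> K" unfolding xw by (intro subspace_add subspace_scale K xz h0)
  have axw: "a (br x w) = 0"
    unfolding xw using a(1)[OF xz subspace_scale[OF K(1) h0(1), of "- s"]] a(2)[OF h0(1), of "- s"] xy(2)
    by (simp add: h0_def s_def)
  have yxw: "br y (br x w) = 0"
    using br_anti[of "br x w" y] y(2)[OF xwK] axw y(1) xwK K(2) by auto
  have cl: "(br y ^^ k) w \<in> \<g>" for k by (rule lin_on_funpow_closed[OF br_lin[OF y(1)] w])
  have hw: "br h0 w = lie_scale L (- 2) w"
  proof -
    have "br h0 w = br h0 z + lie_scale L (- s) (br h0 y)"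
      unfolding w_def using h0 y z g_subspace by (simp add: br_add_right subspace_scale br_scale_right del: scale_minus_left)
    also have "\<dots> = lie_scale L (- 2) w"
      unfolding y(2)[OF h0(1)] z(2)[OF h0(1)] w_def using xy(2)
      by (simp add: h0_def scale_right_diff_distrib mult.commute)
    finally show ?thesis .
  qed
  have hy: "br h0 y = lie_scale L (- 2) y" using y(2)[OF h0(1)] xy(2) by (simp add: h0_def)
  have hk: "br h0 ((br y ^^ k) w) = lie_scale L (- 2 * (of_nat k + 1)) ((br y ^^ k) w)" for k
  proof (induction k)
    case 0
    then show ?case using hw by simp
  next
    case (Suc k)
    have "br h0 (br y ((br y ^^ k) w)) = br (br h0 y) ((br y ^^ k) w) + br y (br h0 ((br y ^^ k) w))"
      by (rule br_derivation[OF h0(2) y(1) cl])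
    also have "\<dots> = lie_scale L (- 2 + - 2 * (of_nat k + 1)) (br y ((br y ^^ k) w))"
      unfolding Suc hy br_scale_left[OF y(1) cl] br_scale_right[OF y(1) cl]
      by (rule scale_left_distrib[symmetric])
    finally show ?case by (simp add: algebra_simps)
  qed
  have up: "br x ((br y ^^ Suc k) w) = lie_scale L (- ((of_nat k + 1) * (of_nat k + 2))) ((br y ^^ k) w)" for k
  proof (induction k)
    case 0
    have "br x (br y w) = br h0 w + br y (br x w)"
      unfolding h0_def by (rule br_derivation[OF x(1) y(1) w])
    then show ?case using hw yxw by simp
  next
    case (Suc k)
    have "br x ((br y ^^ Suc (Suc k)) w) = br h0 ((br y ^^ Suc k) w) + br y (br x ((br y ^^ Suc k) w))"
      using br_derivation[OF x(1) y(1) cl[of "Suc k"]] by (simp add: h0_def)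
    also have "\<dots> = lie_scale L (- 2 * (of_nat (Suc k) + 1)) ((br y ^^ Suc k) w)
        + lie_scale L (- ((of_nat k + 1) * (of_nat k + 2))) ((br y ^^ Suc k) w)"
      unfolding hk[of "Suc k"] Suc br_scale_right[OF y(1) cl[of k]] by simp
    also have "\<dots> = lie_scale L (- 2 * (of_nat (Suc k) + 1) + - ((of_nat k + 1) * (of_nat k + 2))) ((br y ^^ Suc k) w)"
      by (simp only: scale_left_distrib)
    also have "- 2 * (of_nat (Suc k) + 1) + - ((of_nat k + 1) * (of_nat k + 2))
        = - ((of_nat (Suc k) + 1) * (of_nat (Suc k) + 2 :: 'k))"
      by (simp add: algebra_simps)
    finally show ?case .
  qed
  have "(br y ^^ (N - k)) w = 0" for k
  proof (induction k)
    case 0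
    then show ?case using nil[OF w] by simp
  next
    case (Suc k)
    show ?case
    proof (cases "N \<le> k")
      case True
      then show ?thesis using Suc by simp
    next
      case False
      then have "N - k = Suc (N - Suc k)" by simp
      then have "lie_scale L (- ((of_nat (N - Suc k) + 1) * (of_nat (N - Suc k) + 2))) ((br y ^^ (N - Suc k)) w) = 0"
        using up[of "N - Suc k"] Suc br_zero_right[OF x(1)] by simp
      moreover have "(of_nat (N - Suc k) + 1 :: 'k) \<noteq> 0" "(of_nat (N - Suc k) + 2 :: 'k) \<noteq> 0"
        using of_nat_neq_0[of "N - Suc k", where 'a = 'k] of_nat_neq_0[of "Suc (N - Suc k)", where 'a = 'k]
        by (simp_all add: add.commute del: of_nat_diff)
      ultimately show ?thesis by (simp only: scale_eq_0_iff neg_equal_0_iff_equal mult_eq_0_iff) auto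
    qed
  qed
  from this[of N] have "w = 0" by simp
  then have "z = lie_scale L s y" by (simp add: w_def)
  then show ?thesis by (simp add: s_def)
qed

end

locale cartan_alg = fin_dim_lie_algebra L
  for L :: "('k::{alg_closed_field, field_char_0}, 'g::ab_group_add) lie_alg" +
  fixes H :: "'g set"
  assumes cartan: "cartan_subalgebra L H"
begin

lemma H_subspace: "subspace H" and H_subset: "H \<subseteq> \<g>"
  and H_comm: "h \<in> H \<Longrightarrow> k \<in> H \<Longrightarrow> br h k = 0"
  and H_diag: "h \<in> H \<Longrightarrow> \<g> \<subseteq> span {x \<in> \<g>. \<exists>c. br h x = lie_scale L c x}"
  using cartan by (auto simp: cartan_subalgebra_def abelian_subalgebra_def)

lemma H_maximal:
  assumes z: "z \<in> \<g>" "\<And>h. h \<in> H \<Longrightarrow> br h z = 0"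
  shows "z \<in> H"
proof -
  define A where "A = {h + lie_scale L c z | h c. h \<in> H}"
  have HA: "H \<subseteq> A"
  proof
    fix h assume "h \<in> H"
    then have "h = h + lie_scale L 0 z \<and> h \<in> H" by simp
    then show "h \<in> A" unfolding A_def by blast
  qed
  have "subspace A"
    unfolding subspace_def
  proof (intro conjI ballI allI)
    show "0 \<in> A" using HA subspace_0[OF H_subspace] by blast
    fix u v assume "u \<in> A" "v \<in> A"
    then obtain h c h' c' where "u = h + lie_scale L c z" "v = h' + lie_scale L c' z" "h \<in> H" "h' \<in> H"
      unfolding A_def by blast
    then have "u + v = (h + h') + lie_scale L (c + c') z \<and> h + h' \<in> H"
      using subspace_add[OF H_subspace] by (simp add: scale_left_distrib algebra_simps)
    then show "u + v \<in> A" unfolding A_def by blast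
  next
    fix c u assume "u \<in> A"
    then obtain h c' where "u = h + lie_scale L c' z" "h \<in> H" unfolding A_def by blast
    then have "lie_scale L c u = lie_scale L c h + lie_scale L (c * c') z \<and> lie_scale L c h \<in> H"
      using subspace_scale[OF H_subspace] by (simp add: scale_right_distrib)
    then show "lie_scale L c u \<in> A" unfolding A_def by blast
  qed
  moreover have Ag: "A \<subseteq> \<g>"
    unfolding A_def using H_subset z g_subspace by (auto intro!: subspace_add subspace_scale)
  moreover have "br u v = 0" if "u \<in> A" "v \<in> A" for u v
  proof -
    obtain h c h' c' where *: "u = h + lie_scale L c z" "v = h' + lie_scale L c' z" "h \<in> H" "h' \<in> H"
      using \<open>u \<in> A\<close> \<open>v \<in> A\<close> unfolding A_def by blast
    have hz: "br z k = 0" if "k \<in> H" for k using br_anti[of k z] z that H_subset by auto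
    have g: "h \<in> \<g>" "h' \<in> \<g>" "lie_scale L c z \<in> \<g>" "lie_scale L c' z \<in> \<g>"
      using * H_subset z subspace_scale[OF g_subspace] by auto
    then have "br u v = (br h h' + br h (lie_scale L c' z)) + (br (lie_scale L c z) h' + br (lie_scale L c z) (lie_scale L c' z))"
      unfolding *(1,2) using subspace_add[OF g_subspace g(2,4)] by (simp only: br_add_left br_add_right)
    also have "br h (lie_scale L c' z) = 0" using br_scale_right[OF g(1) z(1)] z(2)[OF *(3)] by simp
    also have "br (lie_scale L c z) h' = 0" using br_scale_left[OF z(1) g(2)] hz[OF *(4)] by simp
    also have "br (lie_scale L c z) (lie_scale L c' z) = 0"
      using br_scale_left[OF z(1) g(4)] br_scale_right[OF z(1) z(1)] br_self[OF z(1)] by simp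
    finally show ?thesis using H_comm[OF *(3,4)] by simp
  qed
  ultimately have "abelian_subalgebra L A" unfolding abelian_subalgebra_def by blast
  then have "A = H" using cartan HA unfolding cartan_subalgebra_def by blast
  moreover have "z = 0 + lie_scale L 1 z \<and> 0 \<in> H" using subspace_0[OF H_subspace] by simp
  then have "z \<in> A" unfolding A_def by blast
  ultimately show ?thesis by simp
qed

text \<open>If \<open>ad z\<close> is nonzero on an \<open>H\<close>-stable subspace, one of its eigenspaces there with nonzero
  eigenvalue contains a joint eigenvector of \<open>H\<close>, whose weight is a root.\<close>

lemma root_detecting:
  assumes V: "subspace V" "V \<subseteq> \<g>" "\<And>h v. h \<in> H \<Longrightarrow> v \<in> V \<Longrightarrow> br h v \<in> V"
    and z: "z \<in> H" and v: "v \<in> V" "br z v \<noteq> 0"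
  shows "\<exists>\<mu>\<in>roots L H. \<mu> z \<noteq> 0 \<and> (\<exists>u\<in>V. u \<noteq> 0 \<and> u \<in> root_space L H \<mu>)"
proof -
  have zg: "z \<in> \<g>" using z H_subset by blast
  define Eig where "Eig = (\<lambda>a. {x \<in> \<g>. br z x = lie_scale L a x})"
  have Eig_sub: "subspace (Eig a)" for a
    using g_subspace br_zero_right[OF zg] unfolding subspace_def Eig_def
    by (auto simp: br_add_right br_scale_right zg scale_right_distrib mult.commute)
  have "{x \<in> \<g>. \<exists>c. br z x = lie_scale L c x} = (\<Union>a\<in>UNIV. Eig a)" by (auto simp: Eig_def)
  then have "v \<in> span (\<Union>a\<in>UNIV. Eig a)" using H_diag[OF z] v(1) V(2) by auto
  then obtain E g where Eg: "finite E" "\<And>a. a \<in> E \<Longrightarrow> g a \<in> Eig a" "v = sum g E"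
    using span_Union_decomposition[of UNIV Eig v] Eig_sub by metis
  have gV: "\<forall>a\<in>E. g a \<in> V"
  proof (rule eigen_components[where u = "\<lambda>_. br z" and \<chi> = "\<lambda>a _. a" and I = "{()}" and C = \<g>])
    show "lin_on (lie_scale L) \<g> (br z)" by (rule br_lin[OF zg])
    show "sum g E \<in> V" using Eg(3) v(1) by simp
  qed (use V g_subspace Eg z in \<open>auto simp: Eig_def\<close>)
  have "br z v = (\<Sum>a\<in>E. br z (g a))"
    unfolding Eg(3) by (rule lin_on_sum[OF br_lin[OF zg] g_subspace]) (use Eg(2) in \<open>auto simp: Eig_def\<close>)
  then have "\<exists>a\<in>E. br z (g a) \<noteq> 0" using v(2) by (metis sum.neutral)
  then obtain a where a: "a \<in> E" "br z (g a) \<noteq> 0" by blast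
  have ga: "br z (g a) = lie_scale L a (g a)" using Eg(2)[OF a(1)] by (simp add: Eig_def)
  then have a0: "a \<noteq> 0" "g a \<noteq> 0" using a(2) by auto
  define Va where "Va = V \<inter> Eig a"
  have Va: "subspace Va" unfolding Va_def by (intro subspace_inter V Eig_sub)
  have Vag: "Va \<subseteq> \<g>" using V(2) by (auto simp: Va_def)
  have Va_fin: "fin_dim (lie_scale L) Va" using fd Vag unfolding fin_dim_def by blast
  have Va_nz: "Va \<noteq> {0}" using gV a(1) Eg(2) a0 by (auto simp: Va_def)
  have stab: "br h u \<in> Va" if h: "h \<in> H" and u: "u \<in> Va" for h u
  proof -
    have g: "h \<in> \<g>" "u \<in> \<g>" using h u H_subset Vag by auto
    have "br z (br h u) = br (br z h) u + br h (br z u)" by (rule br_derivation[OF zg g])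
    also have "\<dots> = lie_scale L a (br h u)"
      using H_comm[OF z h] u g by (simp add: br_zero_left Va_def Eig_def br_scale_right)
    finally show ?thesis using V(3)[OF h] u br_closed[OF g] by (simp add: Va_def Eig_def)
  qed
  have Va_lin: "lin_on (lie_scale L) Va (br h)" if "h \<in> H" for h
    using stab[OF that] br_lin[of h] that H_subset Vag unfolding lin_on_def by blast
  have Va_comm: "br h (br k u) = br k (br h u)" if "h \<in> H" "k \<in> H" "u \<in> Va" for h k u
  proof -
    have "h \<in> \<g>" "k \<in> \<g>" "u \<in> \<g>" using that H_subset Vag by auto
    then show ?thesis
      using br_derivation[of h k u] H_comm[OF that(1,2)] br_closed[of k] br_closed[of h] br_zero_left[of u] by simp
  qed
  have "\<exists>u\<in>Va. u \<noteq> 0 \<and> (\<forall>h\<in>H. \<exists>c. br h u = lie_scale L c u)"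
    using joint_eigenvector_exists[OF vector_space_axioms Va Va_fin Va_nz Va_lin Va_comm] .
  then obtain u where u: "u \<in> Va" "u \<noteq> 0" "\<And>h. h \<in> H \<Longrightarrow> \<exists>c. br h u = lie_scale L c u"
    by blast
  obtain m where m: "\<And>h. h \<in> H \<Longrightarrow> br h u = lie_scale L (m h) u" using u(3) by metis
  define \<mu> where "\<mu> = (\<lambda>h. if h \<in> H then m h else 0)"
  have ug: "u \<in> \<g>" using u Vag by blast
  have inj: "c = c'" if "lie_scale L c u = lie_scale L c' u" for c c'
    using that u(2) by simp
  have "\<mu> \<in> dual_space L H"
    unfolding dual_space_def
  proof (intro CollectI conjI ballI allI impI)
    fix h k assume hk: "h \<in> H" "k \<in> H"
    have hkH: "h + k \<in> H" using subspace_add[OF H_subspace] hk by blast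
    have "lie_scale L (m (h + k)) u = lie_scale L (m h + m k) u"
      using m[OF hkH] m[OF hk(1)] m[OF hk(2)] hk H_subset ug
      by (simp add: br_add_left subset_iff scale_left_distrib)
    then have "m (h + k) = m h + m k" by (rule inj)
    then show "\<mu> (h + k) = \<mu> h + \<mu> k" using hk hkH by (simp add: \<mu>_def)
  next
    fix c h assume h: "h \<in> H"
    have chH: "lie_scale L c h \<in> H" using subspace_scale[OF H_subspace] h by blast
    have hg: "h \<in> \<g>" using h H_subset by blast
    have "lie_scale L (m (lie_scale L c h)) u = lie_scale L c (br h u)"
      unfolding m[OF chH, symmetric] by (rule br_scale_left[OF hg ug])
    also have "\<dots> = lie_scale L (c * m h) u" unfolding m[OF h] by simp
    finally have "lie_scale L (m (lie_scale L c h)) u = lie_scale L (c * m h) u" .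
    then have "m (lie_scale L c h) = c * m h" by (rule inj)
    then show "\<mu> (lie_scale L c h) = c * \<mu> h" using h chH by (simp add: \<mu>_def)
  qed (simp add: \<mu>_def)
  moreover have "lie_scale L (m z) u = lie_scale L a u"
    using m[OF z] u(1) by (simp add: Va_def Eig_def)
  then have \<mu>z: "\<mu> z = a" using z by (simp add: \<mu>_def inj)
  moreover have us: "u \<in> root_space L H \<mu>" using ug m by (simp add: root_space_def \<mu>_def)
  moreover have "\<mu> \<noteq> (\<lambda>_. 0)"
  proof
    assume "\<mu> = (\<lambda>_. 0)"
    then show False using \<mu>z a0(1) by simp
  qed
  moreover have "root_space L H \<mu> \<noteq> {0}" using us u(2) by blast
  ultimately have "\<mu> \<in> roots L H" "\<mu> z \<noteq> 0" using a0(1) by (simp_all add: roots_def)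
  moreover have "u \<in> V" using u(1) by (simp add: Va_def)
  ultimately show ?thesis using us u(2) by blast
qed

end

text \<open>The centralizer of the fixed points \<open>H\<^sup>\<sigma>\<close> among the fixed points of a diagram automorphism
  is \<open>H\<^sup>\<sigma>\<close> itself: the element on which all simple roots are 1 is fixed by \<open>\<sigma>\<close>, and no root
  vanishes on it.\<close>

lemma (in cartan_alg) diagram_centralizer:
  assumes simple: "simple_lie_algebra L" and diag: "diagram_automorphism L H \<sigma>"
    and z: "z \<in> \<g>" "\<And>h. h \<in> H \<Longrightarrow> \<sigma> h = h \<Longrightarrow> br h z = 0"
  shows "z \<in> H"
proof -
  obtain B E F \<tau> where base: "root_base L H B" and \<tau>: "bij_betw \<tau> B B"
    and EF': "\<forall>\<alpha>\<in>B. E \<alpha> \<in> root_space L H \<alpha> \<and> F \<alpha> \<in> root_space L H (- \<alpha>) \<and> \<alpha> (br (E \<alpha>) (F \<alpha>)) = 2"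
    and \<sigma>E': "\<forall>\<alpha>\<in>B. \<sigma> (E \<alpha>) = E (\<tau> \<alpha>) \<and> \<sigma> (F \<alpha>) = F (\<tau> \<alpha>)"
    using diag unfolding diagram_automorphism_def by (elim conjE exE) (rule that; assumption)
  have EF: "E \<beta> \<in> root_space L H \<beta>" "F \<beta> \<in> root_space L H (- \<beta>)" "\<beta> (br (E \<beta>) (F \<beta>)) = 2"
    and \<sigma>E: "\<sigma> (E \<beta>) = E (\<tau> \<beta>)" if "\<beta> \<in> B" for \<beta>
    using EF' \<sigma>E' that by simp_all
  have aut: "lie_automorphism L \<sigma>" and \<sigma>H: "\<sigma> ` H = H" using diag by (auto simp: diagram_automorphism_def)
  have \<sigma>br: "\<sigma> (br x y) = br (\<sigma> x) (\<sigma> y)" if "x \<in> \<g>" "y \<in> \<g>" for x y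
    using aut that by (simp add: lie_automorphism_def)
  have B: "finite B" "B \<subseteq> roots L H"
    and ind: "\<And>c. (\<forall>h\<in>H. (\<Sum>\<alpha>\<in>B. c \<alpha> * \<alpha> h) = 0) \<Longrightarrow> \<forall>\<alpha>\<in>B. c \<alpha> = 0"
    and comb: "\<And>\<beta>. \<beta> \<in> roots L H \<Longrightarrow> \<exists>n :: ('g \<Rightarrow> 'k) \<Rightarrow> nat.
        (\<forall>h\<in>H. \<beta> h = (\<Sum>\<alpha>\<in>B. of_nat (n \<alpha>) * \<alpha> h)) \<or> (\<forall>h\<in>H. \<beta> h = - (\<Sum>\<alpha>\<in>B. of_nat (n \<alpha>) * \<alpha> h))"
    using base by (auto simp: root_base_def)
  have Bd: "\<beta> (h + k) = \<beta> h + \<beta> k" "\<beta> (lie_scale L c h) = c * \<beta> h"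
    if "\<beta> \<in> B" "h \<in> H" "k \<in> H" for \<beta> h k c
    using that B(2) by (auto simp: roots_def dual_space_def)
  obtain \<rho> where \<rho>: "\<rho> \<in> H" "\<And>\<beta>. \<beta> \<in> B \<Longrightarrow> \<beta> \<rho> = 1"
    using independent_functionals[OF B(1) H_subspace _ _ ind, of "\<lambda>_. 1"] Bd by blast
  have \<rho>g: "\<rho> \<in> \<g>" "\<sigma> \<rho> \<in> H" using \<rho> \<sigma>H H_subset by auto
  have one: "\<gamma> (\<sigma> \<rho>) = 1" if \<gamma>: "\<gamma> \<in> B" for \<gamma>
  proof -
    obtain \<beta> where \<beta>: "\<beta> \<in> B" "\<gamma> = \<tau> \<beta>" using \<tau> \<gamma> unfolding bij_betw_def by blast
    have Es: "E \<beta> \<in> \<g>" "br \<rho> (E \<beta>) = lie_scale L (\<beta> \<rho>) (E \<beta>)"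
      using EF(1)[OF \<beta>(1)] \<rho>(1) by (simp_all add: root_space_def)
    have E: "E \<beta> \<in> \<g>" "br \<rho> (E \<beta>) = E \<beta>" using Es \<rho>(2)[OF \<beta>(1)] by simp_all
    have Eg: "E \<gamma> \<in> \<g>" "br (\<sigma> \<rho>) (E \<gamma>) = lie_scale L (\<gamma> (\<sigma> \<rho>)) (E \<gamma>)" "F \<gamma> \<in> \<g>"
      using EF(1,2)[OF \<gamma>] \<rho>g by (simp_all add: root_space_def)
    have "br (\<sigma> \<rho>) (E \<gamma>) = E \<gamma>" using \<sigma>br[OF \<rho>g(1) E(1)] E(2) \<sigma>E[OF \<beta>(1)] \<beta>(2) by simp
    then have "lie_scale L (\<gamma> (\<sigma> \<rho>)) (E \<gamma>) = lie_scale L 1 (E \<gamma>)" using Eg(2) by simp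
    moreover have "E \<gamma> \<noteq> 0"
    proof
      assume "E \<gamma> = 0"
      then have "\<gamma> 0 = 2" using EF[OF \<gamma>] br_zero_left[OF Eg(3)] by auto
      moreover have "\<gamma> 0 = 0" using Bd(2)[OF \<gamma> subspace_0[OF H_subspace] subspace_0[OF H_subspace], of 0] by simp
      ultimately show False by simp
    qed
    ultimately show ?thesis using scale_cancel_right by blast
  qed
  define d where "d = \<sigma> \<rho> + lie_scale L (- 1) \<rho>"
  have dH: "d \<in> H" unfolding d_def using \<rho> \<rho>g H_subspace by (intro subspace_add subspace_scale)
  have dB: "\<beta> d = 0" if "\<beta> \<in> B" for \<beta>
    using Bd(1)[OF that \<rho>g(2) subspace_scale[OF H_subspace \<rho>(1), of "- 1"]]
      Bd(2)[OF that \<rho>(1) \<rho>(1), of "- 1"] one[OF that] \<rho>(2)[OF that] by (simp add: d_def)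
  have "\<mu> d = 0" if "\<mu> \<in> roots L H" for \<mu>
    using comb[OF that] dH dB by (auto simp: sum.neutral)
  then have dc: "br d v = 0" if "v \<in> \<g>" for v
    using root_detecting[OF g_subspace _ _ dH that] br_closed H_subset by blast
  have "d = 0"
  proof -
    define Z where "Z = {c \<in> \<g>. \<forall>v\<in>\<g>. br v c = 0}"
    have "lie_ideal L Z"
      unfolding lie_ideal_def
    proof (intro conjI ballI)
      show "subspace Z"
        using g_subspace unfolding subspace_def Z_def
        by (auto simp: br_zero_right br_add_right br_scale_right)
      show "br x y \<in> Z" if "x \<in> \<g>" "y \<in> Z" for x y
        using that br_zero_right subspace_0[OF g_subspace] by (auto simp: Z_def)
    qed (auto simp: Z_def)
    then have "Z = {0} \<or> Z = \<g>" using simple by (auto simp: simple_lie_algebra_def)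
    moreover have "Z \<noteq> \<g>" using simple unfolding simple_lie_algebra_def Z_def by blast
    moreover have "d \<in> Z"
      unfolding Z_def using dc dH H_subset br_anti[of d] by fastforce
    ultimately show ?thesis by blast
  qed
  then have fix\<rho>: "\<sigma> \<rho> = \<rho>" by (simp add: d_def)
  have nonvanish: "\<mu> \<rho> \<noteq> 0" if \<mu>: "\<mu> \<in> roots L H" for \<mu>
  proof
    assume 0: "\<mu> \<rho> = 0"
    obtain n :: "('g \<Rightarrow> 'k) \<Rightarrow> nat" where n: "(\<forall>h\<in>H. \<mu> h = (\<Sum>\<alpha>\<in>B. of_nat (n \<alpha>) * \<alpha> h)) \<or>
        (\<forall>h\<in>H. \<mu> h = - (\<Sum>\<alpha>\<in>B. of_nat (n \<alpha>) * \<alpha> h))" using comb[OF \<mu>] by blast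
    have "(\<Sum>\<alpha>\<in>B. of_nat (n \<alpha>) * \<alpha> \<rho>) = (of_nat (\<Sum>\<alpha>\<in>B. n \<alpha>) :: 'k)"
      by (simp add: \<rho>(2))
    then have "(of_nat (\<Sum>\<alpha>\<in>B. n \<alpha>) :: 'k) = 0" using n \<rho>(1) 0 by auto
    then have "(\<Sum>\<alpha>\<in>B. n \<alpha>) = 0" by (simp only: of_nat_eq_0_iff)
    then have "\<forall>\<alpha>\<in>B. n \<alpha> = 0" using B(1) by simp
    then have "\<mu> h = 0" if "h \<in> H" for h using n that by auto
    moreover have "\<mu> h = 0" if "h \<notin> H" for h using \<mu> that by (auto simp: roots_def dual_space_def)
    ultimately have "\<mu> = (\<lambda>_. 0)" by blast
    then show False using \<mu> by (simp add: roots_def)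
  qed
  define V where "V = {v \<in> \<g>. br \<rho> v = 0}"
  have V: "subspace V" "V \<subseteq> \<g>"
    using g_subspace br_zero_right[OF \<rho>g(1)] unfolding subspace_def V_def
    by (auto simp: br_add_right br_scale_right \<rho>g)
  have Vst: "br h v \<in> V" if "h \<in> H" "v \<in> V" for h v
  proof -
    have g: "h \<in> \<g>" "v \<in> \<g>" using that H_subset by (auto simp: V_def)
    show ?thesis using br_derivation[OF \<rho>g(1) g] H_comm[OF \<rho>(1) that(1)] that(2) br_closed[OF g]
      by (simp add: V_def br_zero_left br_zero_right g)
  qed
  have zV: "z \<in> V" unfolding V_def using z \<rho>(1) fix\<rho> by simp
  have "br h z = 0" if h: "h \<in> H" for h
  proof (rule ccontr)
    assume "br h z \<noteq> 0"
    then obtain \<mu> u where \<mu>: "\<mu> \<in> roots L H" "u \<in> V" "u \<noteq> 0" "u \<in> root_space L H \<mu>"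
      using root_detecting[OF V Vst h zV] by blast
    then have "lie_scale L (\<mu> \<rho>) u = 0" using \<rho>(1) by (simp add: V_def root_space_def)
    then show False using nonvanish[OF \<mu>(1)] \<mu>(3) by simp
  qed
  then show ?thesis by (rule H_maximal[OF z(1)])
qed

section \<open>Real roots of affine algebras\<close>

text \<open>Both kinds of affine algebras: \<open>X j\<close> is the space of coefficients of \<open>t\<^sup>j\<close>, and \<open>H'\<close> is the
  finite-dimensional part of the Cartan subalgebra.\<close>

locale affine_alg = cartan_alg L H
  for L :: "('k::{alg_closed_field, field_char_0}, 'g::ab_group_add) lie_alg" and H :: "'g set" +
  fixes form :: "'g \<Rightarrow> 'g \<Rightarrow> 'k" and X :: "int \<Rightarrow> 'g set" and H' :: "'g set"
    and G :: "('k, ('k, 'g) aff) lie_alg" and HH :: "('k, 'g) aff set"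
  assumes form: "nondeg_invariant_form L form"
    and G: "lie_carrier G = {(p, d, c). \<forall>j. Poly_Mapping.lookup p j \<in> X j}"
      "lie_scale G = aff_scale (lie_scale L)" "lie_bracket G = aff_bracket L form"
    and HH: "HH = affine_cartan H'"
    and X_subspace: "\<And>j. subspace (X j)" and X_subset: "\<And>j. X j \<subseteq> lie_carrier L"
    and X_bracket: "\<And>i j x y. x \<in> X i \<Longrightarrow> y \<in> X j \<Longrightarrow> lie_bracket L x y \<in> X (i + j)"
    and H'_subspace: "subspace H'" and H'_H: "H' \<subseteq> H" and H'_X: "H' \<subseteq> X 0"
    and H'_centralizer: "\<And>z. z \<in> X 0 \<Longrightarrow> (\<And>h. h \<in> H' \<Longrightarrow> lie_bracket L h z = 0) \<Longrightarrow> z \<in> H'"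
begin

abbreviation coef :: "(int \<Rightarrow>\<^sub>0 'g) \<Rightarrow> int \<Rightarrow> 'g" where "coef \<equiv> Poly_Mapping.lookup"
abbreviation mono :: "int \<Rightarrow> 'g \<Rightarrow> int \<Rightarrow>\<^sub>0 'g" where "mono \<equiv> Poly_Mapping.single"

lemma H'_subset: "H' \<subseteq> \<g>" using H'_H H_subset by blast

lemma form_zero: "x \<in> \<g> \<Longrightarrow> form 0 x = 0" "x \<in> \<g> \<Longrightarrow> form x 0 = 0"
proof -
  assume x: "x \<in> \<g>"
  have z: "0 \<in> \<g>" by (rule subspace_0[OF g_subspace])
  have "form (0 + 0) x = form 0 x + form 0 x"
    using form x z unfolding nondeg_invariant_form_def by blast
  then show *: "form 0 x = 0" by simp
  have "form x 0 = form 0 x" using form x z unfolding nondeg_invariant_form_def by blast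
  then show "form x 0 = 0" using * by simp
qed

lemma lookup_scale:
  "coef (Poly_Mapping.map (lie_scale L a) p) k = lie_scale L a (coef p k)"
  by (simp add: Poly_Mapping.map.rep_eq when_def)

lemma lookup_sum_single:
  assumes "finite S"
  shows "coef (\<Sum>n\<in>S. mono n (g n)) k = (if k \<in> S then g k else 0)"
  using assms by (simp add: lookup_sum lookup_single when_def)

text \<open>This covers brackets with monomials (\<open>d0 = c0 = 0\<close>) as well as with elements of the Cartan subalgebra
  (\<open>n = 0\<close>).\<close>

lemma bracket_single:
  assumes y: "y \<in> \<g>" and p: "\<And>j. coef p j \<in> \<g>"
  shows "\<exists>r. lie_bracket G (mono n y, d0, c0) (p, d, c)
      = (r, 0, of_int n * form y (coef p (- n))) \<and>
    (\<forall>k. coef r k = br y (coef p (k - n))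
       + lie_scale L (d0 * of_int k) (coef p k)
       - (if k = n then lie_scale L (d * of_int n) y else 0))"
proof -
  let ?s = "mono n y" and ?K = "Poly_Mapping.keys p" and ?p = "coef p"
  define r1 where "r1 = (\<Sum>m\<in>Poly_Mapping.keys ?s. \<Sum>j\<in>?K. mono (m + j) (br (coef ?s m) (?p j)))"
  define r2 where "r2 = (\<Sum>j\<in>?K. mono j (lie_scale L (d0 * of_int j) (?p j)))"
  define r3 where "r3 = (\<Sum>m\<in>Poly_Mapping.keys ?s. mono m (lie_scale L (d * of_int m) (coef ?s m)))"
  have keys: "Poly_Mapping.keys ?s = (if y = 0 then {} else {n})" by simp
  have 1: "coef r1 k = br y (?p (k - n))" for k
  proof (cases "y = 0")
    case True
    then show ?thesis using br_zero_left[OF p] by (simp add: r1_def)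
  next
    case False
    have r1: "r1 = (\<Sum>j\<in>?K. mono (n + j) (br y (?p j)))"
      using False by (simp add: r1_def)
    have "coef r1 k = (\<Sum>j\<in>?K. if j = k - n then br y (?p (k - n)) else 0)"
      unfolding r1 lookup_sum by (intro sum.cong) (auto simp: lookup_single when_def)
    also have "\<dots> = br y (?p (k - n))"
      using br_zero_right[OF y] by (simp add: in_keys_iff)
    finally show ?thesis .
  qed
  have 2: "coef r2 k = lie_scale L (d0 * of_int k) (?p k)" for k
    unfolding r2_def by (simp add: lookup_sum_single in_keys_iff)
  have 3: "coef r3 k = (if k = n then lie_scale L (d * of_int n) y else 0)" for k
    unfolding r3_def keys by (simp add: lookup_single when_def)
  have "(\<Sum>m\<in>Poly_Mapping.keys ?s. of_int m * form (coef ?s m) (?p (- m)))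
      = of_int n * form y (?p (- n))"
    unfolding keys using form_zero(1)[OF p] by simp
  then have "lie_bracket G (?s, d0, c0) (p, d, c) = (r1 + r2 - r3, 0, of_int n * form y (?p (- n)))"
    unfolding G(3) r1_def r2_def r3_def by simp
  moreover have "coef (r1 + r2 - r3) k = br y (?p (k - n))
       + lie_scale L (d0 * of_int k) (?p k) - (if k = n then lie_scale L (d * of_int n) y else 0)" for k
    by (simp add: lookup_add lookup_minus 1 2 3)
  ultimately show ?thesis by blast
qed

lemma zero_G: "0 \<in> lie_carrier G"
  using subspace_0[OF X_subspace] by (simp add: G zero_prod_def)

lemma lie_closed_G: "lie_closed G"
proof
  fix u v assume uv: "u \<in> lie_carrier G" "v \<in> lie_carrier G"
  obtain p d c q d' c' where pq: "u = (p, d, c)" "v = (q, d', c')" by (metis prod_cases3)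
  have X: "coef p j \<in> X j" "coef q j \<in> X j" for j
    using uv by (auto simp: G pq)
  show "u + v \<in> lie_carrier G"
    using X by (auto simp: G pq lookup_add intro!: subspace_add[OF X_subspace])
  show "lie_bracket G u v \<in> lie_carrier G"
    using X X_bracket unfolding G pq
    by (auto simp: lookup_add lookup_minus lookup_sum lookup_single when_def
        intro!: subspace_add[OF X_subspace] subspace_diff[OF X_subspace] subspace_sum[OF X_subspace]
          subspace_scale[OF X_subspace] subspace_0[OF X_subspace])
next
  fix u c assume u: "u \<in> lie_carrier G"
  obtain p d c' where p: "u = (p, d, c')" by (metis prod_cases3)
  then show "lie_scale G c u \<in> lie_carrier G"
    using u by (auto simp: G lookup_scale intro!: subspace_scale[OF X_subspace])
qed

lemma HH_subset: "HH \<subseteq> lie_carrier G"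
  using H'_X subspace_0[OF X_subspace] by (auto simp: HH affine_cartan_def G lookup_single when_def)

abbreviation emb :: "'g \<Rightarrow> ('k, 'g) aff" where "emb h \<equiv> (mono 0 h, 0, 0)"

lemma emb_HH: "h \<in> H' \<Longrightarrow> emb h \<in> HH" and D_HH: "(0, 1, 0) \<in> HH" and K_HH: "(0, 0, 1) \<in> HH"
proof -
  show "h \<in> H' \<Longrightarrow> emb h \<in> HH" by (auto simp: HH affine_cartan_def)
  have "(0 :: int \<Rightarrow>\<^sub>0 'g) = mono 0 0" by simp
  then show "(0, 1, 0) \<in> HH" "(0, 0, 1) \<in> HH"
    unfolding HH affine_cartan_def using subspace_0[OF H'_subspace] by blast+
qed

lemma aff_scale_simps: "aff_scale (lie_scale L) a (mono n x, d, c)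
    = (mono n (lie_scale L a x), a * d, a * c)"
proof -
  have "Poly_Mapping.map (lie_scale L a) (mono n x) = mono n (lie_scale L a x)"
    by (rule poly_mapping_eqI) (simp add: lookup_scale lookup_single when_def)
  then show ?thesis by simp
qed

lemma dual_HH:
  assumes \<gamma>: "\<gamma> \<in> dual_space G HH" and h: "h \<in> H'"
  shows "\<gamma> (mono 0 h, d, c) = \<gamma> (emb h) + d * \<gamma> (0, 1, 0) + c * \<gamma> (0, 0, 1)"
proof -
  have z: "aff_scale (lie_scale L) a (0, u, w) = (0, a * u, a * w)" for a u w
    using aff_scale_simps[of a 0 0 u w] by simp
  have "(0, d, c) \<in> HH" for d c
  proof -
    have "(0, d, c) = (mono 0 0 :: int \<Rightarrow>\<^sub>0 'g, d, c)" by simp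
    then show ?thesis unfolding HH affine_cartan_def using subspace_0[OF H'_subspace] by blast
  qed
  note mem = this
  have add: "\<gamma> (u + v) = \<gamma> u + \<gamma> v" if "u \<in> HH" "v \<in> HH" for u v
    using \<gamma> that by (simp add: dual_space_def)
  have scl: "\<gamma> (lie_scale G a u) = a * \<gamma> u" if "u \<in> HH" for u a
    using \<gamma> that by (simp add: dual_space_def)
  have "\<gamma> (emb h + (0, d, c)) = \<gamma> (emb h) + \<gamma> (0, d, c)" by (rule add[OF emb_HH[OF h] mem])
  moreover have "\<gamma> ((0, d, 0) + (0, 0, c)) = \<gamma> (0, d, 0) + \<gamma> (0, 0, c)" by (rule add[OF mem mem])
  moreover have "\<gamma> (0, d, 0) = d * \<gamma> (0, 1, 0)" "\<gamma> (0, 0, c) = c * \<gamma> (0, 0, 1)"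
    using scl[OF mem, of d 1 0] scl[OF mem, of c 0 1] unfolding G(2) z by simp_all
  ultimately show ?thesis by (simp add: add.assoc)
qed

text \<open>The integral multiples of \<open>\<delta>\<close>, including zero.\<close>

definition imaginary :: "(('k, 'g) aff \<Rightarrow> 'k) \<Rightarrow> bool" where
  "imaginary \<gamma> \<longleftrightarrow> (\<exists>n :: int. \<gamma> = (\<lambda>x. of_int n * delta HH x))"

lemma root_equation:
  assumes E: "(p, d, c) \<in> root_space G HH \<gamma>" and h: "h \<in> H'"
  shows "br h (coef p k) + lie_scale L (d0 * of_int k) (coef p k)
      = lie_scale L (\<gamma> (mono 0 h, d0, c0)) (coef p k)"
    and "\<gamma> (mono 0 h, d0, c0) * d = 0" "\<gamma> (mono 0 h, d0, c0) * c = 0"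
proof -
  let ?z = "(mono 0 h, d0, c0)"
  have z: "?z \<in> HH" using h by (auto simp: HH affine_cartan_def)
  have p: "coef p j \<in> \<g>" for j using E X_subset by (auto simp: root_space_def G)
  have hg: "h \<in> \<g>" using h H'_subset by blast
  obtain r where r: "lie_bracket G ?z (p, d, c) = (r, 0, of_int 0 * form h (coef p (- 0)))"
    "\<And>k. coef r k = br h (coef p (k - 0))
       + lie_scale L (d0 * of_int k) (coef p k)
       - (if k = 0 then lie_scale L (d * of_int 0) h else 0)"
    using bracket_single[OF hg p, of 0 d0 c0 d c] by blast
  have "lie_bracket G ?z (p, d, c) = aff_scale (lie_scale L) (\<gamma> ?z) (p, d, c)"
    using E z unfolding root_space_def G(2) by blast
  then have "r = Poly_Mapping.map (lie_scale L (\<gamma> ?z)) p" "0 = \<gamma> ?z * d" "0 = \<gamma> ?z * c"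
    using r(1) by simp_all
  then show "br h (coef p k) + lie_scale L (d0 * of_int k) (coef p k)
      = lie_scale L (\<gamma> ?z) (coef p k)" "\<gamma> ?z * d = 0" "\<gamma> ?z * c = 0"
    using r(2)[of k] by (simp_all add: lookup_scale)
qed

text \<open>Comparing coefficients for \<open>D\<close> shows that a root vector is homogeneous in \<open>t\<close> or has \<open>\<gamma>(D) = 0\<close>. If
  \<open>\<gamma>\<close> vanished on \<open>H'\<close> it would be a multiple of \<open>\<delta>\<close>; since it does not, the \<open>D\<close>- and
  \<open>K\<close>-components are zero.\<close>

lemma real_root_vector:
  assumes \<gamma>: "\<gamma> \<in> dual_space G HH" "\<not> imaginary \<gamma>" and E: "E \<in> root_space G HH \<gamma>" "E \<noteq> 0"
  shows "\<exists>n x h1. E = (mono n x, 0, 0) \<and> x \<in> X n \<and> x \<noteq> 0 \<and> \<gamma> (0, 1, 0) = of_int n \<and>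
    (\<forall>h\<in>H'. br h x = lie_scale L (\<gamma> (emb h)) x) \<and> h1 \<in> H' \<and> \<gamma> (emb h1) \<noteq> 0"
proof -
  obtain p d c where pdc: "E = (p, d, c)" by (metis prod_cases3)
  let ?p = "coef p"
  note eq = root_equation[OF E(1)[unfolded pdc]]
  have pX: "?p j \<in> X j" for j using E(1) by (auto simp: pdc root_space_def G)
  have z: "0 \<in> H'" by (rule subspace_0[OF H'_subspace])
  have single0: "mono 0 0 = (0 :: int \<Rightarrow>\<^sub>0 'g)" by simp
  have br0: "br 0 (?p k) = 0" for k using br_zero_left pX X_subset by blast
  have D: "lie_scale L (of_int k) (?p k) = lie_scale L (\<gamma> (0, 1, 0)) (?p k)" for k
    using eq(1)[OF z, of k 1 0] br0 by (simp add: single0)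
  have K: "lie_scale L (\<gamma> (0, 0, 1)) (?p k) = 0" "\<gamma> (0, 0, 1) * d = 0" "\<gamma> (0, 0, 1) * c = 0" for k
    using eq(1)[OF z, of k 0 1] eq(2,3)[OF z, of 0 1] br0 by (simp_all add: single0)
  have Dd: "\<gamma> (0, 1, 0) * d = 0" "\<gamma> (0, 1, 0) * c = 0" using eq(2,3)[OF z, of 1 0] by (simp_all add: single0)
  have nz: "(\<exists>k. ?p k \<noteq> 0) \<or> d \<noteq> 0 \<or> c \<noteq> 0"
  proof (rule ccontr)
    assume "\<not> ?thesis"
    then have "p = 0" "d = 0" "c = 0" by (auto intro: poly_mapping_eqI)
    then show False using E(2) by (simp add: pdc zero_prod_def)
  qed
  then have K0: "\<gamma> (0, 0, 1) = 0" using K by (auto simp: scale_eq_0_iff)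
  have D_int: "\<exists>n :: int. \<gamma> (0, 1, 0) = of_int n"
  proof (cases "\<exists>k. ?p k \<noteq> 0")
    case True
    then obtain k where "?p k \<noteq> 0" by blast
    then have "of_int k = \<gamma> (0, 1, 0)" using D[of k] by simp
    then show ?thesis by metis
  next
    case False
    then have "\<gamma> (0, 1, 0) = 0" using nz Dd by auto
    then show ?thesis by (intro exI[of _ 0]) simp
  qed
  have "\<exists>h1\<in>H'. \<gamma> (emb h1) \<noteq> 0"
  proof (rule ccontr)
    assume no: "\<not> ?thesis"
    obtain n :: int where n: "\<gamma> (0, 1, 0) = of_int n" using D_int by blast
    have "\<gamma> u = of_int n * delta HH u" for u
    proof (cases "u \<in> HH")
      case True
      then obtain h d c where u: "u = (mono 0 h, d, c)" "h \<in> H'"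
        unfolding HH affine_cartan_def by blast
      then show ?thesis using True no dual_HH[OF \<gamma>(1) u(2), of d c] by (simp add: n K0 delta_def)
    next
      case False
      then show ?thesis using \<gamma>(1) by (cases u) (simp add: dual_space_def delta_def)
    qed
    then have "imaginary \<gamma>" unfolding imaginary_def by blast
    then show False using \<gamma>(2) by simp
  qed
  then obtain h1 where h1: "h1 \<in> H'" "\<gamma> (emb h1) \<noteq> 0" by blast
  have dc: "d = 0" "c = 0" using eq(2,3)[OF h1(1), of 0 0] h1(2) by auto
  then obtain n where n: "?p n \<noteq> 0" using nz by blast
  then have Dn: "\<gamma> (0, 1, 0) = of_int n" using D[of n] by simp
  have "?p k = 0" if "k \<noteq> n" for k using D[of k] that unfolding Dn by simp
  then have "p = mono n (?p n)"
    by (intro poly_mapping_eqI) (auto simp: lookup_single when_def)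
  moreover have "br h (?p n) = lie_scale L (\<gamma> (emb h)) (?p n)" if "h \<in> H'" for h
    using eq(1)[OF that, of n 0 0] by simp
  ultimately show ?thesis using pdc dc pX n Dn h1 by metis
qed

text \<open>From the second step on the \<open>D\<close>-component is gone and the coefficients are those of \<open>ad(y)\<^sup>i\<close>. Once
  they vanish, one more step removes the central component.\<close>

lemma monomial_ad_nilpotent:
  assumes y: "y \<in> \<g>" and nil: "\<And>z. z \<in> \<g> \<Longrightarrow> (br y ^^ N) z = 0" and u: "u \<in> lie_carrier G"
  shows "\<exists>M. (lie_bracket G (mono n y, 0, 0) ^^ M) u = 0"
proof -
  let ?f = "(mono n y, 0, 0) :: ('k, 'g) aff"
  obtain p d c where pdc: "u = (p, d, c)" by (metis prod_cases3)
  have p: "coef p j \<in> \<g>" for j using u X_subset by (auto simp: pdc G)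
  have pow: "(br y ^^ i) z \<in> \<g>" if "z \<in> \<g>" for i z by (rule lin_on_funpow_closed[OF br_lin[OF y] that])
  have bb: "br y (lie_scale L a y) = 0" for a by (simp add: br_scale_right y br_self)
  have step: "\<exists>r c'. lie_bracket G ?f (q, d, c) = (r, 0, c') \<and>
      (\<forall>k. coef r k = br y (coef q (k - n))
        - (if k = n then lie_scale L (d * of_int n) y else 0)) \<and> c' = of_int n * form y (coef q (- n))"
    if "\<And>j. coef q j \<in> \<g>" for q d c
    using bracket_single[OF y that, of n 0 0 d c] by simp
  have main: "\<exists>q c'. (lie_bracket G ?f ^^ (i + 2)) u = (q, 0, c') \<and>
      (\<forall>k. coef q k = (br y ^^ (i + 2)) (coef p (k - of_nat (i + 2) * n)))" for i
  proof (induction i)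
    case 0
    obtain r c' where r: "lie_bracket G ?f u = (r, 0, c')"
      "\<And>k. coef r k = br y (coef p (k - n))
        - (if k = n then lie_scale L (d * of_int n) y else 0)"
      using step[OF p, of d c] unfolding pdc by blast
    have rg: "coef r j \<in> \<g>" for j
      unfolding r(2) using p y g_subspace by (auto intro!: subspace_diff subspace_scale subspace_0 br_closed)
    obtain q c'' where q: "lie_bracket G ?f (r, 0, c') = (q, 0, c'')"
      "\<And>k. coef q k = br y (coef r (k - n))"
      using step[OF rg, of 0 c'] by auto
    have "coef q k = br y (br y (coef p (k - 2 * n)))" for k
    proof -
      have "br y (coef r (k - n)) = br y (br y (coef p (k - n - n)))
          - br y (if k - n = n then lie_scale L (d * of_int n) y else 0)"
        unfolding r(2) using p y g_subspace
        by (intro lin_on_diff[OF br_lin g_subspace]) (auto intro!: subspace_scale subspace_0 br_closed)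
      moreover have "br y (if k - n = n then lie_scale L (d * of_int n) y else 0) = 0"
        using bb br_zero_right[OF y] by simp
      moreover have "k - n - n = k - 2 * n" by simp
      ultimately show ?thesis unfolding q(2) by simp
    qed
    then show ?case using r(1) q(1) by (simp add: numeral_2_eq_2)
  next
    case (Suc i)
    then obtain q c' where q: "(lie_bracket G ?f ^^ (i + 2)) u = (q, 0, c')"
      "\<And>k. coef q k = (br y ^^ (i + 2)) (coef p (k - of_nat (i + 2) * n))"
      by blast
    have qg: "coef q j \<in> \<g>" for j unfolding q(2) by (rule pow[OF p])
    obtain r c'' where r: "lie_bracket G ?f (q, 0, c') = (r, 0, c'')"
      "\<And>k. coef r k = br y (coef q (k - n))"
      using step[OF qg, of 0 c'] by auto
    have "coef r k = (br y ^^ (Suc i + 2)) (coef p (k - of_nat (Suc i + 2) * n))" for k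
    proof -
      have shift: "k - n - of_nat (i + 2) * n = k - of_nat (Suc i + 2) * n" by (simp add: algebra_simps)
      show ?thesis unfolding r(2) q(2) shift by simp
    qed
    moreover have "(lie_bracket G ?f ^^ (Suc i + 2)) u = (r, 0, c'')" using q(1) r(1) by simp
    ultimately show ?case by blast
  qed
  obtain q c' where q: "(lie_bracket G ?f ^^ (N + 2)) u = (q, 0, c')"
    "\<And>k. coef q k = (br y ^^ (N + 2)) (coef p (k - of_nat (N + 2) * n))"
    using main[of N] by blast
  have "(br y ^^ (N + 2)) z = 0" if "z \<in> \<g>" for z
    using nil[OF that] br_zero_right[OF y] by (simp add: add.commute[of N] numeral_2_eq_2)
  then have "q = 0" by (intro poly_mapping_eqI) (simp only: q(2) p lookup_zero)
  obtain r c'' where r: "lie_bracket G ?f (q, 0, c') = (r, 0, c'')"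
      "\<And>k. coef r k = br y (coef q (k - n))"
      "c'' = of_int n * form y (coef q (- n))"
    using step[of q 0 c'] subspace_0[OF g_subspace] by (auto simp: \<open>q = 0\<close>)
  have "r = 0" by (intro poly_mapping_eqI) (simp add: r(2) \<open>q = 0\<close> br_zero_right[OF y])
  moreover have "c'' = 0" by (simp add: r(3) \<open>q = 0\<close> form_zero(2)[OF y])
  ultimately have "(lie_bracket G ?f ^^ (N + 3)) u = 0"
    using q(1) r(1) by (simp add: numeral_3_eq_3 numeral_2_eq_2 zero_prod_def)
  then show ?thesis by blast
qed

lemma real_rootD:
  assumes "\<beta> \<in> real_roots G HH"
  shows "\<beta> \<in> dual_space G HH" "\<not> imaginary \<beta>" "- \<beta> \<in> dual_space G HH" "\<not> imaginary (- \<beta>)"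
proof -
  show 1: "\<beta> \<in> dual_space G HH" "\<not> imaginary \<beta>"
    using assms by (auto simp: real_roots_def roots_def imaginary_def)
  show "- \<beta> \<in> dual_space G HH" using 1(1) by (auto simp: dual_space_def)
  show "\<not> imaginary (- \<beta>)"
  proof
    assume "imaginary (- \<beta>)"
    then obtain n :: int where n: "- \<beta> = (\<lambda>x. of_int n * delta HH x)" unfolding imaginary_def by blast
    have "\<beta> x = of_int (- n) * delta HH x" for x
      using fun_cong[OF n, of x] by (simp add: minus_equation_iff[of "\<beta> x"])
    then show False using 1(2) unfolding imaginary_def by blast
  qed
qed

lemma root_vector_ad_nilpotent:
  assumes \<gamma>: "\<gamma> \<in> dual_space G HH" "\<not> imaginary \<gamma>" and E: "E \<in> root_space G HH \<gamma>" "E \<noteq> 0"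
    and u: "u \<in> lie_carrier G"
  shows "\<exists>M. (lie_bracket G E ^^ M) u = 0"
proof -
  obtain n x h1 where x: "E = (mono n x, 0, 0)" "x \<in> X n"
    "\<forall>h\<in>H'. br h x = lie_scale L (\<gamma> (emb h)) x" "h1 \<in> H'" "\<gamma> (emb h1) \<noteq> 0"
    using real_root_vector[OF \<gamma> E] by blast
  have xg: "x \<in> \<g>" "h1 \<in> \<g>" "h1 \<in> H" using x X_subset H'_subset H'_H by auto
  obtain N where "\<forall>z\<in>\<g>. (br x ^^ N) z = 0"
    using eigenvector_ad_nilpotent[OF xg(2) H_diag[OF xg(3)] xg(1)] x(3-5) by blast
  then show ?thesis unfolding x(1) using monomial_ad_nilpotent[OF xg(1) _ u] by blast
qed

lemma zero_bracket:
  assumes "u \<in> lie_carrier G"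
  shows "lie_bracket G 0 u = 0"
proof -
  obtain p d c where pdc: "u = (p, d, c)" by (metis prod_cases3)
  have p: "coef p j \<in> \<g>" for j using assms X_subset by (auto simp: pdc G)
  have z: "(0 :: ('k, 'g) aff) = (mono 0 0, 0, 0)" by (simp add: zero_prod_def)
  obtain r where r: "lie_bracket G (mono 0 0, 0, 0) (p, d, c) = (r, 0, of_int 0 * form 0 (coef p (- 0)))"
    "\<And>k. coef r k = br 0 (coef p (k - 0))
       + lie_scale L (0 * of_int k) (coef p k)
       - (if k = 0 then lie_scale L (d * of_int 0) 0 else 0)"
    using bracket_single[OF subspace_0[OF g_subspace] p, of 0 0 0 d c] by blast
  have "r = 0" by (intro poly_mapping_eqI) (simp add: r(2) br_zero_left[OF p])
  then show ?thesis using r(1) unfolding z pdc by simp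
qed

lemma monomial_bracket:
  assumes "x \<in> \<g>" "y \<in> \<g>"
  shows "\<exists>c. lie_bracket G (mono n x, 0, 0) (mono m y, 0, 0)
    = (mono (n + m) (br x y), 0, c)"
proof -
  have p: "coef (mono m y) j \<in> \<g>" for j
    using assms subspace_0[OF g_subspace] by (simp add: lookup_single when_def)
  obtain r c where r: "lie_bracket G (mono n x, 0, 0) (mono m y, 0, 0) = (r, 0, c)"
    "\<And>k. coef r k = br x (coef (mono m y) (k - n))"
    using bracket_single[OF assms(1) p, of n 0 0 0 0] by auto
  have "r = mono (n + m) (br x y)"
    by (intro poly_mapping_eqI) (auto simp: r(2) lookup_single when_def br_zero_right[OF assms(1)])
  then show ?thesis using r(1) by blast
qed

text \<open>The algebra behind a real root: the triple consists of monomials, its Cartan element lies in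
  \<open>H'\<close> up to the centre, and the two root spaces are lines.\<close>

lemma triple_structure:
  assumes \<beta>: "\<beta> \<in> real_roots G HH"
    and e: "e \<in> root_space G HH \<beta>" and f: "f \<in> root_space G HH (- \<beta>)" and h: "h \<in> HH"
    and sl2: "sl2_triple G e h f"
  shows "root_triple G HH \<beta> e h f" "e \<noteq> 0" "f \<noteq> 0"
    and "\<And>E. E \<in> root_space G HH (- \<beta>) \<Longrightarrow> \<exists>s. E = lie_scale G s f"
    and "\<And>E. E \<in> root_space G HH \<beta> \<Longrightarrow> \<exists>s. E = lie_scale G s e"
proof -
  note rr = real_rootD[OF \<beta>]
  have efh: "lie_bracket G e f = h" "lie_bracket G h e = lie_scale G 2 e" "h \<noteq> 0"
    using sl2 by (auto simp: sl2_triple_def)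
  have efG: "e \<in> lie_carrier G" "f \<in> lie_carrier G" using e f by (auto simp: root_space_def)
  show e0: "e \<noteq> 0" using efh zero_bracket[OF efG(2)] by auto
  obtain n x h1 where x: "e = (mono n x, 0, 0)" "x \<in> X n" "x \<noteq> 0" "\<beta> (0, 1, 0) = of_int n"
    "\<And>k. k \<in> H' \<Longrightarrow> br k x = lie_scale L (\<beta> (emb k)) x" "h1 \<in> H'" "\<beta> (emb h1) \<noteq> 0"
    using real_root_vector[OF rr(1,2) e e0] by blast
  have xg: "x \<in> \<g>" using x X_subset by blast
  show f0: "f \<noteq> 0"
  proof
    assume "f = 0"
    then have "f = (mono 0 0, 0, 0)" by (simp add: zero_prod_def)
    moreover obtain r where "lie_bracket G (mono n x, 0, 0) (0, 0, 0)
        = (r, 0, of_int n * form x (coef 0 (- n)))"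
      "\<And>k. coef r k = br x (coef 0 (k - n))
       + lie_scale L (0 * of_int k) (coef 0 k)
       - (if k = n then lie_scale L (0 * of_int n) x else 0)"
      using bracket_single[OF xg, of 0 n 0 0 0 0] subspace_0[OF g_subspace] by auto
    moreover from this have "r = 0" by (intro poly_mapping_eqI) (simp add: br_zero_right[OF xg])
    ultimately have "h = 0" using efh(1) by (simp add: x(1) form_zero(2)[OF xg] zero_prod_def)
    then show False using efh(3) by simp
  qed
  obtain m y h2 where y: "f = (mono m y, 0, 0)" "y \<in> X m" "y \<noteq> 0" "(- \<beta>) (0, 1, 0) = of_int m"
    "\<And>k. k \<in> H' \<Longrightarrow> br k y = lie_scale L ((- \<beta>) (emb k)) y"
    using real_root_vector[OF rr(3,4) f f0] by blast
  have yg: "y \<in> \<g>" using y X_subset by blast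
  have m: "m = - n"
  proof -
    have "(of_int m :: 'k) = of_int (- n)" using x(4) y(4) by simp
    then show ?thesis by (simp only: of_int_eq_iff)
  qed
  obtain c where "lie_bracket G e f = (mono (n + m) (br x y), 0, c)"
    unfolding x(1) y(1) using monomial_bracket[OF xg yg] by blast
  then have hc: "h = (mono 0 (br x y), 0, c)" using efh(1) m by simp
  have xy: "br x y \<in> H'"
  proof -
    obtain k d c' where "h = (mono 0 k, d, c')" "k \<in> H'"
      using h unfolding HH affine_cartan_def by blast
    then have "mono 0 (br x y) = mono (0 :: int) k" using hc by simp
    then have "br x y = k" by (metis lookup_single_eq)
    then show ?thesis using \<open>k \<in> H'\<close> by simp
  qed
  have \<beta>h: "\<beta> h = 2"
  proof -
    have "lie_scale G (\<beta> h) e = lie_scale G 2 e" using e h efh(2) by (simp add: root_space_def)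
    then have "mono n (lie_scale L (\<beta> h) x) = mono n (lie_scale L 2 x)"
      by (simp add: x(1) G aff_scale_simps)
    then have "lie_scale L (\<beta> h) x = lie_scale L 2 x" by (metis lookup_single_eq)
    then show ?thesis using x(3) scale_cancel_right by blast
  qed
  show "root_triple G HH \<beta> e h f"
    unfolding root_triple_def using rr(1) e f h efh(1) \<beta>h by blast
  define a where "a = (\<lambda>k. \<beta> (emb k))"
  have K0: "\<beta> (0, 0, 1) = 0"
  proof -
    have "lie_scale L (\<beta> (0, 0, 1)) x = 0"
      using root_equation(1)[OF e[unfolded x(1)] subspace_0[OF H'_subspace], of n 0 1] br_zero_left[OF xg] by simp
    then show ?thesis using x(3) by simp
  qed
  have axy: "a (br x y) = 2" using dual_HH[OF rr(1) xy, of 0 c] \<beta>h K0 by (simp add: hc a_def)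
  have a_add: "a (k + l) = a k + a l" if "k \<in> H'" "l \<in> H'" for k l
  proof -
    have "emb (k + l) = emb k + emb l" by (simp add: single_add)
    moreover have "\<beta> (emb k + emb l) = \<beta> (emb k) + \<beta> (emb l)"
      using rr(1) emb_HH[OF that(1)] emb_HH[OF that(2)] unfolding dual_space_def by blast
    ultimately show ?thesis by (simp only: a_def)
  qed
  have a_scale: "a (lie_scale L c k) = c * a k" if "k \<in> H'" for c k
  proof -
    have "emb (lie_scale L c k) = lie_scale G c (emb k)" by (simp add: G aff_scale_simps)
    moreover have "\<beta> (lie_scale G c (emb k)) = c * \<beta> (emb k)"
      using rr(1) emb_HH[OF that] unfolding dual_space_def by blast
    ultimately show ?thesis by (simp only: a_def)
  qed
  have hx: "br k x = lie_scale L (a k) x" and hy: "br k y = lie_scale L (- a k) y" if "k \<in> H'" for k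
    using x(5)[OF that] y(5)[OF that] by (simp_all add: a_def)
  have h1: "h1 \<in> \<g>" "h1 \<in> H" "a h1 \<noteq> 0" using x(6,7) H'_subset H'_H by (auto simp: a_def)
  obtain Ny where Ny: "\<And>v. v \<in> \<g> \<Longrightarrow> (br y ^^ Ny) v = 0"
    using eigenvector_ad_nilpotent[OF h1(1) H_diag[OF h1(2)] yg hy[OF x(6)]] h1(3) by auto
  obtain Nx where Nx: "\<And>v. v \<in> \<g> \<Longrightarrow> (br x ^^ Nx) v = 0"
    using eigenvector_ad_nilpotent[OF h1(1) H_diag[OF h1(2)] xg hx[OF x(6)]] h1(3) by auto
  have zero_weight: "br u v \<in> H'"
    if u: "u \<in> X i" "\<And>k. k \<in> H' \<Longrightarrow> br k u = lie_scale L (b k) u"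
      and v: "v \<in> X (- i)" "\<And>k. k \<in> H' \<Longrightarrow> br k v = lie_scale L (- b k) v" for u v i and b :: "'g \<Rightarrow> 'k"
  proof (rule H'_centralizer)
    show "br u v \<in> X 0" using X_bracket[OF u(1) v(1)] by simp
    fix k assume k: "k \<in> H'"
    have g: "k \<in> \<g>" "u \<in> \<g>" "v \<in> \<g>" using k u(1) v(1) H'_subset X_subset by auto
    have "br k (br u v) = br (br k u) v + br u (br k v)" by (rule br_derivation[OF g])
    also have "\<dots> = 0" unfolding u(2)[OF k] v(2)[OF k] br_scale_left[OF g(2,3)] br_scale_right[OF g(2,3)] by simp
    finally show "br k (br u v) = 0" .
  qed
  fix E
  show "\<exists>s. E = lie_scale G s f" if E: "E \<in> root_space G HH (- \<beta>)"
  proof (cases "E = 0")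
    case True
    then show ?thesis by (intro exI[of _ 0]) (simp add: G y(1) aff_scale_simps zero_prod_def)
  next
    case False
    obtain m' z where z: "E = (mono m' z, 0, 0)" "z \<in> X m'" "(- \<beta>) (0, 1, 0) = of_int m'"
      "\<And>k. k \<in> H' \<Longrightarrow> br k z = lie_scale L ((- \<beta>) (emb k)) z"
      using real_root_vector[OF rr(3,4) E False] by blast
    have m': "m' = m" using z(3) y(4) by (metis of_int_eq_iff)
    have zg: "z \<in> \<g>" using z X_subset by blast
    have hz: "br k z = lie_scale L (- a k) z" if "k \<in> H'" for k using z(4)[OF that] by (simp add: a_def)
    have zX: "z \<in> X (- n)" using z(2) unfolding m' m .
    have xz: "br x z \<in> H'" by (rule zero_weight[OF x(2) hx zX hz])
    have "z = lie_scale L (a (br x z) / 2) y"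
      by (rule root_space_line[OF H'_subspace H'_subset a_add a_scale xg hx yg hy xy axy zg hz xz Ny])
    then have "E = lie_scale G (a (br x z) / 2) f" by (simp add: z(1) y(1) m' G aff_scale_simps)
    then show ?thesis by blast
  qed
  show "\<exists>s. E = lie_scale G s e" if E: "E \<in> root_space G HH \<beta>"
  proof (cases "E = 0")
    case True
    then show ?thesis by (intro exI[of _ 0]) (simp add: G x(1) aff_scale_simps zero_prod_def)
  next
    case False
    obtain n' z where z: "E = (mono n' z, 0, 0)" "z \<in> X n'" "\<beta> (0, 1, 0) = of_int n'"
      "\<And>k. k \<in> H' \<Longrightarrow> br k z = lie_scale L (\<beta> (emb k)) z"
      using real_root_vector[OF rr(1,2) E False] by blast
    have n': "n' = n" using z(3) x(4) by (metis of_int_eq_iff)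
    have zg: "z \<in> \<g>" using z X_subset by blast
    define b where "b = (\<lambda>k. - a k)"
    have b_add: "b (k + l) = b k + b l" if "k \<in> H'" "l \<in> H'" for k l
      using a_add[OF that] by (simp add: b_def)
    have b_scale: "b (lie_scale L c k) = c * b k" if "k \<in> H'" for c k
      using a_scale[OF that] by (simp add: b_def)
    have bx: "br k x = lie_scale L (- b k) x" and by': "br k y = lie_scale L (b k) y"
      and bz: "br k z = lie_scale L (- b k) z" if "k \<in> H'" for k
      using hx[OF that] hy[OF that] z(4)[OF that] by (simp_all add: b_def a_def)
    have yx: "br y x = lie_scale L (- 1) (br x y)" using br_anti[OF xg yg] by simp
    have yxH: "br y x \<in> H'" unfolding yx by (rule subspace_scale[OF H'_subspace xy])
    have byx: "b (br y x) = 2" unfolding yx b_scale[OF xy] using axy by (simp add: b_def)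
    have zX: "z \<in> X (- m)" using z(2) unfolding n' m by simp
    have yz: "br y z \<in> H'" by (rule zero_weight[OF y(2) by' zX bz])
    have "z = lie_scale L (b (br y z) / 2) x"
      by (rule root_space_line[OF H'_subspace H'_subset b_add b_scale yg by' xg bx yxH byx zg bz yz Nx])
    then have "E = lie_scale G (b (br y z) / 2) e" by (simp add: z(1) x(1) n' G aff_scale_simps)
    then show ?thesis by blast
  qed
qed

end

section \<open>Untwisted and twisted affine algebras\<close>

text \<open>That \<open>H'\<close> is its own centralizer is maximality of \<open>H\<close> in the untwisted case, and
  \<open>diagram_centralizer\<close> in the twisted case.\<close>

lemma affine_pair_affine_alg:
  fixes L :: "('k::{alg_closed_field, field_char_0}, 'g::ab_group_add) lie_alg"
  assumes simple: "simple_lie_algebra L" and fd: "fin_dim (lie_scale L) (lie_carrier L)"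
    and cartan: "cartan_subalgebra L H" and form: "nondeg_invariant_form L form"
    and pair: "affine_pair L H form G HH"
  obtains X H' where "affine_alg L H form X H' G HH"
proof -
  have lie: "lie_algebra L" using simple by (simp add: simple_lie_algebra_def)
  interpret cartan_alg L H
    by (intro cartan_alg.intro fin_dim_lie_algebra.intro cartan_alg_axioms.intro lie fd cartan)
  from pair consider (untwisted) "G = affine L form" "HH = affine_cartan H"
    | (twisted) \<sigma> s \<epsilon> where "diagram_automorphism L H \<sigma>" "automorphism_order L \<sigma> s"
      "primitive_root_of_unity s \<epsilon>" "G = twisted_affine L form \<sigma> \<epsilon>"
      "HH = affine_cartan {h \<in> H. \<sigma> h = h}"
    unfolding affine_pair_def by blast
  then show ?thesis
  proof cases
    case untwisted
    have "affine_alg L H form (\<lambda>_. \<g>) H G HH"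
    proof
      show "lie_carrier G = {(p, d, c). \<forall>j. Poly_Mapping.lookup p j \<in> \<g>}"
        "lie_scale G = aff_scale (lie_scale L)" "lie_bracket G = aff_bracket L form"
        by (simp_all add: untwisted affine_def)
      show "z \<in> H" if "z \<in> \<g>" "\<And>h. h \<in> H \<Longrightarrow> br h z = 0" for z
        using that by (rule H_maximal)
    qed (simp_all add: form untwisted g_subspace br_closed H_subspace H_subset)
    then show ?thesis by (rule that)
  next
    case (twisted \<sigma> s \<epsilon>)
    have aut: "lie_automorphism L \<sigma>" using twisted(1) by (simp add: diagram_automorphism_def)
    have \<sigma>_add: "\<sigma> (x + y) = \<sigma> x + \<sigma> y" and \<sigma>_br: "\<sigma> (br x y) = br (\<sigma> x) (\<sigma> y)"
      if "x \<in> \<g>" "y \<in> \<g>" for x y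
      using aut that by (auto simp: lie_automorphism_def)
    have \<sigma>_scale: "\<sigma> (lie_scale L c x) = lie_scale L c (\<sigma> x)" if "x \<in> \<g>" for c x
      using aut that by (auto simp: lie_automorphism_def)
    have \<sigma>_zero: "\<sigma> 0 = 0" using \<sigma>_scale[OF subspace_0[OF g_subspace], of 0] by simp
    have \<epsilon>: "\<epsilon> \<noteq> 0"
    proof
      assume "\<epsilon> = 0"
      then have "(0 :: 'k) ^ s = 1" "0 < s" using twisted(3) by (auto simp: primitive_root_of_unity_def)
      then show False by (simp add: zero_power)
    qed
    define X where "X = (\<lambda>j. {x \<in> \<g>. \<sigma> x = lie_scale L (\<epsilon> powi j) x})"
    have "affine_alg L H form X {h \<in> H. \<sigma> h = h} G HH"
    proof
      show "lie_carrier G = {(p, d, c). \<forall>j. Poly_Mapping.lookup p j \<in> X j}"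
        "lie_scale G = aff_scale (lie_scale L)" "lie_bracket G = aff_bracket L form"
        by (simp_all add: twisted(4) twisted_affine_def affine_def X_def)
      show "subspace (X j)" for j
        using g_subspace \<sigma>_zero unfolding subspace_def X_def
        by (auto simp: \<sigma>_add \<sigma>_scale scale_right_distrib mult.commute)
      show "X j \<subseteq> \<g>" for j by (auto simp: X_def)
      show "br x y \<in> X (i + j)" if "x \<in> X i" "y \<in> X j" for i j x y
        using that subspace_scale[OF g_subspace]
        by (auto simp: X_def br_closed \<sigma>_br br_scale_left br_scale_right power_int_add \<epsilon> mult.commute)
      show "subspace {h \<in> H. \<sigma> h = h}"
        using H_subspace H_subset \<sigma>_zero unfolding subspace_def
        by (auto simp: \<sigma>_add \<sigma>_scale subset_iff)
      show "{h \<in> H. \<sigma> h = h} \<subseteq> X 0" using H_subset by (auto simp: X_def)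
      show "z \<in> {h \<in> H. \<sigma> h = h}" if "z \<in> X 0" "\<And>h. h \<in> {h \<in> H. \<sigma> h = h} \<Longrightarrow> br h z = 0" for z
        using diagram_centralizer[OF simple twisted(1), of z] that by (auto simp: X_def)
    qed (auto simp: form twisted(5))
    then show ?thesis by (rule that)
  qed
qed

section \<open>Simple weight modules as twisted localizations\<close>

context weight_rep
begin

text \<open>Since \<open>f e\<close> is injective on the finite-dimensional weight spaces, it is onto.\<close>

lemma root_vector_invertible:
  assumes t: "root_triple L H \<alpha> e h f"
    and inj: "inj_on (rep_act M e) C" "inj_on (rep_act M f) C"
  obtains G where "conjugation (rep_scale M) C (rep_act M f) G"
proof -
  have ef: "e \<in> lie_carrier L" "f \<in> lie_carrier L" "e \<in> root_space L H \<alpha>" "f \<in> root_space L H (- \<alpha>)"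
    using t by (auto simp: root_triple_def root_space_def)
  let ?E = "rep_act M e" and ?F = "rep_act M f"
  have inj0: "v = 0" if "v \<in> C" "rep_act M z v = 0" "inj_on (rep_act M z) C" "z \<in> lie_carrier L" for v z
    using that lin_on_zero[OF act_lin[OF that(4)] subspace_C] subspace_0[OF subspace_C]
    by (metis inj_onD)
  have onto_wt: "\<exists>u\<in>C. ?F u = v" if \<mu>: "\<mu> \<in> dual_space L H" and v: "v \<in> wt \<mu>" for \<mu> v
  proof -
    obtain B where B: "finite B" "wt \<mu> \<subseteq> span B" using wt_fin[OF \<mu>] by (auto simp: fin_dim_def)
    have "\<exists>w\<in>wt \<mu>. ?F (?E w) = v"
    proof (rule injective_imp_onto[OF fe_lin[OF t] wt_subspace B v])
      fix w assume w: "w \<in> wt \<mu>" "?F (?E w) = 0"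
      have wC: "w \<in> C" using w by (simp add: wt_C)
      have "?E w = 0" by (rule inj0[OF act_closed[OF ef(1) wC] w(2) inj(2) ef(2)])
      then show "w = 0" by (rule inj0[OF wC _ inj(1) ef(1)])
    qed
    then show ?thesis using act_closed[OF ef(1)] wt_C by blast
  qed
  have onto: "\<exists>u\<in>C. ?F u = v" if v: "v \<in> C" for v
  proof -
    obtain E g where Eg: "finite E" "E \<subseteq> dual_space L H" "\<And>\<mu>. \<mu> \<in> E \<Longrightarrow> g \<mu> \<in> wt \<mu>" "v = sum g E"
      using weight_decomposition[OF v] by metis
    have "\<forall>\<mu>\<in>E. \<exists>u\<in>C. ?F u = g \<mu>" using onto_wt Eg(2,3) by blast
    then obtain u where u: "\<And>\<mu>. \<mu> \<in> E \<Longrightarrow> u \<mu> \<in> C \<and> ?F (u \<mu>) = g \<mu>" by metis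
    have "?F (sum u E) = (\<Sum>\<mu>\<in>E. ?F (u \<mu>))"
      by (rule lin_on_sum[OF act_lin[OF ef(2)] subspace_C]) (use u in blast)
    then have "?F (sum u E) = v" using u by (simp add: Eg(4))
    moreover have "sum u E \<in> C" using u by (intro subspace_sum subspace_C) blast
    ultimately show ?thesis by blast
  qed
  define G where "G = inv_into C ?F"
  have G: "G v \<in> C" "?F (G v) = v" if "v \<in> C" for v
    using onto[OF that] unfolding G_def by (auto intro: inv_into_into f_inv_into_f)
  have GF: "G (?F v) = v" if "v \<in> C" for v using inj(2) that by (simp add: G_def)
  have "conjugation (rep_scale M) C ?F G"
  proof (intro conjugation.intro conjugation_axioms.intro lin_space_axioms subspace_C act_lin ef)
    show "lin_on (rep_scale M) C G"
    proof (rule lin_onI)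
      fix v w assume vw: "v \<in> C" "w \<in> C"
      have "?F (G v + G w) = v + w" using G vw by (simp add: lin_on_add[OF act_lin[OF ef(2)]])
      then show "G (v + w) = G v + G w" using GF[of "G v + G w"] subspace_add[OF subspace_C] G vw by simp
    next
      fix c v assume v: "v \<in> C"
      have "?F (rep_scale M c (G v)) = rep_scale M c v" using G v by (simp add: lin_on_scale[OF act_lin[OF ef(2)]])
      then show "G (rep_scale M c v) = rep_scale M c (G v)"
        using GF[of "rep_scale M c (G v)"] subspace_scale[OF subspace_C] G v by simp
    qed (rule G)
  qed (auto simp: G GF)
  then show ?thesis by (rule that)
qed

text \<open>The condition on \<open>x\<close> says that in the twist of \<open>M\<close> by \<open>-x\<close> the vector \<open>f w\<close> is annihilated
  by \<open>e\<close>.\<close>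

lemma simple_twisted_localization:
  assumes zero: "0 \<in> lie_carrier L" and t: "root_triple L H \<alpha> e h f"
    and f_nil: "\<And>y. y \<in> lie_carrier L \<Longrightarrow> \<exists>n. (lie_bracket L f ^^ n) y = 0"
    and e_nil: "\<And>y. y \<in> lie_carrier L \<Longrightarrow> \<exists>n. (lie_bracket L e ^^ n) y = 0"
    and inj: "inj_on (rep_act M e) C" "inj_on (rep_act M f) C"
    and simple: "simple_module L M"
    and w: "\<mu> \<in> dual_space L H" "w \<in> wt \<mu>" "w \<noteq> 0"
      "rep_act M f (rep_act M e w) + rep_scale M ((1 + x) * (\<mu> h - x)) w = 0"
  obtains N :: "('k, 'l, 'm) rep" where "simple_module L N" "N \<in> W_fin L H"
    "module_isomorphic (uea L) (uea_module M) (twisted_localization L f x N)"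
    "\<And>v. v \<in> rep_carrier N \<Longrightarrow> \<exists>n. (rep_act N e ^^ n) v = 0"
    "\<And>\<beta> e' h' f' v. root_triple L H \<beta> e' h' f' \<Longrightarrow>
        (\<And>v. v \<in> C \<Longrightarrow> \<exists>n. (rep_act M e' ^^ n) v = 0) \<Longrightarrow> v \<in> rep_carrier N \<Longrightarrow>
        \<exists>n. (rep_act N e' ^^ n) v = 0"
proof -
  obtain G where G: "conjugation (rep_scale M) C (rep_act M f) G"
    using root_vector_invertible[OF t inj] .
  interpret twisted_simple L M H \<alpha> e h f G x \<mu> w
    by (intro twisted_simple.intro twisted_module.intro twisted_module_axioms.intro
        twisted_simple_axioms.intro weight_rep_axioms zero t f_nil e_nil G simple w)
  show ?thesis
    by (rule that[of socle_rep, OF socle_simple socle_W_fin socle_isomorphic])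
      (auto simp: socle_simps(1) intro: socle_e_nilpotent socle_locally_nilpotent)
qed

end

theorem theorem35:
  fixes L :: "('k::{alg_closed_field, field_char_0}, 'g::ab_group_add) lie_alg"
    and H :: "'g set" and form :: "'g \<Rightarrow> 'g \<Rightarrow> 'k"
    and G :: "('k, ('k, 'g) aff) lie_alg" and HH :: "('k, 'g) aff set"
    and e h f :: "(('k, 'g) aff \<Rightarrow> 'k) \<Rightarrow> ('k, 'g) aff"
    and M :: "('k, ('k, 'g) aff, 'm::ab_group_add) rep"
    and \<alpha> :: "('k, 'g) aff \<Rightarrow> 'k"
  assumes "simple_lie_algebra L" and "fin_dim (lie_scale L) (lie_carrier L)"
    and "cartan_subalgebra L H" and "nondeg_invariant_form L form"
    and "affine_pair L H form G HH"
    and "\<And>\<beta>. \<beta> \<in> real_roots G HH \<Longrightarrow>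
           e \<beta> \<in> root_space G HH \<beta> \<and> f \<beta> \<in> root_space G HH (- \<beta>) \<and> h \<beta> \<in> HH \<and>
           sl2_triple G (e \<beta>) (h \<beta>) (f \<beta>)"
    and "simple_module G M" and "M \<in> W_fin G HH"
    and "\<alpha> \<in> real_roots G HH"
    and "\<alpha> \<in> Delta_i (real_roots G HH) e M" and "- \<alpha> \<in> Delta_i (real_roots G HH) e M"
  shows "\<exists>(x :: 'k) (N :: ('k, ('k, 'g) aff, 'm) rep) (L' :: ('k, ('k, 'g) aff, 'm) rep).
           simple_module G N \<and> N \<in> W_fin G HH \<and>
           simple_module G L' \<and> L' \<in> W_fin G HH \<and>
           module_isomorphic (uea G) (uea_module M) (twisted_localization G (f \<alpha>) x N) \<and>
           module_isomorphic (uea G) (uea_module M) (twisted_localization G (f (- \<alpha>)) (- x) L') \<and>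
           \<alpha> \<in> Delta_f (real_roots G HH) e N \<and>
           - \<alpha> \<in> Delta_f (real_roots G HH) e L' \<and>
           (\<forall>\<beta> \<in> Delta_f (real_roots G HH) e M.
              \<beta> \<in> Delta_f (real_roots G HH) e N \<and> \<beta> \<in> Delta_f (real_roots G HH) e L')"
proof -
  obtain X H' where "affine_alg L H form X H' G HH"
    using affine_pair_affine_alg[OF assms(1-5)] .
  then interpret aff: affine_alg L H form X H' G HH .
  note simple = assms(7)
  have mod: "lie_module G M" using simple by (simp add: simple_module_def)
  interpret lie_closed G by (rule aff.lie_closed_G)
  have "vector_space (rep_scale M)" using mod by (simp add: lie_module_def)
  then interpret weight_rep G M HH
    by (intro weight_rep.intro lie_rep.intro lie_closed_axioms lin_space.intro lie_rep_axioms.intro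
        weight_rep_axioms.intro mod aff.HH_subset assms(8))
  define R where "R = real_roots G HH"
  have \<alpha>: "\<alpha> \<in> R" "- \<alpha> \<in> R" using assms(10,11) by (auto simp: Delta_i_def R_def)
  have tri: "e \<beta> \<in> root_space G HH \<beta>" "f \<beta> \<in> root_space G HH (- \<beta>)" "h \<beta> \<in> HH"
      "sl2_triple G (e \<beta>) (h \<beta>) (f \<beta>)" if "\<beta> \<in> R" for \<beta>
    using assms(6)[of \<beta>] that by (auto simp: R_def)
  have ts: "root_triple G HH \<beta> (e \<beta>) (h \<beta>) (f \<beta>)" "e \<beta> \<noteq> 0" "f \<beta> \<noteq> 0"
      "\<And>E. E \<in> root_space G HH (- \<beta>) \<Longrightarrow> \<exists>s. E = lie_scale G s (f \<beta>)"
      "\<And>E. E \<in> root_space G HH \<beta> \<Longrightarrow> \<exists>s. E = lie_scale G s (e \<beta>)" if "\<beta> \<in> R" for \<beta>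
    using aff.triple_structure[OF _ tri[OF that]] that by (auto simp: R_def)
  have nil_e: "\<exists>n. (lie_bracket G (e \<beta>) ^^ n) y = 0" and nil_f: "\<exists>n. (lie_bracket G (f \<beta>) ^^ n) y = 0"
    if "\<beta> \<in> R" "y \<in> lie_carrier G" for \<beta> y
    using aff.root_vector_ad_nilpotent[OF aff.real_rootD(1,2) tri(1)[OF that(1)] ts(2)[OF that(1)] that(2)]
      aff.root_vector_ad_nilpotent[OF aff.real_rootD(3,4) tri(2)[OF that(1)] ts(3)[OF that(1)] that(2)] that(1)
    by (auto simp: R_def)
  have mem: "e \<beta> \<in> lie_carrier G" "f \<beta> \<in> lie_carrier G" if "\<beta> \<in> R" for \<beta>
    using tri(1,2)[OF that] by (auto simp: root_space_def)
  note Ge = mem(1)[OF \<alpha>(1)] and Gf = mem(2)[OF \<alpha>(1)]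
  \<comment> \<open>The root spaces are lines, so the triple of \<open>-\<alpha>\<close> is proportional to that of \<open>\<alpha>\<close>.\<close>
  have neg_neg: "- (- \<alpha>) = \<alpha>" by (simp add: fun_eq_iff)
  obtain c' where c': "f (- \<alpha>) = lie_scale G c' (e \<alpha>)"
    using ts(5)[OF \<alpha>(1)] tri(2)[OF \<alpha>(2)] unfolding neg_neg by blast
  obtain d' where d': "e (- \<alpha>) = lie_scale G d' (f \<alpha>)"
    using ts(4)[OF \<alpha>(1)] tri(1)[OF \<alpha>(2)] by blast
  have fneg: "rep_act M (f (- \<alpha>)) v = rep_scale M c' (rep_act M (e \<alpha>) v)" if "v \<in> C" for v
    unfolding c' by (rule act_scale[OF Ge that])
  have eneg: "rep_act M (e (- \<alpha>)) v = rep_scale M d' (rep_act M (f \<alpha>) v)" if "v \<in> C" for v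
    unfolding d' by (rule act_scale[OF Gf that])
  have inj_e: "inj_on (rep_act M (e \<alpha>)) C" "inj_on (rep_act M (e (- \<alpha>))) C"
    using assms(10,11) by (auto simp: Delta_i_def)
  have inj_f: "inj_on (rep_act M (f \<alpha>)) C"
    using inj_e(2) eneg unfolding inj_on_def by metis

  \<comment> \<open>An eigenvector of \<open>f e\<close> in a weight space, and the exponent \<open>x\<close>.\<close>
  obtain v0 where v0: "v0 \<in> C" "v0 \<noteq> 0"
    using simple subspace_0[OF subspace_C] unfolding simple_module_def by blast
  obtain E g where Eg: "finite E" "E \<subseteq> dual_space G HH" "\<And>\<mu>. \<mu> \<in> E \<Longrightarrow> g \<mu> \<in> wt \<mu>" "v0 = sum g E"
    using weight_decomposition[OF v0(1)] by metis
  obtain \<mu> where \<mu>E: "\<mu> \<in> E" "g \<mu> \<noteq> 0" using v0(2) Eg(4) by (metis sum.neutral)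
  then have \<mu>: "\<mu> \<in> dual_space G HH" "g \<mu> \<in> wt \<mu>" "g \<mu> \<noteq> 0" using Eg by auto
  note t = ts(1)[OF \<alpha>(1)]
  obtain a w where w: "w \<in> wt \<mu>" "w \<noteq> 0" "rep_act M (f \<alpha>) (rep_act M (e \<alpha>) w) = rep_scale M a w"
    using eigenvector_exists[OF vector_space_axioms fe_lin[OF t] wt_subspace wt_fin[OF \<mu>(1)] \<mu>(2,3)] .
  define c where "c = \<mu> (h \<alpha>)"
  obtain x where x: "a + (1 + x) * (c - x) = 0"
  proof -
    have "degree [:a + c, c - 1, - 1:] > 0" by simp
    then obtain x where "poly [:a + c, c - 1, - 1:] x = 0" using alg_closed_imp_poly_has_root by blast
    then have "a + (1 + x) * (c - x) = 0" by (simp add: algebra_simps)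
    then show ?thesis by (rule that)
  qed
  have sing: "rep_act M (f \<alpha>) (rep_act M (e \<alpha>) w) + rep_scale M ((1 + x) * (\<mu> (h \<alpha>) - x)) w = 0"
    using x unfolding w(3) c_def[symmetric] scale_left_distrib[symmetric] by simp
  obtain N :: "('k, ('k, 'g) aff, 'm) rep" where N: "simple_module G N" "N \<in> W_fin G HH"
    "module_isomorphic (uea G) (uea_module M) (twisted_localization G (f \<alpha>) x N)"
    "\<And>v. v \<in> rep_carrier N \<Longrightarrow> \<exists>n. (rep_act N (e \<alpha>) ^^ n) v = 0"
    "\<And>\<beta> e' h' f' v. root_triple G HH \<beta> e' h' f' \<Longrightarrow>
        (\<And>v. v \<in> C \<Longrightarrow> \<exists>n. (rep_act M e' ^^ n) v = 0) \<Longrightarrow> v \<in> rep_carrier N \<Longrightarrow>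
        \<exists>n. (rep_act N e' ^^ n) v = 0"
    using simple_twisted_localization[OF aff.zero_G t nil_f[OF \<alpha>(1)] nil_e[OF \<alpha>(1)] inj_e(1) inj_f
        simple \<mu>(1) w(1,2) sing] by blast

  \<comment> \<open>For \<open>-\<alpha>\<close> the vector \<open>f w\<close> satisfies the corresponding condition with \<open>-x\<close>.\<close>
  define w' where "w' = rep_act M (f \<alpha>) w"
  define \<mu>' where "\<mu>' = (\<lambda>z. \<mu> z + (- \<alpha>) z)"
  have wC: "w \<in> C" using w by (simp add: wt_C)
  have w'C: "w' \<in> C" unfolding w'_def by (rule act_closed[OF Gf wC])
  have w'wt: "w' \<in> wt \<mu>'" unfolding w'_def \<mu>'_def by (rule wt_root[OF tri(2)[OF \<alpha>(1)] w(1)])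
  have w'0: "w' \<noteq> 0"
  proof
    assume "w' = 0"
    then have "rep_act M (f \<alpha>) w = rep_act M (f \<alpha>) 0"
      using lin_on_zero[OF act_lin[OF Gf] subspace_C] by (simp add: w'_def)
    then show False using inj_onD[OF inj_f _ wC subspace_0[OF subspace_C]] w(2) by blast
  qed
  have \<mu>': "\<mu>' \<in> dual_space G HH"
    using dual_space_shift[OF \<mu>(1), of \<alpha> "- 1"] aff.real_rootD(1) \<alpha>(1) by (simp add: \<mu>'_def R_def)
  note t' = ts(1)[OF \<alpha>(2)]
  have \<alpha>h: "\<alpha> (h \<alpha>) = 2" "h \<alpha> \<in> HH" "lie_bracket G (e \<alpha>) (f \<alpha>) = h \<alpha>"
    and \<alpha>h': "(- \<alpha>) (h (- \<alpha>)) = 2" "h (- \<alpha>) \<in> HH" "lie_bracket G (e (- \<alpha>)) (f (- \<alpha>)) = h (- \<alpha>)"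
    using t t' by (auto simp: root_triple_def)
  have hneg: "\<nu> (h (- \<alpha>)) = - (d' * c') * \<nu> (h \<alpha>)" if v: "v \<in> wt \<nu>" "v \<noteq> 0" for \<nu> v
  proof -
    have vC: "v \<in> C" using v by (simp add: wt_C)
    let ?e = "rep_act M (e \<alpha>)" and ?f = "rep_act M (f \<alpha>)"
    have cl: "?e v \<in> C" "?f v \<in> C" using act_closed Ge Gf vC by blast+
    have "rep_scale M (\<nu> (h (- \<alpha>))) v = rep_act M (h (- \<alpha>)) v" using wt_act[OF v(1) \<alpha>h'(2)] by simp
    also have "\<dots> = rep_act M (e (- \<alpha>)) (rep_act M (f (- \<alpha>)) v) - rep_act M (f (- \<alpha>)) (rep_act M (e (- \<alpha>)) v)"
      unfolding \<alpha>h'(3)[symmetric] by (rule act_bracket[OF mem[OF \<alpha>(2)] vC])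
    also have "\<dots> = rep_scale M (d' * c') (?f (?e v)) - rep_scale M (d' * c') (?e (?f v))"
      unfolding fneg[OF vC] eneg[OF vC]
      using cl subspace_scale[OF subspace_C]
      by (simp add: fneg eneg lin_on_scale[OF act_lin[OF Ge]] lin_on_scale[OF act_lin[OF Gf]] mult.commute)
    also have "\<dots> = rep_scale M (- (d' * c')) (?e (?f v) - ?f (?e v))"
      by (simp add: scale_right_diff_distrib)
    also have "?e (?f v) - ?f (?e v) = rep_scale M (\<nu> (h \<alpha>)) v"
      using act_bracket[OF Ge Gf vC] wt_act[OF v(1) \<alpha>h(2)] by (simp add: \<alpha>h(3))
    finally have "rep_scale M (\<nu> (h (- \<alpha>))) v = rep_scale M (- (d' * c') * \<nu> (h \<alpha>)) v"
      by (simp only: scale_scale)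
    then show ?thesis using v(2) scale_cancel_right by blast
  qed
  have dc: "d' * c' = 1"
  proof -
    have "\<mu>' (h (- \<alpha>)) = - (d' * c') * \<mu>' (h \<alpha>)" "\<mu> (h (- \<alpha>)) = - (d' * c') * \<mu> (h \<alpha>)"
      using hneg[OF w'wt w'0] hneg[OF w(1,2)] .
    then have "\<mu>' (h (- \<alpha>)) - \<mu> (h (- \<alpha>)) = - (d' * c') * (\<mu>' (h \<alpha>) - \<mu> (h \<alpha>))"
      by (simp only: right_diff_distrib)
    then have "2 = - (d' * c') * (- 2)" using \<alpha>h(1) \<alpha>h'(1) by (simp add: \<mu>'_def)
    then have "2 * (d' * c') = 2 * 1" by (simp add: mult.commute)
    then show ?thesis by (simp only: mult_cancel_left) simp
  qed
  have \<mu>'h: "\<mu>' (h (- \<alpha>)) = 2 - c"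
    using hneg[OF w'wt w'0] dc \<alpha>h(1) by (simp add: \<mu>'_def c_def)
  have inj_f': "inj_on (rep_act M (f (- \<alpha>))) C"
  proof (rule inj_onI)
    fix u v assume uv: "u \<in> C" "v \<in> C" "rep_act M (f (- \<alpha>)) u = rep_act M (f (- \<alpha>)) v"
    have "c' \<noteq> 0" using dc by auto
    then have "rep_act M (e \<alpha>) u = rep_act M (e \<alpha>) v"
      using uv by (simp add: fneg)
    then show "u = v" using inj_onD[OF inj_e(1)] uv by blast
  qed
  have sing': "rep_act M (f (- \<alpha>)) (rep_act M (e (- \<alpha>)) w')
      + rep_scale M ((1 + - x) * (\<mu>' (h (- \<alpha>)) - - x)) w' = 0"
  proof -
    let ?e = "rep_act M (e \<alpha>)" and ?f = "rep_act M (f \<alpha>)"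
    have "rep_act M (f (- \<alpha>)) (rep_act M (e (- \<alpha>)) w') = rep_scale M (c' * d') (?e (?f w'))"
      using w'C act_closed[OF Gf w'C] subspace_scale[OF subspace_C]
      by (simp add: eneg fneg lin_on_scale[OF act_lin[OF Ge]])
    also have "\<dots> = ?e ((?f ^^ Suc 1) w)" using dc by (simp add: w'_def mult.commute)
    also have "\<dots> = (?f ^^ Suc 1) (?e w) + rep_scale M ((of_nat 1 + 1) * (c - of_nat 1)) ((?f ^^ 1) w)"
      unfolding c_def by (rule triple_commute[OF t w(1)])
    also have "(?f ^^ Suc 1) (?e w) = rep_scale M a w'"
      using w(3) wC by (simp add: w'_def lin_on_scale[OF act_lin[OF Gf]])
    also have "rep_scale M a w' + rep_scale M ((of_nat 1 + 1) * (c - of_nat 1)) ((?f ^^ 1) w)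
        = rep_scale M (a + 2 * (c - 1)) w'"
      by (simp add: w'_def scale_left_distrib)
    finally have "rep_act M (f (- \<alpha>)) (rep_act M (e (- \<alpha>)) w') = rep_scale M (a + 2 * (c - 1)) w'" .
    moreover have "a + 2 * (c - 1) + (1 + - x) * (2 - c - - x) = a + (1 + x) * (c - x)"
      by (simp add: algebra_simps)
    ultimately show ?thesis using x unfolding \<mu>'h by (simp only: scale_left_distrib[symmetric] scale_zero_left)
  qed
  obtain N' :: "('k, ('k, 'g) aff, 'm) rep" where N': "simple_module G N'" "N' \<in> W_fin G HH"
    "module_isomorphic (uea G) (uea_module M) (twisted_localization G (f (- \<alpha>)) (- x) N')"
    "\<And>v. v \<in> rep_carrier N' \<Longrightarrow> \<exists>n. (rep_act N' (e (- \<alpha>)) ^^ n) v = 0"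
    "\<And>\<beta> e' h' f' v. root_triple G HH \<beta> e' h' f' \<Longrightarrow>
        (\<And>v. v \<in> C \<Longrightarrow> \<exists>n. (rep_act M e' ^^ n) v = 0) \<Longrightarrow> v \<in> rep_carrier N' \<Longrightarrow>
        \<exists>n. (rep_act N' e' ^^ n) v = 0"
    using simple_twisted_localization[OF aff.zero_G t' nil_f[OF \<alpha>(2)] nil_e[OF \<alpha>(2)] inj_e(2) inj_f'
        simple \<mu>' w'wt w'0 sing'] by blast
  have "\<beta> \<in> Delta_f R e N \<and> \<beta> \<in> Delta_f R e N'" if "\<beta> \<in> Delta_f R e M" for \<beta>
    using that N(5)[OF ts(1)] N'(5)[OF ts(1)] unfolding Delta_f_def by blast
  moreover have "\<alpha> \<in> Delta_f R e N" "- \<alpha> \<in> Delta_f R e N'"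
    using N(4) N'(4) \<alpha> unfolding Delta_f_def by blast+
  ultimately show ?thesis using N(1-3) N'(1-3) unfolding R_def by blast
qed

end
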